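(* Let $k\ge1$, $0\le r\le k$ and $l$ be integers. The vectors $$\omega_p=\varphi_{a_1,n_1}\varphi_{a_2,n_2}\cdots\ \in\ \pi_r\otimes\mathcal H_{\frac{r+2l}{\sqrt{2k}}},\qquad p=(a_j,n_j)_{j\ge1}\in\mathcal P_{r,r+2l},$$ are linearly independent, where $\mathcal P_{r,r+2l}$ is the set of paths belonging to $\omega_{r,r+2l}$ and the operators $\varphi_{a,n}$ and vectors $\omega_p$ are as defined in the context.
   Context: **$\widehat{sl}_2$ and vertex operators.** $\widehat{sl}_2=sl_2\otimes\mathbb C[t,t^{-1}]\oplus\mathbb Cc\oplus\mathbb Cd$, $X_i=X\otimes t^i$, with the standard basis $E,H,F$ of $sl_2$ and $[d,X_i]=iX_i$. For $0\le j\le k$, $\pi_j$ is the integrable highest weight module of level $k$ ($c=k$) generated by $|j\rangle$ with $E_i|j\rangle=0$ ($i\ge0$), $H_i|j\rangle=F_i|j\rangle=0$ ($i\ge1$), $H_0|j\rangle=j|j\rangle$, $d|j\rangle=0$. Let $V$ be the $(k+1)$-dimensional irreducible $sl_2$-module with basis $\psi_0,\dots,\psi_k$, $E\psi_a=(k-a+1)\psi_{a-1}$, $H\psi_a=(k-2a)\psi_a$, $F\psi_a=(a+1)\psi_{a+1}$. The vertex operators $\psi_a(z)=\sum_{n\in\mathbb Z}\psi_{a,n}z^{-n}$, $\psi_{a,n}:\pi_j\to\pi_{k-j}$, are determined by $[X_i,\psi_a(z)]=z^i(X\psi_a)(z)$ for $X\in sl_2$, $[d,\psi_a(z)]=-z\frac{d}{dz}\psi_a(z)$,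 and $\langle k-j|\psi_j(z)|j\rangle=1$. On $\pi_j$ set $\phi_a(z)=z^{-j/2}\psi_a(z)$. **Heisenberg algebra.** It has basis $a_i$ ($i\in\mathbb Z$) with $[a_i,a_j]=i\delta_{i+j,0}$. $\mathcal H_q$ is its irreducible (Fock) representation with vacuum vector $v(q)$: $a_jv(q)=0$ for $j>0$, $a_0v(q)=qv(q)$. Put $$w(p,z)=\exp\Bigl(-p\sum_{i<0}\tfrac{a_i}{i}z^{-i}\Bigr)T^pz^{pa_0}\exp\Bigl(-p\sum_{i>0}\tfrac{a_i}{i}z^{-i}\Bigr),$$ where $T^p:\mathcal H_q\to\mathcal H_{q+p}$ commutes with $a_i$ ($i\ne0$) and $T^pv(q)=v(q+p)$. **The operators $\varphi_{a,n}$.** $\varphi_a(z)=\phi_a(z)\,w(\sqrt{k/2},z):\pi_j\otimes\mathcal H_q\to\pi_{k-j}\otimes\mathcal H_{q+\sqrt{k/2}}$; for $q=\frac{j+2l}{\sqrt{2k}}$ with $l\in\mathbb Z$ it has an expansion $\varphi_a(z)=\sum_{n\in\mathbb Z}\varphi_{a,n}z^{-n}$ in integer powers. Put $\omega_{j,j+2l}=|j\rangle\otimes v\bigl(\frac{j+2l}{\sqrt{2k}}\bigr)$. One has $\varphi_{j,-l}\,\omega_{j,j+2l}=\omega_{k-j,j+2l+k}$. **Paths.** For $j\ge1$ set $a_j^{(r,r+2l)}=k-r$ and $n_j^{(r,r+2l)}=\frac{(j+1)k}{2}-r-l$ if $j$ is odd; $a_j^{(r,r+2l)}=r$ and $n_j^{(r,r+2l)}=\frac{jk}{2}-l$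 if $j$ is even. A sequence $p=(a_j,n_j)_{j\ge1}$ is a path belonging to $\omega_{r,r+2l}$ if (i) $0\le a_j\le k$ and $n_j\in\mathbb Z$ for all $j$; (ii) $a_j=a_j^{(r,r+2l)}$ and $n_j=n_j^{(r,r+2l)}$ for all sufficiently large $j$; (iii) each consecutive pair is normal-ordered: $\min(a_j,k-a_{j+1})-n_j+n_{j+1}\ge k$ for all $j\ge1$. The formal infinite product $\omega_p$ means $$\omega_p=\varphi_{a_1,n_1}\cdots\varphi_{a_{2N},n_{2N}}\,\omega_{r,\,r+2l-2kN}\in\pi_r\otimes\mathcal H_{\frac{r+2l}{\sqrt{2k}}}$$ for any sufficiently large $N$ (independent of $N$, since $\omega_{r,r+2l}=\varphi_{k-r,k-r-l}\,\varphi_{r,k-l}\,\omega_{r,r+2l-2k}$). *)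

theory Defs
  imports
    Complex_Main
    "HOL-Library.FuncSet"
    "HOL-Library.Function_Algebras"
    "HOL-Library.Groups_Big_Fun"
begin

section \<open>Linear maps between subspaces\<close>

text \<open>
  Modules are carried by subspaces \<open>S\<close> of an ambient complex vector space whose scalar
  multiplication is an explicit parameter, as in the library locale \<open>vector_space\<close>.
\<close>

definition linear_map_on ::
  "(complex \<Rightarrow> 'v::ab_group_add \<Rightarrow> 'v) \<Rightarrow> 'v set \<Rightarrow>
   (complex \<Rightarrow> 'w::ab_group_add \<Rightarrow> 'w) \<Rightarrow> 'w set \<Rightarrow> ('v \<Rightarrow> 'w) \<Rightarrow> bool"
  where "linear_map_on sv S sw S' f \<longleftrightarrow>
    (\<forall>x\<in>S. f x \<in> S') \<and>
    (\<forall>x\<in>S. \<forall>y\<in>S. f (x + y) = f x + f y) \<and>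
    (\<forall>c. \<forall>x\<in>S. f (sv c x) = sw c (f x))"


section \<open>The affine Lie algebra and its integrable highest weight modules\<close>

datatype sl2 = E | H | F

text \<open>The basis \<open>X\<^sub>i = X \<otimes> t\<^sup>i\<close> (\<open>Loop X i\<close>), \<open>c\<close>, \<open>d\<close> of the affine Lie algebra.\<close>

datatype affine_sl2 = Loop sl2 int | Central | Deriv

text \<open>Brackets of basis elements are formal linear combinations of basis elements.\<close>

fun sl2_bracket :: "sl2 \<Rightarrow> sl2 \<Rightarrow> (complex \<times> sl2) list" where
  "sl2_bracket E F = [(1, H)]"
| "sl2_bracket F E = [(- 1, H)]"
| "sl2_bracket H E = [(2, E)]"
| "sl2_bracket E H = [(- 2, E)]"
| "sl2_bracket H F = [(- 2, F)]"
| "sl2_bracket F H = [(2, F)]"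
| "sl2_bracket _ _ = []"

text \<open>The trace form \<open>tr (X Y)\<close>.\<close>

fun sl2_form :: "sl2 \<Rightarrow> sl2 \<Rightarrow> complex" where
  "sl2_form E F = 1"
| "sl2_form F E = 1"
| "sl2_form H H = 2"
| "sl2_form _ _ = 0"

fun affine_bracket :: "affine_sl2 \<Rightarrow> affine_sl2 \<Rightarrow> (complex \<times> affine_sl2) list" where
  "affine_bracket (Loop X i) (Loop Y j) =
     map (\<lambda>(c, Z). (c, Loop Z (i + j))) (sl2_bracket X Y) @
     (if i + j = 0 then [(of_int i * sl2_form X Y, Central)] else [])"
| "affine_bracket Deriv (Loop X i) = [(of_int i, Loop X i)]"
| "affine_bracket (Loop X i) Deriv = [(- of_int i, Loop X i)]"
| "affine_bracket _ _ = []"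

locale affine_module = vector_space scale
  for scale :: "complex \<Rightarrow> 'v::ab_group_add \<Rightarrow> 'v" (infixr "*s" 75) +
  fixes S :: "'v set" and \<rho> :: "affine_sl2 \<Rightarrow> 'v \<Rightarrow> 'v"
  assumes subspace_carrier: "subspace S"
    and action_linear: "\<And>x. linear_map_on scale S scale S (\<rho> x)"
    and action_bracket: "\<And>x y u. u \<in> S \<Longrightarrow>
      \<rho> x (\<rho> y u) - \<rho> y (\<rho> x u) = (\<Sum>(c, z)\<leftarrow>affine_bracket x y. c *s \<rho> z u)"

text \<open>
  The integrable highest weight module of level \<open>k\<close> with highest weight vector \<open>vac = |j\<rangle>\<close>.
  Integrability is local nilpotency of all real root vectors.
\<close>

locale integrable_highest_weight_module = affine_module scale S \<rho>
  for scale :: "complex \<Rightarrow> 'v::ab_group_add \<Rightarrow> 'v" (infixr "*s" 75)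
    and S :: "'v set" and \<rho> :: "affine_sl2 \<Rightarrow> 'v \<Rightarrow> 'v" +
  fixes k j :: nat and vac :: 'v
  assumes level: "\<And>u. u \<in> S \<Longrightarrow> \<rho> Central u = of_nat k *s u"
    and vac_carrier: "vac \<in> S" and vac_nonzero: "vac \<noteq> 0"
    and vac_E: "\<And>i. i \<ge> 0 \<Longrightarrow> \<rho> (Loop E i) vac = 0"
    and vac_H: "\<And>i. i \<ge> 1 \<Longrightarrow> \<rho> (Loop H i) vac = 0"
    and vac_F: "\<And>i. i \<ge> 1 \<Longrightarrow> \<rho> (Loop F i) vac = 0"
    and vac_H0: "\<rho> (Loop H 0) vac = of_nat j *s vac"
    and vac_d: "\<rho> Deriv vac = 0"
    and generated: "\<And>U. U \<subseteq> S \<Longrightarrow> subspace U \<Longrightarrow> (\<And>x u. u \<in> U \<Longrightarrow> \<rho> x u \<in> U) \<Longrightarrow>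
      vac \<in> U \<Longrightarrow> U = S"
    and integrable_E: "\<And>i u. u \<in> S \<Longrightarrow> \<exists>N. (\<rho> (Loop E i) ^^ N) u = 0"
    and integrable_F: "\<And>i u. u \<in> S \<Longrightarrow> \<exists>N. (\<rho> (Loop F i) ^^ N) u = 0"

text \<open>
  The functional \<open>\<langle>j|\<close>: the highest weight vector of the dual right module, normalised by
  \<open>\<langle>j|j\<rangle> = 1\<close>.
\<close>

locale dual_vacuum = integrable_highest_weight_module scale S \<rho> k j vac
  for scale :: "complex \<Rightarrow> 'v::ab_group_add \<Rightarrow> 'v" (infixr "*s" 75)
    and S :: "'v set" and \<rho> :: "affine_sl2 \<Rightarrow> 'v \<Rightarrow> 'v" and k j :: nat and vac :: 'v +
  fixes bra :: "'v \<Rightarrow> complex"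
  assumes bra_linear: "linear_map_on scale S (*) UNIV bra"
    and bra_vac: "bra vac = 1"
    and bra_E: "\<And>i u. u \<in> S \<Longrightarrow> i \<le> - 1 \<Longrightarrow> bra (\<rho> (Loop E i) u) = 0"
    and bra_H: "\<And>i u. u \<in> S \<Longrightarrow> i \<le> - 1 \<Longrightarrow> bra (\<rho> (Loop H i) u) = 0"
    and bra_F: "\<And>i u. u \<in> S \<Longrightarrow> i \<le> 0 \<Longrightarrow> bra (\<rho> (Loop F i) u) = 0"


section \<open>Fock representations of the Heisenberg algebra\<close>

locale fock_module = vector_space scale
  for scale :: "complex \<Rightarrow> 'h::ab_group_add \<Rightarrow> 'h" (infixr "*s" 75) +
  fixes S :: "'h set" and a :: "int \<Rightarrow> 'h \<Rightarrow> 'h" and q :: real and v :: 'h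
  assumes subspace_carrier: "subspace S"
    and a_linear: "\<And>i. linear_map_on scale S scale S (a i)"
    and heisenberg: "\<And>i j u. u \<in> S \<Longrightarrow>
      a i (a j u) - a j (a i u) = (if i + j = 0 then of_int i *s u else 0)"
    and irreducible: "\<And>U. U \<subseteq> S \<Longrightarrow> subspace U \<Longrightarrow> (\<And>i u. u \<in> U \<Longrightarrow> a i u \<in> U) \<Longrightarrow>
      U = {0} \<or> U = S"
    and v_carrier: "v \<in> S" and v_nonzero: "v \<noteq> 0"
    and v_annihilated: "\<And>j. j > 0 \<Longrightarrow> a j v = 0"
    and v_charge: "a 0 v = of_real q *s v"


section \<open>Formal power series with operator coefficients\<close>

text \<open>\<open>op_pow A N s\<close> is the coefficient of \<open>z\<^sup>s\<close> in the \<open>N\<close>-th power of \<open>\<Sum>\<^sub>m A m z\<^sup>m\<close>.\<close>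

fun op_pow :: "(nat \<Rightarrow> 'h \<Rightarrow> 'h::comm_monoid_add) \<Rightarrow> nat \<Rightarrow> nat \<Rightarrow> 'h \<Rightarrow> 'h" where
  "op_pow A 0 s u = (if s = 0 then u else 0)"
| "op_pow A (Suc N) s u = (\<Sum>m\<le>s. A m (op_pow A N (s - m) u))"

text \<open>
  The coefficient of \<open>z\<^sup>s\<close> in \<open>exp (\<Sum>\<^sub>m A m z\<^sup>m)\<close>.  It is only used when \<open>A 0 = 0\<close>, and then
  the powers with exponent \<open>N > s\<close> do not contribute.
\<close>

definition op_exp :: "(complex \<Rightarrow> 'h \<Rightarrow> 'h::comm_monoid_add) \<Rightarrow>
    (nat \<Rightarrow> 'h \<Rightarrow> 'h) \<Rightarrow> nat \<Rightarrow> 'h \<Rightarrow> 'h"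
  where "op_exp scale A s u = (\<Sum>N\<le>s. scale (1 / fact N) (op_pow A N s u))"


section \<open>Tensor products\<close>

text \<open>
  \<open>S \<otimes> U\<close> is realised inside the dual of the space of bilinear forms on \<open>S \<times> U\<close>: the pure
  tensor \<open>x \<otimes> u\<close> is evaluation at \<open>(x, u)\<close>.  Over a field the bilinear forms separate the
  elements of the algebraic tensor product, so that the span of these evaluations is
  the algebraic tensor product.
\<close>

type_synonym ('v, 'h) tensor = "('v \<Rightarrow> 'h \<Rightarrow> complex) \<Rightarrow> complex"

definition bilinear_form_on ::
  "(complex \<Rightarrow> 'v::ab_group_add \<Rightarrow> 'v) \<Rightarrow> (complex \<Rightarrow> 'h::ab_group_add \<Rightarrow> 'h) \<Rightarrow>
   'v set \<Rightarrow> 'h set \<Rightarrow> ('v \<Rightarrow> 'h \<Rightarrow> complex) \<Rightarrow> bool"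
  where "bilinear_form_on sv sh S U B \<longleftrightarrow>
    (\<forall>u\<in>U. linear_map_on sv S (*) UNIV (\<lambda>x. B x u)) \<and>
    (\<forall>x\<in>S. linear_map_on sh U (*) UNIV (B x))"

definition tensor_scale :: "complex \<Rightarrow> ('v, 'h) tensor \<Rightarrow> ('v, 'h) tensor"
  where "tensor_scale c t = (\<lambda>B. c * t B)"

interpretation tensor: vector_space tensor_scale
  by unfold_locales (auto simp: tensor_scale_def fun_eq_iff algebra_simps)

definition tensor ::
  "(complex \<Rightarrow> 'v::ab_group_add \<Rightarrow> 'v) \<Rightarrow> (complex \<Rightarrow> 'h::ab_group_add \<Rightarrow> 'h) \<Rightarrow>
   'v set \<Rightarrow> 'h set \<Rightarrow> 'v \<Rightarrow> 'h \<Rightarrow> ('v, 'h) tensor"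
  where "tensor sv sh S U x u = (\<lambda>B. if bilinear_form_on sv sh S U B then B x u else 0)"

definition tensor_space ::
  "(complex \<Rightarrow> 'v::ab_group_add \<Rightarrow> 'v) \<Rightarrow> (complex \<Rightarrow> 'h::ab_group_add \<Rightarrow> 'h) \<Rightarrow>
   'v set \<Rightarrow> 'h set \<Rightarrow> ('v, 'h) tensor set"
  where "tensor_space sv sh S U = tensor.span {tensor sv sh S U x u |x u. x \<in> S \<and> u \<in> U}"

text \<open>
  The operator \<open>f \<otimes> g : S \<otimes> U \<rightarrow> S' \<otimes> U'\<close> for \<open>f : S \<rightarrow> S'\<close> and \<open>g : U \<rightarrow> U'\<close>: it is dual to the
  pullback of bilinear forms along \<open>f \<times> g\<close>.
\<close>

definition tensor_map ::
  "(complex \<Rightarrow> 'v::ab_group_add \<Rightarrow> 'v) \<Rightarrow> (complex \<Rightarrow> 'h::ab_group_add \<Rightarrow> 'h) \<Rightarrow>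
   'v set \<Rightarrow> 'h set \<Rightarrow> ('v \<Rightarrow> 'v) \<Rightarrow> ('h \<Rightarrow> 'h) \<Rightarrow> ('v, 'h) tensor \<Rightarrow> ('v, 'h) tensor"
  where "tensor_map sv sh S' U' f g t =
    (\<lambda>B. if bilinear_form_on sv sh S' U' B then t (\<lambda>x u. B (f x) (g u)) else 0)"

lemma tensor_map_tensor:
  assumes "linear_map_on sv S sv S' f" "linear_map_on sh U sh U' g" "x \<in> S" "u \<in> U"
  shows "tensor_map sv sh S' U' f g (tensor sv sh S U x u) = tensor sv sh S' U' (f x) (g u)"
  using assms
  by (auto simp: tensor_map_def tensor_def bilinear_form_on_def linear_map_on_def fun_eq_iff)


section \<open>Vertex operators\<close>

text \<open>
  The action on the \<open>(k+1)\<close>-dimensional irreducible module with basis \<open>\<psi>\<^sub>0, \<dots>, \<psi>\<^sub>k\<close>: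
  \<open>X \<psi>\<^sub>a\<close> is the sum of \<open>c \<psi>\<^sub>b\<close> over the entries \<open>(c, b)\<close> of \<open>fin_action k X a\<close>.
\<close>

fun fin_action :: "nat \<Rightarrow> sl2 \<Rightarrow> nat \<Rightarrow> (complex \<times> nat) list" where
  "fin_action k E a = (if a = 0 then [] else [(of_nat k - of_nat a + 1, a - 1)])"
| "fin_action k H a = [(of_nat k - 2 * of_nat a, a)]"
| "fin_action k F a = (if a = k then [] else [(of_nat a + 1, a + 1)])"

text \<open>
  In the following locale \<open>\<psi> j a n\<close> is the mode \<open>\<psi>\<^bsub>a,n\<^esub>\<close> on \<open>\<pi>\<^sub>j\<close>, \<open>a q i\<close> is the
  action of \<open>a\<^sub>i\<close> on \<open>\<H>\<^sub>q\<close>, and \<open>T p q\<close> is the shift \<open>T\<^sup>p\<close> on \<open>\<H>\<^sub>q\<close>.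
\<close>

locale vertex_operators =
  fixes k :: nat
    and sv :: "complex \<Rightarrow> 'v::ab_group_add \<Rightarrow> 'v" and sh :: "complex \<Rightarrow> 'h::ab_group_add \<Rightarrow> 'h"
    and \<pi> :: "nat \<Rightarrow> 'v set" and \<rho> :: "nat \<Rightarrow> affine_sl2 \<Rightarrow> 'v \<Rightarrow> 'v"
    and vac :: "nat \<Rightarrow> 'v" and bra :: "nat \<Rightarrow> 'v \<Rightarrow> complex"
    and \<psi> :: "nat \<Rightarrow> nat \<Rightarrow> int \<Rightarrow> 'v \<Rightarrow> 'v"
    and \<H> :: "real \<Rightarrow> 'h set" and a :: "real \<Rightarrow> int \<Rightarrow> 'h \<Rightarrow> 'h" and v :: "real \<Rightarrow> 'h"
    and T :: "real \<Rightarrow> real \<Rightarrow> 'h \<Rightarrow> 'h"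
  assumes module_and_dual: "\<And>j. j \<le> k \<Longrightarrow> dual_vacuum sv (\<pi> j) (\<rho> j) k j (vac j) (bra j)"
    and psi_linear: "\<And>j b n. j \<le> k \<Longrightarrow> b \<le> k \<Longrightarrow> linear_map_on sv (\<pi> j) sv (\<pi> (k - j)) (\<psi> j b n)"
    and psi_Loop: "\<And>j b n X i u. j \<le> k \<Longrightarrow> b \<le> k \<Longrightarrow> u \<in> \<pi> j \<Longrightarrow>
      \<rho> (k - j) (Loop X i) (\<psi> j b n u) - \<psi> j b n (\<rho> j (Loop X i) u) =
      (\<Sum>(c, b')\<leftarrow>fin_action k X b. sv c (\<psi> j b' (n + i) u))"
    and psi_Deriv: "\<And>j b n u. j \<le> k \<Longrightarrow> b \<le> k \<Longrightarrow> u \<in> \<pi> j \<Longrightarrow>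
      \<rho> (k - j) Deriv (\<psi> j b n u) - \<psi> j b n (\<rho> j Deriv u) = sv (of_int n) (\<psi> j b n u)"
    and psi_normalised: "\<And>j n. j \<le> k \<Longrightarrow>
      bra (k - j) (\<psi> j j n (vac j)) = (if n = 0 then 1 else 0)"
    and fock: "\<And>q. fock_module sh (\<H> q) (a q) q (v q)"
    and T_linear: "\<And>p q. linear_map_on sh (\<H> q) sh (\<H> (q + p)) (T p q)"
    and T_commute: "\<And>p q i u. i \<noteq> 0 \<Longrightarrow> u \<in> \<H> q \<Longrightarrow> T p q (a q i u) = a (q + p) i (T p q u)"
    and T_vac: "\<And>p q. T p q (v q) = v (q + p)"
begin

text \<open>
  On \<open>\<H>\<^sub>q\<close>: the coefficient of \<open>z\<^sup>s\<close> in the exponential over \<open>i < 0\<close> and the coefficient of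
  \<open>z\<^sup>-\<^sup>s\<close> in the exponential over \<open>i > 0\<close>.
\<close>

definition creation :: "real \<Rightarrow> real \<Rightarrow> nat \<Rightarrow> 'h \<Rightarrow> 'h"
  where "creation p q = op_exp sh (\<lambda>m u. if m = 0 then 0
    else sh (of_real (- p) / of_int (- int m)) (a q (- int m) u))"

definition annihilation :: "real \<Rightarrow> real \<Rightarrow> nat \<Rightarrow> 'h \<Rightarrow> 'h"
  where "annihilation p q = op_exp sh (\<lambda>m u. if m = 0 then 0
    else sh (of_real (- p) / of_int (int m)) (a q (int m) u))"

text \<open>
  The coefficient of \<open>z\<^sup>e\<close>, \<open>e\<close> real, in \<open>w (p, z)\<close> restricted to \<open>\<H>\<^sub>q\<close>, where the middle factor
  \<open>z\<close> to the \<open>p a\<^sub>0\<close> is \<open>z\<close> to the \<open>p q\<close>.  Only finitely many summands are nonzero on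
  a given vector of \<open>\<H>\<^sub>q\<close>, and \<open>Sum_any\<close> adds these.
\<close>

definition w_coeff :: "real \<Rightarrow> real \<Rightarrow> real \<Rightarrow> 'h \<Rightarrow> 'h"
  where "w_coeff p q e u = Sum_any (\<lambda>(s, m).
    if real s + p * q - real m = e
    then creation p (q + p) s (T p q (annihilation p q m u)) else 0)"

text \<open>
  The mode \<open>\<phi>\<^bsub>b,n\<^esub>\<close> on \<open>\<pi>\<^sub>j \<otimes> \<H>\<^sub>q\<close>: the coefficient of \<open>z\<^sup>-\<^sup>n\<close> in the product of
  \<open>\<phi>\<^sub>b (z)\<close>, with terms \<open>\<psi>\<^bsub>b,m\<^esub>\<close> times \<open>z\<close> to the \<open>- j/2 - m\<close>, and \<open>w (p, z)\<close> for
  \<open>p\<close> the square root of \<open>k/2\<close>.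
\<close>

definition phi :: "nat \<Rightarrow> real \<Rightarrow> nat \<Rightarrow> int \<Rightarrow> ('v, 'h) tensor \<Rightarrow> ('v, 'h) tensor"
  where "phi j q b n t = (let p = sqrt (real k / 2) in
    Sum_any (\<lambda>m::int. tensor_map sv sh (\<pi> (k - j)) (\<H> (q + p))
      (\<psi> j b m) (w_coeff p q (real j / 2 + of_int m - of_int n)) t))"

text \<open>
  The product of the modes \<open>\<phi>\<^bsub>b,n\<^esub>\<close> over a list of pairs \<open>(b, n)\<close>, applied to \<open>t\<close> in
  \<open>\<pi>\<^sub>j \<otimes> \<H>\<^sub>q\<close>.  Each factor exchanges \<open>\<pi>\<^sub>j\<close> and \<open>\<pi>\<^bsub>k-j\<^esub>\<close> and raises \<open>q\<close> by the square
  root of \<open>k/2\<close>.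
\<close>

primrec phi_word :: "nat \<Rightarrow> real \<Rightarrow> (nat \<times> int) list \<Rightarrow> ('v, 'h) tensor \<Rightarrow> ('v, 'h) tensor" where
  "phi_word j q [] t = t"
| "phi_word j q (x # xs) t =
     phi (if even (length xs) then j else k - j) (q + of_nat (length xs) * sqrt (real k / 2))
       (fst x) (snd x) (phi_word j q xs t)"

definition charge :: "int \<Rightarrow> real"
  where "charge m = of_int m / sqrt (2 * real k)"

definition omega :: "nat \<Rightarrow> int \<Rightarrow> ('v, 'h) tensor"
  where "omega j m = tensor sv sh (\<pi> j) (\<H> (charge m)) (vac j) (v (charge m))"

definition truncated_path_vector ::
    "nat \<Rightarrow> int \<Rightarrow> (nat \<Rightarrow> nat \<times> int) \<Rightarrow> nat \<Rightarrow> ('v, 'h) tensor"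
  where "truncated_path_vector r l P N = (let m = int r + 2 * l - 2 * int k * int N in
    phi_word r (charge m) (map P [1..<2 * N + 1]) (omega r m))"

definition path_vector :: "nat \<Rightarrow> int \<Rightarrow> (nat \<Rightarrow> nat \<times> int) \<Rightarrow> ('v, 'h) tensor"
  where "path_vector r l P = (THE t. \<exists>N\<^sub>0. \<forall>N\<ge>N\<^sub>0. truncated_path_vector r l P N = t)"

end


section \<open>Paths\<close>

definition ground_path :: "nat \<Rightarrow> nat \<Rightarrow> int \<Rightarrow> nat \<Rightarrow> nat \<times> int"
  where "ground_path k r l j =
    (if odd j then (k - r, (int j + 1) * int k div 2 - int r - l)
     else (r, int j * int k div 2 - l))"

text \<open>A path is indexed by \<open>j \<ge> 1\<close>; as an extensional function it is \<open>undefined\<close> at \<open>0\<close>.\<close>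

definition paths :: "nat \<Rightarrow> nat \<Rightarrow> int \<Rightarrow> (nat \<Rightarrow> nat \<times> int) set"
  where "paths k r l = {P \<in> {1..} \<rightarrow>\<^sub>E {0..k} \<times> UNIV.
    (\<exists>J. \<forall>j\<ge>J. P j = ground_path k r l j) \<and>
    (\<forall>j\<ge>1. int (min (fst (P j)) (k - fst (P (j + 1)))) - snd (P j) + snd (P (j + 1)) \<ge> int k)}"

end

theory Submission
  imports Defs "HOL-Library.FSet" "HOL-Library.Product_Plus"
begin

text \<open>
  The independence is proved in a fermionic model.  In the Fock space of \<open>k\<close> doublets of charged
  fermions, with basis the states \<open>D\<close> differing from a Dirac sea by finitely many modes, the
  affine algebra acts with level \<open>k\<close> and the total charge current gives a commuting Heisenberg
  algebra.  The coefficients of the product of the \<open>k\<close> fields \<open>\<psi>\<^sub>\<up> (z) + x \<psi>\<^sub>\<down> (z)\<close> satisfy the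
  commutation relations of the \<open>\<phi>\<^sub>b (z)\<close>, and they map a filled sea into the module generated by
  the next filled sea (by Newton's identity, applied to the Heisenberg modes).

  Pairs of a tensor and a state generated from a pair of highest weight vectors form a
  correspondence, which is single valued from tensors to states because the contravariant form on
  the Fock space is positive definite; the operators \<open>\<phi>\<^bsub>b,n\<^esub>\<close> and the fermionic fields preserve it.
  A relation between path vectors therefore gives the same relation between their fermionic
  analogues.

  The latter are independent by triangularity: the normal ordering condition allows the fermionic
  modes of a leading state of a path to be chosen strictly increasing within each doublet from one
  letter to the next.  The coefficient of the leading state of a path \<open>(a\<^sub>j, n\<^sub>j)\<close> in the vector of
  another path \<open>(a'\<^sub>j, n'\<^sub>j)\<close> vanishes unless \<open>2 n'\<^sub>j - a'\<^sub>j > 2 n\<^sub>j - a\<^sub>j\<close> at the first difference.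
\<close>

section \<open>Generation by lowering operators\<close>

text \<open>A map from tensors to fermions would have to be checked against all relations of
  \<open>\<pi> j\<close>, which are known only through the axioms of a highest weight module; this
  is why pairs are used. Newton's identity answers another obstacle. Operators mixing the doublets
  commute with both algebras, so the Fock space is far from irreducible, and a fermionic vertex
  operator might lead out of the submodule generated by a sea. It does not, because the derivative
  of each spin-down field is its normally ordered product with its own current. Summed over the
  doublets, this becomes a recursion for the modes of the product of the spin-down fields. The
  summed current is half the difference of the charge current and the H current, hence lies in the
  algebra that generates the submodule. The other components of the product follow by E_0. The key
  \<open>2 n - b\<close> arises because a mode at level N contributes \<open>2 (N div 2)\<close>
  minus its spin, that is N - 1: up to the constant k, the key of a letter is the total level of the
  k modes that it creates.\<close>

inductive_set gen :: "(complex \<Rightarrow> 'b \<Rightarrow> 'b::ab_group_add) \<Rightarrow> ('x \<Rightarrow> 'b \<Rightarrow> 'b) \<Rightarrow> 'x set \<Rightarrow> 'b set \<Rightarrow> 'b set"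
  for sc P L B where
  gen_base: "b \<in> B \<Longrightarrow> b \<in> gen sc P L B"
| gen_zero: "0 \<in> gen sc P L B"
| gen_add: "u \<in> gen sc P L B \<Longrightarrow> w \<in> gen sc P L B \<Longrightarrow> u + w \<in> gen sc P L B"
| gen_scale: "u \<in> gen sc P L B \<Longrightarrow> sc c u \<in> gen sc P L B"
| gen_step: "x \<in> L \<Longrightarrow> u \<in> gen sc P L B \<Longrightarrow> P x u \<in> gen sc P L B"

lemma gen_uminus:
  assumes "vector_space sc" "u \<in> gen sc P L B"
  shows "- u \<in> gen sc P L B"
proof -
  interpret vector_space sc by fact
  have "- u = sc (- 1) u" by simp
  then show ?thesis using assms(2) by (metis gen_scale)
qed

lemma gen_diff:
  assumes "vector_space sc" "u \<in> gen sc P L B" "w \<in> gen sc P L B"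
  shows "u - w \<in> gen sc P L B"
  using gen_add[OF assms(2) gen_uminus[OF assms(1,3)]] by simp

lemma gen_sum: "(\<And>i. i \<in> I \<Longrightarrow> f i \<in> gen sc P L B) \<Longrightarrow> sum f I \<in> gen sc P L B"
  by (induction I rule: infinite_finite_induct) (auto intro: gen_zero gen_add)

lemma gen_sum_list: "(\<And>i. i \<in> set xs \<Longrightarrow> f i \<in> gen sc P L B) \<Longrightarrow> (\<Sum>i\<leftarrow>xs. f i) \<in> gen sc P L B"
  by (induction xs) (auto intro: gen_zero gen_add)

text \<open>A generating set stable under the other letters needs only words in the letters of \<open>L\<close>.\<close>

lemma gen_lowering_closed:
  assumes add: "\<And>x u w. x \<in> K \<Longrightarrow> u \<in> gen sc P L B \<Longrightarrow> w \<in> gen sc P L B \<Longrightarrow> P x (u + w) = P x u + P x w"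
    and scale: "\<And>x c u. x \<in> K \<Longrightarrow> u \<in> gen sc P L B \<Longrightarrow> P x (sc c u) = sc c (P x u)"
    and base: "\<And>x b. x \<in> K \<Longrightarrow> x \<notin> L \<Longrightarrow> b \<in> B \<Longrightarrow> P x b \<in> gen sc P L B"
    and bracket: "\<And>x y u. x \<in> K \<Longrightarrow> y \<in> L \<Longrightarrow> u \<in> gen sc P L B \<Longrightarrow>
      (\<And>z. z \<in> K \<Longrightarrow> P z u \<in> gen sc P L B) \<Longrightarrow>
      P x (P y u) - P y (P x u) \<in> gen sc P L B"
    and u: "u \<in> gen sc P L B" and x: "x \<in> K"
  shows "P x u \<in> gen sc P L B"
  using u x
proof (induction arbitrary: x)
  case (gen_base b)
  then show ?case by (cases "x \<in> L") (auto intro: gen.intros base)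
next
  case gen_zero
  have "P x (0 + 0) = P x 0 + P x 0" by (rule add) (auto intro: gen.intros gen_zero)
  then show ?case by (simp add: gen.gen_zero)
next
  case (gen_add u w)
  then show ?case by (simp add: add gen.gen_add)
next
  case (gen_scale u c)
  then show ?case by (simp add: scale gen.gen_scale)
next
  case (gen_step y u)
  have "P x (P y u) - P y (P x u) \<in> gen sc P L B"
    using bracket gen_step by blast
  moreover have "P y (P x u) \<in> gen sc P L B"
    using gen_step by (blast intro: gen.gen_step)
  ultimately have "(P x (P y u) - P y (P x u)) + P y (P x u) \<in> gen sc P L B"
    by (rule gen.gen_add)
  then show ?case by simp
qed


section \<open>The fermionic Fock space\<close>

text \<open>A state is recorded by its finite set of deviations from the Dirac sea in which exactly
  the modes \<open>0 \<le> \<nu>\<close> are filled. Excitations fill negative modes or empty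
  nonnegative ones, so positive shifts annihilate and negative shifts create.\<close>

definition occ :: "int fset \<Rightarrow> int \<Rightarrow> bool"
  where "occ D \<nu> \<longleftrightarrow> (\<nu> |\<in>| D) \<noteq> (0 \<le> \<nu>)"

definition toggle :: "int \<Rightarrow> int fset \<Rightarrow> int fset"
  where "toggle \<nu> D = (if \<nu> |\<in>| D then D |-| {|\<nu>|} else finsert \<nu> D)"

text \<open>Jordan-Wigner sign, counted on deviations in place of occupied modes. Anticommutation
  rests on the sign flipping exactly when a smaller mode is toggled, which this count also
  provides.\<close>

definition jw_sign :: "int \<Rightarrow> int fset \<Rightarrow> complex"
  where "jw_sign \<nu> D = (- 1) ^ card {\<mu> \<in> fset D. \<mu> < \<nu>}"

lemma toggle_toggle [simp]: "toggle \<nu> (toggle \<nu> D) = D"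
  by (auto simp: toggle_def)

lemma toggle_commute: "toggle \<nu> (toggle \<mu> D) = toggle \<mu> (toggle \<nu> D)"
  by (auto simp: toggle_def)

lemma occ_toggle [simp]: "occ (toggle \<mu> D) \<nu> = (if \<mu> = \<nu> then \<not> occ D \<nu> else occ D \<nu>)"
  by (auto simp: occ_def toggle_def)

lemma occ_eqI: "(\<And>\<nu>. occ D \<nu> = occ D' \<nu>) \<Longrightarrow> D = D'"
  by (rule fset_eqI) (auto simp: occ_def)

lemma jw_sign_toggle [simp]: "jw_sign \<nu> (toggle \<mu> D) = (if \<mu> < \<nu> then - jw_sign \<nu> D else jw_sign \<nu> D)"
proof (cases "\<mu> < \<nu>")
  case False
  then have "{x \<in> fset (toggle \<mu> D). x < \<nu>} = {x \<in> fset D. x < \<nu>}"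
    by (auto simp: toggle_def)
  with False show ?thesis by (simp add: jw_sign_def)
next
  case True
  show ?thesis
  proof (cases "\<mu> |\<in>| D")
    case mem: True
    have eq: "{x \<in> fset D. x < \<nu>} = insert \<mu> {x \<in> fset (toggle \<mu> D). x < \<nu>}"
      using mem True by (auto simp: toggle_def)
    have "\<mu> \<notin> {x \<in> fset (toggle \<mu> D). x < \<nu>}" using mem by (auto simp: toggle_def)
    then have "card {x \<in> fset D. x < \<nu>} = Suc (card {x \<in> fset (toggle \<mu> D). x < \<nu>})"
      unfolding eq by (subst card_insert_disjoint) auto
    then show ?thesis using True by (simp add: jw_sign_def)
  next
    case mem: False
    have eq: "{x \<in> fset (toggle \<mu> D). x < \<nu>} = insert \<mu> {x \<in> fset D. x < \<nu>}"
      using mem True by (auto simp: toggle_def)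
    have "card {x \<in> fset (toggle \<mu> D). x < \<nu>} = Suc (card {x \<in> fset D. x < \<nu>})"
      unfolding eq using mem by (subst card_insert_disjoint) auto
    then show ?thesis using True by (simp add: jw_sign_def)
  qed
qed

lemma jw_sign_square [simp]: "jw_sign \<nu> D * jw_sign \<nu> D = 1"
  by (simp add: jw_sign_def flip: power_mult_distrib)

lemma jw_sign_square' [simp]: "jw_sign \<nu> D * (jw_sign \<nu> D * z) = z"
  by (simp flip: mult.assoc)

lemma jw_sign_nonzero [simp]: "jw_sign \<nu> D \<noteq> 0"
  by (simp add: jw_sign_def)

lemma cnj_jw_sign [simp]: "cnj (jw_sign \<nu> D) = jw_sign \<nu> D"
  by (simp add: jw_sign_def)

text \<open>Arbitrary coefficient functions are allowed because the modes of the fermionic fields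
  are infinite sums that make sense only coefficientwise. Finite support is imposed separately by
  \<open>finsupp\<close>, where brackets and pairings call for it.\<close>

type_synonym fock = "int fset \<Rightarrow> complex"

definition fsc :: "complex \<Rightarrow> fock \<Rightarrow> fock"
  where "fsc c f = (\<lambda>D. c * f D)"

lemma fsc_apply [simp]: "fsc c f D = c * f D"
  by (simp add: fsc_def)

interpretation fock: vector_space fsc
  by unfold_locales (auto simp: fsc_def fun_eq_iff algebra_simps)

definition creator :: "int \<Rightarrow> fock \<Rightarrow> fock"
  where "creator \<nu> f = (\<lambda>D. if occ D \<nu> then jw_sign \<nu> D * f (toggle \<nu> D) else 0)"

definition annihilator :: "int \<Rightarrow> fock \<Rightarrow> fock"
  where "annihilator \<nu> f = (\<lambda>D. if occ D \<nu> then 0 else jw_sign \<nu> D * f (toggle \<nu> D))"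

definition basis :: "int fset \<Rightarrow> fock"
  where "basis D = (\<lambda>D'. if D' = D then 1 else 0)"

lemma creator_linear [simp]:
  "creator \<nu> (f + g) = creator \<nu> f + creator \<nu> g" "creator \<nu> (fsc c f) = fsc c (creator \<nu> f)"
  "creator \<nu> (f - g) = creator \<nu> f - creator \<nu> g" "creator \<nu> (- f) = - creator \<nu> f" "creator \<nu> 0 = 0"
  by (auto simp: creator_def fun_eq_iff algebra_simps)

lemma annihilator_linear [simp]:
  "annihilator \<nu> (f + g) = annihilator \<nu> f + annihilator \<nu> g"
  "annihilator \<nu> (fsc c f) = fsc c (annihilator \<nu> f)"
  "annihilator \<nu> (f - g) = annihilator \<nu> f - annihilator \<nu> g"
  "annihilator \<nu> (- f) = - annihilator \<nu> f" "annihilator \<nu> 0 = 0"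
  by (auto simp: annihilator_def fun_eq_iff algebra_simps)

lemma creator_creator: "creator \<mu> (creator \<nu> f) = - creator \<nu> (creator \<mu> f)"
  by (auto simp: creator_def fun_eq_iff toggle_commute[of \<mu> \<nu>])

lemma annihilator_annihilator: "annihilator \<mu> (annihilator \<nu> f) = - annihilator \<nu> (annihilator \<mu> f)"
  by (auto simp: annihilator_def fun_eq_iff toggle_commute[of \<mu> \<nu>])

lemma annihilator_creator:
  "annihilator \<mu> (creator \<nu> f) = (if \<mu> = \<nu> then f else 0) - creator \<nu> (annihilator \<mu> f)"
  by (auto simp: creator_def annihilator_def fun_eq_iff toggle_commute[of \<mu> \<nu>])

lemma creator_basis: "creator \<nu> (basis D) = (if occ D \<nu> then 0 else fsc (jw_sign \<nu> D) (basis (toggle \<nu> D)))"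
  by (auto simp: creator_def basis_def fun_eq_iff)

lemma annihilator_basis:
  "annihilator \<nu> (basis D) = (if occ D \<nu> then fsc (jw_sign \<nu> D) (basis (toggle \<nu> D)) else 0)"
  by (auto simp: annihilator_def basis_def fun_eq_iff)


subsection \<open>One-particle operators\<close>

text \<open>Subtracting the value of the sea for \<open>d = 0\<close> is normal ordering; without it
  the diagonal operators would be divergent sums.\<close>

definition shift_term :: "int \<Rightarrow> int \<Rightarrow> fock \<Rightarrow> fock"
  where "shift_term d \<nu> f = creator (\<nu> + d) (annihilator \<nu> f) - (if d = 0 \<and> 0 \<le> \<nu> then f else 0)"

definition shift_op :: "(int \<Rightarrow> complex) \<Rightarrow> int \<Rightarrow> fock \<Rightarrow> fock"
  where "shift_op c d f = (\<lambda>D. Sum_any (\<lambda>\<nu>. c \<nu> * shift_term d \<nu> f D))"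

text \<open>The moves that can end in D. Away from the deviations both ends of a move carry the
  occupation of the sea, so for \<open>d \<noteq> 0\<close> the move has to cross the Fermi level,
  hence the interval \<open>{- d..<0}\<close>.\<close>

definition shift_window :: "int \<Rightarrow> int fset \<Rightarrow> int set"
  where "shift_window d D = (if d = 0 then fset D
     else fset D \<union> (\<lambda>\<nu>. \<nu> - d) ` fset D \<union> {- d..<0})"

lemma finite_shift_window [simp]: "finite (shift_window d D)"
  by (simp add: shift_window_def)

lemma shift_term_outside:
  assumes "\<nu> \<notin> shift_window d D" shows "shift_term d \<nu> f D = 0"
proof (cases "d = 0")
  case True
  then have "occ D \<nu> \<longleftrightarrow> 0 \<le> \<nu>" using assms by (auto simp: shift_window_def occ_def)
  then show ?thesis using True by (auto simp: shift_term_def creator_def annihilator_def)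
next
  case False
  then have "occ D \<nu> \<longleftrightarrow> 0 \<le> \<nu>" "occ D (\<nu> + d) \<longleftrightarrow> 0 \<le> \<nu> + d"
    using assms by (force simp: shift_window_def occ_def image_iff)+
  then show ?thesis using False assms
    by (auto simp: shift_term_def creator_def annihilator_def shift_window_def)
qed

lemma shift_op_eq_sum:
  assumes "finite V" "shift_window d D \<subseteq> V"
  shows "shift_op c d f D = (\<Sum>\<nu>\<in>V. c \<nu> * shift_term d \<nu> f D)"
  unfolding shift_op_def
proof (rule Sum_any.expand_superset)
  show "{\<nu>. c \<nu> * shift_term d \<nu> f D \<noteq> 0} \<subseteq> V"
    using assms(2) shift_term_outside[of _ d D f] by auto
qed (fact assms)

lemma shift_term_linear [simp]:
  "shift_term d \<nu> (f + g) = shift_term d \<nu> f + shift_term d \<nu> g"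
  "shift_term d \<nu> (fsc c f) = fsc c (shift_term d \<nu> f)"
  "shift_term d \<nu> (f - g) = shift_term d \<nu> f - shift_term d \<nu> g"
  by (auto simp: shift_term_def fun_eq_iff algebra_simps)

lemma shift_op_linear [simp]:
  "shift_op c d (f + g) = shift_op c d f + shift_op c d g"
  "shift_op c d (fsc a f) = fsc a (shift_op c d f)"
  "shift_op c d (f - g) = shift_op c d f - shift_op c d g"
  by (auto simp: fun_eq_iff shift_op_eq_sum[OF _ subset_refl] algebra_simps sum.distrib
      sum_subtractf sum_distrib_left)

lemma shift_op_zero [simp]: "shift_op c d 0 = 0"
  using shift_op_linear(3)[of c d 0 0] by simp

lemma shift_op_uminus [simp]: "shift_op c d (- f) = - shift_op c d f"
  using shift_op_linear(3)[of c d 0 f] by simp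

lemma shift_term_creator:
  "shift_term d \<nu> (creator \<mu> f) = creator \<mu> (shift_term d \<nu> f) + (if \<nu> = \<mu> then creator (\<mu> + d) f else 0)"
  by (auto simp: shift_term_def annihilator_creator creator_creator[of _ \<mu>])

lemma shift_term_annihilator:
  "shift_term d \<nu> (annihilator \<mu> f) = annihilator \<mu> (shift_term d \<nu> f) - (if \<nu> + d = \<mu> then annihilator \<nu> f else 0)"
  by (auto simp: shift_term_def annihilator_creator annihilator_annihilator[of _ \<mu>])

text \<open>The normal ordering constant drops out of the commutator, and the only surviving term is
  the move of the mode \<mu> just created.\<close>

lemma shift_op_creator:
  "shift_op c d (creator \<mu> f) = creator \<mu> (shift_op c d f) + fsc (c \<mu>) (creator (\<mu> + d) f)"
proof
  fix D
  \<comment> \<open>One finite index set that covers both states, so that the two operators are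
    expanded over the same sum.\<close>
  let ?V = "insert \<mu> (shift_window d D \<union> shift_window d (toggle \<mu> D))"
  have "shift_op c d (creator \<mu> f) D = (\<Sum>\<nu>\<in>?V. c \<nu> * shift_term d \<nu> (creator \<mu> f) D)"
    by (rule shift_op_eq_sum) auto
  also have "\<dots> = (\<Sum>\<nu>\<in>?V. c \<nu> * creator \<mu> (shift_term d \<nu> f) D) +
      (\<Sum>\<nu>\<in>?V. if \<nu> = \<mu> then c \<nu> * creator (\<mu> + d) f D else 0)"
    unfolding sum.distrib[symmetric]
    by (rule sum.cong) (auto simp: shift_term_creator algebra_simps)
  also have "(\<Sum>\<nu>\<in>?V. c \<nu> * creator \<mu> (shift_term d \<nu> f) D) = creator \<mu> (shift_op c d f) D"
  proof -
    have "shift_op c d f (toggle \<mu> D) = (\<Sum>\<nu>\<in>?V. c \<nu> * shift_term d \<nu> f (toggle \<mu> D))"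
      by (rule shift_op_eq_sum) auto
    then show ?thesis by (auto simp: creator_def sum_distrib_left ac_simps)
  qed
  also have "(\<Sum>\<nu>\<in>?V. if \<nu> = \<mu> then c \<nu> * creator (\<mu> + d) f D else 0) = c \<mu> * creator (\<mu> + d) f D"
    by (subst sum.delta) auto
  finally show "shift_op c d (creator \<mu> f) D = (creator \<mu> (shift_op c d f) + fsc (c \<mu>) (creator (\<mu> + d) f)) D"
    by simp
qed

lemma shift_op_annihilator:
  "shift_op c d (annihilator \<mu> f) = annihilator \<mu> (shift_op c d f) - fsc (c (\<mu> - d)) (annihilator (\<mu> - d) f)"
proof
  fix D
  let ?V = "insert (\<mu> - d) (shift_window d D \<union> shift_window d (toggle \<mu> D))"
  have "shift_op c d (annihilator \<mu> f) D = (\<Sum>\<nu>\<in>?V. c \<nu> * shift_term d \<nu> (annihilator \<mu> f) D)"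
    by (rule shift_op_eq_sum) auto
  also have "\<dots> = (\<Sum>\<nu>\<in>?V. c \<nu> * annihilator \<mu> (shift_term d \<nu> f) D) -
      (\<Sum>\<nu>\<in>?V. if \<nu> = \<mu> - d then c \<nu> * annihilator \<nu> f D else 0)"
    unfolding sum_subtractf[symmetric]
    by (rule sum.cong) (auto simp: shift_term_annihilator algebra_simps)
  also have "(\<Sum>\<nu>\<in>?V. c \<nu> * annihilator \<mu> (shift_term d \<nu> f) D) = annihilator \<mu> (shift_op c d f) D"
  proof -
    have "shift_op c d f (toggle \<mu> D) = (\<Sum>\<nu>\<in>?V. c \<nu> * shift_term d \<nu> f (toggle \<mu> D))"
      by (rule shift_op_eq_sum) auto
    then show ?thesis by (auto simp: annihilator_def sum_distrib_left ac_simps)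
  qed
  also have "(\<Sum>\<nu>\<in>?V. if \<nu> = \<mu> - d then c \<nu> * annihilator \<nu> f D else 0) = c (\<mu> - d) * annihilator (\<mu> - d) f D"
    by (subst sum.delta) auto
  finally show "shift_op c d (annihilator \<mu> f) D =
      (annihilator \<mu> (shift_op c d f) - fsc (c (\<mu> - d)) (annihilator (\<mu> - d) f)) D"
    by simp
qed

subsection \<open>Finitely supported states\<close>

definition finsupp :: "fock \<Rightarrow> bool"
  where "finsupp f \<longleftrightarrow> finite {D. f D \<noteq> 0}"

lemma finsupp_zero [simp]: "finsupp 0"
  by (simp add: finsupp_def)

lemma finsupp_basis [simp]: "finsupp (basis D)"
  by (simp add: finsupp_def basis_def)

lemma finsupp_add [simp]: "finsupp f \<Longrightarrow> finsupp g \<Longrightarrow> finsupp (f + g)"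
  unfolding finsupp_def by (rule finite_subset[of _ "{D. f D \<noteq> 0} \<union> {D. g D \<noteq> 0}"]) auto

lemma finsupp_fsc [simp]: "finsupp f \<Longrightarrow> finsupp (fsc c f)"
  unfolding finsupp_def by (rule finite_subset[of _ "{D. f D \<noteq> 0}"]) auto

lemma finsupp_sum: "(\<And>i. i \<in> I \<Longrightarrow> finsupp (f i)) \<Longrightarrow> finsupp (sum f I)"
  by (induction I rule: infinite_finite_induct) auto

lemma finsupp_induct [consumes 1, case_names zero add]:
  assumes "finsupp f" and "P 0"
    and step: "\<And>f c D. finsupp f \<Longrightarrow> P f \<Longrightarrow> P (f + fsc c (basis D))"
  shows "P f"
proof -
  have "P f \<and> finsupp f" if "finite S" "{D. f D \<noteq> 0} \<subseteq> S" for S f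
    using that
  proof (induction S arbitrary: f rule: finite_induct)
    case empty
    then have "f = 0" by (auto simp: fun_eq_iff)
    then show "P f \<and> finsupp f" using assms(2) by simp
  next
    case (insert D S)
    let ?g = "f - fsc (f D) (basis D)"
    have "P ?g \<and> finsupp ?g"
      using insert.prems by (intro insert.IH) (auto simp: basis_def)
    then have "P (?g + fsc (f D) (basis D)) \<and> finsupp (?g + fsc (f D) (basis D))"
      using step[of ?g "f D" D] finsupp_add[of ?g "fsc (f D) (basis D)"] by simp
    then show "P f \<and> finsupp f" by simp
  qed
  from this[of "{D. f D \<noteq> 0}" f] assms(1) show ?thesis by (simp add: finsupp_def)
qed

lemma sum_apply: "(sum f I :: fock) D = (\<Sum>i\<in>I. f i D)"
  by (induction I rule: infinite_finite_induct) auto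

lemma finsupp_creator_basis: "finsupp (creator \<nu> (basis D))"
  by (simp add: creator_basis)

lemma finsupp_shift_term_basis: "finsupp (shift_term d \<nu> (basis D))"
proof -
  have "finsupp (creator (\<nu> + d) (annihilator \<nu> (basis D)))"
    by (auto simp: annihilator_basis finsupp_creator_basis)
  then have "finsupp (creator (\<nu> + d) (annihilator \<nu> (basis D)) +
      fsc (if d = 0 \<and> 0 \<le> \<nu> then - 1 else 0) (basis D))"
    by (intro finsupp_add finsupp_fsc) auto
  then show ?thesis
    by (auto simp: shift_term_def fsc_def fun_diff_def plus_fun_def split: if_splits)
qed

text \<open>The analogue of \<open>shift_window\<close> seen from the state being moved instead of
  the result; the interval across the Fermi level therefore becomes
  \<open>{0..<- d}\<close>.\<close>

lemma shift_term_basis_outside: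
  assumes "\<nu> \<notin> fset D \<union> (\<lambda>\<nu>. \<nu> - d) ` fset D \<union> {0..<- d}"
  shows "shift_term d \<nu> (basis D) = 0"
proof -
  have 1: "occ D \<nu> \<longleftrightarrow> 0 \<le> \<nu>" "occ D (\<nu> + d) \<longleftrightarrow> 0 \<le> \<nu> + d"
    using assms by (force simp: occ_def image_iff)+
  show ?thesis
  proof (cases "d = 0")
    case True
    with 1 show ?thesis
      by (auto simp: shift_term_def annihilator_basis creator_basis)
  next
    case False
    with 1 assms show ?thesis
      by (auto simp: shift_term_def annihilator_basis creator_basis)
  qed
qed

lemma shift_op_basis_sum:
  fixes D d
  defines "V \<equiv> fset D \<union> (\<lambda>\<nu>. \<nu> - d) ` fset D \<union> {0..<- d}"
  shows "shift_op c d (basis D) = (\<Sum>\<nu>\<in>V. fsc (c \<nu>) (shift_term d \<nu> (basis D)))"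
proof
  fix D'
  have fin: "finite V" by (simp add: V_def)
  have "shift_op c d (basis D) D' = (\<Sum>\<nu>\<in>V \<union> shift_window d D'. c \<nu> * shift_term d \<nu> (basis D) D')"
    using fin by (intro shift_op_eq_sum) auto
  also have "\<dots> = (\<Sum>\<nu>\<in>V. c \<nu> * shift_term d \<nu> (basis D) D')"
    using fin shift_term_basis_outside[of _ D d]
    by (intro sum.mono_neutral_right) (auto simp: V_def)
  finally show "shift_op c d (basis D) D' = (\<Sum>\<nu>\<in>V. fsc (c \<nu>) (shift_term d \<nu> (basis D))) D'"
    by (simp add: sum_apply)
qed

lemma finsupp_shift_op [simp]:
  assumes "finsupp f" shows "finsupp (shift_op c d f)"
  using assms
proof (induction f rule: finsupp_induct)
  case (add f a D)
  have "finsupp (shift_op c d (basis D))"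
    by (auto simp: shift_op_basis_sum intro!: finsupp_sum finsupp_shift_term_basis finsupp_fsc)
  with add show "finsupp (shift_op c d (f + fsc a (basis D)))" by simp
next
  case zero show "finsupp (shift_op c d 0)" by simp
qed


subsection \<open>Filled seas\<close>

definition ray :: "int \<Rightarrow> int fset"
  where "ray e = (if 0 \<le> e then fset_of_list [0..e - 1] else fset_of_list [e..- 1])"

lemma occ_ray [simp]: "occ (ray e) \<nu> \<longleftrightarrow> e \<le> \<nu>"
  by (auto simp: occ_def ray_def fset_of_list_elem)

lemma ray_zero: "ray 0 = {||}"
  by (simp add: ray_def)

lemma occ_empty [simp]: "occ {||} \<nu> \<longleftrightarrow> 0 \<le> \<nu>"
  by (simp add: occ_def)

text \<open>Pauli exclusion: every move that c allows ends in an occupied mode.\<close>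

lemma shift_op_basis_eq_zero:
  assumes "d \<noteq> 0" "\<And>\<nu>. c \<nu> \<noteq> 0 \<Longrightarrow> occ D \<nu> \<Longrightarrow> occ D (\<nu> + d)"
  shows "shift_op c d (basis D) = 0"
proof -
  have "fsc (c \<nu>) (shift_term d \<nu> (basis D)) = 0" for \<nu>
    using assms by (cases "c \<nu> = 0") (auto simp: shift_term_def annihilator_basis creator_basis fun_eq_iff)
  then show ?thesis unfolding shift_op_basis_sum by (intro sum.neutral) blast
qed

lemma shift_op_ray: "d > 0 \<Longrightarrow> shift_op c d (basis (ray e)) = 0"
  by (rule shift_op_basis_eq_zero) auto

text \<open>A filled sea cannot be the result of a downward move: if \<open>\<nu> + d\<close> is
  occupied in it, then so is the mode \<nu> that the move would have emptied.\<close>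

lemma shift_op_at_ray:
  assumes "d < 0" shows "shift_op c d f (ray e) = 0"
proof -
  have "shift_term d \<nu> f (ray e) = 0" for \<nu>
    using assms by (auto simp: shift_term_def creator_def annihilator_def)
  then show ?thesis by (simp add: shift_op_def)
qed

lemma shift_op_diagonal:
  assumes "finite V" "\<And>\<nu>. \<nu> \<notin> V \<Longrightarrow> occ D \<nu> \<longleftrightarrow> 0 \<le> \<nu>"
  shows "shift_op c 0 f D = (\<Sum>\<nu>\<in>V. c \<nu> * (of_bool (occ D \<nu>) - of_bool (0 \<le> \<nu>))) * f D"
proof -
  have "shift_window 0 D \<subseteq> V" using assms(2) by (auto simp: shift_window_def occ_def)
  then have "shift_op c 0 f D = (\<Sum>\<nu>\<in>V. c \<nu> * shift_term 0 \<nu> f D)"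
    by (intro shift_op_eq_sum assms)
  also have "\<dots> = (\<Sum>\<nu>\<in>V. c \<nu> * (of_bool (occ D \<nu>) - of_bool (0 \<le> \<nu>)) * f D)"
    by (intro sum.cong) (auto simp: shift_term_def creator_def annihilator_def)
  finally show ?thesis by (simp add: sum_distrib_right)
qed

lemma shift_op_diagonal_ray:
  "shift_op c 0 (basis (ray e)) = fsc (sum c {e..<0} - sum c {0..<e}) (basis (ray e))"
proof
  fix D
  show "shift_op c 0 (basis (ray e)) D = fsc (sum c {e..<0} - sum c {0..<e}) (basis (ray e)) D"
  proof (cases "D = ray e")
    case True
    have "shift_op c 0 (basis (ray e)) (ray e) =
      (\<Sum>\<nu>\<in>{e..<0} \<union> {0..<e}. c \<nu> * (of_bool (occ (ray e) \<nu>) - of_bool (0 \<le> \<nu>))) * basis (ray e) (ray e)"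
      by (rule shift_op_diagonal) auto
    also have "(\<Sum>\<nu>\<in>{e..<0} \<union> {0..<e}. c \<nu> * (of_bool (occ (ray e) \<nu>) - of_bool (0 \<le> \<nu>)))
      = (\<Sum>\<nu>\<in>{e..<0}. c \<nu> * (of_bool (occ (ray e) \<nu>) - of_bool (0 \<le> \<nu>))) +
        (\<Sum>\<nu>\<in>{0..<e}. c \<nu> * (of_bool (occ (ray e) \<nu>) - of_bool (0 \<le> \<nu>)))"
      by (rule sum.union_disjoint) auto
    also have "\<dots> = sum c {e..<0} - sum c {0..<e}"
      by (simp flip: sum_negf)
    finally show ?thesis using True by simp
  next
    case False
    have "shift_op c 0 (basis (ray e)) D =
      (\<Sum>\<nu>\<in>fset D. c \<nu> * (of_bool (occ D \<nu>) - of_bool (0 \<le> \<nu>))) * basis (ray e) D"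
      by (rule shift_op_diagonal) (auto simp: occ_def)
    then show ?thesis using False by (simp add: basis_def)
  qed
qed


subsection \<open>The commutator of one-particle operators\<close>

text \<open>The Schwinger term: the vacuum expectation value of the commutator of two one-particle
  operators, produced by particle-hole pairs across the Fermi level.\<close>

definition cocycle :: "(int \<Rightarrow> complex) \<Rightarrow> int \<Rightarrow> (int \<Rightarrow> complex) \<Rightarrow> int \<Rightarrow> complex"
  where "cocycle c d c' d' = (if d + d' = 0
    then (\<Sum>\<nu>\<in>{- d..<0}. c \<nu> * c' (\<nu> + d)) - (\<Sum>\<nu>\<in>{- d'..<0}. c' \<nu> * c (\<nu> + d')) else 0)"

text \<open>The signs are left unevaluated so that they meet the same expressions in
  \<open>shift_op_pair_value\<close> and square to one.\<close>

lemma shift_op_at_empty: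
  assumes "d > 0"
  shows "shift_op c d f {||} = (\<Sum>\<nu>\<in>{- d..<0}. c \<nu> *
    (jw_sign (\<nu> + d) {||} * jw_sign \<nu> (toggle (\<nu> + d) {||}) * f (toggle \<nu> (toggle (\<nu> + d) {||}))))"
proof -
  have "shift_op c d f {||} = (\<Sum>\<nu>\<in>{- d..<0}. c \<nu> * shift_term d \<nu> f {||})"
    using assms by (intro shift_op_eq_sum) (auto simp: shift_window_def)
  also have "\<dots> = (\<Sum>\<nu>\<in>{- d..<0}. c \<nu> *
    (jw_sign (\<nu> + d) {||} * jw_sign \<nu> (toggle (\<nu> + d) {||}) * f (toggle \<nu> (toggle (\<nu> + d) {||}))))"
    using assms by (intro sum.cong refl)
      (auto simp: shift_term_def creator_def annihilator_def simp del: jw_sign_toggle)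
  finally show ?thesis .
qed

lemma shift_op_pair_value:
  assumes d: "d > 0" and d': "d' < 0" and \<nu>: "\<nu> < 0" "0 \<le> \<nu> + d"
  shows "shift_op c' d' (basis {||}) (toggle \<nu> (toggle (\<nu> + d) {||})) =
    (if d + d' = 0 then c' (\<nu> + d) * jw_sign (\<nu> + d) {||} * jw_sign \<nu> (toggle (\<nu> + d) {||}) else 0)"
proof -
  let ?D = "toggle \<nu> (toggle (\<nu> + d) {||})"
  let ?V = "insert (\<nu> + d) (shift_window d' ?D)"
  have trm: "shift_term d' \<mu> (basis {||}) ?D =
    (if \<mu> = \<nu> + d \<and> d + d' = 0 then jw_sign (\<nu> + d) {||} * jw_sign \<nu> (toggle (\<nu> + d) {||}) else 0)" for \<mu>
  proof (cases "toggle \<mu> (toggle (\<mu> + d') ?D) = {||}")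
    case True
    \<comment> \<open>Comparing occupations at the two toggled modes forces the move to be the one
      that creates exactly this pair.\<close>
    have "occ (toggle \<mu> (toggle (\<mu> + d') ?D)) x = occ {||} x" for x by (simp only: True)
    from this[of \<nu>] this[of "\<nu> + d"] have "\<mu> = \<nu> + d \<and> d + d' = 0"
      using d d' \<nu> by (auto split: if_splits)
    then have "\<mu> = \<nu> + d" "d' = - d" by auto
    then show ?thesis using d \<nu>
      by (auto simp: shift_term_def creator_def annihilator_def basis_def)
  next
    case False
    then have "\<not> (\<mu> = \<nu> + d \<and> d + d' = 0)"
      by (auto simp: toggle_commute add_eq_0_iff)
    then show ?thesis using False d'
      by (auto simp: shift_term_def creator_def annihilator_def basis_def)
  qed
  have "shift_op c' d' (basis {||}) ?D = (\<Sum>\<mu>\<in>?V. c' \<mu> * shift_term d' \<mu> (basis {||}) ?D)"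
    by (rule shift_op_eq_sum) auto
  also have "\<dots> = (\<Sum>\<mu>\<in>?V. if \<mu> = \<nu> + d then (if d + d' = 0 then c' (\<nu> + d) * jw_sign (\<nu> + d) {||} * jw_sign \<nu> (toggle (\<nu> + d) {||}) else 0) else 0)"
    unfolding trm by (intro sum.cong) (auto simp: ac_simps)
  also have "\<dots> = (if d + d' = 0 then c' (\<nu> + d) * jw_sign (\<nu> + d) {||} * jw_sign \<nu> (toggle (\<nu> + d) {||}) else 0)"
    by (subst sum.delta) auto
  finally show ?thesis .
qed

lemma shift_op_shift_op_at_empty:
  "shift_op c d (shift_op c' d' (basis {||})) {||} =
    (if d + d' = 0 then \<Sum>\<nu>\<in>{- d..<0}. c \<nu> * c' (\<nu> + d) else 0)"
proof -
  have eq0: "shift_op c 0 f {||} = 0" for c f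
    using shift_op_diagonal[of "{}" "{||}" c f] by simp
  have vac0: "shift_op c 0 (basis {||}) = 0" for c
    using shift_op_diagonal_ray[of c 0] by (simp add: ray_zero)
  have vac: "shift_op c d (basis {||}) = 0" if "d > 0" for c d
    using shift_op_ray[OF that, of c 0] by (simp add: ray_zero)
  have at: "shift_op c d f {||} = 0" if "d < 0" for c d f
    using shift_op_at_ray[OF that, of c f 0] by (simp add: ray_zero)
  consider "d < 0" | "d = 0" | "d > 0" "d' = 0" | "d > 0" "d' > 0" | "d > 0" "d' < 0" by linarith
  then show ?thesis
  proof cases
    case 5
    have "shift_op c d (shift_op c' d' (basis {||})) {||} =
      (\<Sum>\<nu>\<in>{- d..<0}. c \<nu> * (if d + d' = 0 then c' (\<nu> + d) else 0))"
      unfolding shift_op_at_empty[OF 5(1)]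
    proof (intro sum.cong refl, goal_cases)
      case (1 \<nu>)
      then have \<nu>: "\<nu> < 0" "0 \<le> \<nu> + d" by auto
      show ?case unfolding shift_op_pair_value[OF 5 \<nu>]
        by (simp add: ac_simps del: jw_sign_toggle)
    qed
    then show ?thesis by simp
  qed (simp_all add: at eq0 vac0 vac)
qed

text \<open>Any deviation \<nu> of D is undone by one of the operators assumed to kill f, so the
  coefficient at D vanishes.\<close>

lemma vacuum_unique:
  assumes "\<And>\<nu>. \<nu> < 0 \<Longrightarrow> annihilator \<nu> f = 0" "\<And>\<nu>. 0 \<le> \<nu> \<Longrightarrow> creator \<nu> f = 0"
  shows "f = fsc (f {||}) (basis {||})"
proof
  fix D
  show "f D = fsc (f {||}) (basis {||}) D"
  proof (cases "D = {||}")
    case False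
    then obtain \<nu> where \<nu>: "\<nu> |\<in>| D" by auto
    have "(if \<nu> < 0 then annihilator \<nu> f else creator \<nu> f) (toggle \<nu> D) = 0"
      using assms[of \<nu>] by auto
    moreover have "occ D \<nu> \<longleftrightarrow> \<nu> < 0" using \<nu> by (auto simp: occ_def)
    ultimately have "f D = 0" by (auto simp: annihilator_def creator_def split: if_splits)
    then show ?thesis using False by (simp add: basis_def)
  qed (simp add: basis_def)
qed

text \<open>Schur's lemma for the fermions: K preserves the conditions that characterise the vacuum,
  hence maps it to a multiple of itself, and every basis state is a word in the fermions applied to
  the vacuum.\<close>

lemma scalar_on_basis:
  assumes scale: "\<And>c f. K (fsc c f) = fsc c (K f)"
    and cr: "\<And>\<nu> f. K (creator \<nu> f) = creator \<nu> (K f)"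
    and an: "\<And>\<nu> f. K (annihilator \<nu> f) = annihilator \<nu> (K f)"
  shows "K (basis D) = fsc (K (basis {||}) {||}) (basis D)"
proof (induction D rule: fset_induct_stronger)
  case empty
  have zero: "K 0 = 0" using scale[of 0 0] by (simp add: fsc_def zero_fun_def)
  show ?case
    by (rule vacuum_unique) (simp_all flip: cr an add: annihilator_basis creator_basis zero)
next
  case (insert \<nu> D)
  have eq: "basis (finsert \<nu> D) = fsc (jw_sign \<nu> D) (if \<nu> < 0 then creator \<nu> (basis D) else annihilator \<nu> (basis D))"
    using insert by (auto simp: creator_basis annihilator_basis occ_def toggle_def fun_eq_iff)
  note IH = insert(2)
  show ?case unfolding eq
    by (cases "\<nu> < 0") (simp_all only: if_True if_False scale cr an IH creator_linear annihilator_linear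
        fock.scale_left_commute)
qed

text \<open>The commutator and the one-particle operator on the right have the same commutators with
  all fermion modes, so their difference is a scalar by \<open>scalar_on_basis\<close>, and the
  scalar can be read off at the vacuum.\<close>

lemma shift_op_bracket:
  assumes "finsupp f"
  shows "shift_op c d (shift_op c' d' f) - shift_op c' d' (shift_op c d f) =
    shift_op (\<lambda>\<nu>. c (\<nu> + d') * c' \<nu> - c' (\<nu> + d) * c \<nu>) (d + d') f + fsc (cocycle c d c' d') f"
proof -
  let ?c = "\<lambda>\<nu>. c (\<nu> + d') * c' \<nu> - c' (\<nu> + d) * c \<nu>"
  define K where "K f = shift_op c d (shift_op c' d' f) - shift_op c' d' (shift_op c d f) - shift_op ?c (d + d') f" for f
  have add: "K (f + g) = K f + K g" for f g by (simp add: K_def)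
  have scale: "K (fsc a f) = fsc a (K f)" for a f
    by (simp add: K_def fun_eq_iff algebra_simps)
  have cr: "K (creator \<nu> f) = creator \<nu> (K f)" for \<nu> f
    by (simp add: K_def shift_op_creator fun_eq_iff algebra_simps)
  have an: "K (annihilator \<nu> f) = annihilator \<nu> (K f)" for \<nu> f
    by (simp add: K_def shift_op_annihilator fun_eq_iff algebra_simps)
  \<comment> \<open>A normally ordered operator has vacuum expectation zero, so the scalar is that
    of the commutator alone.\<close>
  have "shift_op ?c (d + d') (basis {||}) {||} = 0"
  proof -
    consider "d + d' < 0" | "d + d' = 0" | "d + d' > 0" by linarith
    then show ?thesis
    proof cases
      case 1 then show ?thesis using shift_op_at_ray[OF 1, of ?c _ 0] by (simp add: ray_zero)
    next
      case 2 then show ?thesis using shift_op_diagonal[of "{}" "{||}" ?c] by simp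
    next
      case 3 then show ?thesis using shift_op_ray[OF 3, of ?c 0] by (simp add: ray_zero)
    qed
  qed
  then have k0: "K (basis {||}) {||} = cocycle c d c' d'"
    by (simp add: K_def shift_op_shift_op_at_empty cocycle_def add.commute[of d' d])
  have kb: "K (basis D) = fsc (cocycle c d c' d') (basis D)" for D
    unfolding k0[symmetric] by (rule scalar_on_basis[of K, OF scale cr an])
  have "K f = fsc (cocycle c d c' d') f"
    using assms
  proof (induction f rule: finsupp_induct)
    case zero
    show "K 0 = fsc (cocycle c d c' d') 0" by (simp add: K_def)
  next
    case (add f a D)
    show "K (f + fsc a (basis D)) = fsc (cocycle c d c' d') (f + fsc a (basis D))"
      by (simp only: \<open>\<And>f g. K (f + g) = K f + K g\<close> scale kb add fock.scale_right_distrib fock.scale_left_commute)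
  qed
  then show ?thesis by (simp add: K_def diff_eq_eq add.commute)
qed


subsection \<open>The contravariant form\<close>

text \<open>Bilinear and not Hermitian, so that transposes involve no conjugation; positivity enters
  through \<open>conj_state\<close>.\<close>

definition pairing :: "fock \<Rightarrow> fock \<Rightarrow> complex"
  where "pairing f g = Sum_any (\<lambda>D. f D * g D)"

lemma pairing_eq_sum:
  assumes "finite S" "{D. f D \<noteq> 0} \<subseteq> S"
  shows "pairing f g = (\<Sum>D\<in>S. f D * g D)"
  unfolding pairing_def using assms by (intro Sum_any.expand_superset) auto

lemma pairing_basis [simp]: "pairing (basis D) g = g D"
  by (subst pairing_eq_sum[of "{D}"]) (auto simp: basis_def)

lemma pairing_basis_right:
  assumes "finsupp f" shows "pairing f (basis D) = f D"
proof -
  have "pairing f (basis D) = (\<Sum>D'\<in>{D'. f D' \<noteq> 0}. if D' = D then f D' else 0)"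
    unfolding pairing_eq_sum[OF assms[unfolded finsupp_def] subset_refl]
    by (intro sum.cong) (auto simp: basis_def)
  then show ?thesis using assms by (simp add: finsupp_def)
qed

lemma pairing_zero [simp]: "pairing 0 g = 0"
  by (simp add: pairing_def)

lemma pairing_add_left:
  assumes "finsupp f" "finsupp f'"
  shows "pairing (f + f') g = pairing f g + pairing f' g"
proof -
  let ?S = "{D. f D \<noteq> 0} \<union> {D. f' D \<noteq> 0}"
  have S: "finite ?S" using assms by (simp add: finsupp_def)
  show ?thesis
    by (subst (1 2 3) pairing_eq_sum[OF S]) (auto simp: algebra_simps sum.distrib)
qed

lemma pairing_add_right: "finsupp f \<Longrightarrow> pairing f (g + g') = pairing f g + pairing f g'"
  by (subst (1 2 3) pairing_eq_sum[of "{D. f D \<noteq> 0}"]) (auto simp: finsupp_def algebra_simps sum.distrib)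

lemma pairing_fsc_left: "finsupp f \<Longrightarrow> pairing (fsc c f) g = c * pairing f g"
  by (subst (1 2) pairing_eq_sum[of "{D. f D \<noteq> 0}"]) (auto simp: finsupp_def sum_distrib_left ac_simps)

lemma pairing_fsc_right: "finsupp f \<Longrightarrow> pairing f (fsc c g) = c * pairing f g"
  by (subst (1 2) pairing_eq_sum[of "{D. f D \<noteq> 0}"]) (auto simp: finsupp_def sum_distrib_left ac_simps)

lemma pairing_zero_right [simp]: "pairing f 0 = 0"
  by (simp add: pairing_def)

lemma shift_term_transpose:
  "shift_term d \<nu> (basis D) D' = shift_term (- d) (\<nu> + d) (basis D') D"
proof (cases "d = 0")
  case True
  then show ?thesis
    by (cases "D = D'") (auto simp: shift_term_def creator_def annihilator_def basis_def)
next
  case False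
  have lhs: "shift_term d \<nu> (basis D) D' = (if occ D' (\<nu> + d) \<and> \<not> occ D' \<nu>
    then jw_sign (\<nu> + d) D' * (jw_sign \<nu> (toggle (\<nu> + d) D') * basis D (toggle \<nu> (toggle (\<nu> + d) D'))) else 0)"
    using False by (auto simp: shift_term_def creator_def annihilator_def simp del: jw_sign_toggle)
  have rhs: "shift_term (- d) (\<nu> + d) (basis D') D = (if occ D \<nu> \<and> \<not> occ D (\<nu> + d)
    then jw_sign \<nu> D * (jw_sign (\<nu> + d) (toggle \<nu> D) * basis D' (toggle (\<nu> + d) (toggle \<nu> D))) else 0)"
    using False by (auto simp: shift_term_def creator_def annihilator_def simp del: jw_sign_toggle)
  have eq: "toggle (\<nu> + d) (toggle \<nu> D) = D' \<longleftrightarrow> toggle \<nu> (toggle (\<nu> + d) D') = D"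
    by (metis toggle_toggle)
  show ?thesis
  proof (cases "toggle (\<nu> + d) (toggle \<nu> D) = D'")
    case True
    then have "D' = toggle (\<nu> + d) (toggle \<nu> D)" by simp
    then show ?thesis unfolding lhs rhs using False by (simp add: basis_def mult.commute)
  next
    case neq: False
    then show ?thesis unfolding lhs rhs using eq by (simp add: basis_def)
  qed
qed

lemma shift_op_transpose:
  "shift_op c d (basis D) D' = shift_op (\<lambda>\<nu>. c (\<nu> - d)) (- d) (basis D') D"
proof -
  let ?V = "shift_window d D' \<union> (\<lambda>\<nu>. \<nu> - d) ` shift_window (- d) D"
  have "shift_op c d (basis D) D' = (\<Sum>\<nu>\<in>?V. c \<nu> * shift_term d \<nu> (basis D) D')"
    by (rule shift_op_eq_sum) auto
  also have "\<dots> = (\<Sum>\<nu>\<in>?V. c (\<nu> + d - d) * shift_term (- d) (\<nu> + d) (basis D') D)"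
    by (simp add: shift_term_transpose[of d _ D])
  also have "\<dots> = (\<Sum>\<nu>\<in>(\<lambda>\<nu>. \<nu> + d) ` ?V. c (\<nu> - d) * shift_term (- d) \<nu> (basis D') D)"
    by (subst sum.reindex) (auto simp: inj_on_def)
  also have "\<dots> = shift_op (\<lambda>\<nu>. c (\<nu> - d)) (- d) (basis D') D"
    by (rule shift_op_eq_sum[symmetric]) (auto simp: image_Un image_image)
  finally show ?thesis .
qed

lemma pairing_shift_op:
  assumes "finsupp f" "finsupp g"
  shows "pairing (shift_op c d f) g = pairing f (shift_op (\<lambda>\<nu>. c (\<nu> - d)) (- d) g)"
  using assms(1)
proof (induction f rule: finsupp_induct)
  case zero
  show "pairing (shift_op c d 0) g = pairing 0 (shift_op (\<lambda>\<nu>. c (\<nu> - d)) (- d) g)" by simp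
next
  case (add f a D)
  have "pairing (shift_op c d (basis D)) g = shift_op (\<lambda>\<nu>. c (\<nu> - d)) (- d) g D"
    using assms(2)
  proof (induction g rule: finsupp_induct)
    case zero
    show "pairing (shift_op c d (basis D)) 0 = shift_op (\<lambda>\<nu>. c (\<nu> - d)) (- d) 0 D" by simp
  next
    case (add g b D')
    have "pairing (shift_op c d (basis D)) (basis D') = shift_op (\<lambda>\<nu>. c (\<nu> - d)) (- d) (basis D') D"
      by (simp add: pairing_basis_right shift_op_transpose[of c d D D'])
    with add show "pairing (shift_op c d (basis D)) (g + fsc b (basis D')) =
        shift_op (\<lambda>\<nu>. c (\<nu> - d)) (- d) (g + fsc b (basis D')) D"
      by (simp add: pairing_add_right pairing_fsc_right)
  qed
  with add show "pairing (shift_op c d (f + fsc a (basis D))) g =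
      pairing (f + fsc a (basis D)) (shift_op (\<lambda>\<nu>. c (\<nu> - d)) (- d) g)"
    by (simp add: pairing_add_left pairing_fsc_left)
qed

section \<open>Conjugation and positivity\<close>

definition conj_state :: "fock \<Rightarrow> fock"
  where "conj_state f = (\<lambda>D. cnj (f D))"

lemma conj_state_simps [simp]:
  "conj_state (f + g) = conj_state f + conj_state g" "conj_state (fsc c f) = fsc (cnj c) (conj_state f)"
  "conj_state 0 = 0" "conj_state (basis D) = basis D"
  by (auto simp: conj_state_def fun_eq_iff basis_def)

lemma conj_state_shift_op:
  assumes "\<And>\<nu>. cnj (c \<nu>) = c \<nu>"
  shows "conj_state (shift_op c d f) = shift_op c d (conj_state f)"
proof
  fix D
  have "cnj (shift_term d \<nu> f D) = shift_term d \<nu> (conj_state f) D" for \<nu>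
    by (auto simp: shift_term_def creator_def annihilator_def conj_state_def)
  then show "conj_state (shift_op c d f) D = shift_op c d (conj_state f) D"
    by (simp add: conj_state_def shift_op_eq_sum[OF _ subset_refl] assms)
qed

text \<open>The pairing with the conjugate is the sum of the squared moduli of the
  coefficients.\<close>

lemma pairing_conj_eq_zero:
  assumes "finsupp f" "pairing (conj_state f) f = 0"
  shows "f = 0"
proof -
  have S: "finite {D. f D \<noteq> 0}" using assms by (simp add: finsupp_def)
  have "pairing (conj_state f) f = (\<Sum>D | f D \<noteq> 0. of_real ((cmod (f D))\<^sup>2))"
    by (subst pairing_eq_sum[OF S])
      (auto simp: conj_state_def complex_norm_square mult.commute simp del: of_real_power intro!: sum.cong)
  also have "\<dots> = of_real (\<Sum>D | f D \<noteq> 0. (cmod (f D))\<^sup>2)" by simp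
  finally have "(\<Sum>D | f D \<noteq> 0. (cmod (f D))\<^sup>2) = 0"
    using assms(2) by (simp del: of_real_sum of_real_power)
  then have "\<forall>D\<in>{D. f D \<noteq> 0}. (cmod (f D))\<^sup>2 = 0"
    using S by (subst (asm) sum_nonneg_eq_0_iff) auto
  then show ?thesis by (auto simp: fun_eq_iff)
qed

section \<open>The affine and Heisenberg algebras on the Fock space\<close>

text \<open>The coefficient depends only on the level \<open>\<nu> div k\<close> and the shift is a
  multiple of k, so all doublets are moved alike.\<close>

definition step_op :: "nat \<Rightarrow> (int \<Rightarrow> complex) \<Rightarrow> int \<Rightarrow> fock \<Rightarrow> fock"
  where "step_op k g m = shift_op (\<lambda>\<nu>. g (\<nu> div int k)) (int k * m)"

lemma div_shift: "k > 0 \<Longrightarrow> (\<nu> + int k * m) div int k = \<nu> div int k + m"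
  by simp

text \<open>Each level contains k modes, one for each doublet; this factor becomes the level of the
  affine representation.\<close>

lemma sum_blocks:
  assumes "k > 0"
  shows "(\<Sum>\<nu>\<in>{- (int k * m)..<0}. G (\<nu> div int k)) = of_nat k * (\<Sum>N\<in>{- m..<0}. G N :: complex)"
proof (cases "m \<ge> 0")
  case True
  then obtain n where m: "m = int n" using nonneg_int_cases by blast
  show ?thesis unfolding m
  proof (induction n)
    case (Suc n)
    have "0 \<le> int k * int n" by simp
    then have kn: "- (int k * int n) \<le> 0" by linarith
    then have split1: "{- (int k * int (Suc n))..<0} =
        {- (int k * int (Suc n))..<- (int k * int n)} \<union> {- (int k * int n)..<0}"
      by (simp add: distrib_left ivl_disj_un_two(3))
    have split2: "{- int (Suc n)..<0} = insert (- int (Suc n)) {- int n..<0}"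
      by auto
    have block: "\<nu> div int k = - int (Suc n)" if "\<nu> \<in> {- (int k * int (Suc n))..<- (int k * int n)}" for \<nu>
    proof (rule int_div_pos_eq[of _ _ _ "\<nu> + int k * int (Suc n)"])
      show "\<nu> = int k * - int (Suc n) + (\<nu> + int k * int (Suc n))" by (simp add: algebra_simps)
    qed (use that in \<open>auto simp: algebra_simps\<close>)
    have "(\<Sum>\<nu>\<in>{- (int k * int (Suc n))..<- (int k * int n)}. G (\<nu> div int k)) =
      (\<Sum>\<nu>\<in>{- (int k * int (Suc n))..<- (int k * int n)}. G (- int (Suc n)))"
      by (intro sum.cong refl) (metis block)
    also have "\<dots> = of_nat k * G (- int (Suc n))"
      by (simp add: algebra_simps)
    finally have "(\<Sum>\<nu>\<in>{- (int k * int (Suc n))..<0}. G (\<nu> div int k)) =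
        of_nat k * G (- int (Suc n)) + (\<Sum>\<nu>\<in>{- (int k * int n)..<0}. G (\<nu> div int k))"
      unfolding split1 by (subst sum.union_disjoint) auto
    also have "\<dots> = of_nat k * (\<Sum>N\<in>{- int (Suc n)..<0}. G N)"
      unfolding split2 Suc.IH by (subst sum.insert) (auto simp: algebra_simps)
    finally show ?case .
  qed simp
next
  case False
  then have "{- (int k * m)..<0} = {}" "{- m..<0} = {}"
    using assms by (auto simp: mult_le_0_iff)
  then show ?thesis by simp
qed

definition step_cocycle :: "(int \<Rightarrow> complex) \<Rightarrow> int \<Rightarrow> (int \<Rightarrow> complex) \<Rightarrow> int \<Rightarrow> complex"
  where "step_cocycle g m g' m' = (if m + m' = 0
    then (\<Sum>N\<in>{- m..<0}. g N * g' (N + m)) - (\<Sum>N\<in>{- m'..<0}. g' N * g (N + m')) else 0)"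

lemma step_op_bracket:
  assumes "k > 0" "finsupp f"
  shows "step_op k g m (step_op k g' m' f) - step_op k g' m' (step_op k g m f) =
    step_op k (\<lambda>N. g (N + m') * g' N - g' (N + m) * g N) (m + m') f + fsc (of_nat k * step_cocycle g m g' m') f"
proof -
  have "cocycle (\<lambda>\<nu>. g (\<nu> div int k)) (int k * m) (\<lambda>\<nu>. g' (\<nu> div int k)) (int k * m')
    = of_nat k * step_cocycle g m g' m'"
  proof -
    have eq: "int k * m + int k * m' = 0 \<longleftrightarrow> m + m' = 0"
      using assms(1) by (simp flip: distrib_left)
    show ?thesis
      unfolding cocycle_def step_cocycle_def eq div_shift[OF assms(1)]
      using sum_blocks[OF assms(1), where G = "\<lambda>N. g N * g' (N + m)" and m = m]
        sum_blocks[OF assms(1), where G = "\<lambda>N. g' N * g (N + m')" and m = m']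
      by (simp add: right_diff_distrib)
  qed
  then show ?thesis
    using shift_op_bracket[OF assms(2), of "\<lambda>\<nu>. g (\<nu> div int k)" "int k * m" "\<lambda>\<nu>. g' (\<nu> div int k)" "int k * m'"]
    by (simp only: step_op_def div_shift[OF assms(1)] distrib_left)
qed

text \<open>Mode \<open>\<nu> = k N + i\<close> belongs to the \<open>i\<close>-th of \<open>k\<close> doublets of fermions; the spin of its
  doublet component is up for odd \<open>N\<close> and down for even \<open>N\<close>, and its energy is \<open>N div 2\<close>.\<close>

fun sl2_coeff :: "sl2 \<Rightarrow> int \<Rightarrow> complex" where
  "sl2_coeff E N = (if even N then 1 else 0)"
| "sl2_coeff F N = (if odd N then 1 else 0)"
| "sl2_coeff H N = (if odd N then 1 else - 1)"

fun sl2_step :: "sl2 \<Rightarrow> int" where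
  "sl2_step E = 1" | "sl2_step H = 0" | "sl2_step F = - 1"

datatype letter = Lp sl2 int | Hs int

text \<open>The current counting all 2 k species of fermions has commutator \<open>2 k i\<close>;
  dividing it by the square root of 2 k gives the Heisenberg relations. A unit of energy is two
  levels, hence the steps \<open>2 i\<close>.\<close>

fun mop :: "nat \<Rightarrow> letter \<Rightarrow> fock \<Rightarrow> fock" where
  "mop k (Lp X i) f = step_op k (sl2_coeff X) (2 * i + sl2_step X) f"
| "mop k (Hs i) f = fsc (of_real (1 / sqrt (2 * real k))) (step_op k (\<lambda>_. 1) (2 * i) f)"

lemma step_op_linear [simp]:
  "step_op k g m (f + f') = step_op k g m f + step_op k g m f'"
  "step_op k g m (fsc a f) = fsc a (step_op k g m f)"
  "step_op k g m (f - f') = step_op k g m f - step_op k g m f'"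
  "step_op k g m (- f) = - step_op k g m f"
  "step_op k g m 0 = 0"
  by (simp_all add: step_op_def)

lemma mop_linear [simp]:
  "mop k x (f + f') = mop k x f + mop k x f'" "mop k x (fsc a f) = fsc a (mop k x f)"
  "mop k x (f - f') = mop k x f - mop k x f'" "mop k x 0 = 0"
  by (cases x; simp add: fock.scale_right_distrib fock.scale_right_diff_distrib mult.commute)+

lemma finsupp_mop [simp]: "finsupp f \<Longrightarrow> finsupp (mop k x f)"
  by (cases x) (auto simp: step_op_def)

lemma step_op_coeff_add:
  "step_op k (\<lambda>N. g N + g' N) m f = step_op k g m f + step_op k g' m f"
  by (auto simp: step_op_def fun_eq_iff shift_op_eq_sum[OF _ subset_refl] algebra_simps sum.distrib)

lemma step_op_coeff_scale:
  "step_op k (\<lambda>N. a * g N) m f = fsc a (step_op k g m f)"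
  by (auto simp: step_op_def fun_eq_iff shift_op_eq_sum[OF _ subset_refl] algebra_simps sum_distrib_left)

lemma step_op_coeff_zero [simp]: "step_op k (\<lambda>N. 0) m f = 0"
  by (auto simp: step_op_def fun_eq_iff shift_op_def)

section \<open>Central terms: counting levels next to the Fermi level\<close>

lemma count_even: "(\<Sum>N\<in>{- (2 * i + 1)..<0}. (if even N then 1 else 0)) = (if 0 \<le> i then of_int i else 0 :: complex)"
proof (cases "i \<ge> 0")
  case True
  then obtain n where i: "i = int n" using nonneg_int_cases by blast
  show ?thesis unfolding i
  proof (induction n)
    case (Suc n)
    have eq: "{- (2 * int (Suc n) + 1)..<0} =
      insert (- (2 * int n + 3)) (insert (- (2 * int n + 2)) {- (2 * int n + 1)..<0})" by auto
    show ?case unfolding eq using Suc by (subst sum.insert; simp)+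
  next
    case 0
    have "{- (2 * int 0 + 1)..<0} = {- 1}" by auto
    then show ?case by simp
  qed
qed auto

lemma count_odd: "(\<Sum>N\<in>{- (2 * i + 1)..<0}. (if odd N then 1 else 0)) = (if 0 \<le> i then of_int i + 1 else 0 :: complex)"
proof (cases "i \<ge> 0")
  case True
  then obtain n where i: "i = int n" using nonneg_int_cases by blast
  have "(\<Sum>N\<in>{- (2 * i + 1)..<0}. (if odd N then 1 else 0)) + (\<Sum>N\<in>{- (2 * i + 1)..<0}. (if even N then 1 else 0)) =
    (\<Sum>N\<in>{- (2 * i + 1)..<0}. 1 :: complex)"
    unfolding sum.distrib[symmetric] by (intro sum.cong) auto
  also have "\<dots> = of_int (2 * i + 1)" using True by simp
  finally have "(\<Sum>N\<in>{- (2 * i + 1)..<0}. (if odd N then 1 else 0)) = of_int (2 * i + 1) - (of_int i :: complex)"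
    unfolding eq_diff_eq using True by (simp only: count_even if_True)
  then show ?thesis using True by simp
qed auto

lemma count_all: "(\<Sum>N\<in>{- (2 * i)..<0}. 1) = (if 0 \<le> i then 2 * of_int i else 0 :: complex)"
  by auto

lemma count_sign:
  fixes i :: int
  shows "(\<Sum>N\<in>{- (2 * i)..<0}. (if odd N then 1 else - 1)) = (0 :: complex)"
proof (cases "i \<ge> 0")
  case True
  then obtain n where i: "i = int n" using nonneg_int_cases by blast
  show ?thesis unfolding i
  proof (induction n)
    case (Suc n)
    have eq: "{- (2 * int (Suc n))..<0} =
      insert (- (2 * int n + 2)) (insert (- (2 * int n + 1)) {- (2 * int n)..<0})" by auto
    show ?case unfolding eq using Suc by (subst sum.insert; simp)+
  qed simp
qed auto

lemma step_cocycle_swap: "step_cocycle g' m' g m = - step_cocycle g m g' m'"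
  by (simp add: step_cocycle_def add.commute[of m' m])

text \<open>For \<open>0 \<le> i\<close> the central term counts the i even levels among the
  \<open>2 i + 1\<close> levels below the Fermi level. For negative i it is minus the number
  \<open>- i\<close> of odd levels in the interval of the opposite operator.\<close>

lemma step_cocycle_EF:
  "step_cocycle (sl2_coeff E) (2 * i + 1) (sl2_coeff F) (- (2 * i + 1)) = of_int i"
proof -
  have A: "(\<Sum>N\<in>{- (2 * i + 1)..<0}. sl2_coeff E N * sl2_coeff F (N + (2 * i + 1))) =
      (if 0 \<le> i then of_int i else 0)"
    unfolding count_even[symmetric] by (intro sum.cong) auto
  have set_eq: "- (2 * (- i - 1) + 1) = - (- (2 * i + 1))" by simp
  have B: "(\<Sum>N\<in>{- (- (2 * i + 1))..<0}. sl2_coeff F N * sl2_coeff E (N + - (2 * i + 1))) =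
      (if 0 \<le> - i - 1 then of_int (- i - 1) + 1 else 0)"
    unfolding count_odd[of "- i - 1", unfolded set_eq, symmetric] by (intro sum.cong) auto
  show ?thesis unfolding step_cocycle_def A B by simp
qed

text \<open>Only E with F and H with H contribute: H with E or F has an odd, hence nonzero, total
  step, and for two equal letters other than H the two coefficients live on levels of opposite
  parity.\<close>

lemma step_cocycle_sl2:
  "step_cocycle (sl2_coeff X) (2 * i + sl2_step X) (sl2_coeff Y) (2 * j + sl2_step Y) =
    (if i + j = 0 then of_int i * sl2_form X Y else 0)"
proof -
  consider "X = E" "Y = F" | "X = F" "Y = E" | "X = H" "Y = H"
    | "X = Y" "X \<noteq> H" | "X = H" "Y \<noteq> H" | "X \<noteq> H" "Y = H"
    by (cases X; cases Y) auto
  then show ?thesis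
  proof cases
    case 1
    show ?thesis
    proof (cases "i + j = 0")
      case True
      then have j: "2 * j + sl2_step Y = - (2 * i + 1)" using 1 by simp
      show ?thesis unfolding j using 1 True step_cocycle_EF[of i] by (simp del: minus_add_distrib)
    qed (use 1 in \<open>simp add: step_cocycle_def\<close>)
  next
    case 2
    show ?thesis
    proof (cases "i + j = 0")
      case True
      then have j: "2 * i + sl2_step X = - (2 * j + 1)" "i = - j" using 2 by simp_all
      show ?thesis unfolding j(1) step_cocycle_swap[of _ _ "sl2_coeff Y"]
        using 2 True j(2) step_cocycle_EF[of j] by (simp del: minus_add_distrib)
    qed (use 2 in \<open>simp add: step_cocycle_def\<close>)
  next
    case 3
    have sum: "(\<Sum>N\<in>{- (2 * i)..<0}. sl2_coeff H N * sl2_coeff H (N + 2 * i)) =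
      (if 0 \<le> i then 2 * of_int i else 0)" for i :: int
      unfolding count_all[symmetric] by (intro sum.cong) auto
    show ?thesis
    proof (cases "i + j = 0")
      case True
      then have j: "j = - i" by simp
      show ?thesis unfolding 3 j sl2_step.simps add_0_right step_cocycle_def sum by simp
    qed (use 3 in \<open>simp add: step_cocycle_def\<close>)
  next
    case 4
    have "sl2_coeff X N * sl2_coeff Y (N + (2 * i + sl2_step X)) = 0"
      "sl2_coeff Y N * sl2_coeff X (N + (2 * i + sl2_step Y)) = 0" for N i
      using 4 by (cases X; simp)+
    moreover have "sl2_form X Y = 0" using 4 by (cases X) auto
    ultimately show ?thesis by (simp only: step_cocycle_def sum.neutral_const) simp
  next
    case 5
    then have "2 * i + sl2_step X + (2 * j + sl2_step Y) \<noteq> 0" by (cases Y) (simp_all, presburger+)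
    moreover have "sl2_form X Y = 0" using 5 by (cases Y) auto
    ultimately show ?thesis by (simp add: step_cocycle_def)
  next
    case 6
    then have "2 * i + sl2_step X + (2 * j + sl2_step Y) \<noteq> 0" by (cases X) (simp_all, presburger+)
    moreover have "sl2_form X Y = 0" using 6 by (cases X) auto
    ultimately show ?thesis by (simp add: step_cocycle_def)
  qed
qed

lemma sl2_coeff_bracket:
  "step_op k (\<lambda>N. sl2_coeff X (N + (2 * j + sl2_step Y)) * sl2_coeff Y N -
       sl2_coeff Y (N + (2 * i + sl2_step X)) * sl2_coeff X N)
     (2 * i + sl2_step X + (2 * j + sl2_step Y)) f =
   (\<Sum>(c, Z)\<leftarrow>sl2_bracket X Y. fsc c (mop k (Lp Z (i + j)) f))"
proof -
  have *: "step_op k g m f = fsc a (step_op k g' m' f)" if "m = m'" "\<And>N. g N = a * g' N" for g g' m m' a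
  proof -
    have "g = (\<lambda>N. a * g' N)" using that by auto
    then show ?thesis using that(1) by (simp add: step_op_coeff_scale)
  qed
  have **: "step_op k g m f = 0" if "\<And>N. g N = 0" for g m
  proof -
    have "g = (\<lambda>N. 0)" using that by auto
    then show ?thesis by simp
  qed
  show ?thesis
    by (cases X; cases Y; simp only: sl2_bracket.simps list.map prod.case sum_list.Cons sum_list.Nil add_0_right
        mop.simps; (rule * | rule **); auto)
qed

lemma mop_bracket_loop:
  assumes "k > 0" "finsupp f"
  shows "mop k (Lp X i) (mop k (Lp Y j) f) - mop k (Lp Y j) (mop k (Lp X i) f) =
    (\<Sum>(c, Z)\<leftarrow>sl2_bracket X Y. fsc c (mop k (Lp Z (i + j)) f)) +
    fsc (if i + j = 0 then of_int i * sl2_form X Y * of_nat k else 0) f"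
  unfolding mop.simps(1)[of k X] mop.simps(1)[of k Y] step_op_bracket[OF assms] sl2_coeff_bracket
    step_cocycle_sl2 by (simp add: mult.commute)

text \<open>Charge is blind to spin, so the coefficient functions commute. The central term with E
  or F has odd total step, and the one with H is a sum of spin signs over an interval of even
  length, which cancels.\<close>

lemma mop_bracket_Hs_loop:
  assumes "k > 0" "finsupp f"
  shows "mop k (Hs i) (mop k (Lp Y j) f) = mop k (Lp Y j) (mop k (Hs i) f)"
proof -
  have "step_cocycle (\<lambda>_. 1) (2 * i) (sl2_coeff Y) (2 * j + sl2_step Y) = 0"
  proof (cases Y)
    case H
    have s1: "(\<Sum>N\<in>{- (2 * i)..<0}. 1 * sl2_coeff H (N + 2 * i)) = 0"
      unfolding count_sign[of i, symmetric] by (intro sum.cong) auto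
    have s2: "(\<Sum>N\<in>{- (2 * j)..<0}. sl2_coeff H N * 1) = 0"
      unfolding count_sign[of j, symmetric] by (intro sum.cong) auto
    show ?thesis unfolding H sl2_step.simps add_0_right step_cocycle_def s1 s2 by simp
  qed (simp_all add: step_cocycle_def, presburger+)
  moreover have "(\<lambda>N. 1 * sl2_coeff Y N - sl2_coeff Y (N + 2 * i) * 1) = (\<lambda>N. 0)"
    by (cases Y) (auto simp: fun_eq_iff)
  ultimately have "step_op k (\<lambda>_. 1) (2 * i) (mop k (Lp Y j) f) - mop k (Lp Y j) (step_op k (\<lambda>_. 1) (2 * i) f) = 0"
    unfolding mop.simps step_op_bracket[OF assms] by (simp add: fsc_def zero_fun_def)
  then show ?thesis by simp
qed

lemma mop_bracket_Hs:
  assumes "k > 0" "finsupp f"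
  shows "mop k (Hs i) (mop k (Hs j) f) - mop k (Hs j) (mop k (Hs i) f) =
    (if i + j = 0 then fsc (of_int i) f else 0)"
proof -
  define a :: complex where "a = of_real (1 / sqrt (2 * real k))"
  have "a * a = of_real (1 / (2 * real k))"
    unfolding a_def using assms(1) by (simp flip: of_real_mult)
  moreover have "a * (a * (of_nat k * (2 * z))) = (a * a) * (2 * of_nat k) * z" for z
    by (simp only: ac_simps)
  ultimately have sq: "a * (a * (of_nat k * (2 * z))) = z" for z
    using assms(1) by simp
  have "step_cocycle (\<lambda>_. 1) (2 * i) (\<lambda>_. 1) (2 * j) = (if i + j = 0 then 2 * of_int i else 0)"
  proof (cases "i + j = 0")
    case True
    then have "j = - i" by simp
    then show ?thesis using count_all[of i] count_all[of "- i"] by (auto simp: step_cocycle_def)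
  next
    case False
    then have "2 * i + 2 * j \<noteq> 0" by presburger
    then show ?thesis using False by (simp add: step_cocycle_def)
  qed
  then have "step_op k (\<lambda>_. 1) (2 * i) (step_op k (\<lambda>_. 1) (2 * j) f) -
      step_op k (\<lambda>_. 1) (2 * j) (step_op k (\<lambda>_. 1) (2 * i) f) =
      fsc (of_nat k * (if i + j = 0 then 2 * of_int i else 0)) f"
    unfolding step_op_bracket[OF assms] by simp
  then have "fsc a (fsc a
    (step_op k (\<lambda>_. 1) (2 * i) (step_op k (\<lambda>_. 1) (2 * j) f) -
      step_op k (\<lambda>_. 1) (2 * j) (step_op k (\<lambda>_. 1) (2 * i) f))) = fsc (if i + j = 0 then of_int i else 0) f"
    by (simp add: sq)
  then show ?thesis
    unfolding mop.simps a_def[symmetric]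
    by (simp add: fock.scale_right_diff_distrib split: if_splits)
qed

section \<open>Contravariance, and filled seas as highest weight vectors\<close>

fun adjoint_letter :: "letter \<Rightarrow> letter" where
  "adjoint_letter (Lp E i) = Lp F (- i)"
| "adjoint_letter (Lp F i) = Lp E (- i)"
| "adjoint_letter (Lp H i) = Lp H (- i)"
| "adjoint_letter (Hs i) = Hs (- i)"

lemma step_op_transpose:
  assumes "k > 0" "finsupp f" "finsupp f'" "\<And>N. g' N = g (N - m)" "m' = - m"
  shows "pairing (step_op k g m f) f' = pairing f (step_op k g' m' f')"
proof -
  have "(\<lambda>\<nu>. g ((\<nu> - int k * m) div int k)) = (\<lambda>\<nu>. g' (\<nu> div int k))"
    using assms(1) div_shift[of k _ "- m"] by (simp add: fun_eq_iff assms(4))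
  then show ?thesis
    using pairing_shift_op[OF assms(2,3), of "\<lambda>\<nu>. g (\<nu> div int k)" "int k * m"]
    by (simp add: step_op_def assms(5))
qed

lemma pairing_mop:
  assumes "k > 0" "finsupp f" "finsupp f'"
  shows "pairing (mop k x f) f' = pairing f (mop k (adjoint_letter x) f')"
proof (cases x)
  case (Lp X i)
  then show ?thesis using assms by (cases X) (auto intro!: step_op_transpose)
next
  case (Hs i)
  have fs: "finsupp (step_op k g m h)" if "finsupp h" for g m h using that by (simp add: step_op_def)
  show ?thesis using Hs assms fs
    by (simp add: pairing_fsc_left pairing_fsc_right step_op_transpose[of k f f' "\<lambda>_. 1" "\<lambda>_. 1" "2 * i" "- (2 * i)"])
qed

lemma conj_state_mop: "conj_state (mop k x f) = mop k x (conj_state f)"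
proof -
  have "cnj (sl2_coeff X N) = sl2_coeff X N" for X N by (cases X) auto
  then show ?thesis by (cases x) (simp_all add: step_op_def conj_state_shift_op)
qed

fun lowering :: "letter \<Rightarrow> bool" where
  "lowering (Lp X i) \<longleftrightarrow> i < 0 \<or> i = 0 \<and> X = F"
| "lowering (Hs i) \<longleftrightarrow> i < 0"

text \<open>The zero mode is excluded because it does not match on the two sides: on a sea
  \<open>ray e\<close> it acts by \<open>- e / sqrt (2 k)\<close>, and for the seas paired with
  vacua of \<open>\<H> q\<close> below this differs from q by
  \<open>2 l / sqrt (2 k)\<close>.\<close>

definition proper_letters :: "letter set"
  where "proper_letters = {x. x \<noteq> Hs 0}"

text \<open>Every lowering letter has a negative step. Hence the coefficient of a filled sea is a
  functional that vanishes on lowered states, as the dual vacua do on the tensor side.\<close>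

lemma mop_lowering_at_ray:
  assumes "k > 0" "lowering x" shows "mop k x f (ray e) = 0"
proof (cases x)
  case (Lp X i)
  with assms have "int k * (2 * i + sl2_step X) < 0"
    by (cases X) (auto simp: mult_less_0_iff)
  then show ?thesis using Lp by (simp add: step_op_def shift_op_at_ray)
next
  case (Hs i)
  with assms have "int k * (2 * i) < 0" by (auto simp: mult_less_0_iff)
  then show ?thesis using Hs by (simp add: step_op_def shift_op_at_ray)
qed

text \<open>The H_0 weight of the sea, which lies between 0 and k; a sea can therefore stand for one
  of the k + 1 highest weight vectors \<open>|j>\<close>.\<close>

definition ray_weight :: "nat \<Rightarrow> int \<Rightarrow> nat"
  where "ray_weight k e = card {\<nu> \<in> {e - int k..<e}. even (\<nu> div int k)}"

lemma ray_weight_sum: "of_nat (ray_weight k e) = (\<Sum>\<nu>\<in>{e - int k..<e}. (if even (\<nu> div int k) then 1 else 0) :: complex)"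
  by (simp add: ray_weight_def sum.If_cases Int_def)

text \<open>Both sides satisfy the same recursion in e: consecutive seas differ by the mode e, and
  consecutive windows by e and \<open>e - k\<close>, which lie on adjacent levels of opposite
  spin.\<close>

lemma H0_ray:
  assumes "k > 0"
  shows "mop k (Lp H 0) (basis (ray e)) = fsc (of_nat (ray_weight k e)) (basis (ray e))"
proof -
  let ?h = "\<lambda>\<nu>. sl2_coeff H (\<nu> div int k)"
  let ?W = "\<lambda>e. sum ?h {e..<0} - sum ?h {0..<e}"
  let ?J = "\<lambda>e. \<Sum>\<nu>\<in>{e - int k..<e}. (if even (\<nu> div int k) then 1 else 0) :: complex"
  have W: "?W e = ?h e + ?W (e + 1)" for e
  proof (cases "e < 0")
    case True
    then have "{e..<0} = insert e {e + 1..<0}" by auto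
    with True show ?thesis by simp
  next
    case False
    then have "{0..<e + 1} = insert e {0..<e}" by auto
    with False show ?thesis by simp
  qed
  have J: "?J e = ?h e + ?J (e + 1)" for e
  proof -
    have "{e - int k..<e} = insert (e - int k) {e + 1 - int k..<e}"
      "{e + 1 - int k..<e + 1} = insert e {e + 1 - int k..<e}" using assms by auto
    moreover have "(e - int k) div int k = e div int k - 1"
      using assms div_shift[of k e "- 1"] by simp
    ultimately show ?thesis by simp
  qed
  have J0: "?J 0 = 0"
  proof (intro sum.neutral ballI)
    fix \<nu> assume "\<nu> \<in> {0 - int k..<0}"
    then have "\<nu> div int k = - 1"
      by (intro int_div_pos_eq[of _ _ _ "\<nu> + int k"]) auto
    then show "(if even (\<nu> div int k) then 1 else 0) = (0 :: complex)" by simp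
  qed
  have "?W e = ?J e"
  proof (induction e rule: int_induct[of _ 0])
    case base
    show ?case unfolding J0 by simp
  next
    case (step1 i)
    then show ?case using W[of i] J[of i] by simp
  next
    case (step2 i)
    then show ?case using W[of "i - 1"] J[of "i - 1"] by simp
  qed
  then show ?thesis by (simp only: mop.simps step_op_def sl2_step.simps) (simp only: mult_zero_right add_0 shift_op_diagonal_ray ray_weight_sum)
qed

lemma mop_raising_ray:
  assumes "k > 0" "x \<in> proper_letters" "\<not> lowering x"
  shows "mop k x (basis (ray e)) = (if x = Lp H 0 then fsc (of_nat (ray_weight k e)) (basis (ray e)) else 0)"
proof (cases x)
  case (Lp X i)
  show ?thesis
  proof (cases "x = Lp H 0")
    case False
    with assms Lp have "int k * (2 * i + sl2_step X) > 0"
      by (cases X) (auto simp: zero_less_mult_iff)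
    then have "mop k x (basis (ray e)) = 0" using Lp by (simp add: step_op_def shift_op_ray)
    then show ?thesis using False by simp
  qed (use H0_ray[OF assms(1)] in simp)
next
  case (Hs i)
  with assms have "int k * (2 * i) > 0" by (auto simp: proper_letters_def)
  then show ?thesis using Hs by (simp add: step_op_def shift_op_ray)
qed

section \<open>The fermionic vertex operators\<close>

subsection \<open>Pointwise finite sums\<close>

text \<open>A fermionic field mode is a sum with infinitely many nonzero terms, of which each
  coefficient sees only finitely many; \<open>psum\<close> is the resulting completed sum.\<close>

definition pfin :: "(int \<Rightarrow> fock) \<Rightarrow> bool"
  where "pfin g \<longleftrightarrow> (\<forall>D. finite {N. g N D \<noteq> 0})"

definition psum :: "(int \<Rightarrow> fock) \<Rightarrow> fock"
  where "psum g = (\<lambda>D. Sum_any (\<lambda>N. g N D))"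

lemma pfinI: "(\<And>D. finite {N. g N D \<noteq> 0}) \<Longrightarrow> pfin g"
  by (simp add: pfin_def)

lemma pfin_subset:
  assumes "pfin g" "\<And>N D. h N D \<noteq> 0 \<Longrightarrow> g N D \<noteq> 0"
  shows "pfin h"
proof (rule pfinI)
  fix D
  have "finite {N. g N D \<noteq> 0}" using assms(1) by (simp add: pfin_def)
  then show "finite {N. h N D \<noteq> 0}" by (rule rev_finite_subset) (auto dest: assms(2))
qed

lemma pfin_add: "pfin g \<Longrightarrow> pfin h \<Longrightarrow> pfin (\<lambda>N. g N + h N)"
  unfolding pfin_def
proof
  fix D assume "\<forall>D. finite {N. g N D \<noteq> 0}" "\<forall>D. finite {N. h N D \<noteq> 0}"
  then show "finite {N. (g N + h N) D \<noteq> 0}"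
    by - (rule finite_subset[of _ "{N. g N D \<noteq> 0} \<union> {N. h N D \<noteq> 0}"], auto)
qed

lemma pfin_diff: "pfin g \<Longrightarrow> pfin h \<Longrightarrow> pfin (\<lambda>N. g N - h N)"
  unfolding pfin_def
proof
  fix D assume "\<forall>D. finite {N. g N D \<noteq> 0}" "\<forall>D. finite {N. h N D \<noteq> 0}"
  then show "finite {N. (g N - h N) D \<noteq> 0}"
    by - (rule finite_subset[of _ "{N. g N D \<noteq> 0} \<union> {N. h N D \<noteq> 0}"], auto)
qed

lemma pfin_fsc: "pfin g \<Longrightarrow> pfin (\<lambda>N. fsc (a N) (g N))"
  by (rule pfin_subset) auto

lemma pfin_sum: "(\<And>i. i \<in> I \<Longrightarrow> pfin (g i)) \<Longrightarrow> pfin (\<lambda>N. \<Sum>i\<in>I. g i N)"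
  by (induction I rule: infinite_finite_induct) (auto simp: pfin_add, auto simp: pfin_def)

lemma pfin_creator:
  assumes "pfin g" shows "pfin (\<lambda>N. creator \<mu> (g N))"
proof (rule pfinI)
  fix D
  show "finite {N. creator \<mu> (g N) D \<noteq> 0}"
    using assms by - (rule finite_subset[of _ "{N. g N (toggle \<mu> D) \<noteq> 0}"], auto simp: creator_def pfin_def)
qed

lemma pfin_annihilator:
  assumes "pfin g" shows "pfin (\<lambda>N. annihilator \<mu> (g N))"
proof (rule pfinI)
  fix D
  show "finite {N. annihilator \<mu> (g N) D \<noteq> 0}"
    using assms by - (rule finite_subset[of _ "{N. g N (toggle \<mu> D) \<noteq> 0}"], auto simp: annihilator_def pfin_def)
qed

lemma pfin_shift_term: "pfin g \<Longrightarrow> pfin (\<lambda>N. shift_term d \<nu> (g N))"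
  unfolding shift_term_def
  by (intro pfin_diff pfin_creator pfin_annihilator) (auto simp: pfin_def)

lemma pfin_shift_op:
  assumes "pfin g" shows "pfin (\<lambda>N. shift_op c d (g N))"
proof (rule pfinI)
  fix D
  have "{N. shift_op c d (g N) D \<noteq> 0} \<subseteq> (\<Union>\<nu>\<in>shift_window d D. {N. shift_term d \<nu> (g N) D \<noteq> 0})"
    by (auto simp: shift_op_eq_sum[OF _ subset_refl] elim!: sum.not_neutral_contains_not_neutral)
  moreover have "finite \<dots>" using pfin_shift_term[OF assms] by (auto simp: pfin_def)
  ultimately show "finite {N. shift_op c d (g N) D \<noteq> 0}" by (rule finite_subset)
qed

lemma Collect_shift: "{N :: int. P N} = (\<lambda>N. N + a) ` {N. P (N + a)}"
proof (intro equalityI subsetI)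
  fix N assume "N \<in> {N. P N}"
  then show "N \<in> (\<lambda>N. N + a) ` {N. P (N + a)}" by (intro image_eqI[of _ _ "N - a"]) auto
qed auto

lemma pfin_reindex: "pfin (\<lambda>N. g (N + a)) \<longleftrightarrow> pfin g"
proof -
  have "finite {N. g (N + a) D \<noteq> 0} \<longleftrightarrow> finite {N. g N D \<noteq> 0}" for D
  proof -
    have "{N. g N D \<noteq> 0} = (\<lambda>N. N + a) ` {N. g (N + a) D \<noteq> 0}"
      by (rule Collect_shift)
    then show ?thesis by (simp add: finite_image_iff)
  qed
  then show ?thesis by (simp add: pfin_def)
qed

lemma psum_cong: "(\<And>N. g N = h N) \<Longrightarrow> psum g = psum h"
  by (simp add: psum_def)

lemma psum_zero [simp]: "psum (\<lambda>N. 0) = 0"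
  by (simp add: psum_def fun_eq_iff)

lemma psum_add: "pfin g \<Longrightarrow> pfin h \<Longrightarrow> psum (\<lambda>N. g N + h N) = psum g + psum h"
  by (simp add: psum_def fun_eq_iff pfin_def Sum_any.distrib)

lemma psum_fsc: "psum (\<lambda>N. fsc a (g N)) = fsc a (psum g)"
proof (cases "a = 0")
  case False
  show ?thesis
  proof
    fix D
    have "{N. a * g N D \<noteq> 0} = {N. g N D \<noteq> 0}" using False by auto
    then show "psum (\<lambda>N. fsc a (g N)) D = fsc a (psum g) D"
      by (simp add: psum_def Sum_any.expand_set sum_distrib_left)
  qed
qed (simp add: psum_def fun_eq_iff)

lemma psum_diff:
  assumes "pfin g" "pfin h" shows "psum (\<lambda>N. g N - h N) = psum g - psum h"
proof -
  have "psum (\<lambda>N. g N + fsc (- 1) (h N)) = psum g + fsc (- 1) (psum h)"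
    using assms by (simp only: psum_add pfin_fsc psum_fsc)
  then show ?thesis by simp
qed

lemma psum_sum:
  "(\<And>i. i \<in> I \<Longrightarrow> pfin (g i)) \<Longrightarrow> psum (\<lambda>N. \<Sum>i\<in>I. g i N) = (\<Sum>i\<in>I. psum (g i))"
proof (induction I rule: infinite_finite_induct)
  case (insert i I)
  then have "psum (\<lambda>N. g i N + (\<Sum>i\<in>I. g i N)) = psum (g i) + psum (\<lambda>N. \<Sum>i\<in>I. g i N)"
    by (intro psum_add pfin_sum) auto
  with insert show "psum (\<lambda>N. \<Sum>i\<in>insert i I. g i N) = (\<Sum>i\<in>insert i I. psum (g i))" by simp
qed simp_all

lemma psum_creator: "creator \<mu> (psum g) = psum (\<lambda>N. creator \<mu> (g N))"
proof
  fix D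
  have "{N. jw_sign \<mu> D * g N (toggle \<mu> D) \<noteq> 0} = {N. g N (toggle \<mu> D) \<noteq> 0}" by auto
  then show "creator \<mu> (psum g) D = psum (\<lambda>N. creator \<mu> (g N)) D"
    by (simp add: creator_def psum_def Sum_any.expand_set sum_distrib_left)
qed

lemma psum_annihilator: "annihilator \<mu> (psum g) = psum (\<lambda>N. annihilator \<mu> (g N))"
proof
  fix D
  have "{N. jw_sign \<mu> D * g N (toggle \<mu> D) \<noteq> 0} = {N. g N (toggle \<mu> D) \<noteq> 0}" by auto
  then show "annihilator \<mu> (psum g) D = psum (\<lambda>N. annihilator \<mu> (g N)) D"
    by (simp add: annihilator_def psum_def Sum_any.expand_set sum_distrib_left)
qed

lemma psum_shift_term:
  assumes "pfin g" shows "shift_term d \<nu> (psum g) = psum (\<lambda>N. shift_term d \<nu> (g N))"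
proof (cases "d = 0 \<and> 0 \<le> \<nu>")
  case True
  then show ?thesis
    using psum_diff[OF pfin_creator[OF pfin_annihilator[OF assms]] assms, of "\<nu> + d" \<nu>]
    by (simp add: shift_term_def psum_creator psum_annihilator)
qed (auto simp: shift_term_def psum_creator psum_annihilator)

lemma psum_shift_op:
  assumes "pfin g" shows "shift_op c d (psum g) = psum (\<lambda>N. shift_op c d (g N))"
proof
  fix D
  let ?V = "shift_window d D"
  let ?S = "\<Union>\<nu>\<in>?V. {N. shift_term d \<nu> (g N) D \<noteq> 0}"
  have S: "finite ?S" using pfin_shift_term[OF assms] by (auto simp: pfin_def)
  have "shift_op c d (psum g) D = (\<Sum>\<nu>\<in>?V. c \<nu> * (\<Sum>N\<in>?S. shift_term d \<nu> (g N) D))"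
    unfolding shift_op_eq_sum[OF finite_shift_window subset_refl] psum_shift_term[OF assms]
  proof (intro sum.cong refl arg_cong2[of _ _ _ _ "(*)"])
    fix \<nu> assume "\<nu> \<in> ?V"
    then show "psum (\<lambda>N. shift_term d \<nu> (g N)) D = (\<Sum>N\<in>?S. shift_term d \<nu> (g N) D)"
      unfolding psum_def using S by (intro Sum_any.expand_superset) auto
  qed
  also have "\<dots> = (\<Sum>N\<in>?S. shift_op c d (g N) D)"
    unfolding shift_op_eq_sum[OF finite_shift_window subset_refl] sum_distrib_left by (rule sum.swap)
  also have "\<dots> = psum (\<lambda>N. shift_op c d (g N)) D"
    unfolding psum_def using S
    by (intro Sum_any.expand_superset[symmetric])
      (auto simp: shift_op_eq_sum[OF finite_shift_window subset_refl] elim!: sum.not_neutral_contains_not_neutral)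
  finally show "shift_op c d (psum g) D = psum (\<lambda>N. shift_op c d (g N)) D" .
qed

lemma psum_reindex: "psum (\<lambda>N. g (N + a)) = psum g"
proof
  fix D
  have eq: "{N. g N D \<noteq> 0} = (\<lambda>N. N + a) ` {N. g (N + a) D \<noteq> 0}"
    by (rule Collect_shift)
  show "psum (\<lambda>N. g (N + a)) D = psum g D"
    unfolding psum_def Sum_any.expand_set eq by (subst sum.reindex) (auto simp: inj_on_def)
qed

lemma psum_single: "psum (\<lambda>N. if N = a then g N else 0) = g a"
proof
  fix D
  have "(\<lambda>N. (if N = a then g N else 0) D) = (\<lambda>N. if N = a then g N D else 0)" by (rule ext) auto
  then show "psum (\<lambda>N. if N = a then g N else 0) D = g a D"
    unfolding psum_def by (simp only: Sum_any.delta)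
qed

lemma psum_double:
  assumes "\<And>N. odd N \<Longrightarrow> g N = 0"
  shows "psum g = psum (\<lambda>m. g (2 * m))"
proof
  fix D
  have eq: "{N. g N D \<noteq> 0} = (\<lambda>m. 2 * m) ` {m. g (2 * m) D \<noteq> 0}"
  proof (intro equalityI subsetI)
    fix N assume N: "N \<in> {N. g N D \<noteq> 0}"
    have "even N"
    proof (rule ccontr)
      assume "odd N"
      then have "g N = 0" by (rule assms)
      with N show False by simp
    qed
    then obtain m where "N = 2 * m" by (rule evenE)
    with N show "N \<in> (\<lambda>m. 2 * m) ` {m. g (2 * m) D \<noteq> 0}" by (intro image_eqI[of _ _ m]) auto
  next
    fix N assume "N \<in> (\<lambda>m. 2 * m) ` {m. g (2 * m) D \<noteq> 0}"
    then show "N \<in> {N. g N D \<noteq> 0}" by (rule imageE) simp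
  qed
  show "psum g D = psum (\<lambda>m. g (2 * m)) D"
    unfolding psum_def Sum_any.expand_set eq by (subst sum.reindex) (auto simp: inj_on_def)
qed

lemma shift_op_psum: "shift_op c d f = psum (\<lambda>\<nu>. fsc (c \<nu>) (shift_term d \<nu> f))"
  by (simp add: shift_op_def psum_def)

lemma pfin_shift_terms: "pfin (\<lambda>\<nu>. fsc (c \<nu>) (shift_term d \<nu> f))"
proof (rule pfinI)
  fix D show "finite {\<nu>. fsc (c \<nu>) (shift_term d \<nu> f) D \<noteq> 0}"
    by (rule finite_subset[of _ "shift_window d D"]) (auto intro: ccontr dest: shift_term_outside)
qed


subsection \<open>Products over the doublets\<close>

definition spin_down :: "int \<Rightarrow> int"
  where "spin_down N = (if even N then 1 else 0)"

text \<open>\<open>cur k s b n\<close> is the coefficient of \<open>x\<^sup>b z\<^sup>-\<^sup>n\<close> in the product, over the first \<open>s\<close> doublets,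
  of the fermion fields \<open>\<psi>\<^sub>\<up> (z) + x \<psi>\<^sub>\<down> (z)\<close>.\<close>

fun cur :: "nat \<Rightarrow> nat \<Rightarrow> int \<Rightarrow> int \<Rightarrow> fock \<Rightarrow> fock" where
  "cur k 0 b n f = (if b = 0 \<and> n = 0 then f else 0)"
| "cur k (Suc s) b n f =
     psum (\<lambda>N. creator (int k * N + int s) (cur k s (b - spin_down N) (n - N div 2) f))"

text \<open>A nonzero coefficient exhibits the modes that were created: one in each doublet,
  occupied in D, whose removal leads back into the support of f. Vanishing and uniqueness statements
  about \<open>cur\<close> are read off from such a choice.\<close>

lemma cur_support:
  assumes "cur k s b n f D \<noteq> 0"
  obtains N D' where "f D' \<noteq> 0"
    "\<And>\<nu>. occ D' \<nu> \<longleftrightarrow> occ D \<nu> \<and> (\<forall>i<s. \<nu> \<noteq> int k * N i + int i)"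
    "\<And>i. i < s \<Longrightarrow> occ D (int k * N i + int i)"
    "(\<Sum>i<s. spin_down (N i)) = b" "(\<Sum>i<s. N i div 2) = n"
proof -
  have "\<exists>N D'. f D' \<noteq> 0 \<and> (\<forall>\<nu>. occ D' \<nu> \<longleftrightarrow> occ D \<nu> \<and> (\<forall>i<s. \<nu> \<noteq> int k * N i + int i)) \<and>
    (\<forall>i<s. occ D (int k * N i + int i)) \<and> (\<Sum>i<s. spin_down (N i)) = b \<and> (\<Sum>i<s. N i div 2) = n"
    using assms
  proof (induction s arbitrary: b n D)
    case 0
    then show ?case by (auto split: if_splits)
  next
    case (Suc s)
    from Suc.prems obtain M where M: "creator (int k * M + int s) (cur k s (b - spin_down M) (n - M div 2) f) D \<noteq> 0"
      by (auto simp: psum_def elim: Sum_any.not_neutral_obtains_not_neutral)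
    let ?\<mu> = "int k * M + int s"
    from M have occ: "occ D ?\<mu>" and nz: "cur k s (b - spin_down M) (n - M div 2) f (toggle ?\<mu> D) \<noteq> 0"
      by (auto simp: creator_def split: if_splits)
    from Suc.IH[OF nz] obtain N D' where N: "f D' \<noteq> 0"
      "\<And>\<nu>. occ D' \<nu> \<longleftrightarrow> occ (toggle ?\<mu> D) \<nu> \<and> (\<forall>i<s. \<nu> \<noteq> int k * N i + int i)"
      "\<And>i. i < s \<Longrightarrow> occ (toggle ?\<mu> D) (int k * N i + int i)"
      "(\<Sum>i<s. spin_down (N i)) = b - spin_down M" "(\<Sum>i<s. N i div 2) = n - M div 2"
      by blast
    let ?N = "N(s := M)"
    have "\<forall>\<nu>. occ D' \<nu> \<longleftrightarrow> occ D \<nu> \<and> (\<forall>i<Suc s. \<nu> \<noteq> int k * ?N i + int i)"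
      using N(2) occ by (auto simp: less_Suc_eq)
    moreover have "occ D (int k * N i + int i)" if "i < s" for i
      using N(3)[OF that] occ by (cases "int k * M + int s = int k * N i + int i") auto
    then have "\<forall>i<Suc s. occ D (int k * ?N i + int i)"
      using occ by (auto simp: less_Suc_eq)
    moreover have "(\<Sum>i<s. spin_down (?N i)) = (\<Sum>i<s. spin_down (N i))"
      "(\<Sum>i<s. ?N i div 2) = (\<Sum>i<s. N i div 2)" by (auto intro: sum.cong)
    ultimately show ?case using N(1,4,5) by (intro exI[of _ ?N] exI[of _ D']) auto
  qed
  then show ?thesis using that by blast
qed

lemma cur_range:
  assumes "b < 0 \<or> int s < b" shows "cur k s b n f = 0"
proof
  fix D
  show "cur k s b n f D = 0 D"
  proof (rule ccontr)
    assume "cur k s b n f D \<noteq> 0 D"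
    then obtain N where N: "(\<Sum>i<s. spin_down (N i)) = b" by (auto elim: cur_support)
    have "0 \<le> (\<Sum>i<s. spin_down (N i))" by (rule sum_nonneg) (simp add: spin_down_def)
    moreover have "(\<Sum>i<s. spin_down (N i)) \<le> (\<Sum>i<s. 1)" by (rule sum_mono) (simp add: spin_down_def)
    ultimately show False using N assms by simp
  qed
qed

lemma occ_bounded_below: "\<exists>B. \<forall>\<nu>. occ D \<nu> \<longrightarrow> int k * B \<le> \<nu>" if "k > 0"
proof -
  have "bdd_below (fset D)" by (intro bdd_below_finite) simp
  then obtain L where L: "\<And>\<nu>. \<nu> \<in> fset D \<Longrightarrow> L \<le> \<nu>" by (auto simp: bdd_below_def)
  let ?B = "min L 0"
  have "int k * ?B \<le> 1 * ?B" using that by (intro mult_right_mono_neg) auto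
  moreover have "occ D \<nu> \<Longrightarrow> ?B \<le> \<nu>" for \<nu> using L[of \<nu>] by (auto simp: occ_def)
  ultimately show ?thesis by (intro exI[of _ ?B]) fastforce
qed

lemma level_bound:
  assumes "int k * B \<le> int k * N + int i" "i < k" shows "B \<le> N"
proof (rule ccontr)
  assume "\<not> B \<le> N"
  then have "int k * (N + 1) \<le> int k * B" by (intro mult_left_mono) auto
  then show False using assms by (simp add: algebra_simps)
qed

text \<open>The occupied modes of D are bounded below and the energies of the chosen modes add up to
  n, so each of them is bounded above as well.\<close>

lemma pfin_cur:
  assumes "s < k"
  shows "pfin (\<lambda>N. creator (int k * N + int s) (cur k s (b - spin_down N) (n - N div 2) f))"
proof (rule pfinI)
  fix D
  obtain B where B: "\<And>\<nu>. occ D \<nu> \<Longrightarrow> int k * B \<le> \<nu>"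
    using occ_bounded_below[of k D] assms by auto
  \<comment> \<open>The first s energies sum to at least \<open>s (B div 2)\<close>, which bounds
    \<open>N div 2\<close>; the final 1 accounts for odd N.\<close>
  have "N \<in> {B..2 * (n - int s * (B div 2)) + 1}"
    if nz: "creator (int k * N + int s) (cur k s (b - spin_down N) (n - N div 2) f) D \<noteq> 0" for N
  proof -
    let ?\<mu> = "int k * N + int s"
    from nz have occ: "occ D ?\<mu>" and nz': "cur k s (b - spin_down N) (n - N div 2) f (toggle ?\<mu> D) \<noteq> 0"
      by (auto simp: creator_def split: if_splits)
    from nz' obtain M where M: "\<And>i. i < s \<Longrightarrow> occ (toggle ?\<mu> D) (int k * M i + int i)"
      and sum: "(\<Sum>i<s. M i div 2) = n - N div 2" by (rule cur_support) blast
    have "B \<le> M i" if "i < s" for i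
      using M[OF that] B assms that occ level_bound[of k B "M i" i] by (auto split: if_splits)
    then have "(\<Sum>i<s. B div 2) \<le> (\<Sum>i<s. M i div 2)" by (intro sum_mono zdiv_mono1) auto
    then have "N div 2 \<le> n - int s * (B div 2)" using sum by simp
    moreover have "B \<le> N" using level_bound[of k B N s] B[OF occ] assms by simp
    ultimately show ?thesis by auto
  qed
  then show "finite {N. creator (int k * N + int s) (cur k s (b - spin_down N) (n - N div 2) f) D \<noteq> 0}"
    by - (rule finite_subset[of _ "{B..2 * (n - int s * (B div 2)) + 1}"], auto)
qed

lemma cur_add: "s \<le> k \<Longrightarrow> cur k s b n (f + g) = cur k s b n f + cur k s b n g"
proof (induction s arbitrary: b n)
  case (Suc s)
  have "cur k (Suc s) b n (f + g) = psum (\<lambda>N. creator (int k * N + int s) (cur k s (b - spin_down N) (n - N div 2) f)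
    + creator (int k * N + int s) (cur k s (b - spin_down N) (n - N div 2) g))"
    using Suc.prems by (simp only: cur.simps Suc.IH Suc_leD creator_linear)
  also have "\<dots> = cur k (Suc s) b n f + cur k (Suc s) b n g"
    unfolding cur.simps using Suc.prems by (intro psum_add pfin_cur) auto
  finally show "cur k (Suc s) b n (f + g) = cur k (Suc s) b n f + cur k (Suc s) b n g" .
qed auto

lemma cur_fsc: "cur k s b n (fsc a f) = fsc a (cur k s b n f)"
proof (induction s arbitrary: b n)
  case (Suc s)
  show "cur k (Suc s) b n (fsc a f) = fsc a (cur k (Suc s) b n f)"
    by (simp only: cur.simps Suc creator_linear psum_fsc)
qed auto

lemma cur_zero [simp]: "cur k s b n 0 = 0"
  using cur_fsc[of k s b n 0 0] by (simp only: fock.scale_zero_left)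

lemma creator_cur: "creator \<nu> (cur k s b n f) = fsc ((- 1) ^ s) (cur k s b n (creator \<nu> f))"
proof (induction s arbitrary: b n)
  case (Suc s)
  have "creator \<nu> (cur k (Suc s) b n f) =
    psum (\<lambda>N. fsc (- 1) (creator (int k * N + int s) (creator \<nu> (cur k s (b - spin_down N) (n - N div 2) f))))"
    unfolding cur.simps psum_creator by (intro psum_cong) (simp add: creator_creator[of \<nu>])
  then show "creator \<nu> (cur k (Suc s) b n f) = fsc ((- 1) ^ Suc s) (cur k (Suc s) b n (creator \<nu> f))"
    by (simp only: Suc psum_fsc creator_linear cur.simps fock.scale_scale power_Suc)
qed auto

lemma annihilator_cur:
  assumes "\<And>N i. i < s \<Longrightarrow> \<nu> \<noteq> int k * N + int i"
  shows "annihilator \<nu> (cur k s b n f) = fsc ((- 1) ^ s) (cur k s b n (annihilator \<nu> f))"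
  using assms
proof (induction s arbitrary: b n)
  case (Suc s)
  have "annihilator \<nu> (cur k (Suc s) b n f) =
    psum (\<lambda>N. fsc (- 1) (creator (int k * N + int s) (annihilator \<nu> (cur k s (b - spin_down N) (n - N div 2) f))))"
    unfolding cur.simps psum_annihilator using Suc.prems[of s]
    by (intro psum_cong) (simp add: annihilator_creator)
  moreover have "annihilator \<nu> (cur k s b n f) = fsc ((- 1) ^ s) (cur k s b n (annihilator \<nu> f))" for b n
    by (rule Suc.IH) (use Suc.prems in auto)
  ultimately show "annihilator \<nu> (cur k (Suc s) b n f) = fsc ((- 1) ^ Suc s) (cur k (Suc s) b n (annihilator \<nu> f))"
    by (simp only: psum_fsc creator_linear cur.simps fock.scale_scale power_Suc)
qed auto

lemma step_op_creator:
  assumes "i < k"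
  shows "step_op k g m (creator (int k * N + int i) f) = creator (int k * N + int i) (step_op k g m f) +
    fsc (g N) (creator (int k * (N + m) + int i) f)"
proof -
  have "(int k * N + int i) div int k = N" using assms by simp
  then show ?thesis by (simp add: step_op_def shift_op_creator algebra_simps)
qed

text \<open>Commuting with the product moves one factor by m levels, which changes (b, n) by (t, j).
  Collected by the configuration that is reached, the coefficients sum to a number depending only on
  s and b; \<gamma> is this number, and its recursion splits off the last factor.\<close>

lemma step_op_cur:
  fixes \<gamma> :: "nat \<Rightarrow> int \<Rightarrow> complex"
  assumes g: "\<And>N. g N \<noteq> 0 \<Longrightarrow> spin_down (N + m) = spin_down N + t \<and> (N + m) div 2 = N div 2 + j"
    and \<gamma>: "\<And>s b N. \<gamma> s (b - spin_down N) + g (N - m) = \<gamma> (Suc s) b" and \<gamma>0: "\<gamma> 0 (- t) = 0"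
    and s: "s \<le> k"
  shows "step_op k g m (cur k s b n f) = cur k s b n (step_op k g m f) + fsc (\<gamma> s b) (cur k s (b + t) (n + j) f)"
  using s
proof (induction s arbitrary: b n)
  case 0
  have "b + t = 0 \<Longrightarrow> \<gamma> 0 b = 0" using \<gamma>0 by (simp add: eq_neg_iff_add_eq_0 flip: eq_neg_iff_add_eq_0)
  then show "step_op k g m (cur k 0 b n f) = cur k 0 b n (step_op k g m f) + fsc (\<gamma> 0 b) (cur k 0 (b + t) (n + j) f)"
    by (auto simp: fun_eq_iff)
next
  case (Suc s)
  let ?c = "\<lambda>N. creator (int k * N + int s)"
  let ?A = "\<lambda>N. ?c N (cur k s (b - spin_down N) (n - N div 2) (step_op k g m f))"
  let ?C = "\<lambda>N. ?c N (cur k s (b + t - spin_down N) (n + j - N div 2) f)"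
  have pf: "pfin ?A" "pfin ?C" using Suc.prems pfin_cur[of s k] by simp_all
  have "step_op k g m (cur k (Suc s) b n f) =
    psum (\<lambda>N. step_op k g m (?c N (cur k s (b - spin_down N) (n - N div 2) f)))"
    unfolding cur.simps step_op_def using Suc.prems by (intro psum_shift_op pfin_cur) simp
  also have "\<dots> = psum (\<lambda>N. ?A N + (fsc (\<gamma> s (b - spin_down N)) (?C N)
      + fsc (g (N + m - m)) (?C (N + m))))"
  proof (rule psum_cong)
    fix N
    have "fsc (g N) (?c (N + m) (cur k s (b - spin_down N) (n - N div 2) f)) = fsc (g N) (?C (N + m))"
      using g[of N] by (cases "g N = 0") (auto simp: algebra_simps)
    then have third: "fsc (g N) (?c (N + m) (cur k s (b - spin_down N) (n - N div 2) f)) = fsc (g (N + m - m)) (?C (N + m))"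
      by (simp only: add_diff_cancel_right')
    have IH: "step_op k g m (cur k s (b - spin_down N) (n - N div 2) f) =
      cur k s (b - spin_down N) (n - N div 2) (step_op k g m f) +
      fsc (\<gamma> s (b - spin_down N)) (cur k s (b - spin_down N + t) (n - N div 2 + j) f)"
      using Suc.prems by (intro Suc.IH) simp
    have ix: "b - spin_down N + t = b + t - spin_down N" "n - N div 2 + j = n + j - N div 2" by simp_all
    have "s < k" using Suc.prems by simp
    then show "step_op k g m (?c N (cur k s (b - spin_down N) (n - N div 2) f)) =
      ?A N + (fsc (\<gamma> s (b - spin_down N)) (?C N) + fsc (g (N + m - m)) (?C (N + m)))"
      by (simp only: step_op_creator third IH ix creator_linear add.assoc)
  qed
  also have "\<dots> = psum ?A + (psum (\<lambda>N. fsc (\<gamma> s (b - spin_down N)) (?C N)) +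
      psum (\<lambda>N. fsc (g (N + m - m)) (?C (N + m))))"
    using pf pfin_reindex[of ?C m] by (subst psum_add; (intro pfin_add pfin_fsc)?; simp add: psum_add pfin_fsc)
  \<comment> \<open>Indexing by the level reached allows the contribution of the last factor to be
    added to that of the others term by term.\<close>
  also have "psum (\<lambda>N. fsc (g (N + m - m)) (?C (N + m))) = psum (\<lambda>N. fsc (g (N - m)) (?C N))"
    by (rule psum_reindex[of "\<lambda>N. fsc (g (N - m)) (?C N)"])
  also have "psum (\<lambda>N. fsc (\<gamma> s (b - spin_down N)) (?C N)) + psum (\<lambda>N. fsc (g (N - m)) (?C N)) =
      psum (\<lambda>N. fsc (\<gamma> (Suc s) b) (?C N))"
    using pf by (subst psum_add[symmetric]) (auto intro: pfin_fsc simp: \<gamma> simp flip: fock.scale_left_distrib)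
  finally show "step_op k g m (cur k (Suc s) b n f) =
      cur k (Suc s) b n (step_op k g m f) + fsc (\<gamma> (Suc s) b) (cur k (Suc s) (b + t) (n + j) f)"
    by (simp only: psum_fsc cur.simps)
qed

text \<open>In the configuration that is reached: the number of spin-up factors for E, of spin-down
  factors for F, and their difference for H. These are the matrix entries of the (s+1)-dimensional
  module.\<close>

fun spin_factor :: "sl2 \<Rightarrow> nat \<Rightarrow> int \<Rightarrow> complex" where
  "spin_factor E s b = of_nat s - of_int b + 1"
| "spin_factor H s b = of_nat s - 2 * of_int b"
| "spin_factor F s b = of_int b + 1"

lemma loop_cur:
  "mop k (Lp X i) (cur k k b n f) = cur k k b n (mop k (Lp X i) f) +
     fsc (spin_factor X k b) (cur k k (b - sl2_step X) (n + i) f)"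
proof -
  have "step_op k (sl2_coeff X) (2 * i + sl2_step X) (cur k k b n f) =
    cur k k b n (step_op k (sl2_coeff X) (2 * i + sl2_step X) f) +
    fsc (spin_factor X k b) (cur k k (b + - sl2_step X) (n + i) f)"
  proof (rule step_op_cur)
    show "spin_factor X 0 (- (- sl2_step X)) = 0" by (cases X) auto
    show "spin_factor X s (b - spin_down N) + sl2_coeff X (N - (2 * i + sl2_step X)) = spin_factor X (Suc s) b" for s b N
      by (cases X) (auto simp: spin_down_def)
    show "spin_down (N + (2 * i + sl2_step X)) = spin_down N + - sl2_step X \<and>
      (N + (2 * i + sl2_step X)) div 2 = N div 2 + i" if "sl2_coeff X N \<noteq> 0" for N
      using that by (cases X) (auto simp: spin_down_def split: if_splits elim!: evenE oddE)
  qed simp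
  then show ?thesis by simp
qed

text \<open>Each of the k factors carries one unit of charge; with the normalisation of the current
  the total is \<open>k / sqrt (2 k)\<close>, which is the momentum \<open>sqrt (k / 2)\<close> of
  the bosonic vertex operator.\<close>

lemma heisenberg_cur:
  assumes "k > 0"
  shows "mop k (Hs i) (cur k k b n f) = cur k k b n (mop k (Hs i) f) +
    fsc (of_real (sqrt (real k / 2))) (cur k k b (n + i) f)"
proof -
  have "step_op k (\<lambda>_. 1) (2 * i) (cur k k b n f) =
    cur k k b n (step_op k (\<lambda>_. 1) (2 * i) f) + fsc (of_nat k) (cur k k (b + 0) (n + i) f)"
    by (rule step_op_cur) (auto simp: spin_down_def)
  moreover have "1 / sqrt (2 * real k) * real k = sqrt (real k / 2)"
    using assms by (simp add: real_sqrt_mult real_sqrt_divide field_simps)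
  then have "complex_of_real (1 / sqrt (2 * real k)) * of_nat k = of_real (sqrt (real k / 2))"
    by (metis of_real_mult of_real_of_nat_eq)
  ultimately show ?thesis by (simp add: cur_fsc fock.scale_right_distrib del: of_real_divide)
qed

text \<open>The list omits the indices outside 0, ..., k; the closed formula agrees with it because
  \<open>cur\<close> vanishes there.\<close>

lemma fin_action_cur:
  assumes "b \<le> k"
  shows "(\<Sum>(c, b')\<leftarrow>fin_action k X b. fsc c (cur k k (int b') n f)) =
    fsc (spin_factor X k (int b)) (cur k k (int b - sl2_step X) n f)"
  using assms by (cases X) (auto simp: cur_range of_nat_diff add.commute)

subsection \<open>Words of creation operators\<close>

definition word :: "int list \<Rightarrow> fock \<Rightarrow> fock"
  where "word L f = foldr creator L f"

lemma word_simps [simp]: "word [] f = f" "word (\<nu> # L) f = creator \<nu> (word L f)"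
  "word (L @ L') f = word L (word L' f)"
  by (simp_all add: word_def)

lemma word_basis:
  assumes "distinct L" "\<And>\<nu>. \<nu> \<in> set L \<Longrightarrow> \<not> occ D \<nu>"
  obtains a D' where "a \<noteq> 0" "word L (basis D) = fsc a (basis D')"
    "\<And>\<nu>. occ D' \<nu> \<longleftrightarrow> occ D \<nu> \<or> \<nu> \<in> set L"
proof -
  have "\<exists>a D'. a \<noteq> 0 \<and> word L (basis D) = fsc a (basis D') \<and> (\<forall>\<nu>. occ D' \<nu> \<longleftrightarrow> occ D \<nu> \<or> \<nu> \<in> set L)"
    using assms
  proof (induction L)
    case Nil
    have "word [] (basis D) = fsc 1 (basis D)" by simp
    then show ?case by (intro exI[of _ 1] exI[of _ D]) auto
  next
    case (Cons \<mu> L)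
    have "\<exists>a D'. a \<noteq> 0 \<and> word L (basis D) = fsc a (basis D') \<and> (\<forall>\<nu>. occ D' \<nu> \<longleftrightarrow> occ D \<nu> \<or> \<nu> \<in> set L)"
      by (rule Cons.IH) (use Cons.prems in auto)
    then obtain a D' where IH: "a \<noteq> 0" "word L (basis D) = fsc a (basis D')"
      "\<And>\<nu>. occ D' \<nu> \<longleftrightarrow> occ D \<nu> \<or> \<nu> \<in> set L" by blast
    have "\<not> occ D' \<mu>" using Cons.prems IH(3) by auto
    then have "word (\<mu> # L) (basis D) = fsc (a * jw_sign \<mu> D') (basis (toggle \<mu> D'))"
      by (simp only: word_simps IH(2) creator_linear creator_basis if_False fock.scale_scale)
    moreover have "\<forall>\<nu>. occ (toggle \<mu> D') \<nu> \<longleftrightarrow> occ D \<nu> \<or> \<nu> \<in> set (\<mu> # L)"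
      using IH(3) \<open>\<not> occ D' \<mu>\<close> by auto
    ultimately show ?case using IH(1) by (intro exI[of _ "a * jw_sign \<mu> D'"] exI[of _ "toggle \<mu> D'"]) auto
  qed
  then show ?thesis using that by blast
qed

text \<open>The analogue of the \<open>s\<close>-th elementary symmetric function in the operators lowering one letter by \<open>k\<close>.\<close>

fun elementary_word :: "nat \<Rightarrow> int list \<Rightarrow> nat \<Rightarrow> fock \<Rightarrow> fock" where
  "elementary_word k [] s f = (if s = 0 then f else 0)"
| "elementary_word k (\<nu> # L) s f = creator \<nu> (elementary_word k L s f) +
     (if s = 0 then 0 else creator (\<nu> - int k) (elementary_word k L (s - 1) f))"

lemma elementary_word_zero: "elementary_word k L 0 f = word L f"
  by (induction L) simp_all

lemma elementary_word_large: "length L < s \<Longrightarrow> elementary_word k L s f = 0"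
proof (induction L arbitrary: s)
  case (Cons \<nu> L)
  have "elementary_word k L s f = 0" "elementary_word k L (s - 1) f = 0"
    using Cons.prems by (auto intro!: Cons.IH)
  then show "elementary_word k (\<nu> # L) s f = 0" by simp
qed simp

lemma elementary_word_top: "elementary_word k L (length L) f = word (map (\<lambda>\<nu>. \<nu> - int k) L) f"
proof (induction L)
  case (Cons \<nu> L)
  have "elementary_word k L (length (\<nu> # L)) f = 0" by (rule elementary_word_large) simp
  then show "elementary_word k (\<nu> # L) (length (\<nu> # L)) f = word (map (\<lambda>\<nu>. \<nu> - int k) (\<nu> # L)) f"
    using Cons by simp
qed simp

lemma F0_creator:
  assumes "k > 0"
  shows "mop k (Lp F 0) (creator \<nu> f) = creator \<nu> (mop k (Lp F 0) f) +
    (if odd (\<nu> div int k) then creator (\<nu> - int k) f else 0)"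
  by (simp add: step_op_def shift_op_creator)

text \<open>A term with s + 1 lowered letters arises from s + 1 terms with s of them, according to
  which letter was lowered last. Lowered letters sit on even levels, which F_0 does not
  move.\<close>

lemma F0_elementary_word:
  assumes "k > 0" "mop k (Lp F 0) f = 0" "\<And>\<nu>. \<nu> \<in> set L \<Longrightarrow> odd (\<nu> div int k)"
  shows "mop k (Lp F 0) (elementary_word k L s f) = fsc (of_nat (Suc s)) (elementary_word k L (Suc s) f)"
  using assms(3)
proof (induction L arbitrary: s)
  case Nil
  show "mop k (Lp F 0) (elementary_word k [] s f) = fsc (of_nat (Suc s)) (elementary_word k [] (Suc s) f)"
    using assms(2) by (simp del: mop.simps)
next
  case (Cons \<nu> L)
  have odd: "odd (\<nu> div int k)" using Cons.prems by simp
  have even: "\<not> odd ((\<nu> - int k) div int k)"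
    using odd div_shift[OF assms(1), of \<nu> "- 1"] by simp
  have IH: "mop k (Lp F 0) (elementary_word k L s f) = fsc (of_nat (Suc s)) (elementary_word k L (Suc s) f)" for s
    by (rule Cons.IH) (use Cons.prems in auto)
  show "mop k (Lp F 0) (elementary_word k (\<nu> # L) s f) =
      fsc (of_nat (Suc s)) (elementary_word k (\<nu> # L) (Suc s) f)"
  proof (cases s)
    case 0
    show ?thesis using odd even unfolding 0
      by (simp add: F0_creator[OF assms(1)] IH fock.scale_right_distrib del: mop.simps)
        (simp add: add.commute)?
  next
    case (Suc s')
    have "mop k (Lp F 0) (elementary_word k (\<nu> # L) s f) =
      (fsc (of_nat (Suc s)) (creator \<nu> (elementary_word k L (Suc s) f)) + creator (\<nu> - int k) (elementary_word k L s f)) +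
      fsc (of_nat s) (creator (\<nu> - int k) (elementary_word k L s f))"
      using odd even Suc IH[of s'] by (simp add: F0_creator[OF assms(1)] IH del: mop.simps of_nat_Suc)
    also have "\<dots> = fsc (of_nat (Suc s)) (elementary_word k (\<nu> # L) (Suc s) f)"
      by (simp add: fun_eq_iff algebra_simps)
    finally show ?thesis .
  qed
qed


subsection \<open>Newton's identity\<close>

text \<open>For \<open>s \<le> k\<close>, the indicator of the spin-down modes of the first s
  doublets: these are the residues below s modulo 2 k.\<close>

definition down_coeff :: "nat \<Rightarrow> nat \<Rightarrow> int \<Rightarrow> complex"
  where "down_coeff k s \<nu> = (if \<nu> mod (2 * int k) < int s then 1 else 0)"

definition down_op :: "nat \<Rightarrow> nat \<Rightarrow> int \<Rightarrow> fock \<Rightarrow> fock"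
  where "down_op k s r = shift_op (down_coeff k s) (- (2 * int k * r))"

definition colour_op :: "nat \<Rightarrow> nat \<Rightarrow> int \<Rightarrow> fock \<Rightarrow> fock"
  where "colour_op k s r = shift_op (\<lambda>\<nu>. if \<nu> mod (2 * int k) = int s then 1 else 0) (- (2 * int k * r))"

definition down_mode :: "nat \<Rightarrow> nat \<Rightarrow> int \<Rightarrow> int"
  where "down_mode k s m = int k * (2 * m) + int s"

text \<open>The energy of the highest spin-down mode of doublet s that is empty in
  \<open>ray e\<close>.\<close>

definition top_mode :: "nat \<Rightarrow> int \<Rightarrow> nat \<Rightarrow> int"
  where "top_mode k e s = (e - int s - 1) div (2 * int k)"

lemma down_mode_less_iff:
  assumes "k > 0" shows "down_mode k s m < e \<longleftrightarrow> m \<le> top_mode k e s"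
proof -
  have "m \<le> top_mode k e s \<longleftrightarrow> m * (2 * int k) \<le> e - int s - 1"
  proof -
    define a where "a = e - int s - 1"
    define c where "c = 2 * int k"
    have c: "c > 0" using assms by (simp add: c_def)
    have "a = c * (a div c) + a mod c" "0 \<le> a mod c" "a mod c < c" using c by simp_all
    moreover have "c * m \<le> c * (a div c)" if "m \<le> a div c" using c that by simp
    moreover have "c * (a div c) + c \<le> c * m" if "\<not> m \<le> a div c"
    proof -
      have "c * (a div c + 1) \<le> c * m" using c that by (intro mult_left_mono) auto
      then show ?thesis by (simp add: distrib_left)
    qed
    ultimately have "m \<le> a div c \<longleftrightarrow> c * m \<le> a" by linarith
    then show ?thesis by (simp add: top_mode_def a_def c_def mult.commute)
  qed
  then show ?thesis by (auto simp: down_mode_def algebra_simps)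
qed

lemma down_mode_mod:
  assumes "s < k" shows "down_mode k s m mod (2 * int k) = int s"
proof -
  have "down_mode k s m = int s + 2 * int k * m" by (simp add: down_mode_def)
  then show ?thesis using assms by simp
qed

lemma mod_eq_down_mode:
  assumes "\<nu> mod (2 * int k) = int s" shows "\<nu> = down_mode k s (\<nu> div (2 * int k))"
  using assms mult_div_mod_eq[of "2 * int k" \<nu>] by (simp add: down_mode_def algebra_simps)

definition down_cur :: "nat \<Rightarrow> nat \<Rightarrow> int \<Rightarrow> fock \<Rightarrow> fock"
  where "down_cur k s n f = cur k s (int s) n f"

text \<open>With as many spin-down letters as factors, every factor is spin-down and only even
  levels survive.\<close>

lemma down_cur_Suc:
  "down_cur k (Suc s) n f = psum (\<lambda>m. creator (down_mode k s m) (down_cur k s (n - m) f))"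
proof -
  have "down_cur k (Suc s) n f =
    psum (\<lambda>N. creator (int k * N + int s) (cur k s (int (Suc s) - spin_down N) (n - N div 2) f))"
    by (simp add: down_cur_def)
  also have "\<dots> = psum (\<lambda>m. creator (int k * (2 * m) + int s) (cur k s (int (Suc s) - spin_down (2 * m)) (n - 2 * m div 2) f))"
    by (rule psum_double) (simp add: cur_range spin_down_def)
  also have "\<dots> = psum (\<lambda>m. creator (down_mode k s m) (down_cur k s (n - m) f))"
    by (rule psum_cong) (simp add: down_mode_def down_cur_def spin_down_def)
  finally show ?thesis .
qed

lemma pfin_down_cur:
  assumes "s < k"
  shows "pfin (\<lambda>m. creator (down_mode k s m) (down_cur k s (n - m) f))"
proof (rule pfinI)
  fix D
  let ?g = "\<lambda>N. creator (int k * N + int s) (cur k s (int (Suc s) - spin_down N) (n - N div 2) f) D"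
  have "finite {N. ?g N \<noteq> 0}" using pfin_cur[OF assms] by (simp add: pfin_def)
  then have "finite ((\<lambda>m. 2 * m) -` {N. ?g N \<noteq> 0})"
    by (rule finite_vimageI) (simp add: inj_on_def)
  then show "finite {m. creator (down_mode k s m) (down_cur k s (n - m) f) D \<noteq> 0}"
    by (simp add: vimage_def down_mode_def down_cur_def spin_down_def)
qed

lemma antisymmetric_sum:
  fixes h :: "int \<Rightarrow> fock"
  assumes "\<And>r. r \<in> R \<Longrightarrow> b - r \<in> R" "\<And>r. r \<in> R \<Longrightarrow> h (b - r) = - h r"
  shows "sum h R = 0"
proof -
  have "sum h R = (\<Sum>r\<in>R. h (b - r))"
    by (rule sum.reindex_bij_witness[of _ "\<lambda>r. b - r" "\<lambda>r. b - r"]) (use assms(1) in auto)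
  also have "\<dots> = - sum h R" using assms(2) by (simp add: sum_negf)
  finally have "sum h R D = - sum h R D" for D by (metis uminus_apply)
  then show ?thesis by (auto simp: fun_eq_iff)
qed

text \<open>Here g is the highest empty energy of the colour in f. Commuting the current past the
  creator yields \<open>g - m\<close> copies of the target mode, and the remaining double sum pairs
  two creators and cancels by antisymmetry.\<close>

lemma newton_colour:
  assumes s: "s < k"
    and cr: "\<And>m. m > g \<Longrightarrow> creator (down_mode k s m) f = 0"
    and an: "\<And>m. m \<le> g \<Longrightarrow> annihilator (down_mode k s m) f = 0"
    and R: "g - m \<le> R"
  shows "(\<Sum>r\<in>{1..R}. colour_op k s r (creator (down_mode k s (m + r)) f)) =
    fsc (of_int (g - m)) (creator (down_mode k s m) f)"
proof (cases "m \<le> g")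
  case False
  then have "creator (down_mode k s (m + r)) f = 0" if "r \<ge> 0" for r using cr that by simp
  from this[of 0] this show ?thesis by (simp add: colour_op_def)
next
  case True
  let ?c = "\<lambda>m. creator (down_mode k s m)"
  let ?R = "{1..g - m}"
  have "(\<Sum>r\<in>{1..R}. colour_op k s r (?c (m + r) f)) = (\<Sum>r\<in>?R. colour_op k s r (?c (m + r) f))"
    using R cr by (intro sum.mono_neutral_right) (auto simp: colour_op_def)
  also have "\<dots> = (\<Sum>r\<in>?R. ?c (m + r) (colour_op k s r f) + ?c m f)"
  proof (intro sum.cong refl)
    fix r
    have "down_mode k s (m + r) + - (2 * int k * r) = down_mode k s m"
      by (simp add: down_mode_def algebra_simps)
    then show "colour_op k s r (?c (m + r) f) = ?c (m + r) (colour_op k s r f) + ?c m f"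
      unfolding colour_op_def shift_op_creator using down_mode_mod[OF s] by simp
  qed
  also have "\<dots> = (\<Sum>r\<in>?R. ?c (m + r) (colour_op k s r f)) + (\<Sum>r\<in>?R. ?c m f)"
    by (rule sum.distrib)
  also have "(\<Sum>r\<in>?R. ?c m f) = fsc (of_int (g - m)) (?c m f)"
  proof
    fix D
    have "(\<Sum>r\<in>?R. ?c m f) D = (\<Sum>r\<in>?R. ?c m f D)" by (rule sum_apply)
    then show "(\<Sum>r\<in>?R. ?c m f) D = fsc (of_int (g - m)) (?c m f) D"
      using True by (simp del: sum_constant add: sum_constant[where 'a = complex])
  qed
  also have "(\<Sum>r\<in>?R. ?c (m + r) (colour_op k s r f)) = 0"
  proof -
    let ?a = "\<lambda>\<nu>. if \<nu> mod (2 * int k) = int s then 1 else 0 :: complex"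
    let ?t = "\<lambda>r \<nu>. fsc (?a \<nu>) (?c (m + r) (shift_term (- (2 * int k * r)) \<nu> f))"
    have "(\<Sum>r\<in>?R. ?c (m + r) (colour_op k s r f)) = (\<Sum>r\<in>?R. psum (?t r))"
      unfolding colour_op_def shift_op_psum psum_creator creator_linear ..
    also have "\<dots> = psum (\<lambda>\<nu>. \<Sum>r\<in>?R. ?t r \<nu>)"
    proof (rule psum_sum[symmetric])
      fix r show "pfin (?t r)"
        using pfin_creator[OF pfin_shift_terms[of ?a "- (2 * int k * r)" f], of "down_mode k s (m + r)"]
        by (simp only: creator_linear)
    qed
    also have "\<dots> = psum (\<lambda>\<nu>. 0)"
    proof (rule psum_cong)
      fix \<nu>
      show "(\<Sum>r\<in>?R. ?t r \<nu>) = 0"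
      proof (cases "\<nu> mod (2 * int k) = int s")
        case nu: True
        define t where "t = \<nu> div (2 * int k)"
        have \<nu>: "\<nu> = down_mode k s t" unfolding t_def by (rule mod_eq_down_mode[OF nu])
        let ?Y = "annihilator \<nu> f"
        have trm: "?t r \<nu> = ?c (m + r) (?c (t - r) ?Y)" if "r \<in> ?R" for r
        proof -
          have "\<nu> + - (2 * int k * r) = down_mode k s (t - r)"
            unfolding \<nu> by (simp add: down_mode_def algebra_simps)
          moreover have "- (2 * int k * r) \<noteq> 0" using that s by auto
          ultimately show ?thesis using nu by (simp add: shift_term_def)
        qed
        show ?thesis
        proof (cases "t \<le> g")
          case True
          then have "?Y = 0" using an \<nu> by simp
          then show ?thesis by (intro sum.neutral ballI) (simp only: trm creator_linear)
        next
          case False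
          let ?h = "\<lambda>r. ?c (m + r) (?c (t - r) ?Y)"
          have kill: "?c (t - r) ?Y = 0" if "t - r > g" "r \<noteq> 0" for r
          proof -
            have ne: "\<nu> \<noteq> down_mode k s (t - r)" using \<nu> that s by (simp add: down_mode_def)
            have "?c (t - r) ?Y = - annihilator \<nu> (?c (t - r) f)"
              using annihilator_creator[of \<nu> "down_mode k s (t - r)" f] ne by simp
            then show ?thesis using cr[OF that(1)] by simp
          qed
          have "(\<Sum>r\<in>?R. ?t r \<nu>) = (\<Sum>r\<in>?R. ?h r)" using trm by (rule sum.cong[OF refl])
          \<comment> \<open>Terms with \<open>t - r > g\<close> create a filled mode. What remains
            is an interval stable under r -> t - m - r, which exchanges the two creators.\<close>
          also have "\<dots> = (\<Sum>r\<in>{max 1 (t - g)..g - m}. ?h r)"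
          proof (rule sum.mono_neutral_right)
            show "\<forall>r\<in>?R - {max 1 (t - g)..g - m}. ?h r = 0"
            proof
              fix r assume "r \<in> ?R - {max 1 (t - g)..g - m}"
              then have "t - r > g" "r \<noteq> 0" by auto
              then show "?h r = 0" using kill by simp
            qed
          qed auto
          also have "\<dots> = 0"
          proof (rule antisymmetric_sum[where b = "t - m"])
            fix r assume "r \<in> {max 1 (t - g)..g - m}"
            then show "t - m - r \<in> {max 1 (t - g)..g - m}" using False by auto
            show "?h (t - m - r) = - ?h r"
              using creator_creator[of "down_mode k s (t - r)" "down_mode k s (m + r)" ?Y] by (simp add: algebra_simps)
          qed
          finally show ?thesis .
        qed
      qed simp
    qed
    finally show ?thesis by simp
  qed
  finally show ?thesis by (simp only: add_0)
qed

text \<open>Every created mode is spin-down and was empty in the sea, so its energy is at most that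
  of the top mode of its doublet.\<close>

lemma down_cur_vanish:
  assumes "k > 0" "s \<le> k" "(\<Sum>i<s. top_mode k e i) < n"
  shows "down_cur k s n (basis (ray e)) = 0"
proof
  fix D
  show "down_cur k s n (basis (ray e)) D = 0 D"
  proof (rule ccontr)
    assume "down_cur k s n (basis (ray e)) D \<noteq> 0 D"
    then have "cur k s (int s) n (basis (ray e)) D \<noteq> 0" by (simp add: down_cur_def)
    then obtain N D' where N: "basis (ray e) D' \<noteq> 0"
      "\<And>\<nu>. occ D' \<nu> \<longleftrightarrow> occ D \<nu> \<and> (\<forall>i<s. \<nu> \<noteq> int k * N i + int i)"
      "(\<Sum>i<s. spin_down (N i)) = int s" "(\<Sum>i<s. N i div 2) = n"
      by (rule cur_support) blast
    have D': "D' = ray e" using N(1) by (simp add: basis_def split: if_splits)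
    have even: "even (N i)" if "i < s" for i
    proof (rule ccontr)
      assume odd: "odd (N i)"
      have "(\<Sum>i<s. spin_down (N i)) < (\<Sum>i<s. 1)"
        by (rule sum_strict_mono_ex1) (use that odd in \<open>auto simp: spin_down_def intro!: bexI[of _ i]\<close>)
      then show False using N(3) by simp
    qed
    have "N i div 2 \<le> top_mode k e i" if "i < s" for i
    proof -
      have "\<not> occ D' (int k * N i + int i)" using N(2) that by blast
      then have "int k * N i + int i < e" by (simp add: D')
      moreover have "2 * (N i div 2) = N i" using even[OF that] by simp
      ultimately have "down_mode k i (N i div 2) < e" by (simp add: down_mode_def)
      then show ?thesis using down_mode_less_iff[OF assms(1)] by simp
    qed
    then have "(\<Sum>i<s. N i div 2) \<le> (\<Sum>i<s. top_mode k e i)" by (intro sum_mono) auto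
    then show False using N(4) assms(3) by simp
  qed
qed

text \<open>Induction on the number of doublets. The current of the first s commutes with the
  creator of doublet s, and the product of the first s fields leaves doublet s occupied as in the
  sea, so \<open>newton_colour\<close> applies to it. The two scalars \<open>?G - (n - m)\<close>
  and \<open>?g - m\<close> add up to a number independent of m.\<close>

lemma newton_identity:
  assumes "s \<le> k" "k > 0" "(\<Sum>i<s. top_mode k e i) - n \<le> R"
  shows "(\<Sum>r\<in>{1..R}. down_op k s r (down_cur k s (n + r) (basis (ray e)))) =
    fsc (of_int ((\<Sum>i<s. top_mode k e i) - n)) (down_cur k s n (basis (ray e)))"
  using assms(1,3)
proof (induction s arbitrary: n R)
  case 0
  have "down_op k 0 r f = 0" for r f
  proof -
    have "0 \<le> \<nu> mod (2 * int k)" for \<nu> using assms(2) by (intro pos_mod_sign) simp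
    then have "down_coeff k 0 = (\<lambda>\<nu>. 0)" by (simp add: down_coeff_def fun_eq_iff not_less)
    then show ?thesis by (simp add: down_op_def shift_op_def fun_eq_iff)
  qed
  then show "(\<Sum>r\<in>{1..R}. down_op k 0 r (down_cur k 0 (n + r) (basis (ray e)))) =
    fsc (of_int ((\<Sum>i<0. top_mode k e i) - n)) (down_cur k 0 n (basis (ray e)))"
    by (simp add: down_cur_def)
next
  case (Suc s)
  let ?e = "basis (ray e)"
  let ?c = "\<lambda>m. creator (down_mode k s m)"
  let ?G = "\<Sum>i<s. top_mode k e i"
  let ?g = "top_mode k e s"
  have s: "s < k" using Suc.prems by simp
  have op_split: "down_op k (Suc s) r f = down_op k s r f + colour_op k s r f" for r f
  proof -
    have "shift_op (\<lambda>\<nu>. down_coeff k s \<nu> + (if \<nu> mod (2 * int k) = int s then 1 else 0)) d f =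
      shift_op (down_coeff k s) d f + shift_op (\<lambda>\<nu>. if \<nu> mod (2 * int k) = int s then 1 else 0) d f" for d
      by (auto simp: fun_eq_iff shift_op_eq_sum[OF _ subset_refl] distrib_right sum.distrib)
    moreover have "down_coeff k (Suc s) = (\<lambda>\<nu>. down_coeff k s \<nu> + (if \<nu> mod (2 * int k) = int s then 1 else 0))"
      by (auto simp: down_coeff_def fun_eq_iff)
    ultimately show ?thesis by (simp add: down_op_def colour_op_def)
  qed
  have kill_cr: "?c m (down_cur k s n' ?e) = 0" if "m > ?g" for m n'
  proof -
    have "e \<le> down_mode k s m" using that down_mode_less_iff[OF assms(2), of s m e] by linarith
    then have "?c m ?e = 0" by (simp add: creator_basis)
    then show ?thesis by (simp add: down_cur_def creator_cur)
  qed
  have kill_an: "annihilator (down_mode k s m) (down_cur k s n' ?e) = 0" if "m \<le> ?g" for m n'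
  proof -
    have "\<not> e \<le> down_mode k s m" using that down_mode_less_iff[OF assms(2), of s m e] by linarith
    then have "annihilator (down_mode k s m) ?e = 0" by (simp add: annihilator_basis)
    moreover have "down_mode k s m \<noteq> int k * N + int i" if "i < s" for N i
    proof
      assume "down_mode k s m = int k * N + int i"
      then have "(int k * (2 * m) + int s) mod int k = (int k * N + int i) mod int k" by (simp add: down_mode_def)
      then show False using that s by simp
    qed
    ultimately show ?thesis unfolding down_cur_def by (subst annihilator_cur) auto
  qed
  have down_comm: "down_op k s r (?c m f) = ?c m (down_op k s r f)" for r m f
    using down_mode_mod[OF s] by (simp add: down_op_def shift_op_creator down_coeff_def)
  have pf: "pfin (\<lambda>m. ?c m (down_cur k s (n' - m) ?e))" for n' by (rule pfin_down_cur[OF s])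
  have partA: "(\<Sum>r\<in>{1..R}. down_op k s r (down_cur k (Suc s) (n + r) ?e)) =
    psum (\<lambda>m. fsc (of_int (?G - (n - m))) (?c m (down_cur k s (n - m) ?e)))"
  proof -
    have "(\<Sum>r\<in>{1..R}. down_op k s r (down_cur k (Suc s) (n + r) ?e)) =
      (\<Sum>r\<in>{1..R}. psum (\<lambda>m. ?c m (down_op k s r (down_cur k s (n - m + r) ?e))))"
    proof (intro sum.cong refl)
      fix r
      have "down_op k s r (down_cur k (Suc s) (n + r) ?e) = psum (\<lambda>m. down_op k s r (?c m (down_cur k s (n + r - m) ?e)))"
        unfolding down_cur_Suc down_op_def by (rule psum_shift_op[OF pf])
      also have "\<dots> = psum (\<lambda>m. ?c m (down_op k s r (down_cur k s (n - m + r) ?e)))"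
        by (rule psum_cong) (simp only: down_comm diff_add_eq)
      finally show "down_op k s r (down_cur k (Suc s) (n + r) ?e) =
        psum (\<lambda>m. ?c m (down_op k s r (down_cur k s (n - m + r) ?e)))" .
    qed
    also have "\<dots> = psum (\<lambda>m. \<Sum>r\<in>{1..R}. ?c m (down_op k s r (down_cur k s (n - m + r) ?e)))"
    proof (rule psum_sum[symmetric])
      fix r
      have "pfin (\<lambda>m. down_op k s r (?c m (down_cur k s (n + r - m) ?e)))"
        unfolding down_op_def by (rule pfin_shift_op[OF pf])
      then show "pfin (\<lambda>m. ?c m (down_op k s r (down_cur k s (n - m + r) ?e)))"
        by (simp only: down_comm diff_add_eq)
    qed
    also have "\<dots> = psum (\<lambda>m. fsc (of_int (?G - (n - m))) (?c m (down_cur k s (n - m) ?e)))"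
    proof (rule psum_cong)
      fix m
      show "(\<Sum>r\<in>{1..R}. ?c m (down_op k s r (down_cur k s (n - m + r) ?e))) =
        fsc (of_int (?G - (n - m))) (?c m (down_cur k s (n - m) ?e))"
      proof (cases "m \<le> ?g")
        case True
        have cs: "?c m (sum F I) = (\<Sum>r\<in>I. ?c m (F r))" for F :: "int \<Rightarrow> fock" and I
          by (induction I rule: infinite_finite_induct) (simp_all only: creator_linear sum.infinite sum.empty sum.insert not_False_eq_True)
        have "(\<Sum>r\<in>{1..R}. down_op k s r (down_cur k s (n - m + r) ?e)) =
          fsc (of_int (?G - (n - m))) (down_cur k s (n - m) ?e)"
          using Suc.prems True by (intro Suc.IH) auto
        then show ?thesis by (simp only: cs[symmetric] creator_linear)
      next
        case False
        then have "?c m (down_cur k s n' ?e) = 0" for n' using kill_cr by simp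
        then show ?thesis by (simp flip: down_comm) (simp add: down_op_def)
      qed
    qed
    finally show ?thesis .
  qed
  have partB: "(\<Sum>r\<in>{1..R}. colour_op k s r (down_cur k (Suc s) (n + r) ?e)) =
    psum (\<lambda>m. fsc (of_int (?g - m)) (?c m (down_cur k s (n - m) ?e)))"
  proof -
    have step: "psum (\<lambda>m. colour_op k s r (?c m (down_cur k s (n + r - m) ?e))) =
      psum (\<lambda>m. colour_op k s r (?c (m + r) (down_cur k s (n - m) ?e)))" for r
      using psum_reindex[of "\<lambda>m. colour_op k s r (?c m (down_cur k s (n + r - m) ?e))" r] by simp
    have pfB: "pfin (\<lambda>m. colour_op k s r (?c (m + r) (down_cur k s (n - m) ?e)))" for r
      using pfin_reindex[of "\<lambda>m. colour_op k s r (?c m (down_cur k s (n + r - m) ?e))" r]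
        pfin_shift_op[OF pf[of "n + r"]] by (simp add: colour_op_def)
    have "(\<Sum>r\<in>{1..R}. colour_op k s r (down_cur k (Suc s) (n + r) ?e)) =
      (\<Sum>r\<in>{1..R}. psum (\<lambda>m. colour_op k s r (?c (m + r) (down_cur k s (n - m) ?e))))"
      unfolding step[symmetric] unfolding down_cur_Suc colour_op_def
      by (intro sum.cong refl psum_shift_op pf)
    also have "\<dots> = psum (\<lambda>m. \<Sum>r\<in>{1..R}. colour_op k s r (?c (m + r) (down_cur k s (n - m) ?e)))"
      by (rule psum_sum[symmetric]) (rule pfB)
    also have "\<dots> = psum (\<lambda>m. fsc (of_int (?g - m)) (?c m (down_cur k s (n - m) ?e)))"
    proof (rule psum_cong)
      fix m
      show "(\<Sum>r\<in>{1..R}. colour_op k s r (?c (m + r) (down_cur k s (n - m) ?e))) =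
        fsc (of_int (?g - m)) (?c m (down_cur k s (n - m) ?e))"
      proof (cases "n - m \<le> ?G")
        case True
        then show ?thesis using Suc.prems kill_cr kill_an by (intro newton_colour s) auto
      next
        case False
        then have "down_cur k s (n - m) ?e = 0" using s assms(2) by (intro down_cur_vanish) auto
        then show ?thesis by (simp add: colour_op_def)
      qed
    qed
    finally show ?thesis .
  qed
  have "(\<Sum>r\<in>{1..R}. down_op k (Suc s) r (down_cur k (Suc s) (n + r) ?e)) =
    psum (\<lambda>m. fsc (of_int (?G - (n - m))) (?c m (down_cur k s (n - m) ?e))) +
    psum (\<lambda>m. fsc (of_int (?g - m)) (?c m (down_cur k s (n - m) ?e)))"
    unfolding op_split sum.distrib partA partB ..
  also have "\<dots> = psum (\<lambda>m. fsc (of_int (?G - (n - m))) (?c m (down_cur k s (n - m) ?e)) +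
    fsc (of_int (?g - m)) (?c m (down_cur k s (n - m) ?e)))"
    by (rule psum_add[symmetric]) (intro pfin_fsc pf)+
  also have "\<dots> = psum (\<lambda>m. fsc (of_int ((\<Sum>i<Suc s. top_mode k e i) - n)) (?c m (down_cur k s (n - m) ?e)))"
    by (rule psum_cong) (simp only: flip: fock.scale_left_distrib of_int_add, simp add: algebra_simps)
  also have "\<dots> = fsc (of_int ((\<Sum>i<Suc s. top_mode k e i) - n)) (down_cur k (Suc s) n ?e)"
    by (simp only: psum_fsc down_cur_Suc)
  finally show "(\<Sum>r\<in>{1..R}. down_op k (Suc s) r (down_cur k (Suc s) (n + r) ?e)) =
    fsc (of_int ((\<Sum>i<Suc s. top_mode k e i) - n)) (down_cur k (Suc s) n ?e)" .
qed


subsection \<open>Vertex operators applied to a filled sea\<close>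

definition ray_module :: "nat \<Rightarrow> int \<Rightarrow> fock set"
  where "ray_module k e = gen fsc (mop k) proper_letters {basis (ray e)}"

lemma ray_module_closed:
  "basis (ray e) \<in> ray_module k e"
  "0 \<in> ray_module k e"
  "f \<in> ray_module k e \<Longrightarrow> g \<in> ray_module k e \<Longrightarrow> f + g \<in> ray_module k e"
  "f \<in> ray_module k e \<Longrightarrow> fsc a f \<in> ray_module k e"
  "f \<in> ray_module k e \<Longrightarrow> x \<in> proper_letters \<Longrightarrow> mop k x f \<in> ray_module k e"
  unfolding ray_module_def by (auto intro: gen.intros)

lemma ray_module_sum: "(\<And>i. i \<in> I \<Longrightarrow> f i \<in> ray_module k e) \<Longrightarrow> sum f I \<in> ray_module k e"
  unfolding ray_module_def by (rule gen_sum)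

lemma ray_module_finsupp: "f \<in> ray_module k e \<Longrightarrow> finsupp f"
  unfolding ray_module_def
proof (induction f rule: gen.induct)
  case (gen_step x u)
  then show "finsupp (mop k x u)" by simp
next
  case (gen_add u w)
  then show "finsupp (u + w)" by simp
next
  case (gen_scale u c)
  then show "finsupp (fsc c u)" by simp
next
  case gen_zero
  show "finsupp 0" by simp
next
  case (gen_base b)
  then show "finsupp b" by auto
qed

lemma ray_module_cancel:
  assumes "fsc a f \<in> ray_module k e" "a \<noteq> 0" shows "f \<in> ray_module k e"
proof -
  have "inverse a * a = 1" using assms(2) by simp
  then show ?thesis
    using ray_module_closed(4)[OF assms(1), of "inverse a"] by (simp only: fock.scale_scale fock.scale_one)
qed

text \<open>Spin-down is half of charge minus spin; so the current in Newton's identity is built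
  from a Heisenberg letter and an affine letter.\<close>

lemma down_op_full:
  assumes "k > 0"
  shows "down_op k k r f = fsc (1 / 2) (fsc (of_real (sqrt (2 * real k))) (mop k (Hs (- r)) f) - mop k (Lp H (- r)) f)"
proof -
  have "\<nu> mod (2 * int k) < int k \<longleftrightarrow> even (\<nu> div int k)" for \<nu>
  proof -
    have "\<nu> mod (2 * int k) = int k * (\<nu> div int k mod 2) + \<nu> mod int k"
      using zmod_zmult2_eq[of 2 \<nu> "int k"] by (simp add: mult.commute)
    moreover have "0 \<le> \<nu> mod int k" "\<nu> mod int k < int k" using assms by simp_all
    moreover have "\<nu> div int k mod 2 = (if even (\<nu> div int k) then 0 else 1)" by (simp add: mod2_eq_if)
    ultimately show ?thesis by auto
  qed
  then have coeff: "down_coeff k k = (\<lambda>\<nu>. 1 / 2 + (- 1 / 2) * sl2_coeff H (\<nu> div int k))"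
    by (auto simp: down_coeff_def fun_eq_iff)
  have "step_op k (\<lambda>N. 1 / 2 * 1 + (- 1 / 2) * sl2_coeff H N) (2 * - r) f =
    fsc (1 / 2) (step_op k (\<lambda>_. 1) (2 * - r) f) + fsc (- 1 / 2) (step_op k (sl2_coeff H) (2 * - r) f)"
    unfolding step_op_coeff_add step_op_coeff_scale ..
  moreover have "down_op k k r f = step_op k (\<lambda>N. 1 / 2 * 1 + (- 1 / 2) * sl2_coeff H N) (2 * - r) f"
    by (simp add: down_op_def coeff step_op_def ac_simps)
  moreover have "complex_of_real (sqrt (2 * real k)) * of_real (1 / sqrt (2 * real k)) = 1"
    using assms by (simp flip: of_real_mult)
  ultimately show ?thesis
    by (simp add: fun_eq_iff algebra_simps del: of_real_divide)
qed

lemma down_op_closed: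
  assumes "k > 0" "r > 0" "f \<in> ray_module k e" shows "down_op k k r f \<in> ray_module k e"
proof -
  have "fsc (1 / 2) (fsc (of_real (sqrt (2 * real k))) (mop k (Hs (- r)) f) + fsc (- 1) (mop k (Lp H (- r)) f)) \<in> ray_module k e"
    using assms by (intro ray_module_closed) (auto simp: proper_letters_def)
  then show ?thesis unfolding down_op_full[OF assms(1)] by simp
qed

text \<open>At the maximal total energy each doublet has only one choice, its highest empty
  spin-down mode.\<close>

lemma down_cur_top:
  assumes "s \<le> k" "k > 0"
  shows "down_cur k s (\<Sum>i<s. top_mode k e i) (basis (ray e)) =
    word (map (\<lambda>i. down_mode k i (top_mode k e i)) (rev [0..<s])) (basis (ray e))"
  using assms(1)
proof (induction s)
  case 0
  show "down_cur k 0 (\<Sum>i<0. top_mode k e i) (basis (ray e)) =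
    word (map (\<lambda>i. down_mode k i (top_mode k e i)) (rev [0..<0])) (basis (ray e))"
    by (simp add: down_cur_def)
next
  case (Suc s)
  let ?G = "\<Sum>i<s. top_mode k e i" and ?g = "top_mode k e s" and ?e = "basis (ray e)"
  have IH: "down_cur k s ?G ?e = word (map (\<lambda>i. down_mode k i (top_mode k e i)) (rev [0..<s])) ?e"
    using Suc by simp
  have "down_cur k (Suc s) (\<Sum>i<Suc s. top_mode k e i) ?e =
    psum (\<lambda>m. creator (down_mode k s m) (down_cur k s (?G + ?g - m) ?e))"
    by (simp add: down_cur_Suc)
  also have "\<dots> = psum (\<lambda>m. if m = ?g then creator (down_mode k s m) (down_cur k s (?G + ?g - m) ?e) else 0)"
  proof (rule psum_cong)
    fix m
    consider "m = ?g" | "m > ?g" | "m < ?g" by linarith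
    then show "creator (down_mode k s m) (down_cur k s (?G + ?g - m) ?e) =
      (if m = ?g then creator (down_mode k s m) (down_cur k s (?G + ?g - m) ?e) else 0)"
    proof cases
      case 2
      then have "e \<le> down_mode k s m" using down_mode_less_iff[OF assms(2), of s m e] by linarith
      then have "creator (down_mode k s m) ?e = 0" by (simp add: creator_basis)
      then show ?thesis using 2 by (simp add: down_cur_def creator_cur)
    next
      case 3
      then have "down_cur k s (?G + ?g - m) ?e = 0" using Suc.prems assms(2) by (intro down_cur_vanish) auto
      then show ?thesis using 3 by simp
    qed simp
  qed
  also have "\<dots> = creator (down_mode k s ?g) (down_cur k s ?G ?e)"
    unfolding psum_single by simp
  finally show "down_cur k (Suc s) (\<Sum>i<Suc s. top_mode k e i) ?e =
    word (map (\<lambda>i. down_mode k i (top_mode k e i)) (rev [0..<Suc s])) ?e"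
    unfolding IH by simp
qed

lemma top_modes_eq:
  assumes "k > 0"
  shows "(\<lambda>i. down_mode k i (top_mode k e i)) ` {0..<k} = {\<nu>. even (\<nu> div int k) \<and> e - 2 * int k \<le> \<nu> \<and> \<nu> < e}"
proof (intro equalityI subsetI)
  fix \<nu> assume "\<nu> \<in> (\<lambda>i. down_mode k i (top_mode k e i)) ` {0..<k}"
  then obtain i where i: "i < k" and \<nu>: "\<nu> = down_mode k i (top_mode k e i)" by auto
  have "\<nu> < e" unfolding \<nu> down_mode_less_iff[OF assms] ..
  moreover have "\<not> down_mode k i (top_mode k e i + 1) < e" unfolding down_mode_less_iff[OF assms] by simp
  then have "e - 2 * int k \<le> \<nu>" by (simp add: \<nu> down_mode_def algebra_simps)
  moreover have "\<nu> div int k = 2 * top_mode k e i" using i by (simp add: \<nu> down_mode_def)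
  ultimately show "\<nu> \<in> {\<nu>. even (\<nu> div int k) \<and> e - 2 * int k \<le> \<nu> \<and> \<nu> < e}" by simp
next
  fix \<nu> assume \<nu>: "\<nu> \<in> {\<nu>. even (\<nu> div int k) \<and> e - 2 * int k \<le> \<nu> \<and> \<nu> < e}"
  then obtain m where m: "\<nu> div int k = 2 * m" by (auto elim: evenE)
  define i where "i = nat (\<nu> mod int k)"
  have i: "int i = \<nu> mod int k" "i < k" using assms by (auto simp: i_def nat_less_iff)
  have eq: "\<nu> = down_mode k i m"
    using mult_div_mod_eq[of "int k" \<nu>] by (simp add: down_mode_def m i)
  have "m \<le> top_mode k e i" using \<nu> eq down_mode_less_iff[OF assms] by simp
  moreover have "\<not> m + 1 \<le> top_mode k e i"
    unfolding down_mode_less_iff[OF assms, symmetric] using \<nu> eq by (simp add: down_mode_def algebra_simps)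
  ultimately have "m = top_mode k e i" by simp
  with eq i show "\<nu> \<in> (\<lambda>i. down_mode k i (top_mode k e i)) ` {0..<k}" by auto
qed

lemma basis_word_proportional:
  assumes "distinct L" "distinct L'" "\<And>\<nu>. \<nu> \<in> set L \<Longrightarrow> \<not> occ D \<nu>" "\<And>\<nu>. \<nu> \<in> set L' \<Longrightarrow> \<not> occ D' \<nu>"
    and eq: "\<And>\<nu>. occ D \<nu> \<or> \<nu> \<in> set L \<longleftrightarrow> occ D' \<nu> \<or> \<nu> \<in> set L'"
  obtains a where "a \<noteq> 0" "word L (basis D) = fsc a (word L' (basis D'))"
proof -
  obtain a D1 where 1: "a \<noteq> 0" "word L (basis D) = fsc a (basis D1)" "\<And>\<nu>. occ D1 \<nu> \<longleftrightarrow> occ D \<nu> \<or> \<nu> \<in> set L"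
    using word_basis[OF assms(1,3)] by metis
  obtain b D2 where 2: "b \<noteq> 0" "word L' (basis D') = fsc b (basis D2)" "\<And>\<nu>. occ D2 \<nu> \<longleftrightarrow> occ D' \<nu> \<or> \<nu> \<in> set L'"
    using word_basis[OF assms(2,4)] by metis
  have "D1 = D2" by (rule occ_eqI) (simp add: 1(3) 2(3) eq)
  then have "word L (basis D) = fsc (a / b) (word L' (basis D'))"
    using 2(1) by (simp only: 1(2) 2(2) fock.scale_scale) (simp add: 1(1))
  then show ?thesis using 1(1) 2(1) by (intro that[of "a / b"]) auto
qed

text \<open>The component of maximal energy fills, above the sea \<open>ray e\<close>, the even
  levels of \<open>{e - 2 k..<e}\<close>, whereas \<open>ray (e - k)\<close> fills all of
  \<open>{e - k..<e}\<close>. Powers of F_0 move the odd-level modes of the latter down by one level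
  and so turn one state into the other, up to a scalar: this is the lowest weight vector of the
  sl2-string of the sea.\<close>

lemma down_cur_top_mem:
  assumes "k > 0"
  shows "down_cur k k (\<Sum>i<k. top_mode k e i) (basis (ray e)) \<in> ray_module k (e - int k)"
proof -
  define movers where "movers = filter (\<lambda>\<nu>. odd (\<nu> div int k)) [e - int k..e - 1]"
  define evens where "evens = filter (\<lambda>\<nu>. even (\<nu> div int k)) [e - int k..e - 1]"
  let ?M = "ray_module k (e - int k)" and ?e = "basis (ray e)"
  have dm: "distinct movers" and de: "distinct evens" by (simp_all add: movers_def evens_def)
  have sm: "set movers = {\<nu>. odd (\<nu> div int k) \<and> e - int k \<le> \<nu> \<and> \<nu> < e}"
    and se: "set evens = {\<nu>. even (\<nu> div int k) \<and> e - int k \<le> \<nu> \<and> \<nu> < e}"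
    by (auto simp: movers_def evens_def)
  have sh: "(\<nu> - int k) div int k = \<nu> div int k - 1" for \<nu>
    using assms div_shift[of k \<nu> "- 1"] by simp
  obtain b D where D: "b \<noteq> 0" "word evens ?e = fsc b (basis D)" "\<And>\<nu>. occ D \<nu> \<longleftrightarrow> occ (ray e) \<nu> \<or> \<nu> \<in> set evens"
    using word_basis[OF de, of "ray e"] by (auto simp: se)
  \<comment> \<open>All even levels that F_0 could move a mode into are already filled.\<close>
  have "mop k (Lp F 0) (basis D) = 0"
  proof -
    have "occ D (\<nu> + - int k)" if "odd (\<nu> div int k)" "occ D \<nu>" for \<nu>
      using that sh[of \<nu>] unfolding D(3) se by auto
    then have "shift_op (\<lambda>\<nu>. sl2_coeff F (\<nu> div int k)) (- int k) (basis D) = 0"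
      using assms by (intro shift_op_basis_eq_zero) (auto split: if_splits)
    then show ?thesis by (simp add: step_op_def)
  qed
  then have F0: "mop k (Lp F 0) (word evens ?e) = 0" by (simp only: D(2) mop_linear fock.scale_zero_right)
  have "elementary_word k movers s (word evens ?e) \<in> ?M" for s
  proof (induction s)
    case 0
    obtain a where "word (movers @ evens) ?e = fsc a (word [] (basis (ray (e - int k))))"
      by (rule basis_word_proportional[of "movers @ evens" "[]" "ray e" "ray (e - int k)"])
        (use dm de sm se in auto)
    then have "word movers (word evens ?e) = fsc a (basis (ray (e - int k)))" by (simp only: word_simps)
    then show "elementary_word k movers 0 (word evens ?e) \<in> ?M"
      unfolding elementary_word_zero by (simp only: ray_module_closed)
  next
    case (Suc s)
    have "mop k (Lp F 0) (elementary_word k movers s (word evens ?e)) \<in> ?M"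
      using Suc by (intro ray_module_closed) (simp_all add: proper_letters_def)
    moreover have "mop k (Lp F 0) (elementary_word k movers s (word evens ?e)) =
      fsc (of_nat (Suc s)) (elementary_word k movers (Suc s) (word evens ?e))"
      by (rule F0_elementary_word[OF assms F0]) (simp add: sm)
    ultimately have "fsc (of_nat (Suc s)) (elementary_word k movers (Suc s) (word evens ?e)) \<in> ?M"
      by (simp only:)
    then show "elementary_word k movers (Suc s) (word evens ?e) \<in> ?M"
      by (rule ray_module_cancel) (simp del: of_nat_Suc)
  qed
  from this[of "length movers"] have mem: "word (map (\<lambda>\<nu>. \<nu> - int k) movers @ evens) ?e \<in> ?M"
    by (simp only: elementary_word_top word_simps)
  let ?L = "map (\<lambda>i. down_mode k i (top_mode k e i)) (rev [0..<k])"
  have sL: "set ?L = {\<nu>. even (\<nu> div int k) \<and> e - 2 * int k \<le> \<nu> \<and> \<nu> < e}"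
    using top_modes_eq[OF assms, of e] by (simp add: atLeast0LessThan)
  have dL: "distinct ?L"
  proof -
    have "i = j" if "i < k" "j < k" "down_mode k i m = down_mode k j m'" for i j m m'
      using that down_mode_mod[of i k m] down_mode_mod[of j k m'] by simp
    then show ?thesis by (auto simp: distinct_map inj_on_def)
  qed
  have sM: "set (map (\<lambda>\<nu>. \<nu> - int k) movers @ evens) = {\<nu>. even (\<nu> div int k) \<and> e - 2 * int k \<le> \<nu> \<and> \<nu> < e}"
  proof (intro equalityI subsetI)
    fix \<nu> assume \<nu>: "\<nu> \<in> {\<nu>. even (\<nu> div int k) \<and> e - 2 * int k \<le> \<nu> \<and> \<nu> < e}"
    show "\<nu> \<in> set (map (\<lambda>\<nu>. \<nu> - int k) movers @ evens)"
    proof (cases "e - int k \<le> \<nu>")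
      case False
      then have "\<nu> + int k \<in> set movers" using \<nu> assms div_shift[of k \<nu> 1] by (auto simp: sm)
      then have "\<nu> \<in> (\<lambda>\<nu>. \<nu> - int k) ` set movers" by (rule rev_image_eqI) simp
      then show ?thesis by simp
    next
      case True
      then have "\<nu> \<in> set evens" using \<nu> unfolding se by blast
      then show ?thesis by simp
    qed
  next
    fix \<nu> assume "\<nu> \<in> set (map (\<lambda>\<nu>. \<nu> - int k) movers @ evens)"
    then consider \<mu> where "\<nu> = \<mu> - int k" "\<mu> \<in> set movers" | "\<nu> \<in> set evens" by auto
    then show "\<nu> \<in> {\<nu>. even (\<nu> div int k) \<and> e - 2 * int k \<le> \<nu> \<and> \<nu> < e}"
    proof cases
      case (1 \<mu>)
      then have "odd (\<mu> div int k)" "e - int k \<le> \<mu>" "\<mu> < e" unfolding sm by simp_all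
      then show ?thesis unfolding mem_Collect_eq 1(1) sh by simp
    next
      case 2
      then have "even (\<nu> div int k)" "e - int k \<le> \<nu>" "\<nu> < e" unfolding se by simp_all
      then show ?thesis by simp
    qed
  qed
  have dM: "distinct (map (\<lambda>\<nu>. \<nu> - int k) movers @ evens)"
  proof -
    have "\<mu> - int k \<notin> set evens" if "\<mu> \<in> set movers" for \<mu>
      using that unfolding sm se by simp
    then have "set (map (\<lambda>\<nu>. \<nu> - int k) movers) \<inter> set evens = {}" by auto
    moreover have "distinct (map (\<lambda>\<nu>. \<nu> - int k) movers)" unfolding distinct_map
      by (intro conjI dm inj_onI) simp
    ultimately show ?thesis using de by (simp only: distinct_append)
  qed
  obtain a where "word ?L ?e = fsc a (word (map (\<lambda>\<nu>. \<nu> - int k) movers @ evens) ?e)"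
  proof (rule basis_word_proportional[of ?L "map (\<lambda>\<nu>. \<nu> - int k) movers @ evens" "ray e" "ray e"])
    show "\<not> occ (ray e) \<nu>" if "\<nu> \<in> set ?L" for \<nu> using that unfolding sL by simp
    show "\<not> occ (ray e) \<nu>" if "\<nu> \<in> set (map (\<lambda>\<nu>. \<nu> - int k) movers @ evens)" for \<nu>
      using that unfolding sM by simp
    show "occ (ray e) \<nu> \<or> \<nu> \<in> set ?L \<longleftrightarrow> occ (ray e) \<nu> \<or> \<nu> \<in> set (map (\<lambda>\<nu>. \<nu> - int k) movers @ evens)" for \<nu>
      unfolding sL sM ..
  qed (rule dL, rule dM, blast)
  then have "word ?L ?e \<in> ?M" using mem by (simp only: ray_module_closed)
  then show ?thesis by (simp only: down_cur_top[OF order_refl assms])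
qed

text \<open>Descent from the maximal n: Newton's identity expresses component n through currents
  applied to higher components, with the nonzero factor \<open>?G - n\<close>.\<close>

lemma down_cur_mem:
  assumes "k > 0" shows "down_cur k k n (basis (ray e)) \<in> ray_module k (e - int k)"
proof -
  let ?G = "\<Sum>i<k. top_mode k e i"
  show ?thesis
  proof (induction "nat (?G - n)" arbitrary: n rule: less_induct)
    case less
    consider "n > ?G" | "n = ?G" | "n < ?G" by linarith
    then show "down_cur k k n (basis (ray e)) \<in> ray_module k (e - int k)"
    proof cases
      case 1
      then have "down_cur k k n (basis (ray e)) = 0" using assms by (intro down_cur_vanish) auto
      then show ?thesis by (simp only: ray_module_closed)
    next
      case 2
      then show ?thesis using down_cur_top_mem[OF assms, of e] by simp
    next
      case 3
      have "(\<Sum>r\<in>{1..?G - n}. down_op k k r (down_cur k k (n + r) (basis (ray e)))) \<in> ray_module k (e - int k)"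
        using 3 less assms by (intro ray_module_sum down_op_closed) auto
      then have "fsc (of_int (?G - n)) (down_cur k k n (basis (ray e))) \<in> ray_module k (e - int k)"
        using newton_identity[OF order_refl assms, of e n "?G - n"] by (simp only: order_refl)
      then show ?thesis by (rule ray_module_cancel) (simp only: of_int_eq_0_iff, use 3 in simp)
    qed
  qed
qed

text \<open>The values b below k are reached from b = k by E_0, which kills the sea and lowers b by
  one with a nonzero factor.\<close>

lemma cur_ray_mem:
  assumes "k > 0" shows "cur k k b n (basis (ray e)) \<in> ray_module k (e - int k)"
proof -
  have "cur k k (int k - int t) n (basis (ray e)) \<in> ray_module k (e - int k)" for t n
  proof (induction t arbitrary: n)
    case 0
    show "cur k k (int k - int 0) n (basis (ray e)) \<in> ray_module k (e - int k)"
      using down_cur_mem[OF assms, of n e] by (simp add: down_cur_def)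
  next
    case (Suc t)
    show "cur k k (int k - int (Suc t)) n (basis (ray e)) \<in> ray_module k (e - int k)"
    proof -
      have E: "mop k (Lp E 0) (basis (ray e)) = 0"
        using assms by (subst mop_raising_ray) (auto simp: proper_letters_def)
      have "mop k (Lp E 0) (cur k k (int k - int t) n (basis (ray e))) \<in> ray_module k (e - int k)"
        using Suc by (intro ray_module_closed) (simp_all add: proper_letters_def)
      also have "mop k (Lp E 0) (cur k k (int k - int t) n (basis (ray e))) =
        fsc (of_nat (Suc t)) (cur k k (int k - int (Suc t)) n (basis (ray e)))"
        unfolding loop_cur E by (simp add: algebra_simps)
      finally show ?thesis by (rule ray_module_cancel) (simp del: of_nat_Suc)
    qed
  qed
  from this[of "nat (int k - b)"] show ?thesis
  proof (cases "b \<le> int k")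
    case False
    then have "cur k k b n (basis (ray e)) = 0" by (simp add: cur_range)
    then show ?thesis by (simp only: ray_module_closed)
  qed simp
qed

section \<open>Leading terms\<close>

lemma mode_inject:
  assumes "i < k" "j < k" "int k * N + int i = int k * M + int j"
  shows "i = j" "N = M"
proof -
  have "(int k * N + int i) mod int k = int i" "(int k * M + int j) mod int k = int j"
    using assms(1,2) by simp_all
  then show "i = j" using assms(3) by simp
  then show "N = M" using assms by simp
qed

text \<open>If only one choice of modes leads from the support of f to D, no cancellation can
  occur.\<close>

lemma cur_value:
  assumes "s \<le> k" "\<And>i. i < s \<Longrightarrow> occ D (int k * \<mu> i + int i)"
    and "\<And>\<nu>. occ D' \<nu> \<longleftrightarrow> occ D \<nu> \<and> (\<forall>i<s. \<nu> \<noteq> int k * \<mu> i + int i)"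
    and "\<And>N D'. f D' \<noteq> 0 \<Longrightarrow> (\<And>\<nu>. occ D' \<nu> \<longleftrightarrow> occ D \<nu> \<and> (\<forall>i<s. \<nu> \<noteq> int k * N i + int i)) \<Longrightarrow>
      (\<And>i. i < s \<Longrightarrow> occ D (int k * N i + int i)) \<Longrightarrow> (\<Sum>i<s. spin_down (N i)) = b \<Longrightarrow>
      (\<Sum>i<s. N i div 2) = n \<Longrightarrow> \<forall>i<s. N i = \<mu> i"
    and "(\<Sum>i<s. spin_down (\<mu> i)) = b" "(\<Sum>i<s. \<mu> i div 2) = n"
  shows "\<exists>a. a \<noteq> 0 \<and> cur k s b n f D = a * f D'"
  using assms
proof (induction s arbitrary: b n D)
  case 0
  have "D' = D" by (rule occ_eqI) (simp add: 0(3))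
  then show ?case using 0(5,6) by (intro exI[of _ 1]) simp
next
  case (Suc s)
  let ?m = "\<mu> s"
  let ?\<nu> = "int k * ?m + int s"
  have s: "s < k" using Suc.prems(1) by simp
  have occ: "occ D ?\<nu>" using Suc.prems(2) by simp
  let ?t = "\<lambda>M. creator (int k * M + int s) (cur k s (b - spin_down M) (n - M div 2) f) D"
  have zero: "?t M = 0" if "M \<noteq> ?m" for M
  proof (rule ccontr)
    assume nz: "?t M \<noteq> 0"
    let ?\<mu> = "int k * M + int s"
    from nz have oM: "occ D ?\<mu>" and nz': "cur k s (b - spin_down M) (n - M div 2) f (toggle ?\<mu> D) \<noteq> 0"
      by (auto simp: creator_def split: if_splits)
    from nz' obtain N E where N: "f E \<noteq> 0"
      "\<And>\<nu>. occ E \<nu> \<longleftrightarrow> occ (toggle ?\<mu> D) \<nu> \<and> (\<forall>i<s. \<nu> \<noteq> int k * N i + int i)"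
      "\<And>i. i < s \<Longrightarrow> occ (toggle ?\<mu> D) (int k * N i + int i)"
      "(\<Sum>i<s. spin_down (N i)) = b - spin_down M" "(\<Sum>i<s. N i div 2) = n - M div 2"
      by (rule cur_support) blast
    let ?N = "N(s := M)"
    have "\<forall>i<Suc s. ?N i = \<mu> i"
    proof (rule Suc.prems(4)[OF N(1)])
      show "occ E \<nu> \<longleftrightarrow> occ D \<nu> \<and> (\<forall>i<Suc s. \<nu> \<noteq> int k * ?N i + int i)" for \<nu>
        using N(2)[of \<nu>] oM by (auto simp: less_Suc_eq)
      show "occ D (int k * ?N i + int i)" if "i < Suc s" for i
      proof (cases "i = s")
        case False
        then have "i < s" using that by simp
        then show ?thesis using N(3)[of i] oM False
          by (cases "int k * M + int s = int k * N i + int i") auto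
      qed (use oM in simp)
      have "(\<Sum>i<s. spin_down (?N i)) = (\<Sum>i<s. spin_down (N i))" "(\<Sum>i<s. ?N i div 2) = (\<Sum>i<s. N i div 2)"
        by (auto intro: sum.cong)
      then show "(\<Sum>i<Suc s. spin_down (?N i)) = b" "(\<Sum>i<Suc s. ?N i div 2) = n"
        using N(4,5) by simp_all
    qed
    then show False using that by auto
  qed
  have "cur k (Suc s) b n f D = (\<Sum>M\<in>{?m}. ?t M)"
    unfolding cur.simps psum_def by (rule Sum_any.expand_superset) (use zero in auto)
  then have eq: "cur k (Suc s) b n f D = jw_sign ?\<nu> D * cur k s (b - spin_down ?m) (n - ?m div 2) f (toggle ?\<nu> D)"
    using occ by (simp add: creator_def)
  have ne: "int k * N + int i \<noteq> ?\<nu>" if "i < s" for N i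
    using mode_inject(1)[of i k s N ?m] that s by auto
  have "\<exists>a. a \<noteq> 0 \<and> cur k s (b - spin_down ?m) (n - ?m div 2) f (toggle ?\<nu> D) = a * f D'"
  proof (rule Suc.IH)
    show "s \<le> k" using s by simp
    show "occ (toggle ?\<nu> D) (int k * \<mu> i + int i)" if "i < s" for i
      using Suc.prems(2)[of i] that ne[OF that, of "\<mu> i"] by simp
    show "occ D' \<nu> \<longleftrightarrow> occ (toggle ?\<nu> D) \<nu> \<and> (\<forall>i<s. \<nu> \<noteq> int k * \<mu> i + int i)" for \<nu>
      using Suc.prems(3)[of \<nu>] occ by (auto simp: less_Suc_eq)
    show "(\<Sum>i<s. spin_down (\<mu> i)) = b - spin_down ?m" "(\<Sum>i<s. \<mu> i div 2) = n - ?m div 2"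
      using Suc.prems(5,6) by simp_all
    fix N E assume N: "f E \<noteq> 0" "\<And>\<nu>. occ E \<nu> \<longleftrightarrow> occ (toggle ?\<nu> D) \<nu> \<and> (\<forall>i<s. \<nu> \<noteq> int k * N i + int i)"
      "\<And>i. i < s \<Longrightarrow> occ (toggle ?\<nu> D) (int k * N i + int i)"
      "(\<Sum>i<s. spin_down (N i)) = b - spin_down ?m" "(\<Sum>i<s. N i div 2) = n - ?m div 2"
    let ?N = "N(s := ?m)"
    have "\<forall>i<Suc s. ?N i = \<mu> i"
    proof (rule Suc.prems(4)[OF N(1)])
      show "occ E \<nu> \<longleftrightarrow> occ D \<nu> \<and> (\<forall>i<Suc s. \<nu> \<noteq> int k * ?N i + int i)" for \<nu>
        using N(2)[of \<nu>] occ by (auto simp: less_Suc_eq)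
      show "occ D (int k * ?N i + int i)" if "i < Suc s" for i
      proof (cases "i = s")
        case False
        then have "i < s" using that by simp
        then show ?thesis using N(3)[of i] ne[of i "N i"] False by auto
      qed (use occ in simp)
      have "(\<Sum>i<s. spin_down (?N i)) = (\<Sum>i<s. spin_down (N i))" "(\<Sum>i<s. ?N i div 2) = (\<Sum>i<s. N i div 2)"
        by (auto intro: sum.cong)
      then show "(\<Sum>i<Suc s. spin_down (?N i)) = b" "(\<Sum>i<Suc s. ?N i div 2) = n"
        using N(4,5) by simp_all
    qed
    then show "\<forall>i<s. N i = \<mu> i" by (metis fun_upd_other less_SucI less_irrefl)
  qed
  then obtain a where "a \<noteq> 0" "cur k s (b - spin_down ?m) (n - ?m div 2) f (toggle ?\<nu> D) = a * f D'" by blast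
  then show ?case unfolding eq by (intro exI[of _ "jw_sign ?\<nu> D * a"]) simp
qed

lemma ray_modes:
  assumes "i < k"
  obtains N where "e \<le> int k * N + int i" "int k * N + int i < e + int k"
proof
  let ?N = "(e + int k - 1 - int i) div int k"
  have "int k * ?N + (e + int k - 1 - int i) mod int k = e + int k - 1 - int i" by simp
  moreover have "0 \<le> (e + int k - 1 - int i) mod int k" "(e + int k - 1 - int i) mod int k < int k"
    using assms by simp_all
  ultimately show "e \<le> int k * ?N + int i" "int k * ?N + int i < e + int k" by linarith+
qed

lemma mode_window_unique:
  assumes "e \<le> int k * N + int i" "int k * N + int i < e + int k"
    "e \<le> int k * M + int i" "int k * M + int i < e + int k"
  shows "N = M"
proof -
  have "int k * (N - M) < int k * 1" "int k * (M - N) < int k * 1"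
    using assms by (simp_all add: right_diff_distrib)
  moreover have "0 < int k" using assms by linarith
  ultimately have "N - M < 1" "M - N < 1" by (simp_all only: mult_less_cancel_left_pos)
  then show ?thesis by simp
qed

text \<open>Any k consecutive modes contain exactly one of each doublet.\<close>

lemma sum_window:
  fixes G :: "int \<Rightarrow> int"
  assumes "k > 0" "\<And>i. i < k \<Longrightarrow> e \<le> int k * \<mu> i + int i" "\<And>i. i < k \<Longrightarrow> int k * \<mu> i + int i < e + int k"
  shows "(\<Sum>i<k. G (\<mu> i)) = (\<Sum>\<nu>\<in>{e..<e + int k}. G (\<nu> div int k))"
proof (rule sum.reindex_bij_witness[where i = "\<lambda>\<nu>. nat (\<nu> mod int k)" and j = "\<lambda>i. int k * \<mu> i + int i"])
  fix \<nu> assume \<nu>: "\<nu> \<in> {e..<e + int k}"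
  define i where "i = nat (\<nu> mod int k)"
  have i: "int i = \<nu> mod int k" "i < k" using assms(1) by (auto simp: i_def nat_less_iff)
  have eq: "\<nu> = int k * (\<nu> div int k) + int i" by (simp add: i)
  have "\<mu> i = \<nu> div int k"
    using assms(2,3)[OF i(2)] \<nu> eq by (intro mode_window_unique[of e k "\<mu> i" i "\<nu> div int k"]) auto
  then show "int k * \<mu> (nat (\<nu> mod int k)) + int (nat (\<nu> mod int k)) = \<nu>"
    using eq by (simp add: i_def)
  show "nat (\<nu> mod int k) \<in> {..<k}" using i by (simp add: i_def)
qed (use assms in auto)

text \<open>The total energy of the modes whose creation turns \<open>ray e\<close> into
  \<open>ray (e - k)\<close>.\<close>

definition window_energy :: "nat \<Rightarrow> int \<Rightarrow> int"
  where "window_energy k e = (\<Sum>\<nu>\<in>{e - int k..<e}. \<nu> div int k div 2)"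

lemma ray_weight_spin: "int (ray_weight k e) = (\<Sum>\<nu>\<in>{e - int k..<e}. spin_down (\<nu> div int k))"
  by (simp add: ray_weight_def spin_down_def sum.If_cases Int_def)

text \<open>The passage between the two seas leaves no choice of modes. This is the fermionic
  counterpart of the normalisation of the vertex operators between highest weight vectors.\<close>

lemma cur_ray_at_ray:
  assumes "k > 0"
  shows "cur k k b n (basis (ray e)) (ray (e - int k)) \<noteq> 0 \<longleftrightarrow> b = int (ray_weight k e) \<and> n = window_energy k e"
proof -
  let ?c = "e - int k"
  have "\<exists>\<mu>. \<forall>i<k. ?c \<le> int k * \<mu> i + int i \<and> int k * \<mu> i + int i < ?c + int k"
    by (intro choice allI) (metis ray_modes)
  then obtain \<mu> where \<mu>: "\<And>i. i < k \<Longrightarrow> ?c \<le> int k * \<mu> i + int i" "\<And>i. i < k \<Longrightarrow> int k * \<mu> i + int i < ?c + int k"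
    by blast
  have sums: "(\<Sum>i<k. spin_down (\<mu> i)) = int (ray_weight k e)" "(\<Sum>i<k. \<mu> i div 2) = window_energy k e"
    using sum_window[OF assms, of ?c \<mu>] \<mu> by (simp_all add: ray_weight_spin window_energy_def)
  have uniq: "\<forall>i<k. N i = \<mu> i"
    if "basis (ray e) D' \<noteq> 0" "\<And>\<nu>. occ D' \<nu> \<longleftrightarrow> occ (ray ?c) \<nu> \<and> (\<forall>i<k. \<nu> \<noteq> int k * N i + int i)"
      "\<And>i. i < k \<Longrightarrow> occ (ray ?c) (int k * N i + int i)" for N D'
  proof (intro allI impI)
    fix i assume i: "i < k"
    have D': "D' = ray e" using that(1) by (simp add: basis_def split: if_splits)
    have "\<not> occ D' (int k * N i + int i)" using that(2) i by blast
    then have "int k * N i + int i < ?c + int k" by (simp add: D')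
    moreover have "?c \<le> int k * N i + int i" using that(3)[OF i] by simp
    ultimately show "N i = \<mu> i" using \<mu>[OF i] by (intro mode_window_unique)
  qed
  have occ_e: "occ (ray e) \<nu> \<longleftrightarrow> occ (ray ?c) \<nu> \<and> (\<forall>i<k. \<nu> \<noteq> int k * \<mu> i + int i)" for \<nu>
  proof -
    have "\<exists>i<k. \<nu> = int k * \<mu> i + int i" if "?c \<le> \<nu>" "\<nu> < e"
    proof -
      define i where "i = nat (\<nu> mod int k)"
      have i: "int i = \<nu> mod int k" "i < k" using assms by (auto simp: i_def nat_less_iff)
      have eq: "\<nu> = int k * (\<nu> div int k) + int i" by (simp add: i)
      have "\<mu> i = \<nu> div int k"
        using \<mu>[OF i(2)] that eq by (intro mode_window_unique[of ?c k "\<mu> i" i "\<nu> div int k"]) auto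
      then show ?thesis using eq i(2) by metis
    qed
    then show ?thesis using \<mu>(2) by fastforce
  qed
  show ?thesis
  proof
    assume "cur k k b n (basis (ray e)) (ray ?c) \<noteq> 0"
    then obtain N D' where N: "basis (ray e) D' \<noteq> 0"
      "\<And>\<nu>. occ D' \<nu> \<longleftrightarrow> occ (ray ?c) \<nu> \<and> (\<forall>i<k. \<nu> \<noteq> int k * N i + int i)"
      "\<And>i. i < k \<Longrightarrow> occ (ray ?c) (int k * N i + int i)"
      "(\<Sum>i<k. spin_down (N i)) = b" "(\<Sum>i<k. N i div 2) = n" by (rule cur_support) blast
    have "\<forall>i<k. N i = \<mu> i" using uniq[OF N(1-3)] .
    then have "(\<Sum>i<k. spin_down (N i)) = (\<Sum>i<k. spin_down (\<mu> i))" "(\<Sum>i<k. N i div 2) = (\<Sum>i<k. \<mu> i div 2)"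
      by (auto intro: sum.cong)
    then show "b = int (ray_weight k e) \<and> n = window_energy k e" using N(4,5) sums by simp
  next
    assume bn: "b = int (ray_weight k e) \<and> n = window_energy k e"
    have "\<exists>a. a \<noteq> 0 \<and> cur k k b n (basis (ray e)) (ray ?c) = a * basis (ray e) (ray e)"
      by (rule cur_value[where \<mu> = \<mu>]) (use \<mu> bn sums uniq occ_e in \<open>auto simp del: occ_ray, auto\<close>)
    then show "cur k k b n (basis (ray e)) (ray ?c) \<noteq> 0" by (auto simp: basis_def)
  qed
qed

section \<open>Lowest modes and the normal ordering condition\<close>

definition lowest_modes :: "nat \<Rightarrow> int fset \<Rightarrow> (nat \<Rightarrow> int) \<Rightarrow> bool"
  where "lowest_modes k D \<mu> \<longleftrightarrow>
    (\<forall>i<k. occ D (int k * \<mu> i + int i) \<and> (\<forall>N. occ D (int k * N + int i) \<longrightarrow> \<mu> i \<le> N))"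

text \<open>Summed over the doublets, this identifies \<open>2 n - b\<close> with a sum of levels,
  which is minimal exactly for the lowest modes; it is the reason for the form of
  \<open>letter_key\<close>.\<close>

lemma level_key: "2 * (N div 2) - spin_down N = N - 1" for N :: int
  by (auto simp: spin_down_def elim!: evenE oddE)

text \<open>The fields only see the lowest modes of each doublet at leading order: the coefficient of a
  state vanishes unless \<open>2 n - b\<close> is at least the value attained by its lowest modes.\<close>

lemma cur_leading:
  assumes D1: "lowest_modes k D1 \<mu>"
    and D: "\<And>\<nu>. occ D \<nu> \<longleftrightarrow> occ D1 \<nu> \<and> (\<forall>i<k. \<nu> \<noteq> int k * \<mu> i + int i)"
    and b0: "(\<Sum>i<k. spin_down (\<mu> i)) = b0" and n0: "(\<Sum>i<k. \<mu> i div 2) = n0"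
  shows "cur k k b n f D1 \<noteq> 0 \<Longrightarrow> 2 * n - b > 2 * n0 - b0 \<or> b = b0 \<and> n = n0 \<and> f D \<noteq> 0"
    and "\<exists>a. a \<noteq> 0 \<and> cur k k b0 n0 f D1 = a * f D"
proof -
  have key: "2 * (\<Sum>i<k. N i div 2) - (\<Sum>i<k. spin_down (N i)) = (\<Sum>i<k. N i - 1)" for N :: "nat \<Rightarrow> int"
    unfolding sum_distrib_left sum_subtractf[symmetric] by (intro sum.cong refl level_key)
  have low: "\<mu> i \<le> N" if "occ D1 (int k * N + int i)" "i < k" for N i
    using D1 that by (auto simp: lowest_modes_def)
  have uniq: "\<forall>i<k. N i = \<mu> i"
    if "\<And>i. i < k \<Longrightarrow> occ D1 (int k * N i + int i)" "(\<Sum>i<k. N i - 1) \<le> (\<Sum>i<k. \<mu> i - 1)" for N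
  proof (rule ccontr)
    assume "\<not> (\<forall>i<k. N i = \<mu> i)"
    then obtain i where i: "i < k" "N i \<noteq> \<mu> i" by blast
    have "(\<Sum>i<k. \<mu> i - 1) < (\<Sum>i<k. N i - 1)"
    proof (rule sum_strict_mono_ex1)
      show "\<forall>i\<in>{..<k}. \<mu> i - 1 \<le> N i - 1"
      proof
        fix i assume "i \<in> {..<k}"
        then have "i < k" by simp
        then show "\<mu> i - 1 \<le> N i - 1" using low[OF that(1)[OF \<open>i < k\<close>] \<open>i < k\<close>] by simp
      qed
      show "\<exists>i\<in>{..<k}. \<mu> i - 1 < N i - 1" using low[OF that(1)[OF i(1)] i(1)] i by (intro bexI[of _ i]) auto
    qed simp
    then show False using that(2) by simp
  qed
  show "2 * n - b > 2 * n0 - b0 \<or> b = b0 \<and> n = n0 \<and> f D \<noteq> 0" if "cur k k b n f D1 \<noteq> 0"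
  proof -
    from that obtain N D' where N: "f D' \<noteq> 0"
      "\<And>\<nu>. occ D' \<nu> \<longleftrightarrow> occ D1 \<nu> \<and> (\<forall>i<k. \<nu> \<noteq> int k * N i + int i)"
      "\<And>i. i < k \<Longrightarrow> occ D1 (int k * N i + int i)"
      "(\<Sum>i<k. spin_down (N i)) = b" "(\<Sum>i<k. N i div 2) = n" by (rule cur_support) blast
    show ?thesis
    proof (cases "2 * n - b > 2 * n0 - b0")
      case False
      then have eq: "\<forall>i<k. N i = \<mu> i" using key[of N] key[of \<mu>] N(3-5) b0 n0 by (intro uniq) auto
      then have "(\<Sum>i<k. spin_down (N i)) = (\<Sum>i<k. spin_down (\<mu> i))" "(\<Sum>i<k. N i div 2) = (\<Sum>i<k. \<mu> i div 2)"
        by (auto intro: sum.cong)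
      moreover have "D' = D" by (rule occ_eqI) (use N(2) D eq in auto)
      ultimately show ?thesis using N b0 n0 by simp
    qed simp
  qed
  show "\<exists>a. a \<noteq> 0 \<and> cur k k b0 n0 f D1 = a * f D"
  proof (rule cur_value[OF order_refl _ D _ b0 n0])
    show "occ D1 (int k * \<mu> i + int i)" if "i < k" for i using D1 that by (simp add: lowest_modes_def)
    fix N D' assume "\<And>i. i < k \<Longrightarrow> occ D1 (int k * N i + int i)"
      "(\<Sum>i<k. spin_down (N i)) = b0" "(\<Sum>i<k. N i div 2) = n0"
    then show "\<forall>i<k. N i = \<mu> i" using key[of N] key[of \<mu>] b0 n0 by (intro uniq) auto
  qed
qed

lemma spin_down_sum_card:
  fixes k :: nat
  shows "(\<Sum>i<k. spin_down (\<mu> i)) = int (card {i. i < k \<and> even (\<mu> i)})"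
proof -
  have "(\<Sum>i<k. spin_down (\<mu> i)) = (\<Sum>i\<in>{i\<in>{..<k}. even (\<mu> i)}. 1)"
    unfolding spin_down_def by (rule sum.inter_filter[symmetric]) simp
  then show ?thesis by (simp add: lessThan_def)
qed

text \<open>The normal ordering condition is what allows the next letter of a path to be distributed over
  the doublets: choose the even positions to overlap as much as possible with the odd positions of \<open>\<mu>\<close>.\<close>

lemma normal_order_split:
  fixes k a :: nat and n :: int
  assumes k: "k > 0" and a: "a \<le> k" and a': "(\<Sum>i<k. spin_down (\<mu> i)) = int a'"
    and n': "(\<Sum>i<k. \<mu> i div 2) = n'" and cond: "int (min a (k - a')) - n + n' \<ge> int k"
  obtains \<mu>' where "\<And>i. i < k \<Longrightarrow> \<mu>' i < \<mu> i" "(\<Sum>i<k. spin_down (\<mu>' i)) = int a" "(\<Sum>i<k. \<mu>' i div 2) = n"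
proof -
  let ?O = "{i. i < k \<and> odd (\<mu> i)}"
  let ?V = "{i. i < k \<and> even (\<mu> i)}"
  have fin: "finite ?O" "finite ?V" by simp_all
  have cV: "card ?V = a'" using a' by (simp add: spin_down_sum_card)
  have "card ?O + card ?V = card (?O \<union> ?V)" by (rule card_Un_disjoint[symmetric]) auto
  also have "?O \<union> ?V = {..<k}" by auto
  finally have cO: "card ?O = k - a'" "a' \<le> k" using cV by simp_all
  obtain I where I: "I \<subseteq> {..<k}" "card I = a" "card (I \<inter> ?O) = min a (k - a')"
  proof (cases "a \<le> k - a'")
    case True
    then have "a \<le> card ?O" using cO by simp
    then obtain I where "I \<subseteq> ?O" "card I = a" by (rule obtain_subset_with_card_n)
    then show ?thesis using True by (intro that[of I]) (auto simp: Int_absorb2)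
  next
    case False
    then have "a - (k - a') \<le> card ?V" using cV a by simp
    then obtain J where J: "J \<subseteq> ?V" "card J = a - (k - a')" by (rule obtain_subset_with_card_n)
    have disj: "?O \<inter> J = {}" using J(1) by auto
    have "card (?O \<union> J) = a" using card_Un_disjoint[OF fin(1) finite_subset[OF J(1) fin(2)] disj] cO J(2) False by simp
    moreover have "(?O \<union> J) \<inter> ?O = ?O" by auto
    ultimately show ?thesis using False cO J(1) by (intro that[of "?O \<union> J"]) auto
  qed
  \<comment> \<open>In each doublet the largest level below that of \<mu> with the parity prescribed
    by I. The energy drops by one, except where an odd level is replaced by the even level just
    below it.\<close>
  define \<nu> where "\<nu> i = (if i \<in> I then (if odd (\<mu> i) then \<mu> i - 1 else \<mu> i - 2)
    else (if odd (\<mu> i) then \<mu> i - 2 else \<mu> i - 1))" for i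
  have spin: "spin_down (\<nu> i) = (if i \<in> I then 1 else 0)" for i
    by (auto simp: \<nu>_def spin_down_def)
  have div: "\<nu> i div 2 = \<mu> i div 2 - 1 + (if i \<in> I \<inter> ?O then 1 else 0)" if "i < k" for i
    using that by (auto simp: \<nu>_def elim!: evenE oddE)
  have finI: "finite I" using I(1) finite_subset by blast
  have sum_spin: "(\<Sum>i<k. spin_down (\<nu> i)) = int a"
    using I by (simp add: spin sum.If_cases Int_absorb1)
  have sum_div: "(\<Sum>i<k. \<nu> i div 2) = n' - int k + int (min a (k - a'))"
  proof -
    have "(\<Sum>i<k. \<nu> i div 2) = (\<Sum>i<k. \<mu> i div 2 - 1 + (if i \<in> I \<inter> ?O then 1 else 0))"
      by (intro sum.cong) (auto simp only: div lessThan_iff)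
    also have "\<dots> = n' - int k + (\<Sum>i<k. if i \<in> I \<inter> ?O then 1 else 0)"
      by (simp only: sum.distrib sum_subtractf n' sum_constant card_lessThan mult_1_right)
    also have "(\<Sum>i<k. if i \<in> I \<inter> ?O then 1 else 0 :: int) = (\<Sum>i\<in>I \<inter> ?O. 1)"
    proof -
      have "{i \<in> {..<k}. i \<in> I \<inter> ?O} = I \<inter> ?O" by auto
      then show ?thesis using sum.inter_filter[of "{..<k}" "\<lambda>_. 1 :: int" "\<lambda>i. i \<in> I \<inter> ?O"] by simp
    qed
    finally show ?thesis using I(3) by simp
  qed
  define x where "x = n' - int k + int (min a (k - a')) - n"
  have x: "x \<ge> 0" using cond by (simp add: x_def)
  \<comment> \<open>The slack x of the normal ordering condition is absorbed by doublet 0; an even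
    shift preserves the parity.\<close>
  define \<mu>' where "\<mu>' = \<nu>(0 := \<nu> 0 - 2 * x)"
  have split: "(\<Sum>i<k. G (\<mu>' i)) = (\<Sum>i<k. G (\<nu> i)) + (G (\<mu>' 0) - G (\<nu> 0))" for G :: "int \<Rightarrow> int"
  proof -
    have "(\<Sum>i<k. G (h i)) = G (h 0) + (\<Sum>i\<in>{..<k} - {0}. G (h i))" for h :: "nat \<Rightarrow> int"
      using k by (intro sum.remove) auto
    from this[of \<mu>'] this[of \<nu>] show ?thesis by (simp add: \<mu>'_def)
  qed
  show ?thesis
  proof
    show "\<mu>' i < \<mu> i" if "i < k" for i using x by (simp add: \<mu>'_def \<nu>_def)
    have "spin_down (\<mu>' 0) = spin_down (\<nu> 0)" by (simp add: \<mu>'_def spin_down_def)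
    then show "(\<Sum>i<k. spin_down (\<mu>' i)) = int a" by (simp add: split sum_spin)
    have "\<mu>' 0 div 2 = \<nu> 0 div 2 - x" by (simp add: \<mu>'_def) (simp add: algebra_simps)?
    then show "(\<Sum>i<k. \<mu>' i div 2) = n" by (simp add: split[of "\<lambda>N. N div 2"] sum_div x_def)
  qed
qed

lemma add_modes:
  assumes "k > 0" "lowest_modes k D \<mu>" "\<And>i. i < k \<Longrightarrow> \<mu>' i < \<mu> i"
  obtains D1 where "lowest_modes k D1 \<mu>'" "\<And>\<nu>. occ D \<nu> \<longleftrightarrow> occ D1 \<nu> \<and> (\<forall>i<k. \<nu> \<noteq> int k * \<mu>' i + int i)"
proof -
  let ?L = "map (\<lambda>i. int k * \<mu>' i + int i) [0..<k]"
  have unocc: "\<not> occ D (int k * \<mu>' i + int i)" if "i < k" for i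
    using assms(2,3) that by (force simp: lowest_modes_def)
  have dist: "distinct ?L" by (auto simp: distinct_map inj_on_def dest: mode_inject(1)[rotated 2])
  \<comment> \<open>The word of creators serves only to produce a state with the desired
    occupation.\<close>
  obtain D1 where D1: "\<And>\<nu>. occ D1 \<nu> \<longleftrightarrow> occ D \<nu> \<or> \<nu> \<in> set ?L"
  proof (rule word_basis[OF dist, of D])
    show "\<not> occ D \<nu>" if "\<nu> \<in> set ?L" for \<nu> using that unocc by auto
  qed blast
  have mem: "occ D1 \<nu> \<longleftrightarrow> occ D \<nu> \<or> (\<exists>i<k. \<nu> = int k * \<mu>' i + int i)" for \<nu>
    unfolding D1 by auto
  show ?thesis
  proof
    show "lowest_modes k D1 \<mu>'"
      unfolding lowest_modes_def
    proof (intro allI impI conjI)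
      fix i assume i: "i < k"
      then show "occ D1 (int k * \<mu>' i + int i)" unfolding mem by blast
      fix N assume "occ D1 (int k * N + int i)"
      then consider "occ D (int k * N + int i)" | j where "j < k" "int k * N + int i = int k * \<mu>' j + int j"
        unfolding mem by blast
      then show "\<mu>' i \<le> N"
      proof cases
        case 1
        then have "\<mu> i \<le> N" using assms(2) i by (simp add: lowest_modes_def)
        then show ?thesis using assms(3)[OF i] by simp
      next
        case 2
        then show ?thesis using mode_inject[OF i 2(1) 2(2)] by simp
      qed
    qed
    show "occ D \<nu> \<longleftrightarrow> occ D1 \<nu> \<and> (\<forall>i<k. \<nu> \<noteq> int k * \<mu>' i + int i)" for \<nu>
      unfolding mem using unocc by blast
  qed
qed


section \<open>Independence of the fermionic path vectors\<close>

text \<open>The shift d aligns the indices: with \<open>d = l - k\<close>, the index of a ground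
  letter becomes the energy of the corresponding window, see
  \<open>window_energy_ground\<close>.\<close>

primrec fermion_word :: "nat \<Rightarrow> int \<Rightarrow> (nat \<times> int) list \<Rightarrow> fock \<Rightarrow> fock" where
  "fermion_word k d [] f = f"
| "fermion_word k d (x # xs) f = cur k k (int (fst x)) (snd x + d) (fermion_word k d xs f)"

definition letter_key :: "nat \<times> int \<Rightarrow> int"
  where "letter_key x = 2 * snd x - int (fst x)"

definition key_less :: "(nat \<Rightarrow> nat \<times> int) \<Rightarrow> (nat \<Rightarrow> nat \<times> int) \<Rightarrow> bool"
  where "key_less P P' \<longleftrightarrow> (\<exists>j\<ge>1. (\<forall>i\<in>{1..<j}. P i = P' i) \<and> letter_key (P j) < letter_key (P' j))"

lemma key_less_transp: "transp key_less"
proof (rule transpI)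
  fix P P' P'' assume "key_less P P'" "key_less P' P''"
  then obtain j j' where j: "j \<ge> 1" "\<forall>i\<in>{1..<j}. P i = P' i" "letter_key (P j) < letter_key (P' j)"
    and j': "j' \<ge> 1" "\<forall>i\<in>{1..<j'}. P' i = P'' i" "letter_key (P' j') < letter_key (P'' j')"
    unfolding key_less_def by blast
  have "\<forall>i\<in>{1..<min j j'}. P i = P'' i" using j(2) j'(2) by simp
  moreover have "letter_key (P (min j j')) < letter_key (P'' (min j j'))"
  proof (cases j j' rule: linorder_cases)
    case less
    then have "P' j = P'' j" using j(1) j'(2) by simp
    then show ?thesis using less j(3) by simp
  next
    case equal
    then show ?thesis using j(3) j'(3) by simp
  next
    case greater
    then have "P j' = P' j'" using j(2) j'(1) by simp
    then show ?thesis using greater j'(3) by simp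
  qed
  ultimately show "key_less P P''"
    unfolding key_less_def using j(1) j'(1) by (intro exI[of _ "min j j'"]) simp
qed

lemma key_less_irrefl: "\<not> key_less P P"
  by (simp add: key_less_def)

text \<open>The state D is built from the tail of the path. The lowest modes of D realise one
  letter, and normal ordering leaves room strictly below them for the modes of the preceding letter.
  By \<open>cur_leading\<close>, any other word reaching the same state has a larger key at its
  first difference.\<close>

lemma path_dual_state:
  assumes k: "k > 0" "r \<le> k" and P: "P \<in> paths k r l" and T: "even T" "P (T + 1) = ground_path k r l (T + 1)"
    and t: "t \<le> T"
  shows "\<exists>D \<mu>. lowest_modes k D \<mu> \<and> (\<Sum>i<k. spin_down (\<mu> i)) = int (fst (P (t + 1))) \<and>
    (\<Sum>i<k. \<mu> i div 2) = snd (P (t + 1)) + (l - int k) \<and>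
    fermion_word k (l - int k) (map P [t + 1..<T + 1]) (basis (ray (int k * int T - int r))) D \<noteq> 0 \<and>
    (\<forall>P'. fermion_word k (l - int k) (map P' [t + 1..<T + 1]) (basis (ray (int k * int T - int r))) D \<noteq> 0 \<longrightarrow>
      (\<forall>j\<in>{t + 1..T}. P j = P' j) \<or>
      (\<exists>j\<in>{t + 1..T}. (\<forall>i\<in>{t + 1..<j}. P i = P' i) \<and> letter_key (P j) < letter_key (P' j)))"
  using t
proof (induction t rule: inc_induct)
  case base
  let ?c = "int k * int T - int r"
  \<comment> \<open>The lowest modes of the sea realise the ground letter T + 1, which is not part
    of the word but bounds letter T.\<close>
  define \<mu> where "\<mu> i = (if i < k - r then int T else int T - 1)" for i :: nat
  have "lowest_modes k (ray ?c) \<mu>"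
    unfolding lowest_modes_def
  proof (intro allI impI conjI)
    fix i assume i: "i < k"
    then show "occ (ray ?c) (int k * \<mu> i + int i)"
      using k by (auto simp: \<mu>_def right_diff_distrib not_less)
    fix N assume "occ (ray ?c) (int k * N + int i)"
    then have N: "?c \<le> int k * N + int i" by simp
    show "\<mu> i \<le> N"
    proof (cases "i < k - r")
      case True
      then have "int k * (int T - 1) < int k * N" using N k by (simp add: right_diff_distrib)
      then have "int T - 1 < N" using k by simp
      then show ?thesis using True by (simp add: \<mu>_def)
    next
      case False
      then have "int k * (int T - 2) < int k * N" using N k i by (simp add: right_diff_distrib)
      then have "int T - 2 < N" using k by simp
      then show ?thesis using False by (simp add: \<mu>_def)
    qed
  qed
  moreover have split: "(\<Sum>i<k. G (\<mu> i)) = int (k - r) * G (int T) + int r * G (int T - 1)" for G :: "int \<Rightarrow> int"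
  proof -
    have "(\<Sum>i<k. G (\<mu> i)) = (\<Sum>i\<in>{..<k - r} \<union> {k - r..<k}. G (\<mu> i))"
      by (rule sum.cong) auto
    also have "\<dots> = (\<Sum>i\<in>{..<k - r}. G (\<mu> i)) + (\<Sum>i\<in>{k - r..<k}. G (\<mu> i))"
      by (rule sum.union_disjoint) auto
    also have "\<dots> = (\<Sum>i\<in>{..<k - r}. G (int T)) + (\<Sum>i\<in>{k - r..<k}. G (int T - 1))"
      by (simp add: \<mu>_def)
    finally show ?thesis using k by simp
  qed
  obtain m where m: "int T = 2 * m" using T(1) by (metis evenE even_of_nat)
  have "(\<Sum>i<k. spin_down (\<mu> i)) = int (fst (P (T + 1)))"
    unfolding split T(2) using T(1) by (simp add: spin_down_def ground_path_def)
  moreover have "(\<Sum>i<k. \<mu> i div 2) = snd (P (T + 1)) + (l - int k)"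
  proof -
    have d: "(2 * m - 1) div 2 = m - 1" by simp
    have "(int (T + 1) + 1) * int k div 2 = (m + 1) * int k"
      using m by (simp add: algebra_simps)
    then have "snd (P (T + 1)) = (m + 1) * int k - int r - l"
      unfolding T(2) using T(1) by (simp add: ground_path_def)
    moreover have "(\<Sum>i<k. \<mu> i div 2) = int (k - r) * m + int r * (m - 1)"
      unfolding split[of "\<lambda>N. N div 2"] m d by simp
    ultimately show ?thesis using k by (simp add: algebra_simps of_nat_diff)
  qed
  ultimately show ?case by (intro exI[of _ "ray ?c"] exI[of _ \<mu>]) (simp add: basis_def)
next
  case (step t)
  let ?e = "basis (ray (int k * int T - int r))"
  let ?w = "\<lambda>P. fermion_word k (l - int k) (map P [Suc t + 1..<T + 1]) ?e"
  obtain D \<mu> where IH: "lowest_modes k D \<mu>" "(\<Sum>i<k. spin_down (\<mu> i)) = int (fst (P (Suc t + 1)))"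
    "(\<Sum>i<k. \<mu> i div 2) = snd (P (Suc t + 1)) + (l - int k)" "?w P D \<noteq> 0"
    "\<And>P'. ?w P' D \<noteq> 0 \<Longrightarrow> (\<forall>j\<in>{Suc t + 1..T}. P j = P' j) \<or>
      (\<exists>j\<in>{Suc t + 1..T}. (\<forall>i\<in>{Suc t + 1..<j}. P i = P' i) \<and> letter_key (P j) < letter_key (P' j))"
    using step.IH by blast
  have "P (t + 1) \<in> {0..k} \<times> UNIV" using P by (auto simp: paths_def PiE_iff)
  then have a: "fst (P (t + 1)) \<le> k" by (cases "P (t + 1)") simp
  have "int (min (fst (P (t + 1))) (k - fst (P (t + 1 + 1)))) - snd (P (t + 1)) + snd (P (t + 1 + 1)) \<ge> int k"
    using P unfolding paths_def by auto
  then have cond: "int (min (fst (P (t + 1))) (k - fst (P (Suc t + 1)))) - (snd (P (t + 1)) + (l - int k)) +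
      (snd (P (Suc t + 1)) + (l - int k)) \<ge> int k" by simp
  obtain \<mu>' where \<mu>': "\<And>i. i < k \<Longrightarrow> \<mu>' i < \<mu> i" "(\<Sum>i<k. spin_down (\<mu>' i)) = int (fst (P (t + 1)))"
    "(\<Sum>i<k. \<mu>' i div 2) = snd (P (t + 1)) + (l - int k)"
    using normal_order_split[OF k(1) a IH(2,3) cond] by blast
  obtain D1 where D1: "lowest_modes k D1 \<mu>'" "\<And>\<nu>. occ D \<nu> \<longleftrightarrow> occ D1 \<nu> \<and> (\<forall>i<k. \<nu> \<noteq> int k * \<mu>' i + int i)"
    using add_modes[OF k(1) IH(1) \<mu>'(1)] by blast
  have upt: "[t + 1..<T + 1] = (t + 1) # [Suc t + 1..<T + 1]" using step.hyps by (simp add: upt_rec)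
  have word: "fermion_word k (l - int k) (map P' [t + 1..<T + 1]) ?e =
    cur k k (int (fst (P' (t + 1)))) (snd (P' (t + 1)) + (l - int k)) (?w P')" for P'
    unfolding upt by simp
  note lead = cur_leading[OF D1(1,2) \<mu>'(2,3)]
  have "fermion_word k (l - int k) (map P [t + 1..<T + 1]) ?e D1 \<noteq> 0"
    unfolding word using lead(2)[of "?w P"] IH(4) by auto
  moreover have "(\<forall>j\<in>{t + 1..T}. P j = P' j) \<or>
      (\<exists>j\<in>{t + 1..T}. (\<forall>i\<in>{t + 1..<j}. P i = P' i) \<and> letter_key (P j) < letter_key (P' j))"
    if nz: "fermion_word k (l - int k) (map P' [t + 1..<T + 1]) ?e D1 \<noteq> 0" for P'
  proof -
    have "letter_key (P (t + 1)) < letter_key (P' (t + 1)) \<or> P (t + 1) = P' (t + 1) \<and> ?w P' D \<noteq> 0"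
      using lead(1)[OF nz[unfolded word]] by (auto simp: letter_key_def prod_eq_iff)
    then show ?thesis
    proof
      assume "letter_key (P (t + 1)) < letter_key (P' (t + 1))"
      then show ?thesis using step.hyps by (intro disjI2 bexI[of _ "t + 1"]) auto
    next
      assume eq: "P (t + 1) = P' (t + 1) \<and> ?w P' D \<noteq> 0"
      have ins: "{t + 1..<j} = insert (t + 1) {Suc t + 1..<j}" if "t + 1 < j" for j using that by auto
      have "(\<forall>j\<in>{Suc t + 1..T}. P j = P' j) \<or>
        (\<exists>j\<in>{Suc t + 1..T}. (\<forall>i\<in>{Suc t + 1..<j}. P i = P' i) \<and> letter_key (P j) < letter_key (P' j))"
        using IH(5)[of P'] eq by blast
      then show ?thesis
      proof (elim disjE)
        assume "\<forall>j\<in>{Suc t + 1..T}. P j = P' j"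
        moreover have "{t + 1..T} = insert (t + 1) {Suc t + 1..T}" using step.hyps by auto
        ultimately show ?thesis using eq by auto
      next
        assume "\<exists>j\<in>{Suc t + 1..T}. (\<forall>i\<in>{Suc t + 1..<j}. P i = P' i) \<and> letter_key (P j) < letter_key (P' j)"
        then obtain j where j: "j \<in> {Suc t + 1..T}" "\<forall>i\<in>{Suc t + 1..<j}. P i = P' i" "letter_key (P j) < letter_key (P' j)"
          by blast
        then have "\<forall>i\<in>{t + 1..<j}. P i = P' i" using eq ins[of j] by auto
        then show ?thesis using j by (intro disjI2 bexI[of _ j]) auto
      qed
    qed
  qed
  ultimately show ?case using D1(1) \<mu>'(2,3) by blast
qed

text \<open>For a path that is maximal under \<open>key_less\<close> among those with nonzero
  coefficient, no other path of the relation contributes to its leading state.\<close>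

lemma fermion_words_independent:
  assumes k: "k > 0" "r \<le> k" and Q: "finite Q" "Q \<subseteq> paths k r l"
    and T: "even T" "\<And>P j. P \<in> Q \<Longrightarrow> j > T \<Longrightarrow> P j = ground_path k r l j"
    and zero: "(\<Sum>P\<in>Q. fsc (c P) (fermion_word k (l - int k) (map P [1..<T + 1]) (basis (ray (int k * int T - int r))))) = 0"
    and P: "P \<in> Q"
  shows "c P = 0"
proof (rule ccontr)
  assume "c P \<noteq> 0"
  let ?w = "\<lambda>P. fermion_word k (l - int k) (map P [1..<T + 1]) (basis (ray (int k * int T - int r)))"
  let ?S = "{P \<in> Q. c P \<noteq> 0}"
  have "\<exists>M\<in>?S. \<forall>P'\<in>?S. P' \<noteq> M \<longrightarrow> \<not> key_less M P'"
  proof (rule Finite_Set.bex_max_element)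
    show "finite ?S" using Q by simp
    show "?S \<noteq> {}" using P \<open>c P \<noteq> 0\<close> by auto
    show "transp_on ?S key_less" using key_less_transp by (rule transp_on_subset) simp
    show "asymp_on ?S key_less"
    proof (rule asymp_onI)
      fix P P' assume "key_less P P'"
      then show "\<not> key_less P' P"
        using transpD[OF key_less_transp, of P P' P] key_less_irrefl[of P] by blast
    qed
  qed
  then obtain M where M: "M \<in> Q" "c M \<noteq> 0" "\<And>P'. P' \<in> Q \<Longrightarrow> c P' \<noteq> 0 \<Longrightarrow> P' \<noteq> M \<Longrightarrow> \<not> key_less M P'"
    by blast
  have "M \<in> paths k r l" using M(1) Q(2) by blast
  have "M (T + 1) = ground_path k r l (T + 1)" by (rule T(2)[OF M(1)]) simp
  from path_dual_state[OF k \<open>M \<in> paths k r l\<close> T(1) this, of 0]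
  obtain D where D: "?w M D \<noteq> 0" "\<And>P'. ?w P' D \<noteq> 0 \<Longrightarrow> (\<forall>j\<in>{1..T}. M j = P' j) \<or>
      (\<exists>j\<in>{1..T}. (\<forall>i\<in>{1..<j}. M i = P' i) \<and> letter_key (M j) < letter_key (P' j))"
    by (simp only: add_0 le0 simp_thms) blast
  have "c P' * ?w P' D = 0" if "P' \<in> Q - {M}" for P'
  proof (rule ccontr)
    assume "c P' * ?w P' D \<noteq> 0"
    then have nz: "c P' \<noteq> 0" "?w P' D \<noteq> 0" by auto
    have "\<not> key_less M P'" using M(3) nz that by auto
    then have low: "\<forall>j\<in>{1..T}. M j = P' j" using D(2)[OF nz(2)] unfolding key_less_def by auto
    have "P' \<in> Q" using that by simp
    then have high: "M j = P' j" if "j > T" for j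
      by (simp only: T(2)[OF M(1) that] T(2)[OF \<open>P' \<in> Q\<close> that])
    have extensional: "M \<in> {1..} \<rightarrow>\<^sub>E {0..k} \<times> UNIV" if "M \<in> paths k r l" for M
      using that unfolding paths_def mem_Collect_eq by (rule conjunct1)
    \<comment> \<open>Index 0 lies outside the domain of paths, and extensionality fixes the value
      there.\<close>
    have at0: "M 0 = P' 0"
      using PiE_arb[OF extensional[OF \<open>M \<in> paths k r l\<close>], of 0] PiE_arb[OF extensional[OF subsetD[OF Q(2) \<open>P' \<in> Q\<close>]], of 0]
      by simp
    have eqj: "M j = P' j" for j
    proof -
      consider "j = 0" | "j \<in> {1..T}" | "j > T" by fastforce
      then show ?thesis
      proof cases
        case 1 then show ?thesis using at0 by simp
      next
        case 2 then show ?thesis using low by blast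
      next
        case 3 then show ?thesis by (rule high)
      qed
    qed
    have "P' = M" by (rule ext) (rule eqj[symmetric])
    then show False using that by simp
  qed
  then have "(\<Sum>P'\<in>Q - {M}. c P' * ?w P' D) = 0" by (intro sum.neutral ballI)
  then have "(\<Sum>P'\<in>Q. c P' * ?w P' D) = c M * ?w M D"
    using sum.remove[OF Q(1) M(1), of "\<lambda>P'. c P' * ?w P' D"] by (simp only: add_0_right)
  moreover have "(\<Sum>P'\<in>Q. c P' * ?w P' D) = 0"
    using fun_cong[OF zero, of D] by (simp only: sum_apply fsc_apply zero_fun_apply)
  ultimately show False using M(2) D(1) by simp
qed

section \<open>Eigenvectors in highest weight modules\<close>

lemma linear_map_onD:
  assumes "linear_map_on sv S sw S' f"
  shows "x \<in> S \<Longrightarrow> f x \<in> S'" "x \<in> S \<Longrightarrow> y \<in> S \<Longrightarrow> f (x + y) = f x + f y"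
    "x \<in> S \<Longrightarrow> f (sv c x) = sw c (f x)"
  using assms by (auto simp: linear_map_on_def)

locale endomorphism = vector_space scale
  for scale :: "complex \<Rightarrow> 'v::ab_group_add \<Rightarrow> 'v" (infixr "*s" 75) +
  fixes S :: "'v set" and D :: "'v \<Rightarrow> 'v"
  assumes subspace_S: "subspace S" and linear_D: "linear_map_on scale S scale S D"
begin

lemmas D_simps = linear_map_onD[OF linear_D]

lemma S_closed:
  "0 \<in> S" "x \<in> S \<Longrightarrow> y \<in> S \<Longrightarrow> x + y \<in> S" "x \<in> S \<Longrightarrow> c *s x \<in> S" "x \<in> S \<Longrightarrow> y \<in> S \<Longrightarrow> x - y \<in> S"
  using subspace_S by (auto simp: subspace_0 subspace_add subspace_scale subspace_diff)

lemma D_zero [simp]: "D 0 = 0"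
  using D_simps(3)[of 0 0] S_closed(1) by simp

definition shifted :: "complex list \<Rightarrow> 'v \<Rightarrow> 'v"
  where "shifted \<mu>s x = foldr (\<lambda>\<mu> y. D y - \<mu> *s y) \<mu>s x"

lemma shifted_simps [simp]:
  "shifted [] x = x" "shifted (\<mu> # \<mu>s) x = D (shifted \<mu>s x) - \<mu> *s shifted \<mu>s x"
  "shifted (\<mu>s @ \<nu>s) x = shifted \<mu>s (shifted \<nu>s x)"
  by (simp_all add: shifted_def)

lemma shifted_closed: "x \<in> S \<Longrightarrow> shifted \<mu>s x \<in> S"
  by (induction \<mu>s) (auto intro: S_closed D_simps)

lemma D_diff: "x \<in> S \<Longrightarrow> y \<in> S \<Longrightarrow> D (x - y) = D x - D y"
  using D_simps(2)[of x "(- 1) *s y"] D_simps(3)[of y "- 1"] S_closed(3)[of y "- 1"] by simp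

lemma shifted_add: "x \<in> S \<Longrightarrow> y \<in> S \<Longrightarrow> shifted \<mu>s (x + y) = shifted \<mu>s x + shifted \<mu>s y"
  by (induction \<mu>s) (auto simp: D_simps shifted_closed scale_right_distrib)

lemma shifted_scale: "x \<in> S \<Longrightarrow> shifted \<mu>s (c *s x) = c *s shifted \<mu>s x"
  by (induction \<mu>s) (auto simp: D_simps shifted_closed scale_right_diff_distrib mult.commute)

lemma shifted_zero [simp]: "shifted \<mu>s 0 = 0"
  by (induction \<mu>s) auto

lemma shifted_single_commute: "x \<in> S \<Longrightarrow> shifted \<mu>s (D x - \<nu> *s x) = D (shifted \<mu>s x) - \<nu> *s shifted \<mu>s x"
proof (induction \<mu>s)
  case (Cons \<mu> \<mu>s)
  let ?z = "shifted \<mu>s x"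
  have "?z \<in> S" using Cons.prems by (rule shifted_closed)
  then have "D (D ?z - \<nu> *s ?z) - \<mu> *s (D ?z - \<nu> *s ?z) = D (D ?z - \<mu> *s ?z) - \<nu> *s (D ?z - \<mu> *s ?z)"
    by (simp add: D_diff D_simps S_closed scale_right_diff_distrib mult.commute algebra_simps)
  then show ?case by (simp only: shifted_simps Cons.IH[OF Cons.prems])
qed simp

lemma shifted_commute: "x \<in> S \<Longrightarrow> shifted \<mu>s (shifted \<nu>s x) = shifted \<nu>s (shifted \<mu>s x)"
  by (induction \<nu>s) (auto simp: shifted_single_commute shifted_closed)

text \<open>This replaces a decomposition into eigenvectors: a product of factors
  \<open>D - \<mu>\<close> with \<mu> in \<Lambda>, repetitions allowed, kills x. The condition
  passes through sums because such products commute.\<close>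

definition spectral :: "complex set \<Rightarrow> 'v \<Rightarrow> bool"
  where "spectral \<Lambda> x \<longleftrightarrow> x \<in> S \<and> (\<exists>\<mu>s. set \<mu>s \<subseteq> \<Lambda> \<and> shifted \<mu>s x = 0)"

lemma spectral_zero: "spectral \<Lambda> 0"
  by (auto simp: spectral_def S_closed intro: exI[of _ "[]"])

lemma spectral_add:
  assumes "spectral \<Lambda> x" "spectral \<Lambda> y" shows "spectral \<Lambda> (x + y)"
proof -
  obtain \<mu>s \<nu>s where *: "x \<in> S" "y \<in> S" "set \<mu>s \<subseteq> \<Lambda>" "set \<nu>s \<subseteq> \<Lambda>" "shifted \<mu>s x = 0" "shifted \<nu>s y = 0"
    using assms by (auto simp: spectral_def)
  then have "shifted (\<mu>s @ \<nu>s) (x + y) = 0"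
    using shifted_commute[of x \<mu>s \<nu>s] by (simp add: shifted_add shifted_closed)
  then show ?thesis using * by (auto simp: spectral_def S_closed intro!: exI[of _ "\<mu>s @ \<nu>s"])
qed

lemma spectral_scale: "spectral \<Lambda> x \<Longrightarrow> spectral \<Lambda> (c *s x)"
  by (auto simp: spectral_def S_closed shifted_scale)

lemma spectral_mono: "spectral \<Lambda> x \<Longrightarrow> \<Lambda> \<subseteq> \<Lambda>' \<Longrightarrow> spectral \<Lambda>' x"
  unfolding spectral_def by blast

lemma spectral_eigenvector: "x \<in> S \<Longrightarrow> D x = \<mu> *s x \<Longrightarrow> \<mu> \<in> \<Lambda> \<Longrightarrow> spectral \<Lambda> x"
  by (auto simp: spectral_def intro: exI[of _ "[\<mu>]"])

text \<open>Adding \<delta> to every root of a product that kills x gives a product that kills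
  \<open>Y x\<close>.\<close>

lemma spectral_shift:
  assumes Y: "linear_map_on scale S scale S Y" and comm: "\<And>u. u \<in> S \<Longrightarrow> D (Y u) = Y (D u) + \<delta> *s Y u"
    and x: "spectral \<Lambda> x" and \<Lambda>: "\<And>\<mu>. \<mu> \<in> \<Lambda> \<Longrightarrow> \<mu> + \<delta> \<in> \<Lambda>'"
  shows "spectral \<Lambda>' (Y x)"
proof -
  note Y = linear_map_onD[OF Y]
  have Yd: "Y (u - w) = Y u - Y w" if "u \<in> S" "w \<in> S" for u w
    using Y(2)[of u "(- 1) *s w"] Y(3)[of w "- 1"] S_closed(3)[of w "- 1"] that by simp
  have Y0: "Y 0 = 0" using Y(3)[of 0 0] S_closed(1) by simp
  have "shifted (map (\<lambda>\<mu>. \<mu> + \<delta>) \<mu>s) (Y u) = Y (shifted \<mu>s u)" if "u \<in> S" for \<mu>s u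
    using that
    by (induction \<mu>s) (auto simp: comm Yd Y shifted_closed D_simps S_closed scale_left_distrib)
  then show ?thesis
    using x \<Lambda> unfolding spectral_def by (force simp: Y Y0 image_subset_iff intro: exI[of _ "map (\<lambda>\<mu>. \<mu> + \<delta>) _"])
qed

text \<open>On an eigenvector the annihilating product acts by the product of the differences
  \<open>\<mu> - \<nu>\<close>, which is nonzero.\<close>

lemma spectral_eigenvector_zero:
  assumes "spectral \<Lambda> x" "D x = \<mu> *s x" "\<mu> \<notin> \<Lambda>"
  shows "x = 0"
proof -
  obtain \<mu>s where x: "x \<in> S" and \<mu>s: "set \<mu>s \<subseteq> \<Lambda>" "shifted \<mu>s x = 0" using assms(1) by (auto simp: spectral_def)
  have "shifted \<mu>s x = (\<Prod>\<nu>\<leftarrow>\<mu>s. \<mu> - \<nu>) *s x"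
    using x by (induction \<mu>s) (auto simp: D_simps assms(2) algebra_simps scale_left_diff_distrib)
  moreover have "(\<Prod>\<nu>\<leftarrow>\<mu>s. \<mu> - \<nu>) \<noteq> 0" using \<mu>s(1) assms(3) by (auto simp: prod_list_zero_iff)
  ultimately show ?thesis using \<mu>s(2) by simp
qed

end

section \<open>Gradings of the highest weight modules\<close>

definition affine_lowering :: "affine_sl2 set"
  where "affine_lowering = {Loop X i |X i. i < 0 \<or> i = 0 \<and> X = F}"

context integrable_highest_weight_module
begin

lemmas action_simps = linear_map_onD[OF action_linear]

lemma carrier_closed:
  "0 \<in> S" "x \<in> S \<Longrightarrow> y \<in> S \<Longrightarrow> x + y \<in> S" "x \<in> S \<Longrightarrow> c *s x \<in> S" "x \<in> S \<Longrightarrow> y \<in> S \<Longrightarrow> x - y \<in> S"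
  using subspace_carrier by (auto simp: subspace_0 subspace_add subspace_scale subspace_diff)

lemma action_zero [simp]: "\<rho> x 0 = 0"
  using action_simps(3)[of 0 x 0] carrier_closed(1) by simp

lemma gen_carrier: "gen scale \<rho> L {vac} \<subseteq> S"
proof
  fix u assume "u \<in> gen scale \<rho> L {vac}"
  then show "u \<in> S"
    by induction (auto intro: carrier_closed action_simps vac_carrier)
qed

text \<open>The span of the lowering words is stable under every letter, so \<open>generated\<close>
  makes it the whole module.\<close>

lemma gen_lowering: "gen scale \<rho> affine_lowering {vac} = S"
proof (rule generated)
  let ?G = "gen scale \<rho> affine_lowering {vac}"
  show sub: "?G \<subseteq> S" by (rule gen_carrier)
  show "subspace ?G" by (auto intro: subspaceI gen.intros)
  show "vac \<in> ?G" by (auto intro: gen.intros)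
  fix x u assume u: "u \<in> ?G"
  show "\<rho> x u \<in> ?G"
  proof (rule gen_lowering_closed[where K = UNIV])
    show "\<rho> x b \<in> ?G" if "x \<notin> affine_lowering" "b \<in> {vac}" for x b
    proof (cases x)
      case (Loop X i)
      then have "i \<ge> 1 \<or> i = 0 \<and> X \<noteq> F" using that by (auto simp: affine_lowering_def)
      then show ?thesis using that Loop vac_E[of i] vac_H[of i] vac_F[of i] vac_H0
        by (cases X) (auto simp: gen.gen_zero gen.gen_scale gen.gen_base)
    qed (use that level[OF vac_carrier] vac_d in \<open>auto simp: gen.gen_zero gen.gen_scale gen.gen_base\<close>)
    show "\<rho> x (\<rho> y u) - \<rho> y (\<rho> x u) \<in> ?G" if "u \<in> ?G" "\<And>z. z \<in> UNIV \<Longrightarrow> \<rho> z u \<in> ?G" for x y u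
    proof -
      have "\<rho> x (\<rho> y u) - \<rho> y (\<rho> x u) = (\<Sum>(c, z)\<leftarrow>affine_bracket x y. c *s \<rho> z u)"
        using sub that by (intro action_bracket) auto
      then show ?thesis using that by (auto intro!: gen_sum_list gen.gen_scale)
    qed
    show "\<rho> x (u + w) = \<rho> x u + \<rho> x w" if "u \<in> ?G" "w \<in> ?G" for x u w
      using sub that by (intro action_simps) blast+
    show "\<rho> x (c *s u) = c *s \<rho> x u" if "u \<in> ?G" for x c u
      using sub that by (intro action_simps) blast
  qed (use u in simp_all)
qed

lemma lowering_induct [consumes 1, case_names vac zero add scale step]:
  assumes "u \<in> S" "P vac" "P 0" "\<And>u w. u \<in> S \<Longrightarrow> w \<in> S \<Longrightarrow> P u \<Longrightarrow> P w \<Longrightarrow> P (u + w)"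
    "\<And>u c. u \<in> S \<Longrightarrow> P u \<Longrightarrow> P (c *s u)"
    "\<And>X i u. i < 0 \<or> i = 0 \<and> X = F \<Longrightarrow> u \<in> S \<Longrightarrow> P u \<Longrightarrow> P (\<rho> (Loop X i) u)"
  shows "P u"
proof -
  from assms(1) have "u \<in> gen scale \<rho> affine_lowering {vac}" by (simp add: gen_lowering)
  then show ?thesis
  proof induction
    case (gen_step x u)
    then show ?case using assms(6) gen_lowering by (auto simp: affine_lowering_def)
  qed (use assms gen_lowering in auto)
qed

lemma deriv_loop: "u \<in> S \<Longrightarrow> \<rho> Deriv (\<rho> (Loop X i) u) = \<rho> (Loop X i) (\<rho> Deriv u) + of_int i *s \<rho> (Loop X i) u"
  using action_bracket[of u Deriv "Loop X i"] by (simp add: algebra_simps)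

definition loop_weight :: "sl2 \<Rightarrow> int"
  where "loop_weight X = (case X of E \<Rightarrow> 2 | H \<Rightarrow> 0 | F \<Rightarrow> - 2)"

lemma H0_loop: "u \<in> S \<Longrightarrow>
  \<rho> (Loop H 0) (\<rho> (Loop X i) u) = \<rho> (Loop X i) (\<rho> (Loop H 0) u) + of_int (loop_weight X) *s \<rho> (Loop X i) u"
  using action_bracket[of u "Loop H 0" "Loop X i"]
  by (cases X) (auto simp: algebra_simps loop_weight_def)

sublocale deriv: endomorphism scale S "\<rho> Deriv"
  by unfold_locales (rule subspace_carrier action_linear)+

lemma deriv_spectral: "u \<in> S \<Longrightarrow> deriv.spectral {of_int n |n. n \<le> 0} u"
proof (induction u rule: lowering_induct)
  case vac
  show ?case by (rule deriv.spectral_eigenvector[of _ 0]) (auto simp: vac_carrier vac_d intro: exI[of _ 0])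
next
  case (step X i u)
  show ?case
  proof (rule deriv.spectral_shift[OF action_linear deriv_loop step(3)])
    fix \<mu> :: complex assume "\<mu> \<in> {of_int n |n. n \<le> 0}"
    then obtain n where "\<mu> = of_int n" "n \<le> 0" by auto
    then show "\<mu> + of_int i \<in> {of_int n |n. n \<le> 0}" using step(1) by (auto intro!: exI[of _ "n + i"])
  qed
qed (auto intro: deriv.spectral_zero deriv.spectral_add deriv.spectral_scale)

text \<open>Used to kill the vertex operator modes of positive index on highest weight
  vectors.\<close>

lemma deriv_positive:
  assumes "u \<in> S" "\<rho> Deriv u = of_int n *s u" "n > 0" shows "u = 0"
  by (rule deriv.spectral_eigenvector_zero[OF deriv_spectral[OF assms(1)] assms(2)]) (use assms(3) in auto)

text \<open>Any factor above 2 in front of d makes every lowering letter strictly decrease the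
  grading: E_i with i < 0 changes it by at most -3 + 2, and F_0 changes it by -2.\<close>

definition grading :: "'v \<Rightarrow> 'v"
  where "grading u = 3 *s \<rho> Deriv u + \<rho> (Loop H 0) u"

sublocale graded: endomorphism scale S grading
proof
  show "subspace S" by (rule subspace_carrier)
  show "linear_map_on scale S scale S grading"
    by (auto simp: linear_map_on_def grading_def action_simps carrier_closed scale_right_distrib mult.commute algebra_simps)
qed

lemma grading_loop:
  assumes "u \<in> S"
  shows "grading (\<rho> (Loop X i) u) = \<rho> (Loop X i) (grading u) + of_int (3 * i + loop_weight X) *s \<rho> (Loop X i) u"
  using assms
  by (simp add: grading_def deriv_loop H0_loop action_simps carrier_closed scale_right_distrib scale_left_distrib algebra_simps)

lemma grading_vac: "grading vac = of_int (int j) *s vac"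
  by (simp add: grading_def vac_d vac_H0)

lemma grading_step:
  assumes "i < 0 \<or> i = 0 \<and> X = F" "graded.spectral {of_int n |n. n \<le> int j} u"
  shows "graded.spectral {of_int n |n. n < int j} (\<rho> (Loop X i) u)"
proof (rule graded.spectral_shift[OF action_linear grading_loop assms(2)])
  fix \<mu> :: complex assume "\<mu> \<in> {of_int n |n. n \<le> int j}"
  then obtain n where n: "\<mu> = of_int n" "n \<le> int j" by auto
  have "3 * i + loop_weight X < 0" using assms(1) by (cases X) (auto simp: loop_weight_def)
  then show "\<mu> + of_int (3 * i + loop_weight X) \<in> {of_int n |n. n < int j}"
    using n by (intro CollectI exI[of _ "n + (3 * i + loop_weight X)"]) simp
qed

lemma grading_spectral: "u \<in> S \<Longrightarrow> graded.spectral {of_int n |n. n \<le> int j} u"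
proof (induction u rule: lowering_induct)
  case vac
  show ?case by (rule graded.spectral_eigenvector[OF vac_carrier grading_vac]) blast
next
  case (step X i u)
  show ?case by (rule graded.spectral_mono[OF grading_step[OF step(1,3)]]) auto
qed (auto intro: graded.spectral_zero graded.spectral_add graded.spectral_scale)

lemma vac_component: "u \<in> S \<Longrightarrow> \<exists>c w. u = c *s vac + w \<and> graded.spectral {of_int n |n. n < int j} w"
proof (induction u rule: lowering_induct)
  case vac
  show ?case by (rule exI[of _ 1], rule exI[of _ 0]) (simp add: graded.spectral_zero)
next
  case zero
  show ?case by (rule exI[of _ 0], rule exI[of _ 0]) (simp add: graded.spectral_zero)
next
  case (add u w)
  then obtain c x c' x' where "u = c *s vac + x" "w = c' *s vac + x'"
    "graded.spectral {of_int n |n. n < int j} x" "graded.spectral {of_int n |n. n < int j} x'" by blast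
  then show ?case
    by (intro exI[of _ "c + c'"] exI[of _ "x + x'"]) (auto simp: scale_left_distrib algebra_simps graded.spectral_add)
next
  case (scale u a)
  then obtain c x where "u = c *s vac + x" "graded.spectral {of_int n |n. n < int j} x" by blast
  then show ?case
    by (intro exI[of _ "a * c"] exI[of _ "a *s x"]) (auto simp: scale_right_distrib graded.spectral_scale)
next
  case (step X i u)
  show ?case
    by (rule exI[of _ 0], rule exI[of _ "\<rho> (Loop X i) u"]) (simp add: grading_step[OF step(1) grading_spectral[OF step(2)]])
qed

text \<open>Modulo the vacuum line all grading eigenvalues are below j, while u has eigenvalue j; so
  the remainder is an eigenvector for a value outside its spectrum and vanishes.\<close>

lemma top_vector:
  assumes "u \<in> S" "\<rho> Deriv u = 0" "\<rho> (Loop H 0) u = of_nat j *s u"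
  shows "\<exists>c. u = c *s vac"
proof -
  obtain c w where w: "u = c *s vac + w" "graded.spectral {of_int n |n. n < int j} w"
    using vac_component[OF assms(1)] by blast
  have wS: "w \<in> S" using w(2) by (simp add: graded.spectral_def)
  have "grading u = of_int (int j) *s u" by (simp add: grading_def assms)
  then have "c *s (of_int (int j) *s vac) + grading w = of_int (int j) *s (c *s vac + w)"
    using wS by (simp only: w(1) graded.D_simps vac_carrier carrier_closed grading_vac)
  then have "grading w = of_int (int j) *s w" by (simp add: scale_right_distrib mult.commute)
  moreover have "of_int (int j) \<notin> {of_int n :: complex |n. n < int j}"
    by (auto simp only: mem_Collect_eq of_int_eq_iff)
  ultimately have "w = 0" by (rule graded.spectral_eigenvector_zero[OF w(2)])
  then show ?thesis using w(1) by auto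
qed

end

context dual_vacuum
begin

lemmas bra_simps = linear_map_onD[OF bra_linear]

lemma bra_lowering: "u \<in> S \<Longrightarrow> i < 0 \<or> i = 0 \<and> X = F \<Longrightarrow> bra (\<rho> (Loop X i) u) = 0"
  by (cases X) (auto intro: bra_E bra_H bra_F)

lemma bra_zero [simp]: "bra 0 = 0"
  using bra_simps(3)[of 0 0] carrier_closed(1) by simp

lemma bra_H0: "u \<in> S \<Longrightarrow> bra (\<rho> (Loop H 0) u) = of_nat j * bra u"
proof (induction u rule: lowering_induct)
  case (step X i u)
  then show ?case using bra_lowering[OF _ step(1)] by (simp add: H0_loop bra_simps action_simps carrier_closed)
qed (auto simp: vac_H0 action_simps bra_simps vac_carrier algebra_simps)

end

section \<open>The Fock functional\<close>

context fock_module
begin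

lemmas a_simps = linear_map_onD[OF a_linear]

lemma carrier_closed:
  "0 \<in> S" "x \<in> S \<Longrightarrow> y \<in> S \<Longrightarrow> x + y \<in> S" "x \<in> S \<Longrightarrow> c *s x \<in> S" "x \<in> S \<Longrightarrow> y \<in> S \<Longrightarrow> x - y \<in> S"
  using subspace_carrier by (auto simp: subspace_0 subspace_add subspace_scale subspace_diff)

lemma gen_lowering: "gen scale a {..<0} {v} = S"
proof -
  let ?G = "gen scale a {..<0} {v}"
  have sub: "?G \<subseteq> S"
  proof
    fix u assume "u \<in> ?G"
    then show "u \<in> S" by induction (auto intro: carrier_closed a_simps v_carrier)
  qed
  have "?G = {0} \<or> ?G = S"
  proof (rule irreducible[OF sub])
    show "subspace ?G" by (auto intro: subspaceI gen.intros)
    fix i u assume u: "u \<in> ?G"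
    show "a i u \<in> ?G"
    proof (rule gen_lowering_closed[where K = UNIV])
      show "a i b \<in> ?G" if "i \<notin> {..<0}" "b \<in> {v}" for i b
      proof (cases "i = 0")
        case True
        then show ?thesis using that by (auto simp: v_charge intro: gen.intros)
      next
        case False
        then show ?thesis using that v_annihilated[of i] by (auto intro: gen.intros)
      qed
      show "a i (a i' u) - a i' (a i u) \<in> ?G" if "u \<in> ?G" for i i' u
      proof -
        have "u \<in> S" using that sub by blast
        show ?thesis unfolding heisenberg[OF \<open>u \<in> S\<close>] using that by (simp add: gen.gen_scale gen.gen_zero)
      qed
      show "a i (u + w) = a i u + a i w" if "u \<in> ?G" "w \<in> ?G" for i u w
        using sub that by (intro a_simps) blast+
      show "a i (c *s u) = c *s a i u" if "u \<in> ?G" for i c u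
        using sub that by (intro a_simps) blast
    qed (use u in simp_all)
  qed
  moreover have "v \<in> ?G" by (auto intro: gen.intros)
  ultimately show ?thesis using v_nonzero by auto
qed

lemma lowering_induct [consumes 1, case_names vac zero add scale step]:
  assumes "u \<in> S" "P v" "P 0" "\<And>u w. u \<in> S \<Longrightarrow> w \<in> S \<Longrightarrow> P u \<Longrightarrow> P w \<Longrightarrow> P (u + w)"
    "\<And>u c. u \<in> S \<Longrightarrow> P u \<Longrightarrow> P (c *s u)"
    "\<And>i u. i < 0 \<Longrightarrow> u \<in> S \<Longrightarrow> P u \<Longrightarrow> P (a i u)"
  shows "P u"
proof -
  from assms(1) have "u \<in> gen scale a {..<0} {v}" by (simp add: gen_lowering)
  then show ?thesis
  proof induction
    case (gen_step x u)
    then show ?case using assms(6) gen_lowering by auto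
  qed (use assms gen_lowering in auto)
qed

text \<open>A truncation of the number operator, whose full sum is not a finite expression in the
  modes. A statement about a fixed vector is made for all sufficiently large M, as in
  \<open>excited\<close>.\<close>

definition energy :: "nat \<Rightarrow> 'h \<Rightarrow> 'h"
  where "energy M u = (\<Sum>i\<in>{1..M}. a (- int i) (a (int i) u))"

lemma sum_closed: "(\<And>i. i \<in> I \<Longrightarrow> f i \<in> S) \<Longrightarrow> sum f I \<in> S"
  by (induction I rule: infinite_finite_induct) (auto intro: carrier_closed)

lemma energy_linear: "linear_map_on scale S scale S (energy M)"
  by (auto simp: linear_map_on_def energy_def a_simps sum.distrib scale_sum_right intro!: sum_closed sum.cong)

lemma energy_endomorphism: "endomorphism scale S (energy M)"
  by unfold_locales (rule subspace_carrier energy_linear)+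

lemma energy_lowering:
  assumes "u \<in> S" "1 \<le> i" "i \<le> M"
  shows "energy M (a (- int i) u) = a (- int i) (energy M u) + of_nat i *s a (- int i) u"
proof -
  have sum: "a l (sum f I) = (\<Sum>m\<in>I. a l (f m))" if "\<And>m. f m \<in> S" for l f and I :: "nat set"
    using that by (induction I rule: infinite_finite_induct)
      (auto simp: a_simps sum_closed intro: linear_map_onD(3)[OF a_linear, of 0 l 0, simplified] carrier_closed)
  have comm: "a l (a m u) = a m (a l u) + (if l + m = 0 then of_int l *s u else 0)" if "u \<in> S" for l m u
    using heisenberg[OF that, of l m] by (simp add: diff_eq_eq add.commute)
  have a0: "a l 0 = 0" for l using a_simps(3)[of 0 l 0] carrier_closed(1) by simp
  have trm: "a (- int m) (a (int m) (a (- int i) u)) = a (- int i) (a (- int m) (a (int m) u)) +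
    (if m = i then of_nat i *s a (- int i) u else 0)" if "m \<ge> 1" for m
  proof -
    have "a (int m) (a (- int i) u) = a (- int i) (a (int m) u) + (if m = i then of_nat i *s u else 0)"
      using comm[OF assms(1), of "int m" "- int i"] by auto
    then have "a (- int m) (a (int m) (a (- int i) u)) =
      a (- int m) (a (- int i) (a (int m) u)) + a (- int m) (if m = i then of_nat i *s u else 0)"
      using assms(1) by (auto simp: a_simps carrier_closed)
    also have "a (- int m) (a (- int i) (a (int m) u)) = a (- int i) (a (- int m) (a (int m) u))"
      using comm[of "a (int m) u" "- int m" "- int i"] assms(1,2) that by (simp add: a_simps)
    finally show ?thesis using assms(1) by (auto simp: a_simps a0)
  qed
  have "energy M (a (- int i) u) = (\<Sum>m\<in>{1..M}. a (- int i) (a (- int m) (a (int m) u)) +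
    (if m = i then of_nat i *s a (- int i) u else 0))"
    unfolding energy_def by (intro sum.cong refl trm) auto
  also have "\<dots> = (\<Sum>m\<in>{1..M}. a (- int i) (a (- int m) (a (int m) u))) + of_nat i *s a (- int i) u"
    using assms by (simp add: sum.distrib)
  also have "(\<Sum>m\<in>{1..M}. a (- int i) (a (- int m) (a (int m) u))) = a (- int i) (energy M u)"
    unfolding energy_def using assms(1) by (subst sum) (auto simp: a_simps)
  finally show ?thesis .
qed

lemma energy_v: "energy M v = 0"
proof -
  have a0: "a l 0 = 0" for l using a_simps(3)[of 0 l 0] carrier_closed(1) by simp
  show ?thesis unfolding energy_def by (intro sum.neutral) (auto simp: v_annihilated a0)
qed

definition excited :: "nat \<Rightarrow> 'h \<Rightarrow> bool"
  where "excited l u \<longleftrightarrow> u \<in> S \<and> (\<exists>M0. \<forall>M\<ge>M0. endomorphism.spectral scale S (energy M) {of_nat n |n. n \<ge> l} u)"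

lemma excited_zero: "excited l 0"
  unfolding excited_def using endomorphism.spectral_zero[OF energy_endomorphism] carrier_closed(1) by blast

lemma excited_add: "excited l u \<Longrightarrow> excited l w \<Longrightarrow> excited l (u + w)"
  unfolding excited_def
proof (elim conjE exE, intro conjI)
  fix M0 M1 assume "u \<in> S" "w \<in> S"
    "\<forall>M\<ge>M0. endomorphism.spectral scale S (energy M) {of_nat n |n. n \<ge> l} u"
    "\<forall>M\<ge>M1. endomorphism.spectral scale S (energy M) {of_nat n |n. n \<ge> l} w"
  then show "u + w \<in> S" "\<exists>M0. \<forall>M\<ge>M0. endomorphism.spectral scale S (energy M) {of_nat n |n. n \<ge> l} (u + w)"
    by (auto intro!: carrier_closed exI[of _ "max M0 M1"] endomorphism.spectral_add[OF energy_endomorphism])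
qed

lemma excited_scale: "excited l u \<Longrightarrow> excited l (c *s u)"
  unfolding excited_def using endomorphism.spectral_scale[OF energy_endomorphism] carrier_closed(3) by blast

lemma excited_step:
  assumes "excited l u" "i < 0" shows "excited (Suc l) (a i u)"
proof -
  define m where "m = nat (- i)"
  have m: "i = - int m" "m \<ge> 1" using assms(2) by (auto simp: m_def)
  obtain M0 where M0: "u \<in> S" "\<And>M. M \<ge> M0 \<Longrightarrow> endomorphism.spectral scale S (energy M) {of_nat n |n. n \<ge> l} u"
    using assms(1) by (auto simp: excited_def)
  have "endomorphism.spectral scale S (energy M) {of_nat n |n. n \<ge> Suc l} (a i u)" if "M \<ge> max M0 m" for M
  proof (rule endomorphism.spectral_shift[OF energy_endomorphism, where Y = "a i" and \<delta> = "of_nat m" and \<Lambda> = "{of_nat n |n. n \<ge> l}"])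
    show "linear_map_on scale S scale S (a i)" by (rule a_linear)
    show "energy M (a i u) = a i (energy M u) + of_nat m *s a i u" if "u \<in> S" for u
      unfolding m(1) using that m(2) \<open>M \<ge> max M0 m\<close> by (intro energy_lowering) auto
    show "endomorphism.spectral scale S (energy M) {of_nat n |n. n \<ge> l} u" using M0(2) that by simp
    fix \<mu> :: complex assume "\<mu> \<in> {of_nat n |n. n \<ge> l}"
    then obtain n where "\<mu> = of_nat n" "n \<ge> l" by auto
    then show "\<mu> + of_nat m \<in> {of_nat n |n. n \<ge> Suc l}" using m(2) by (auto intro!: exI[of _ "n + m"])
  qed
  then have "\<exists>M1. \<forall>M\<ge>M1. endomorphism.spectral scale S (energy M) {of_nat n |n. n \<ge> Suc l} (a i u)"
    by (intro exI[of _ "max M0 m"]) blast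
  then show ?thesis using a_simps(1)[OF M0(1)] unfolding excited_def by blast
qed

lemma excited_0: "u \<in> S \<Longrightarrow> excited 0 u"
proof (induction u rule: lowering_induct)
  case vac
  have "endomorphism.spectral scale S (energy M) {of_nat n |n. n \<ge> 0} v" for M
    by (rule endomorphism.spectral_eigenvector[OF energy_endomorphism v_carrier, of _ 0])
      (auto simp: energy_v intro: exI[of _ 0])
  then show ?case using v_carrier by (auto simp: excited_def)
next
  case (step i u)
  then have "excited 1 (a i u)" using excited_step[of 0 u i] by simp
  moreover have "{of_nat n |n. n \<ge> 1} \<subseteq> {of_nat n :: complex |n. n \<ge> 0}" by auto
  ultimately show ?case
    unfolding excited_def using endomorphism.spectral_mono[OF energy_endomorphism] by blast
qed (auto intro: excited_zero excited_add excited_scale)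

lemma excited_v: "excited 1 (c *s v) \<Longrightarrow> c = 0"
proof (rule ccontr)
  assume e: "excited 1 (c *s v)" and c: "c \<noteq> 0"
  obtain M where "endomorphism.spectral scale S (energy M) {of_nat n |n. n \<ge> 1} (c *s v)"
    using e unfolding excited_def by blast
  moreover have "energy M (c *s v) = 0 *s (c *s v)"
    using linear_map_onD(3)[OF energy_linear v_carrier, of M c] by (simp add: energy_v)
  ultimately have "c *s v = 0"
    by (rule endomorphism.spectral_eigenvector_zero[OF energy_endomorphism]) auto
  then show False using c v_nonzero by simp
qed

lemma vacuum_component: "u \<in> S \<Longrightarrow> \<exists>c w. u = c *s v + w \<and> excited 1 w"
proof (induction u rule: lowering_induct)
  case vac
  show ?case by (rule exI[of _ 1], rule exI[of _ 0]) (simp add: excited_zero)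
next
  case zero
  show ?case by (rule exI[of _ 0], rule exI[of _ 0]) (simp add: excited_zero)
next
  case (add u w)
  then obtain c x c' x' where "u = c *s v + x" "w = c' *s v + x'" "excited 1 x" "excited 1 x'" by blast
  then show ?case
    by (intro exI[of _ "c + c'"] exI[of _ "x + x'"]) (auto simp: scale_left_distrib algebra_simps excited_add)
next
  case (scale u b)
  then obtain c x where "u = c *s v + x" "excited 1 x" by blast
  then show ?case
    by (intro exI[of _ "b * c"] exI[of _ "b *s x"]) (auto simp: scale_right_distrib excited_scale)
next
  case (step i u)
  have "excited 1 (a i u)" using excited_step[OF excited_0[OF step(2)] step(1)] by simp
  then show ?case by (intro exI[of _ 0] exI[of _ "a i u"]) simp
qed

text \<open>The counterpart of \<open>bra\<close> on the Fock side. It is well defined because a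
  multiple of v that is excited must be zero.\<close>

definition vacuum_functional :: "'h \<Rightarrow> complex"
  where "vacuum_functional u = (THE c. \<exists>w. u = c *s v + w \<and> excited 1 w)"

lemma vacuum_functional_eq:
  assumes "u = c *s v + w" "excited 1 w" shows "vacuum_functional u = c"
  unfolding vacuum_functional_def
proof (rule the_equality)
  show "\<exists>w. u = c *s v + w \<and> excited 1 w" using assms by blast
  fix c' assume "\<exists>w. u = c' *s v + w \<and> excited 1 w"
  then obtain w' where w': "u = c' *s v + w'" "excited 1 w'" by blast
  have "(c' - c) *s v = w + (- 1) *s w'"
    using assms(1) w'(1) by (simp add: scale_left_diff_distrib algebra_simps)
  then have "excited 1 ((c' - c) *s v)" using assms(2) w'(2) excited_add[of 1 w "(- 1) *s w'"] excited_scale[of 1 w' "- 1"] by simp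
  then have "c' - c = 0" by (rule excited_v)
  then show "c' = c" by simp
qed

lemma vacuum_functional_simps:
  "vacuum_functional v = 1"
  "u \<in> S \<Longrightarrow> i < 0 \<Longrightarrow> vacuum_functional (a i u) = 0"
  "linear_map_on scale S (*) UNIV vacuum_functional"
proof -
  show "vacuum_functional v = 1" by (rule vacuum_functional_eq[of _ _ 0]) (simp_all add: excited_zero)
  show "vacuum_functional (a i u) = 0" if "u \<in> S" "i < 0"
    using excited_step[OF excited_0[OF that(1)] that(2)]
    by (intro vacuum_functional_eq[of _ _ "a i u"]) simp_all
  have add: "vacuum_functional (x + y) = vacuum_functional x + vacuum_functional y" if "x \<in> S" "y \<in> S" for x y
  proof -
    obtain c w where x: "x = c *s v + w" "excited 1 w" using vacuum_component[OF \<open>x \<in> S\<close>] by blast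
    obtain c' w' where y: "y = c' *s v + w'" "excited 1 w'" using vacuum_component[OF \<open>y \<in> S\<close>] by blast
    note * = x y
    have "vacuum_functional (x + y) = c + c'"
      by (rule vacuum_functional_eq[of _ _ "w + w'"]) (use * in \<open>auto simp: scale_left_distrib algebra_simps excited_add\<close>)
    then show ?thesis using * vacuum_functional_eq by simp
  qed
  have "vacuum_functional (b *s x) = b * vacuum_functional x" if "x \<in> S" for b x
  proof -
    obtain c w where *: "x = c *s v + w" "excited 1 w" using vacuum_component[OF \<open>x \<in> S\<close>] by blast
    have "vacuum_functional (b *s x) = b * c"
      by (rule vacuum_functional_eq[of _ _ "b *s w"]) (use * in \<open>auto simp: scale_right_distrib excited_scale\<close>)
    then show ?thesis using * vacuum_functional_eq by simp
  qed
  with add show "linear_map_on scale S (*) UNIV vacuum_functional" by (simp add: linear_map_on_def)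
qed

end

section \<open>Commutation relations of the bosonic vertex operator\<close>

locale op_series = vector_space scale
  for scale :: "complex \<Rightarrow> 'h::ab_group_add \<Rightarrow> 'h" (infixr "*s" 75) +
  fixes S :: "'h set" and A :: "nat \<Rightarrow> 'h \<Rightarrow> 'h"
  assumes subspace_S: "subspace S" and A_linear: "\<And>m. linear_map_on scale S scale S (A m)"
    and A_0: "\<And>u. A 0 u = 0"
begin

lemmas A_simps = linear_map_onD[OF A_linear]

lemma S_closed:
  "0 \<in> S" "x \<in> S \<Longrightarrow> y \<in> S \<Longrightarrow> x + y \<in> S" "x \<in> S \<Longrightarrow> c *s x \<in> S"
  using subspace_S by (auto simp: subspace_0 subspace_add subspace_scale)

lemma sum_closed: "(\<And>i. i \<in> I \<Longrightarrow> f i \<in> S) \<Longrightarrow> sum f I \<in> S"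
  by (induction I rule: infinite_finite_induct) (auto intro: S_closed)

lemma linear_zero: "linear_map_on scale S scale S f \<Longrightarrow> f 0 = 0"
  using linear_map_onD(3)[of scale S scale S f 0 0] S_closed(1) by simp

lemma linear_sum:
  assumes "linear_map_on scale S scale S f" "\<And>i. i \<in> I \<Longrightarrow> g i \<in> S"
  shows "f (sum g I) = (\<Sum>i\<in>I. f (g i))"
  using assms(2)
  by (induction I rule: infinite_finite_induct)
    (auto simp: linear_zero[OF assms(1)] linear_map_onD[OF assms(1)] sum_closed)

lemma pow_linear: "linear_map_on scale S scale S (op_pow A N s)"
proof (induction N arbitrary: s)
  case 0
  show ?case by (auto simp: linear_map_on_def S_closed)
next
  case (Suc N)
  note IH = linear_map_onD[OF Suc]
  show ?case
    by (auto simp: linear_map_on_def IH A_simps sum.distrib scale_sum_right intro!: sum_closed sum.cong)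
qed

lemmas pow_simps = linear_map_onD[OF pow_linear]

lemma pow_vanish: "u \<in> S \<Longrightarrow> s < N \<Longrightarrow> op_pow A N s u = 0"
proof (induction N arbitrary: s)
  case (Suc N)
  have "A m (op_pow A N (s - m) u) = 0" if "m \<le> s" for m
  proof (cases m)
    case 0
    then show ?thesis by (simp add: A_0)
  next
    case (Suc m')
    then have "op_pow A N (s - m) u = 0" using Suc.prems that \<open>m \<le> s\<close>
      by (intro Suc.IH) auto
    then show ?thesis using linear_zero[OF A_linear] by simp
  qed
  then show ?case by simp
qed simp

lemma exp_linear: "linear_map_on scale S scale S (op_exp scale A s)"
  by (auto simp: linear_map_on_def op_exp_def pow_simps scale_right_distrib sum.distrib scale_sum_right mult.commute
      intro!: sum_closed S_closed sum.cong)

lemma exp_0 [simp]: "op_exp scale A 0 u = u"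
  by (simp add: op_exp_def)

lemma exp_highest:
  assumes "u \<in> S" "\<And>m. m \<ge> 1 \<Longrightarrow> A m u = 0" "s > 0"
  shows "op_exp scale A s u = 0"
proof -
  have A: "A m u = 0" for m using assms(2)[of m] A_0 by (cases m) auto
  have "op_pow A N s u = (if N = 0 \<and> s = 0 then u else 0)" for N s
  proof (induction N arbitrary: s)
    case (Suc N)
    then show ?case using A linear_zero[OF A_linear] by (auto intro!: sum.neutral)
  qed simp
  then show ?thesis using assms(3) by (auto simp: op_exp_def intro!: sum.neutral)
qed

text \<open>D commutes with all coefficients except \<open>A i\<close>, where the commutator is the
  scalar \<kappa>; by the Leibniz rule one of the N factors is lost in N ways.\<close>

lemma pow_commute:
  assumes D: "linear_map_on scale S scale S D" and i: "i \<ge> 1"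
    and comm: "\<And>m u. u \<in> S \<Longrightarrow> D (A m u) = A m (D u) + (if m = i then \<kappa> *s u else 0)"
    and u: "u \<in> S"
  shows "D (op_pow A N s u) = op_pow A N s (D u) +
    (if i \<le> s then (of_nat N * \<kappa>) *s op_pow A (N - 1) (s - i) u else 0)"
proof (induction N arbitrary: s)
  case 0
  show ?case using linear_zero[OF D] by simp
next
  case (Suc N)
  have "D (op_pow A (Suc N) s u) = (\<Sum>m\<le>s. D (A m (op_pow A N (s - m) u)))"
    using u by (simp add: linear_sum[OF D] A_simps pow_simps)
  also have "\<dots> = (\<Sum>m\<le>s. A m (op_pow A N (s - m) (D u)) +
      (A m (if i \<le> s - m then (of_nat N * \<kappa>) *s op_pow A (N - 1) (s - m - i) u else 0) +
      (if m = i then \<kappa> *s op_pow A N (s - m) u else 0)))"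
    using u by (intro sum.cong refl)
      (auto simp: comm Suc pow_simps A_simps linear_map_onD[OF D] S_closed linear_zero[OF A_linear])
  also have "\<dots> = op_pow A (Suc N) s (D u) +
      ((\<Sum>m\<le>s. A m (if i \<le> s - m then (of_nat N * \<kappa>) *s op_pow A (N - 1) (s - m - i) u else 0)) +
      (\<Sum>m\<le>s. if m = i then \<kappa> *s op_pow A N (s - m) u else 0))"
    by (simp add: sum.distrib)
  also have "(\<Sum>m\<le>s. if m = i then \<kappa> *s op_pow A N (s - m) u else 0) =
      (if i \<le> s then \<kappa> *s op_pow A N (s - i) u else 0)"
    by (simp add: sum.delta)
  also have "(\<Sum>m\<le>s. A m (if i \<le> s - m then (of_nat N * \<kappa>) *s op_pow A (N - 1) (s - m - i) u else 0)) =
      (if i \<le> s then (of_nat N * \<kappa>) *s op_pow A N (s - i) u else 0)"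
  proof (cases "i \<le> s \<and> N \<ge> 1")
    case True
    then obtain N' where N: "N = Suc N'" by (cases N) auto
    have "(\<Sum>m\<le>s. A m (if i \<le> s - m then (of_nat N * \<kappa>) *s op_pow A (N - 1) (s - m - i) u else 0)) =
      (\<Sum>m\<le>s - i. (of_nat N * \<kappa>) *s A m (op_pow A N' (s - i - m) u))"
      using True u by (intro sum.mono_neutral_cong_right)
        (auto simp: N A_simps pow_simps linear_zero[OF A_linear] diff_right_commute algebra_simps simp del: of_nat_Suc)
    then show ?thesis using True by (simp add: N scale_sum_right)
  next
    case False
    then consider "N = 0" | "\<not> i \<le> s" by fastforce
    then show ?thesis by cases (auto simp: linear_zero[OF A_linear] intro!: sum.neutral)
  qed
  finally show ?case
    by (auto simp: scale_left_distrib algebra_simps)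
qed

text \<open>The factor N from \<open>pow_commute\<close> cancels against the factorial, so the
  commutator is \<kappa> times the exponential series shifted by i.\<close>

lemma exp_commute:
  assumes D: "linear_map_on scale S scale S D" and i: "i \<ge> 1"
    and comm: "\<And>m u. u \<in> S \<Longrightarrow> D (A m u) = A m (D u) + (if m = i then \<kappa> *s u else 0)"
    and u: "u \<in> S"
  shows "D (op_exp scale A s u) = op_exp scale A s (D u) + (if i \<le> s then \<kappa> *s op_exp scale A (s - i) u else 0)"
proof -
  have "D (op_exp scale A s u) = (\<Sum>N\<le>s. (1 / fact N) *s D (op_pow A N s u))"
    unfolding op_exp_def using u by (simp add: linear_sum[OF D] linear_map_onD[OF D] pow_simps S_closed)
  also have "\<dots> = (\<Sum>N\<le>s. (1 / fact N) *s op_pow A N s (D u)) +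
      (\<Sum>N\<le>s. if i \<le> s then ((1 / fact N) * (of_nat N * \<kappa>)) *s op_pow A (N - 1) (s - i) u else 0)"
    unfolding sum.distrib[symmetric]
    by (intro sum.cong refl) (simp add: pow_commute[OF D i comm u] scale_right_distrib)
  also have "(\<Sum>N\<le>s. if i \<le> s then ((1 / fact N) * (of_nat N * \<kappa>)) *s op_pow A (N - 1) (s - i) u else 0) =
      (if i \<le> s then \<kappa> *s op_exp scale A (s - i) u else 0)"
  proof (cases "i \<le> s")
    case True
    then obtain s' where s: "s = Suc s'" using i by (cases s) auto
    have "(\<Sum>N\<le>s. ((1 / fact N) * (of_nat N * \<kappa>)) *s op_pow A (N - 1) (s - i) u) =
      (\<Sum>N\<le>s'. ((1 / fact (Suc N)) * (of_nat (Suc N) * \<kappa>)) *s op_pow A N (s - i) u)"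
      unfolding s by (subst sum.atMost_Suc_shift) simp
    also have "\<dots> = (\<Sum>N\<le>s'. (\<kappa> * (1 / fact N)) *s op_pow A N (s - i) u)"
    proof (intro sum.cong refl)
      fix N
      have "(1 / fact (Suc N)) * (of_nat (Suc N) * \<kappa>) = \<kappa> * (1 / fact N :: complex)"
        by (simp add: field_simps del: of_nat_Suc)
      then show "((1 / fact (Suc N)) * (of_nat (Suc N) * \<kappa>)) *s op_pow A N (s - i) u =
        (\<kappa> * (1 / fact N)) *s op_pow A N (s - i) u" by simp
    qed
    \<comment> \<open>Powers beyond the degree vanish because the series has no constant
      term.\<close>
    also have "\<dots> = (\<Sum>N\<le>s - i. (\<kappa> * (1 / fact N)) *s op_pow A N (s - i) u)"
      using i True s u by (intro sum.mono_neutral_right) (auto simp: pow_vanish)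
    also have "\<dots> = \<kappa> *s op_exp scale A (s - i) u"
      by (simp add: op_exp_def scale_sum_right)
    finally show ?thesis using True by simp
  qed simp
  finally show ?thesis by (simp add: op_exp_def)
qed

end

section \<open>The exponentials of the bosonic vertex operator\<close>

context vertex_operators
begin

lemma H_closed:
  "0 \<in> \<H> q" "x \<in> \<H> q \<Longrightarrow> y \<in> \<H> q \<Longrightarrow> x + y \<in> \<H> q" "x \<in> \<H> q \<Longrightarrow> sh c x \<in> \<H> q"
  using fock_module.carrier_closed[OF fock] by auto

lemma vs_sh: "vector_space sh"
  using fock[of 0] by (simp add: fock_module_def)

lemmas a_simps = linear_map_onD[OF fock_module.a_linear[OF fock]]

lemma a_commute:
  "u \<in> \<H> q \<Longrightarrow> a q i (a q l u) = a q l (a q i u) + (if i + l = 0 then sh (of_int i) u else 0)"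
  using fock_module.heisenberg[OF fock, of u q i l] by (simp add: diff_eq_eq add.commute)

lemma coeff_linear: "linear_map_on sh (\<H> q) sh (\<H> q) (\<lambda>u. sh c (a q i u))"
proof -
  interpret vector_space sh by (rule vs_sh)
  show ?thesis
    by (auto simp: linear_map_on_def H_closed a_simps scale_right_distrib mult.commute)
qed

lemma zero_linear: "linear_map_on sh (\<H> q) sh (\<H> q) (\<lambda>u. 0)"
proof -
  interpret vector_space sh by (rule vs_sh)
  show ?thesis by (simp add: linear_map_on_def H_closed)
qed

lemma op_series_H:
  assumes "\<And>m. A m = (if m = 0 then (\<lambda>u. 0) else (\<lambda>u. sh (c m) (a q (f m) u)))"
  shows "op_series sh (\<H> q) A"
proof -
  interpret vector_space sh by (rule vs_sh)
  show ?thesis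
  proof
    show "subspace (\<H> q)" using fock_module.subspace_carrier[OF fock] .
    show "linear_map_on sh (\<H> q) sh (\<H> q) (A m)" for m
      unfolding assms by (simp add: zero_linear coeff_linear)
    show "A 0 u = 0" for u by (simp add: assms)
  qed
qed

lemma creation_series:
  "op_series sh (\<H> q) (\<lambda>m u. if m = 0 then 0 else sh (of_real (- p) / of_int (- int m)) (a q (- int m) u))"
  by (rule op_series_H[where c = "\<lambda>m. of_real (- p) / of_int (- int m)" and f = "\<lambda>m. - int m"]) auto

lemma annihilation_series:
  "op_series sh (\<H> q) (\<lambda>m u. if m = 0 then 0 else sh (of_real (- p) / of_int (int m)) (a q (int m) u))"
  by (rule op_series_H[where c = "\<lambda>m. of_real (- p) / of_int (int m)" and f = "\<lambda>m. int m"]) auto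

text \<open>For i > 0 only the term of the exponent with a_{-i} fails to commute with a_i, and its
  coefficient p / i turns the Heisenberg commutator i into p.\<close>

lemma creation_commute:
  assumes "u \<in> \<H> q" "i \<noteq> 0"
  shows "a q i (creation p q s u) = creation p q s (a q i u) +
    (if 0 < i \<and> nat i \<le> s then sh (of_real p) (creation p q (s - nat i) u) else 0)"
proof -
  interpret vector_space sh by (rule vs_sh)
  let ?A = "\<lambda>m u. if m = 0 then 0 else sh (of_real (- p) / of_int (- int m)) (a q (- int m) u)"
  let ?\<kappa> = "if i > 0 then of_real p else 0 :: complex"
  let ?i = "nat \<bar>i\<bar>"
  have "a q i (op_exp sh ?A s u) = op_exp sh ?A s (a q i u) + (if ?i \<le> s then sh ?\<kappa> (op_exp sh ?A (s - ?i) u) else 0)"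
  proof (rule op_series.exp_commute[OF creation_series _ _ _ assms(1)])
    show "linear_map_on sh (\<H> q) sh (\<H> q) (a q i)" using fock_module.a_linear[OF fock] .
    show "1 \<le> ?i" using assms(2) by simp
    fix m u assume u: "u \<in> \<H> q"
    have a0: "a q i 0 = 0" using a_simps(3)[of 0 q i 0] H_closed(1) by simp
    show "a q i (?A m u) = ?A m (a q i u) + (if m = ?i then sh ?\<kappa> u else 0)"
    proof (cases "m = 0")
      case True
      then show ?thesis using a0 assms(2) by simp
    next
      case False
      have "a q i (?A m u) = a q i (sh (of_real (- p) / of_int (- int m)) (a q (- int m) u))" using False by simp
      also have "\<dots> = sh (of_real (- p) / of_int (- int m)) (a q i (a q (- int m) u))" by (rule a_simps(3)[OF a_simps(1)[OF u]])
      also have "\<dots> = sh (of_real (- p) / of_int (- int m)) (a q (- int m) (a q i u) +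
          (if i + - int m = 0 then sh (of_int i) u else 0))" by (simp only: a_commute[OF u, of i "- int m"])
      finally have "a q i (?A m u) = sh (of_real (- p) / of_int (- int m)) (a q (- int m) (a q i u) +
          (if i + - int m = 0 then sh (of_int i) u else 0))" .
      note eq = this
      show ?thesis
      proof (cases "i = int m")
        case True
        then have "of_real (- p) / of_int (- int m) * of_int i = (of_real p :: complex)" using False by simp
        then show ?thesis unfolding eq using True False by (simp add: scale_right_distrib scale_right_diff_distrib)
      next
        case ne: False
        then have "(if m = ?i then sh ?\<kappa> u else 0) = 0" by auto
        then show ?thesis unfolding eq using ne False by simp
      qed
    qed
  qed
  note * = this
  show ?thesis
  proof (cases "i > 0")
    case True
    then show ?thesis using * unfolding creation_def by simp
  next
    case False
    then show ?thesis using * unfolding creation_def by simp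
  qed
qed

lemma annihilation_commute:
  assumes "u \<in> \<H> q" "i \<noteq> 0"
  shows "a q i (annihilation p q s u) = annihilation p q s (a q i u) +
    (if i < 0 \<and> nat (- i) \<le> s then sh (of_real p) (annihilation p q (s - nat (- i)) u) else 0)"
proof -
  interpret vector_space sh by (rule vs_sh)
  let ?A = "\<lambda>m u. if m = 0 then 0 else sh (of_real (- p) / of_int (int m)) (a q (int m) u)"
  let ?\<kappa> = "if i < 0 then of_real p else 0 :: complex"
  let ?i = "nat \<bar>i\<bar>"
  have "a q i (op_exp sh ?A s u) = op_exp sh ?A s (a q i u) + (if ?i \<le> s then sh ?\<kappa> (op_exp sh ?A (s - ?i) u) else 0)"
  proof (rule op_series.exp_commute[OF annihilation_series _ _ _ assms(1)])
    show "linear_map_on sh (\<H> q) sh (\<H> q) (a q i)" using fock_module.a_linear[OF fock] .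
    show "1 \<le> ?i" using assms(2) by simp
    fix m u assume u: "u \<in> \<H> q"
    have a0: "a q i 0 = 0" using a_simps(3)[of 0 q i 0] H_closed(1) by simp
    show "a q i (?A m u) = ?A m (a q i u) + (if m = ?i then sh ?\<kappa> u else 0)"
    proof (cases "m = 0")
      case True
      then show ?thesis using a0 assms(2) by simp
    next
      case False
      have "a q i (?A m u) = a q i (sh (of_real (- p) / of_int (int m)) (a q (int m) u))" using False by simp
      also have "\<dots> = sh (of_real (- p) / of_int (int m)) (a q i (a q (int m) u))" by (rule a_simps(3)[OF a_simps(1)[OF u]])
      also have "\<dots> = sh (of_real (- p) / of_int (int m)) (a q (int m) (a q i u) +
          (if i + int m = 0 then sh (of_int i) u else 0))" by (simp only: a_commute[OF u, of i "int m"])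
      finally have "a q i (?A m u) = sh (of_real (- p) / of_int (int m)) (a q (int m) (a q i u) +
          (if i + int m = 0 then sh (of_int i) u else 0))" .
      note eq = this
      show ?thesis
      proof (cases "i = - int m")
        case True
        then have "of_real (- p) / of_int (int m) * of_int i = (of_real p :: complex)" using False by simp
        then show ?thesis unfolding eq using True False by (simp add: scale_right_distrib scale_right_diff_distrib)
      next
        case ne: False
        then have "(if m = ?i then sh ?\<kappa> u else 0) = 0" by auto
        then show ?thesis unfolding eq using ne False by (simp add: add_eq_0_iff)
      qed
    qed
  qed
  note * = this
  show ?thesis
  proof (cases "i < 0")
    case True
    then show ?thesis using * unfolding annihilation_def by simp
  next
    case False
    then show ?thesis using * unfolding annihilation_def by simp
  qed
qed

text \<open>Extension by zero to negative indices removes truncated subtraction from the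
  commutators.\<close>

definition creation_int :: "real \<Rightarrow> real \<Rightarrow> int \<Rightarrow> 'h \<Rightarrow> 'h"
  where "creation_int p q s u = (if s < 0 then 0 else creation p q (nat s) u)"

definition annihilation_int :: "real \<Rightarrow> real \<Rightarrow> int \<Rightarrow> 'h \<Rightarrow> 'h"
  where "annihilation_int p q s u = (if s < 0 then 0 else annihilation p q (nat s) u)"

lemma creation_int_commute:
  assumes "u \<in> \<H> q" "i \<noteq> 0"
  shows "a q i (creation_int p q s u) = creation_int p q s (a q i u) +
    (if 0 < i then sh (of_real p) (creation_int p q (s - i) u) else 0)"
proof -
  interpret vector_space sh by (rule vs_sh)
  have a0: "a q i 0 = 0" using a_simps(3)[of 0 q i 0] H_closed(1) by simp
  show ?thesis
    using creation_commute[OF assms, of p "nat s"]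
    by (auto simp: creation_int_def a0 nat_diff_distrib nat_le_iff le_nat_iff)
qed

lemma annihilation_int_commute:
  assumes "u \<in> \<H> q" "i \<noteq> 0"
  shows "a q i (annihilation_int p q s u) = annihilation_int p q s (a q i u) +
    (if i < 0 then sh (of_real p) (annihilation_int p q (s + i) u) else 0)"
proof -
  interpret vector_space sh by (rule vs_sh)
  have a0: "a q i 0 = 0" using a_simps(3)[of 0 q i 0] H_closed(1) by simp
  have "nat s - nat (- i) = nat (s + i)" if "i < 0" "0 \<le> s + i" using that by simp
  then show ?thesis
    using annihilation_commute[OF assms, of p "nat s"]
    by (auto simp: annihilation_int_def a0 nat_le_iff)
qed

lemma creation_int_linear: "linear_map_on sh (\<H> q) sh (\<H> q) (creation_int p q s)"
proof (cases "s < 0")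
  case False
  then have "creation_int p q s = creation p q (nat s)" by (simp add: creation_int_def fun_eq_iff)
  then show ?thesis unfolding creation_def using op_series.exp_linear[OF creation_series] by simp
qed (use zero_linear in \<open>simp add: creation_int_def[abs_def]\<close>)

lemma annihilation_int_linear: "linear_map_on sh (\<H> q) sh (\<H> q) (annihilation_int p q s)"
proof (cases "s < 0")
  case False
  then have "annihilation_int p q s = annihilation p q (nat s)" by (simp add: annihilation_int_def fun_eq_iff)
  then show ?thesis unfolding annihilation_def using op_series.exp_linear[OF annihilation_series] by simp
qed (use zero_linear in \<open>simp add: annihilation_int_def[abs_def]\<close>)

lemmas an_simps = linear_map_onD[OF annihilation_int_linear]
lemmas cr_simps = linear_map_onD[OF creation_int_linear]
lemmas T_simps = linear_map_onD[OF T_linear]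

lemma annihilation_int_v: "annihilation_int p q s (v q) = (if s = 0 then v q else 0)"
proof -
  interpret vector_space sh by (rule vs_sh)
  have "annihilation p q m (v q) = 0" if "m > 0" for m
    unfolding annihilation_def using that
    by (intro op_series.exp_highest[OF annihilation_series])
      (auto simp: fock_module.v_carrier[OF fock] fock_module.v_annihilated[OF fock])
  moreover have "annihilation p q 0 u = u" for u
    unfolding annihilation_def by (rule op_series.exp_0[OF annihilation_series])
  ultimately show ?thesis by (auto simp: annihilation_int_def)
qed

text \<open>Induction on words in the lowering modes: commuting past a_i with i < 0 raises the bound
  by \<open>- i\<close>.\<close>

lemma annihilation_int_bounded:
  assumes "u \<in> \<H> q" shows "\<exists>M. \<forall>m>M. annihilation_int p q m u = 0"
  using assms
proof (induction u rule: fock_module.lowering_induct[OF fock, consumes 1, case_names vac zero add scale step])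
  case vac
  show ?case by (rule exI[of _ 0]) (simp add: annihilation_int_v)
next
  case zero
  interpret vector_space sh by (rule vs_sh)
  show ?case using an_simps(3)[of 0 q p _ 0] H_closed(1) by simp
next
  case (add u w)
  then obtain M M' where "\<forall>m>M. annihilation_int p q m u = 0" "\<forall>m>M'. annihilation_int p q m w = 0" by blast
  then show ?case using add(1,2) by (intro exI[of _ "max M M'"]) (simp add: an_simps)
next
  case (scale u c)
  interpret vector_space sh by (rule vs_sh)
  show ?case using scale by (auto simp: an_simps)
next
  case (step i u)
  interpret vector_space sh by (rule vs_sh)
  obtain M where M: "\<forall>m>M. annihilation_int p q m u = 0" using step by blast
  have "annihilation_int p q m (a q i u) = 0" if "m > M - i" for m
  proof -
    have "a q i 0 = 0" using a_simps(3)[of 0 q i 0] H_closed(1) by simp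
    then show ?thesis using annihilation_int_commute[OF step(2), of i p m] M that step(1) by simp
  qed
  then show ?case by blast
qed

text \<open>The exponent of z forces s = z + m, so the double sum collapses to a sum over m, which M
  makes finite.\<close>

lemma w_coeff_eq:
  assumes "u \<in> \<H> q" and M: "\<forall>m>M. annihilation_int p q m u = 0"
  shows "w_coeff p q (p * q + of_int z) u =
    (\<Sum>m\<in>{0..M}. creation_int p (q + p) (z + m) (T p q (annihilation_int p q m u)))"
proof -
  interpret vector_space sh by (rule vs_sh)
  have T0: "T p q 0 = 0" using T_simps(3)[of 0 q p 0] H_closed(1) by simp
  have c0: "creation_int p (q + p) s 0 = 0" for s using cr_simps(3)[of 0 "q + p" p s 0] H_closed(1) by simp
  let ?f = "\<lambda>(s, m). if real s + p * q - real m = p * q + of_int z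
    then creation p (q + p) s (T p q (annihilation p q m u)) else 0"
  let ?I = "{m \<in> {0..M}. 0 \<le> z + m}"
  let ?P = "(\<lambda>m. (nat (z + m), nat m)) ` ?I"
  have fin: "finite ?I" by (rule finite_subset[of _ "{0..M}"]) auto
  have "w_coeff p q (p * q + of_int z) u = sum ?f ?P"
    unfolding w_coeff_def
  proof (rule Sum_any.expand_superset)
    show "{x. ?f x \<noteq> 0} \<subseteq> ?P"
    proof
      fix x assume x: "x \<in> {x. ?f x \<noteq> 0}"
      obtain s m where sm: "x = (s, m)" by (cases x)
      from x have eq: "real s + p * q - real m = p * q + of_int z"
        and nz: "creation p (q + p) s (T p q (annihilation p q m u)) \<noteq> 0" by (auto simp: sm split: if_splits)
      have "real_of_int (int s) = real_of_int (z + int m)" using eq by simp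
      then have s: "int s = z + int m" by (simp only: of_int_eq_iff)
      have "int m \<le> M"
      proof (rule ccontr)
        assume "\<not> int m \<le> M"
        then have "annihilation_int p q (int m) u = 0" using M by simp
        then have "annihilation p q m u = 0" by (simp add: annihilation_int_def)
        then show False using nz T0 c0[of "int s"] by (simp add: creation_int_def)
      qed
      then show "x \<in> ?P" unfolding sm using s by (intro image_eqI[of _ _ "int m"]) auto
    qed
  qed (use fin in simp)
  also have "\<dots> = (\<Sum>m\<in>?I. ?f (nat (z + m), nat m))"
    by (subst sum.reindex) (auto simp: inj_on_def)
  also have "\<dots> = (\<Sum>m\<in>?I. creation_int p (q + p) (z + m) (T p q (annihilation_int p q m u)))"
    by (intro sum.cong) (auto simp: creation_int_def annihilation_int_def)
  also have "\<dots> = (\<Sum>m\<in>{0..M}. creation_int p (q + p) (z + m) (T p q (annihilation_int p q m u)))"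
    by (intro sum.mono_neutral_left) (auto simp: creation_int_def)
  finally show ?thesis .
qed

lemma w_coeff_linear: "linear_map_on sh (\<H> q) sh (\<H> (q + p)) (w_coeff p q (p * q + of_int z))"
proof -
  interpret vector_space sh by (rule vs_sh)
  have closed: "sum f I \<in> \<H> (q + p)" if "\<And>i. i \<in> I \<Longrightarrow> f i \<in> \<H> (q + p)" for f and I :: "int set"
    using that by (induction I rule: infinite_finite_induct) (auto intro: H_closed)
  let ?t = "\<lambda>m u. creation_int p (q + p) (z + m) (T p q (annihilation_int p q m u))"
  show ?thesis
    unfolding linear_map_on_def
  proof (intro conjI ballI allI)
    fix x assume x: "x \<in> \<H> q"
    obtain M where M: "\<forall>m>M. annihilation_int p q m x = 0" using annihilation_int_bounded[OF x, of p] by blast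
    show "w_coeff p q (p * q + of_int z) x \<in> \<H> (q + p)"
      unfolding w_coeff_eq[OF x M] using x by (intro closed cr_simps T_simps an_simps)
    fix c
    have "\<forall>m>M. annihilation_int p q m (sh c x) = 0" using M x by (simp add: an_simps)
    note eq = w_coeff_eq[OF H_closed(3)[OF x] this]
    show "w_coeff p q (p * q + of_int z) (sh c x) = sh c (w_coeff p q (p * q + of_int z) x)"
      unfolding eq w_coeff_eq[OF x M] scale_sum_right using x
      by (intro sum.cong refl) (simp add: cr_simps T_simps an_simps)
  next
    fix x y assume x: "x \<in> \<H> q" and y: "y \<in> \<H> q"
    obtain M where M: "\<forall>m>M. annihilation_int p q m x = 0" using annihilation_int_bounded[OF x, of p] by blast
    obtain M' where M': "\<forall>m>M'. annihilation_int p q m y = 0" using annihilation_int_bounded[OF y, of p] by blast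
    let ?M = "max M M'"
    have 1: "\<forall>m>?M. annihilation_int p q m x = 0" "\<forall>m>?M. annihilation_int p q m y = 0"
      "\<forall>m>?M. annihilation_int p q m (x + y) = 0"
      using M M' x y by (simp_all add: an_simps)
    show "w_coeff p q (p * q + of_int z) (x + y) = w_coeff p q (p * q + of_int z) x + w_coeff p q (p * q + of_int z) y"
      unfolding w_coeff_eq[OF x 1(1)] w_coeff_eq[OF y 1(2)] w_coeff_eq[OF H_closed(2)[OF x y] 1(3)] sum.distrib[symmetric]
      using x y by (intro sum.cong refl) (simp add: cr_simps T_simps an_simps)
  qed
qed

lemmas w_simps = linear_map_onD[OF w_coeff_linear]

lemma w_coeff_bounded: "u \<in> \<H> q \<Longrightarrow> \<exists>B. \<forall>z<B. w_coeff p q (p * q + of_int z) u = 0"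
proof -
  assume u: "u \<in> \<H> q"
  obtain M where M: "\<forall>m>M. annihilation_int p q m u = 0" using annihilation_int_bounded[OF u, of p] by blast
  have "w_coeff p q (p * q + of_int z) u = 0" if "z < - M" for z
    unfolding w_coeff_eq[OF u M] using that by (intro sum.neutral) (auto simp: creation_int_def)
  then show ?thesis by blast
qed

lemma w_coeff_v: "w_coeff p q (p * q + of_int z) (v q) = creation_int p (q + p) z (v (q + p))"
proof -
  have "w_coeff p q (p * q + of_int z) (v q) =
    (\<Sum>m\<in>{0..0}. creation_int p (q + p) (z + m) (T p q (annihilation_int p q m (v q))))"
    by (rule w_coeff_eq) (auto simp: fock_module.v_carrier[OF fock] annihilation_int_v)
  then show ?thesis by (simp add: annihilation_int_v T_vac)
qed

lemma creation_int_0: "creation_int p q 0 u = u"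
  unfolding creation_int_def creation_def using op_series.exp_0[OF creation_series] by simp

text \<open>For i > 0 the commutator comes from the creation part, for i < 0 from the annihilation
  part, where the summation index has to be shifted; T commutes with the nonzero modes.\<close>

lemma w_coeff_commute:
  assumes u: "u \<in> \<H> q" and i: "i \<noteq> 0"
  shows "a (q + p) i (w_coeff p q (p * q + of_int z) u) = w_coeff p q (p * q + of_int z) (a q i u) +
    sh (of_real p) (w_coeff p q (p * q + of_int (z - i)) u)"
proof -
  interpret vector_space sh by (rule vs_sh)
  have au: "a q i u \<in> \<H> q" using u by (rule a_simps)
  obtain M1 where M1: "\<forall>m>M1. annihilation_int p q m u = 0" using annihilation_int_bounded[OF u, of p] by blast
  obtain M2 where M2: "\<forall>m>M2. annihilation_int p q m (a q i u) = 0" using annihilation_int_bounded[OF au, of p] by blast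
  \<comment> \<open>The margin of the absolute value of i keeps the truncation valid after the shift
    of the index.\<close>
  define M where "M = max M1 (max M2 0) + \<bar>i\<bar>"
  have b1: "annihilation_int p q m u = 0" if "m > M - \<bar>i\<bar>" for m using M1 that by (simp add: M_def)
  have b2: "\<forall>m>M. annihilation_int p q m (a q i u) = 0" using M2 by (simp add: M_def)
  have b1': "\<forall>m>M. annihilation_int p q m u = 0" using b1 by simp
  let ?c = "\<lambda>s. creation_int p (q + p) s"
  let ?n = "\<lambda>m. annihilation_int p q m u"
  have a_sum: "a (q + p) i (sum f I) = (\<Sum>m\<in>I. a (q + p) i (f m))" if "\<And>m. f m \<in> \<H> (q + p)" for f and I :: "int set"
  proof -
    have cl: "sum f I \<in> \<H> (q + p)" for I :: "int set"
      using that by (induction I rule: infinite_finite_induct) (auto intro: H_closed)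
    have "a (q + p) i 0 = 0" using a_simps(3)[of 0 "q + p" i 0] H_closed(1) by simp
    then show ?thesis using that cl by (induction I rule: infinite_finite_induct) (auto simp: a_simps)
  qed
  have Tp0: "T p q 0 = 0" using T_simps(3)[of 0 q p 0] H_closed(1) by simp
  have cp0: "creation_int p (q + p) s 0 = 0" for s using cr_simps(3)[of 0 "q + p" p s 0] H_closed(1) by simp
  have n: "?n m \<in> \<H> q" for m using u by (rule an_simps)
  have Tn: "T p q (?n m) \<in> \<H> (q + p)" for m using n by (rule T_simps)
  have "a (q + p) i (w_coeff p q (p * q + of_int z) u) =
    (\<Sum>m\<in>{0..M}. a (q + p) i (?c (z + m) (T p q (?n m))))"
    unfolding w_coeff_eq[OF u b1'] by (rule a_sum) (intro cr_simps Tn)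
  also have "\<dots> = (\<Sum>m\<in>{0..M}. ?c (z + m) (T p q (annihilation_int p q m (a q i u))) +
    sh (of_real p) (if i < 0 then ?c (z + m) (T p q (?n (m + i))) else ?c (z - i + m) (T p q (?n m))))"
  proof (intro sum.cong refl)
    fix m
    have "a (q + p) i (T p q (?n m)) = T p q (a q i (?n m))" using T_commute[OF i n] by simp
    also have "\<dots> = T p q (annihilation_int p q m (a q i u)) + (if i < 0 then sh (of_real p) (T p q (?n (m + i))) else 0)"
      unfolding annihilation_int_commute[OF u i] using au n by (auto simp: T_simps an_simps H_closed Tp0)
    finally have "?c (z + m) (a (q + p) i (T p q (?n m))) = ?c (z + m) (T p q (annihilation_int p q m (a q i u))) +
      (if i < 0 then sh (of_real p) (?c (z + m) (T p q (?n (m + i)))) else 0)"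
      using au n by (auto simp: cr_simps T_simps an_simps H_closed cp0)
    then show "a (q + p) i (?c (z + m) (T p q (?n m))) = ?c (z + m) (T p q (annihilation_int p q m (a q i u))) +
      sh (of_real p) (if i < 0 then ?c (z + m) (T p q (?n (m + i))) else ?c (z - i + m) (T p q (?n m)))"
      unfolding creation_int_commute[OF Tn i] using i by (auto simp: algebra_simps)
  qed
  also have "\<dots> = w_coeff p q (p * q + of_int z) (a q i u) +
    sh (of_real p) (\<Sum>m\<in>{0..M}. if i < 0 then ?c (z + m) (T p q (?n (m + i))) else ?c (z - i + m) (T p q (?n m)))"
    unfolding w_coeff_eq[OF au b2] by (simp add: sum.distrib scale_sum_right)
  also have "(\<Sum>m\<in>{0..M}. if i < 0 then ?c (z + m) (T p q (?n (m + i))) else ?c (z - i + m) (T p q (?n m))) =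
    (\<Sum>m\<in>{0..M}. ?c (z - i + m) (T p q (?n m)))"
  proof (cases "i < 0")
    case True
    have T0: "T p q 0 = 0" using T_simps(3)[of 0 q p 0] H_closed(1) by simp
    have c0: "creation_int p (q + p) s 0 = 0" for s using cr_simps(3)[of 0 "q + p" p s 0] H_closed(1) by simp
    let ?g = "\<lambda>m. ?c (z - i + m) (T p q (?n m))"
    have "(\<Sum>m\<in>{0..M}. ?c (z + m) (T p q (?n (m + i)))) = sum ?g {i..M + i}"
      by (rule sum.reindex_bij_witness[of _ "\<lambda>m. m - i" "\<lambda>m. m + i"]) auto
    also have "\<dots> = sum ?g {i..M}"
      using True b1 by (intro sum.mono_neutral_left) (auto simp: T0 c0)
    also have "\<dots> = sum ?g {0..M}"
      using True by (intro sum.mono_neutral_right) (auto simp: annihilation_int_def T0 c0)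
    finally show ?thesis using True by simp
  qed simp
  also have "\<dots> = w_coeff p q (p * q + of_int (z - i)) u"
    unfolding w_coeff_eq[OF u b1'] ..
  finally show ?thesis .
qed

definition vac_form :: "real \<Rightarrow> 'h \<Rightarrow> complex"
  where "vac_form q = fock_module.vacuum_functional sh (\<H> q) (a q) (v q)"

lemmas vac_form_simps = fock_module.vacuum_functional_simps[OF fock, folded vac_form_def]
lemmas vac_form_linear = linear_map_onD[OF vac_form_simps(3)]

text \<open>Every term of positive degree is the image of a lowering mode, on which the functional
  vanishes.\<close>

lemma vac_form_creation: "vac_form q (creation_int p q s (v q)) = (if s = 0 then 1 else 0)"
proof -
  interpret vector_space sh by (rule vs_sh)
  let ?A = "\<lambda>m u. if m = 0 then 0 else sh (of_real (- p) / of_int (- int m)) (a q (- int m) u)"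
  interpret A: op_series sh "\<H> q" ?A by (rule creation_series)
  have f0: "vac_form q 0 = 0" using vac_form_linear(3)[of 0 q 0] H_closed(1) by simp
  have f_sum: "vac_form q (sum f I) = (\<Sum>m\<in>I. vac_form q (f m))" if "\<And>m. f m \<in> \<H> q" for f and I :: "nat set"
    using that by (induction I rule: infinite_finite_induct) (auto simp: f0 vac_form_linear A.sum_closed)
  have v: "v q \<in> \<H> q" using fock_module.v_carrier[OF fock] .
  have "vac_form q (op_pow ?A N s (v q)) = 0" if "s > 0" for N s
  proof (cases N)
    case (Suc N')
    have "vac_form q (?A m (op_pow ?A N' (s - m) (v q))) = 0" for m
      using A.pow_simps(1)[OF v, of N' "s - m"] by (auto simp: f0 vac_form_linear vac_form_simps a_simps)
    moreover have "?A m (op_pow ?A N' (s - m) (v q)) \<in> \<H> q" for m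
      using A.A_simps(1)[OF A.pow_simps(1)[OF v, of N' "s - m"], of m] by simp
    ultimately show ?thesis unfolding Suc op_pow.simps by (simp only: f_sum sum.neutral_const)
  qed (use that f0 in simp)
  moreover have "op_pow ?A N s (v q) \<in> \<H> q" for N s using A.pow_simps(1)[OF v] .
  ultimately have "vac_form q (op_exp sh ?A s (v q)) = 0" if "s > 0" for s
    unfolding op_exp_def using that by (simp add: f_sum H_closed vac_form_linear)
  then show ?thesis
    using creation_int_0[of p q] vac_form_simps(1) by (auto simp: creation_int_def creation_def f0)
qed

end

section \<open>Tensor products\<close>

lemma tensor_space_induct [consumes 1, case_names pure zero add scale]:
  assumes t: "t \<in> tensor_space sv sh S U"
    and "\<And>x u. x \<in> S \<Longrightarrow> u \<in> U \<Longrightarrow> P (tensor sv sh S U x u)" "P 0"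
    and "\<And>s t. s \<in> tensor_space sv sh S U \<Longrightarrow> t \<in> tensor_space sv sh S U \<Longrightarrow> P s \<Longrightarrow> P t \<Longrightarrow> P (s + t)"
    and "\<And>c t. t \<in> tensor_space sv sh S U \<Longrightarrow> P t \<Longrightarrow> P (tensor_scale c t)"
  shows "P t"
proof -
  have "t \<in> tensor_space sv sh S U \<and> P t"
    using t unfolding tensor_space_def
  proof (rule tensor.span_induct)
    show "tensor.subspace {t. t \<in> tensor.span {tensor sv sh S U x u |x u. x \<in> S \<and> u \<in> U} \<and> P t}"
      using assms(3-5) unfolding tensor_space_def
      by (intro tensor.subspaceI) (auto intro: tensor.span_zero tensor.span_add tensor.span_scale)
  qed (use assms(2) in \<open>auto intro: tensor.span_base\<close>)
  then show ?thesis by simp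
qed

lemma tensor_space_closed:
  "0 \<in> tensor_space sv sh S U"
  "s \<in> tensor_space sv sh S U \<Longrightarrow> t \<in> tensor_space sv sh S U \<Longrightarrow> s + t \<in> tensor_space sv sh S U"
  "s \<in> tensor_space sv sh S U \<Longrightarrow> tensor_scale c s \<in> tensor_space sv sh S U"
  "x \<in> S \<Longrightarrow> u \<in> U \<Longrightarrow> tensor sv sh S U x u \<in> tensor_space sv sh S U"
  unfolding tensor_space_def
  by (auto intro: tensor.span_zero tensor.span_add tensor.span_scale tensor.span_base)

lemma tensor_space_sum: "(\<And>i. i \<in> I \<Longrightarrow> f i \<in> tensor_space sv sh S U) \<Longrightarrow> sum f I \<in> tensor_space sv sh S U"
  by (induction I rule: infinite_finite_induct) (auto intro: tensor_space_closed)

lemma tensor_bilinear: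
  "x \<in> S \<Longrightarrow> y \<in> S \<Longrightarrow> u \<in> U \<Longrightarrow> tensor sv sh S U (x + y) u = tensor sv sh S U x u + tensor sv sh S U y u"
  "x \<in> S \<Longrightarrow> u \<in> U \<Longrightarrow> tensor sv sh S U (sv c x) u = tensor_scale c (tensor sv sh S U x u)"
  "x \<in> S \<Longrightarrow> u \<in> U \<Longrightarrow> w \<in> U \<Longrightarrow> tensor sv sh S U x (u + w) = tensor sv sh S U x u + tensor sv sh S U x w"
  "x \<in> S \<Longrightarrow> u \<in> U \<Longrightarrow> tensor sv sh S U x (sh c u) = tensor_scale c (tensor sv sh S U x u)"
  by (auto simp: tensor_def tensor_scale_def bilinear_form_on_def linear_map_on_def fun_eq_iff)

lemma tensor_map_linear [simp]:
  "tensor_map sv sh S U f g (s + t) = tensor_map sv sh S U f g s + tensor_map sv sh S U f g t"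
  "tensor_map sv sh S U f g (tensor_scale c s) = tensor_scale c (tensor_map sv sh S U f g s)"
  "tensor_map sv sh S U f g 0 = 0"
  by (auto simp: tensor_map_def tensor_scale_def fun_eq_iff)

lemma linear_map_on_id: "linear_map_on sh U sh U (\<lambda>u. u)"
  by (simp add: linear_map_on_def)

lemma Sum_any_additive:
  fixes g :: "int \<Rightarrow> 'a::comm_monoid_add" and f :: "'a \<Rightarrow> 'b::comm_monoid_add"
  assumes "f 0 = 0" "\<And>x y. f (x + y) = f x + f y" "finite {m. g m \<noteq> 0}"
  shows "f (Sum_any g) = Sum_any (\<lambda>m. f (g m))"
proof -
  have "f (sum g I) = (\<Sum>m\<in>I. f (g m))" for I
    using assms(1,2) by (induction I rule: infinite_finite_induct) auto
  then have "f (Sum_any g) = (\<Sum>m\<in>{m. g m \<noteq> 0}. f (g m))" by (simp add: Sum_any.expand_set)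
  also have "\<dots> = Sum_any (\<lambda>m. f (g m))"
    using assms by (intro Sum_any.expand_superset[symmetric]) auto
  finally show ?thesis .
qed

lemma Sum_any_shift:
  fixes g :: "int \<Rightarrow> 'a::comm_monoid_add"
  shows "Sum_any (\<lambda>m. g (m + i)) = Sum_any g"
proof -
  have eq: "{m. g m \<noteq> 0} = (\<lambda>m. m + i) ` {m. g (m + i) \<noteq> 0}" by (rule Collect_shift)
  show ?thesis unfolding Sum_any.expand_set eq by (subst sum.reindex) (auto simp: inj_on_def)
qed

subsection \<open>Brackets of letters\<close>

text \<open>Affine and Heisenberg relations in one notation: loops commute with Heisenberg letters,
  and brackets of Heisenberg letters are purely central.\<close>

fun letter_bracket :: "letter \<Rightarrow> letter \<Rightarrow> (complex \<times> letter) list" where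
  "letter_bracket (Lp X i) (Lp Y l) = map (\<lambda>(c, Z). (c, Lp Z (i + l))) (sl2_bracket X Y)"
| "letter_bracket _ _ = []"

fun letter_central :: "nat \<Rightarrow> letter \<Rightarrow> letter \<Rightarrow> complex" where
  "letter_central k (Lp X i) (Lp Y l) = (if i + l = 0 then of_int i * sl2_form X Y * of_nat k else 0)"
| "letter_central k (Hs i) (Hs l) = (if i + l = 0 then of_int i else 0)"
| "letter_central k _ _ = 0"

lemma mop_bracket:
  assumes "k > 0" "finsupp f"
  shows "mop k x (mop k y f) - mop k y (mop k x f) =
    (\<Sum>(c, z)\<leftarrow>letter_bracket x y. fsc c (mop k z f)) + fsc (letter_central k x y) f"
proof (cases x; cases y)
  fix X Y i l assume "x = Lp X i" "y = Lp Y l"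
  then show ?thesis
    using mop_bracket_loop[OF assms, of X i Y l] by (simp only: letter_bracket.simps letter_central.simps)
      (simp only: list.map_comp o_def case_prod_beta' fst_conv snd_conv)
next
  fix X i l assume "x = Lp X i" "y = Hs l"
  then show ?thesis using mop_bracket_Hs_loop[OF assms, of l X i] by (simp del: mop.simps)
next
  fix Y i l assume "x = Hs i" "y = Lp Y l"
  then show ?thesis using mop_bracket_Hs_loop[OF assms, of i Y l] by (simp del: mop.simps)
next
  fix i l assume "x = Hs i" "y = Hs l"
  then show ?thesis using mop_bracket_Hs[OF assms, of i l] by (simp del: mop.simps)
qed

lemma letter_bracket_proper: "(c, z) \<in> set (letter_bracket x y) \<Longrightarrow> z \<in> proper_letters"
  by (cases x; cases y) (auto simp: proper_letters_def)

section \<open>Letters acting on tensors\<close>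

context vertex_operators
begin

lemma module_H: "j \<le> k \<Longrightarrow> integrable_highest_weight_module sv (\<pi> j) (\<rho> j) k j (vac j)"
  using module_and_dual[of j] by (simp add: dual_vacuum_def)

lemma pi_closed:
  assumes "j \<le> k"
  shows "0 \<in> \<pi> j" "x \<in> \<pi> j \<Longrightarrow> y \<in> \<pi> j \<Longrightarrow> x + y \<in> \<pi> j" "x \<in> \<pi> j \<Longrightarrow> sv c x \<in> \<pi> j"
  using integrable_highest_weight_module.carrier_closed[OF module_H[OF assms]] by auto

lemma vs_sv: "vector_space sv"
  using module_H[of 0] by (simp add: integrable_highest_weight_module_def affine_module_def)

lemmas rho_linear = affine_module.action_linear[OF integrable_highest_weight_module.axioms(1)[OF module_H]]
lemmas rho_simps = linear_map_onD[OF rho_linear]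
lemmas psi_simps = linear_map_onD[OF psi_linear]

abbreviation pt :: "nat \<Rightarrow> real \<Rightarrow> 'v \<Rightarrow> 'h \<Rightarrow> ('v, 'h) tensor"
  where "pt j q \<equiv> tensor sv sh (\<pi> j) (\<H> q)"

abbreviation TS :: "nat \<Rightarrow> real \<Rightarrow> ('v, 'h) tensor set"
  where "TS j q \<equiv> tensor_space sv sh (\<pi> j) (\<H> q)"

lemma pt_zero: "u \<in> \<H> q \<Longrightarrow> j \<le> k \<Longrightarrow> pt j q 0 u = 0" "x \<in> \<pi> j \<Longrightarrow> pt j q x 0 = 0"
proof -
  interpret vector_space sv by (rule vs_sv)
  interpret h: vector_space sh by (rule vs_sh)
  show "u \<in> \<H> q \<Longrightarrow> j \<le> k \<Longrightarrow> pt j q 0 u = 0"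
    using tensor_bilinear(2)[of 0 "\<pi> j" u "\<H> q" sv sh 0] pi_closed(1) by (simp add: tensor_scale_def zero_fun_def)
  show "x \<in> \<pi> j \<Longrightarrow> pt j q x 0 = 0"
    using tensor_bilinear(4)[of x "\<pi> j" 0 "\<H> q" sv sh 0] H_closed(1) by (simp add: tensor_scale_def zero_fun_def)
qed

fun tact :: "nat \<Rightarrow> real \<Rightarrow> letter \<Rightarrow> ('v, 'h) tensor \<Rightarrow> ('v, 'h) tensor" where
  "tact j q (Lp X i) = tensor_map sv sh (\<pi> j) (\<H> q) (\<rho> j (Loop X i)) (\<lambda>u. u)"
| "tact j q (Hs i) = tensor_map sv sh (\<pi> j) (\<H> q) (\<lambda>x. x) (a q i)"

lemma tact_linear [simp]:
  "tact j q x (s + t) = tact j q x s + tact j q x t"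
  "tact j q x (tensor_scale c s) = tensor_scale c (tact j q x s)"
  "tact j q x 0 = 0"
  by (cases x; simp)+

lemma tact_pure:
  assumes "j \<le> k" "x \<in> \<pi> j" "u \<in> \<H> q"
  shows "tact j q (Lp X i) (pt j q x u) = pt j q (\<rho> j (Loop X i) x) u"
    "tact j q (Hs i) (pt j q x u) = pt j q x (a q i u)"
  using assms
  by (simp_all add: tensor_map_tensor[OF rho_linear linear_map_on_id]
      tensor_map_tensor[OF linear_map_on_id fock_module.a_linear[OF fock]])

lemma tact_closed:
  assumes "j \<le> k" "t \<in> TS j q" shows "tact j q x t \<in> TS j q"
  using assms(2)
proof (induction t rule: tensor_space_induct)
  case (pure y u)
  then show ?case using assms(1)
    by (cases x) (simp_all only: tact_pure, auto intro: tensor_space_closed rho_simps a_simps)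
next
  case zero
  show ?case unfolding tact_linear(3) by (rule tensor_space_closed)
next
  case (add s t)
  then show ?case unfolding tact_linear(1) by (intro tensor_space_closed)
next
  case (scale c t)
  then show ?case unfolding tact_linear(2) by (intro tensor_space_closed)
qed

lemma pt_sum_list:
  assumes "j \<le> k" "u \<in> \<H> q" "\<And>c z. (c, z) \<in> set xs \<Longrightarrow> f z \<in> \<pi> j"
  shows "(\<Sum>(c, z)\<leftarrow>xs. sv c (f z)) \<in> \<pi> j \<and>
    pt j q (\<Sum>(c, z)\<leftarrow>xs. sv c (f z)) u = (\<Sum>(c, z)\<leftarrow>xs. tensor_scale c (pt j q (f z) u))"
  using assms(3)
proof (induction xs)
  case (Cons y xs)
  obtain c z where y: "y = (c, z)" by (cases y)
  have "f z \<in> \<pi> j" "(\<Sum>(c, z)\<leftarrow>xs. sv c (f z)) \<in> \<pi> j"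
    "pt j q (\<Sum>(c, z)\<leftarrow>xs. sv c (f z)) u = (\<Sum>(c, z)\<leftarrow>xs. tensor_scale c (pt j q (f z) u))"
    using Cons y by auto
  then show ?case using assms(1,2) by (simp add: y tensor_bilinear pi_closed)
qed (use assms pi_closed pt_zero in auto)

lemma tact_bracket:
  assumes j: "j \<le> k" and t: "t \<in> TS j q"
  shows "tact j q x (tact j q y t) - tact j q y (tact j q x t) =
    (\<Sum>(c, z)\<leftarrow>letter_bracket x y. tensor_scale c (tact j q z t)) + tensor_scale (letter_central k x y) t"
  using t
proof (induction t rule: tensor_space_induct)
  case (pure w u)
  interpret vector_space sv by (rule vs_sv)
  interpret h: vector_space sh by (rule vs_sh)
  interpret M: integrable_highest_weight_module sv "\<pi> j" "\<rho> j" k j "vac j" by (rule module_H[OF j])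
  have diff1: "pt j q (y - z) u = pt j q y u - pt j q z u" if "y \<in> \<pi> j" "z \<in> \<pi> j" for y z
    using tensor_bilinear(1)[of y "\<pi> j" "sv (- 1) z" u "\<H> q"] tensor_bilinear(2)[of z "\<pi> j" u "\<H> q" sv sh "- 1"]
      that pure pi_closed(3)[OF j, of z "- 1"] by simp
  have diff2: "pt j q w (y - z) = pt j q w y - pt j q w z" if "y \<in> \<H> q" "z \<in> \<H> q" for y z
    using tensor_bilinear(3)[of w "\<pi> j" y "\<H> q" "sh (- 1) z"] tensor_bilinear(4)[of w "\<pi> j" z "\<H> q" sv sh "- 1"]
      that pure H_closed(3)[of z q "- 1"] by simp
  show ?case
  proof (cases x; cases y)
    fix X Y i l assume xy: "x = Lp X i" "y = Lp Y l"
    let ?L = "map (\<lambda>(c, Z). (c, Loop Z (i + l))) (sl2_bracket X Y)"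
    let ?z = "letter_central k x y"
    have "\<rho> j (Loop X i) (\<rho> j (Loop Y l) w) - \<rho> j (Loop Y l) (\<rho> j (Loop X i) w) =
      (\<Sum>(c, z)\<leftarrow>?L. sv c (\<rho> j z w)) + sv ?z w"
      using M.action_bracket[OF pure(1), of "Loop X i" "Loop Y l"] M.level[OF pure(1)]
      by (simp add: xy o_def)
    moreover have "(\<Sum>(c, z)\<leftarrow>?L. sv c (\<rho> j z w)) \<in> \<pi> j \<and>
      pt j q (\<Sum>(c, z)\<leftarrow>?L. sv c (\<rho> j z w)) u = (\<Sum>(c, z)\<leftarrow>?L. tensor_scale c (pt j q (\<rho> j z w) u))"
      using j pure by (intro pt_sum_list rho_simps) auto
    ultimately have "pt j q (\<rho> j (Loop X i) (\<rho> j (Loop Y l) w) - \<rho> j (Loop Y l) (\<rho> j (Loop X i) w)) u =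
      (\<Sum>(c, z)\<leftarrow>?L. tensor_scale c (pt j q (\<rho> j z w) u)) + tensor_scale ?z (pt j q w u)"
      using pure j by (simp add: tensor_bilinear pi_closed)
    moreover have "(\<Sum>(c, z)\<leftarrow>?L. tensor_scale c (pt j q (\<rho> j z w) u)) =
      (\<Sum>(c, z)\<leftarrow>letter_bracket x y. tensor_scale c (tact j q z (pt j q w u)))"
      unfolding xy letter_bracket.simps using tact_pure(1)[OF j pure]
      by (simp add: o_def case_prod_beta del: tact.simps)
    ultimately show ?thesis
      using pure j by (simp add: xy tact_pure rho_simps diff1 del: tact.simps letter_bracket.simps)
  next
    fix X i l assume "x = Lp X i" "y = Hs l"
    then show ?thesis using pure j by (simp add: tact_pure rho_simps a_simps del: tact.simps)
  next
    fix X i l assume "x = Hs l" "y = Lp X i"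
    then show ?thesis using pure j by (simp add: tact_pure rho_simps a_simps del: tact.simps)
  next
    fix i l assume xy: "x = Hs i" "y = Hs l"
    have "pt j q w (a q i (a q l u) - a q l (a q i u)) = tensor_scale (letter_central k x y) (pt j q w u)"
      using fock_module.heisenberg[OF fock pure(2), of i l] pure
      by (simp add: xy tensor_bilinear pt_zero tensor_scale_def zero_fun_def)
    then show ?thesis using pure j by (simp add: xy tact_pure a_simps diff2 del: tact.simps)
  qed
next
  case zero
  have "(\<Sum>(c, z)\<leftarrow>xs. tensor_scale c (tact j q z 0)) = 0" for xs
  proof (induction xs)
    case (Cons y xs)
    then show "(\<Sum>(c, z)\<leftarrow>y # xs. tensor_scale c (tact j q z 0)) = 0"
      by (simp only: list.map sum_list.Cons case_prod_beta' tact_linear tensor.scale_zero_right add_0_left)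
  qed simp
  then show ?case by (simp only: tact_linear tensor.scale_zero_right add_0_left diff_0_right)
next
  case (add s t)
  have "(\<Sum>(c, z)\<leftarrow>xs. tensor_scale c (tact j q z (s + t))) =
    (\<Sum>(c, z)\<leftarrow>xs. tensor_scale c (tact j q z s)) + (\<Sum>(c, z)\<leftarrow>xs. tensor_scale c (tact j q z t))" for xs
    unfolding case_prod_beta tact_linear tensor.scale_right_distrib by (rule sum_list_addf)
  then show ?case unfolding tact_linear tensor.scale_right_distrib using arg_cong2[OF add(3,4), of plus]
    by (simp only: algebra_simps)
next
  case (scale c t)
  have ts: "(\<Sum>x\<leftarrow>xs. tensor_scale c (g x)) = tensor_scale c (\<Sum>x\<leftarrow>xs. g x)" for g :: "_ \<Rightarrow> ('v, 'h) tensor" and xs :: "(complex \<times> letter) list"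
  proof (induction xs)
    case (Cons y xs)
    then show "(\<Sum>x\<leftarrow>y # xs. tensor_scale c (g x)) = tensor_scale c (\<Sum>x\<leftarrow>y # xs. g x)"
      by (simp only: list.map sum_list.Cons tensor.scale_right_distrib)
  qed (simp only: list.map sum_list.Nil tensor.scale_zero_right)
  have "(\<Sum>(d, z)\<leftarrow>xs. tensor_scale d (tact j q z (tensor_scale c t))) =
    tensor_scale c (\<Sum>(d, z)\<leftarrow>xs. tensor_scale d (tact j q z t))" for xs
    unfolding case_prod_beta' tact_linear ts[symmetric] by (simp only: tensor.scale_left_commute)
  then show ?case using arg_cong[OF scale(2), of "tensor_scale c"]
    unfolding tact_linear by (simp only: tensor.scale_right_distrib tensor.scale_right_diff_distrib tensor.scale_left_commute)
qed

end

section \<open>Transfer to the fermionic model\<close>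

text \<open>
  The correspondence between \<open>\<pi>\<^sub>j \<otimes> \<H>\<^sub>q\<close> and the fermionic model is the set of pairs generated
  from a pair of highest weight vectors.  By positivity of the contravariant form it is single
  valued from tensors to states; the converse, which amounts to the irreducibility of \<open>\<pi>\<^sub>j\<close>, is
  not needed.
\<close>

definition psc :: "complex \<Rightarrow> ('v, 'h) tensor \<times> fock \<Rightarrow> ('v, 'h) tensor \<times> fock"
  where "psc c z = (tensor_scale c (fst z), fsc c (snd z))"

lemma psc_simps [simp]: "fst (psc c z) = tensor_scale c (fst z)" "snd (psc c z) = fsc c (snd z)"
  by (simp_all add: psc_def)

lemma vector_space_psc: "vector_space psc"
  by unfold_locales
    (simp_all only: prod_eq_iff psc_simps fst_add snd_add tensor.scale_right_distrib fock.scale_right_distrib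
      tensor.scale_left_distrib fock.scale_left_distrib tensor.scale_scale fock.scale_scale
      tensor.scale_one fock.scale_one simp_thms)

lemma fst_sum_list: "fst (\<Sum>x\<leftarrow>xs. f x) = (\<Sum>x\<leftarrow>xs. fst (f x))"
  by (induction xs) auto

lemma snd_sum_list: "snd (\<Sum>x\<leftarrow>xs. f x) = (\<Sum>x\<leftarrow>xs. snd (f x))"
  by (induction xs) auto

lemma gen_mono:
  assumes "u \<in> gen sc P L B" "\<And>b. b \<in> B \<Longrightarrow> b \<in> gen sc P L B'"
  shows "u \<in> gen sc P L B'"
  using assms(1) by induction (auto intro: gen.intros assms(2))

lemma ray_module_conj:
  assumes "f \<in> ray_module k e" shows "conj_state f \<in> ray_module k e"
  using assms unfolding ray_module_def
proof induction
  case (gen_base b)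
  then show ?case by (auto intro: gen.intros)
next
  case (gen_step x u)
  then show ?case unfolding conj_state_mop by (intro gen.gen_step)
qed (simp_all only: conj_state_simps, (intro gen.gen_zero gen.gen_add gen.gen_scale; assumption)+)

context vertex_operators
begin

definition pact :: "nat \<Rightarrow> real \<Rightarrow> letter \<Rightarrow> ('v, 'h) tensor \<times> fock \<Rightarrow> ('v, 'h) tensor \<times> fock"
  where "pact j q x z = (tact j q x (fst z), mop k x (snd z))"

lemma pact_sel [simp]: "fst (pact j q x z) = tact j q x (fst z)" "snd (pact j q x z) = mop k x (snd z)"
  by (simp_all add: pact_def)

lemma pact_linear [simp]:
  "pact j q x (y + z) = pact j q x y + pact j q x z" "pact j q x (psc c z) = psc c (pact j q x z)"
  "pact j q x 0 = 0"
  by (simp_all only: prod_eq_iff pact_sel psc_simps fst_add snd_add fst_zero snd_zero tact_linear mop_linear simp_thms)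

text \<open>Generation uses lowering letters only, so that functionals vanishing on lowered vectors
  are determined by the generators; stability under the remaining proper letters is the content of
  \<open>joint_closed\<close>.\<close>

abbreviation joint :: "nat \<Rightarrow> real \<Rightarrow> (('v, 'h) tensor \<times> fock) set \<Rightarrow> (('v, 'h) tensor \<times> fock) set"
  where "joint j q B \<equiv> gen psc (pact j q) {x. lowering x} B"

lemma joint_mem:
  assumes "j \<le> k" "\<And>z. z \<in> B \<Longrightarrow> fst z \<in> TS j q \<and> finsupp (snd z)" "z \<in> joint j q B"
  shows "fst z \<in> TS j q \<and> finsupp (snd z)"
  using assms(3)
  by induction
    (simp_all only: assms(2) fst_add snd_add fst_zero snd_zero psc_simps pact_sel
      tact_closed[OF assms(1)] tensor_space_closed finsupp_add finsupp_zero finsupp_fsc finsupp_mop simp_thms)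

lemma pact_bracket:
  assumes "k > 0" "j \<le> k" "fst z \<in> TS j q" "finsupp (snd z)"
  shows "pact j q x (pact j q y z) - pact j q y (pact j q x z) =
    (\<Sum>(c, w)\<leftarrow>letter_bracket x y. psc c (pact j q w z)) + psc (letter_central k x y) z"
  by (simp only: prod_eq_iff fst_diff snd_diff fst_add snd_add fst_sum_list snd_sum_list case_prod_beta'
      pact_sel psc_simps tact_bracket[OF assms(2,3)] mop_bracket[OF assms(1,4)] simp_thms)

lemma joint_closed:
  assumes k: "k > 0" and j: "j \<le> k" and B: "\<And>z. z \<in> B \<Longrightarrow> fst z \<in> TS j q \<and> finsupp (snd z)"
    and base: "\<And>x z. x \<in> proper_letters \<Longrightarrow> \<not> lowering x \<Longrightarrow> z \<in> B \<Longrightarrow> pact j q x z \<in> joint j q B"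
    and z: "z \<in> joint j q B" and x: "x \<in> proper_letters"
  shows "pact j q x z \<in> joint j q B"
proof (rule gen_lowering_closed[where K = proper_letters, OF _ _ _ _ z x])
  fix x y u
  assume "x \<in> proper_letters" "y \<in> {x. lowering x}" and u: "u \<in> joint j q B"
    and IH: "\<And>z. z \<in> proper_letters \<Longrightarrow> pact j q z u \<in> joint j q B"
  have "(\<Sum>(c, w)\<leftarrow>letter_bracket x y. psc c (pact j q w u)) \<in> joint j q B"
    by (rule gen_sum_list) (auto intro!: gen_scale IH dest: letter_bracket_proper)
  then show "pact j q x (pact j q y u) - pact j q y (pact j q x u) \<in> joint j q B"
    using joint_mem[OF j B u] by (simp only: pact_bracket[OF k j]) (intro gen_add gen_scale u)
qed (use base in auto)

text \<open>Since a tensor is a functional on bilinear forms, pairing it with the product of the two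
  dual vacua is evaluation.\<close>

definition tform :: "nat \<Rightarrow> real \<Rightarrow> ('v, 'h) tensor \<Rightarrow> complex"
  where "tform j q t = t (\<lambda>x u. bra j x * vac_form q u)"

lemma tform_simps [simp]:
  "tform j q (s + t) = tform j q s + tform j q t" "tform j q (tensor_scale c t) = c * tform j q t"
  "tform j q 0 = 0"
  by (simp_all add: tform_def tensor_scale_def)

lemma bra_linear: "j \<le> k \<Longrightarrow> linear_map_on sv (\<pi> j) (*) UNIV (bra j)"
  by (rule dual_vacuum.bra_linear[OF module_and_dual])

lemma tform_pure:
  assumes "j \<le> k" "x \<in> \<pi> j" "u \<in> \<H> q" shows "tform j q (pt j q x u) = bra j x * vac_form q u"
proof -
  have "bilinear_form_on sv sh (\<pi> j) (\<H> q) (\<lambda>x u. bra j x * vac_form q u)"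
    by (auto simp: bilinear_form_on_def linear_map_on_def linear_map_onD[OF bra_linear[OF assms(1)]]
        vac_form_linear algebra_simps)
  then show ?thesis by (simp add: tform_def tensor_def)
qed

lemma tform_lowering:
  assumes j: "j \<le> k" and x: "lowering x" and t: "t \<in> TS j q" shows "tform j q (tact j q x t) = 0"
  using t
proof (induction t rule: tensor_space_induct)
  case (pure y u)
  show ?case
  proof (cases x)
    case (Lp X i)
    then show ?thesis using pure x dual_vacuum.bra_lowering[OF module_and_dual[OF j], of y i X]
      by (simp only: tact_pure[OF j pure] tform_pure[OF j rho_simps(1)[OF j pure(1)] pure(2)] lowering.simps) simp
  next
    case (Hs i)
    then show ?thesis using pure x
      by (simp only: tact_pure[OF j pure] tform_pure[OF j pure(1) a_simps(1)[OF pure(2)]] lowering.simps)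
        (simp add: vac_form_simps)
  qed
qed (simp_all only: tact_linear tform_simps, simp_all)

text \<open>Both functionals vanish on lowered vectors, so their agreement on generators
  propagates.\<close>

lemma joint_form:
  assumes k: "k > 0" and j: "j \<le> k" and B: "\<And>z. z \<in> B \<Longrightarrow> fst z \<in> TS j q \<and> finsupp (snd z)"
    and base: "\<And>z. z \<in> B \<Longrightarrow> s * tform j q (fst z) = snd z (ray e)"
    and z: "z \<in> joint j q B"
  shows "s * tform j q (fst z) = snd z (ray e)"
  using z
proof induction
  case (gen_step x u)
  then show ?case using joint_mem[OF j B gen_step(2)]
    by (simp only: pact_sel mem_Collect_eq tform_lowering[OF j] mop_lowering_at_ray[OF k] mult_zero_right)
next
  case (gen_base z)
  then show ?case by (rule base)
next
  case gen_zero
  show "s * tform j q (fst 0) = snd 0 (ray e)"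
    by (simp only: fst_zero snd_zero tform_simps mult_zero_right zero_fun_apply)
next
  case (gen_add u w)
  then show "s * tform j q (fst (u + w)) = snd (u + w) (ray e)"
    by (simp only: fst_add snd_add tform_simps ring_distribs plus_fun_apply)
next
  case (gen_scale u c)
  then show "s * tform j q (fst (psc c u)) = snd (psc c u) (ray e)"
    by (simp only: psc_simps tform_simps fsc_def mult.left_commute)
qed

text \<open>The states paired with zero are stable under all proper letters and have coefficient
  zero at the sea. Moving letters across the contravariant form shows that y is orthogonal to the
  whole of \<open>ray_module\<close>; this module also contains the conjugate of y, so y has norm
  zero.\<close>

lemma joint_unique:
  assumes k: "k > 0" and B: "\<And>z. z \<in> joint j q B \<Longrightarrow> finsupp (snd z)"
    and closed: "\<And>x z. x \<in> proper_letters \<Longrightarrow> z \<in> joint j q B \<Longrightarrow> pact j q x z \<in> joint j q B"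
    and form: "\<And>z. z \<in> joint j q B \<Longrightarrow> s * tform j q (fst z) = snd z (ray e)"
    and y: "(0, y) \<in> joint j q B" "y \<in> ray_module k e"
  shows "y = 0"
proof -
  have "finsupp g \<and> (\<forall>y. (0, y) \<in> joint j q B \<longrightarrow> pairing g y = 0)" if "g \<in> ray_module k e" for g
    using that unfolding ray_module_def
  proof induction
    case (gen_base b)
    have "y (ray e) = 0" if "(0, y) \<in> joint j q B" for y
      using form[OF that] by (simp only: fst_conv snd_conv tform_simps mult_zero_right)
    then show "finsupp b \<and> (\<forall>y. (0, y) \<in> joint j q B \<longrightarrow> pairing b y = 0)"
      using gen_base by (simp only: singleton_iff finsupp_basis pairing_basis) blast
  next
    case (gen_step x u)
    have "pairing (mop k x u) y = 0" if y: "(0, y) \<in> joint j q B" for y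
    proof -
      have "adjoint_letter x \<in> proper_letters" using gen_step(1) by (cases x rule: adjoint_letter.cases) (auto simp: proper_letters_def)
      from closed[OF this y] have "(0, mop k (adjoint_letter x) y) \<in> joint j q B"
        by (simp only: pact_def fst_conv snd_conv tact_linear)
      then show ?thesis using gen_step(3) B[OF y] by (simp only: pairing_mop[OF k] snd_conv)
    qed
    then show "finsupp (mop k x u) \<and> (\<forall>y. (0, y) \<in> joint j q B \<longrightarrow> pairing (mop k x u) y = 0)"
      using finsupp_mop gen_step(3) by blast
  next
    case gen_zero
    show "finsupp 0 \<and> (\<forall>y. (0, y) \<in> joint j q B \<longrightarrow> pairing 0 y = 0)"
      by (simp only: finsupp_zero pairing_zero simp_thms)
  next
    case (gen_add u w)
    then have "pairing (u + w) y = 0" if "(0, y) \<in> joint j q B" for y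
      using pairing_add_left[of u w y] that by fastforce
    then show "finsupp (u + w) \<and> (\<forall>y. (0, y) \<in> joint j q B \<longrightarrow> pairing (u + w) y = 0)"
      using gen_add finsupp_add by blast
  next
    case (gen_scale u c)
    then have "pairing (fsc c u) y = 0" if "(0, y) \<in> joint j q B" for y
      using pairing_fsc_left[of u c y] that by fastforce
    then show "finsupp (fsc c u) \<and> (\<forall>y. (0, y) \<in> joint j q B \<longrightarrow> pairing (fsc c u) y = 0)"
      using gen_scale finsupp_fsc by blast
  qed
  from this[OF ray_module_conj[OF y(2)]] y(1) B[OF y(1)] show ?thesis
    by (auto intro: pairing_conj_eq_zero)
qed

subsection \<open>The correspondence of highest weight vectors\<close>

text \<open>The factor s normalises the sea relative to the vacuum tensor; it changes from one
  vertex operator to the next.\<close>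

definition vacuum_pair :: "nat \<Rightarrow> real \<Rightarrow> int \<Rightarrow> complex \<Rightarrow> ('v, 'h) tensor \<times> fock"
  where "vacuum_pair j q e s = (pt j q (vac j) (v q), fsc s (basis (ray e)))"

abbreviation graph :: "nat \<Rightarrow> real \<Rightarrow> int \<Rightarrow> complex \<Rightarrow> (('v, 'h) tensor \<times> fock) set"
  where "graph j q e s \<equiv> joint j q {vacuum_pair j q e s}"

lemma vac_carrier: "j \<le> k \<Longrightarrow> vac j \<in> \<pi> j"
  by (rule integrable_highest_weight_module.vac_carrier[OF module_H])

lemma v_carrier: "v q \<in> \<H> q"
  by (rule fock_module.v_carrier[OF fock])

lemma vacuum_pair_mem: "j \<le> k \<Longrightarrow> fst (vacuum_pair j q e s) \<in> TS j q \<and> finsupp (snd (vacuum_pair j q e s))"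
  by (simp add: vacuum_pair_def tensor_space_closed vac_carrier v_carrier)

text \<open>Here the two sides have to match: H_0 acts on the sea by its weight and on the vacuum by
  j, and all other non-lowering letters kill both.\<close>

lemma pact_vacuum_pair:
  assumes k: "k > 0" and j: "j \<le> k" and e: "ray_weight k e = j" and x: "x \<in> proper_letters" "\<not> lowering x"
  shows "pact j q x (vacuum_pair j q e s) = psc (if x = Lp H 0 then of_nat j else 0) (vacuum_pair j q e s)"
proof -
  interpret M: integrable_highest_weight_module sv "\<pi> j" "\<rho> j" k j "vac j" by (rule module_H[OF j])
  note m = vac_carrier[OF j] v_carrier
  have "tact j q x (pt j q (vac j) (v q)) = tensor_scale (if x = Lp H 0 then of_nat j else 0) (pt j q (vac j) (v q))"
  proof (cases x)
    case (Lp X i)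
    then have "\<rho> j (Loop X i) (vac j) = sv (if x = Lp H 0 then of_nat j else 0) (vac j)"
      using x M.vac_E[of i] M.vac_H[of i] M.vac_F[of i] M.vac_H0 by (cases X; cases "i = 0") auto
    then show ?thesis unfolding Lp tact_pure[OF j m] using tensor_bilinear(2)[OF m] Lp by simp
  next
    case (Hs i)
    then have "i > 0" using x by (auto simp: proper_letters_def)
    then show ?thesis unfolding Hs tact_pure[OF j m] using fock_module.v_annihilated[OF fock] pt_zero(2)[OF m(1)]
      by (simp add: tensor_scale_def zero_fun_def)
  qed
  moreover have "mop k x (fsc s (basis (ray e))) = fsc (if x = Lp H 0 then of_nat j else 0) (fsc s (basis (ray e)))"
    unfolding mop_linear mop_raising_ray[OF k x] e by (simp add: mult.commute)
  ultimately show ?thesis by (simp only: prod_eq_iff pact_sel psc_simps vacuum_pair_def fst_conv snd_conv simp_thms)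
qed

lemma graph_closed:
  assumes "k > 0" "j \<le> k" "ray_weight k e = j" "x \<in> proper_letters" "z \<in> graph j q e s"
  shows "pact j q x z \<in> graph j q e s"
proof (rule joint_closed[OF assms(1,2) _ _ assms(5,4)])
  fix x z assume "x \<in> proper_letters" "\<not> lowering x" "z \<in> {vacuum_pair j q e s}"
  then show "pact j q x z \<in> graph j q e s"
    by (simp only: singleton_iff pact_vacuum_pair[OF assms(1-3)] simp_thms) (intro gen_scale gen_base singletonI)
qed (use vacuum_pair_mem[OF assms(2)] in auto)

lemma graph_snd: "z \<in> graph j q e s \<Longrightarrow> snd z \<in> ray_module k e"
proof (induction rule: gen.induct)
  case (gen_step x u)
  then show ?case unfolding pact_sel by (intro ray_module_closed(5)) (auto simp: proper_letters_def)
next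
  case (gen_base z)
  then show ?case unfolding singleton_iff by (simp only: vacuum_pair_def snd_conv) (intro ray_module_closed)
next
  case gen_zero
  show "snd 0 \<in> ray_module k e" unfolding snd_zero by (rule ray_module_closed)
next
  case (gen_add u w)
  then show "snd (u + w) \<in> ray_module k e" unfolding snd_add by (intro ray_module_closed)
next
  case (gen_scale u c)
  then show "snd (psc c u) \<in> ray_module k e" unfolding psc_simps by (intro ray_module_closed)
qed

text \<open>Pure tensors are reached from the vacuum by lowering words, with the Heisenberg letters
  applied before the loop letters.\<close>

lemma graph_surj:
  assumes k: "k > 0" and j: "j \<le> k" and e: "ray_weight k e = j" and t: "t \<in> TS j q"
  shows "\<exists>f. (t, f) \<in> graph j q e s"
proof -
  interpret M: integrable_highest_weight_module sv "\<pi> j" "\<rho> j" k j "vac j" by (rule module_H[OF j])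
  interpret F: fock_module sh "\<H> q" "a q" q "v q" by (rule fock)
  let ?D = "fst ` graph j q e s"
  have D0: "0 \<in> ?D" by (rule image_eqI[OF _ gen_zero]) (rule fst_zero[symmetric])
  have D_add: "x + y \<in> ?D" if "x \<in> ?D" "y \<in> ?D" for x y
  proof -
    from that obtain z w where "x = fst z" "z \<in> graph j q e s" "y = fst w" "w \<in> graph j q e s" by blast
    then show ?thesis by (intro image_eqI[OF _ gen_add[of z _ _ _ _ w]]) (simp_all only: fst_add)
  qed
  have D_scale: "tensor_scale c x \<in> ?D" if "x \<in> ?D" for c x
  proof -
    from that obtain z where "x = fst z" "z \<in> graph j q e s" by blast
    then show ?thesis by (intro image_eqI[OF _ gen_scale[of z _ _ _ _ c]]) (simp_all only: psc_simps)
  qed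
  have D_step: "tact j q x t \<in> ?D" if "t \<in> ?D" "lowering x" for t x
  proof -
    from that obtain z where "t = fst z" "z \<in> graph j q e s" by blast
    then show ?thesis using that(2) by (intro image_eqI[OF _ gen_step[of x _ z]]) (simp_all only: pact_sel mem_Collect_eq)
  qed
  have 1: "pt j q (vac j) u \<in> ?D" if "u \<in> \<H> q" for u
    using that
  proof (induction u rule: F.lowering_induct)
    case vac
    show ?case by (rule image_eqI[OF _ gen_base[of "vacuum_pair j q e s"]]) (simp_all add: vacuum_pair_def)
  next
    case zero
    show ?case using D0 by (simp only: pt_zero(2)[OF vac_carrier[OF j]])
  next
    case (add u w)
    then show ?case using D_add by (simp only: tensor_bilinear(3)[OF vac_carrier[OF j]])
  next
    case (scale u c)
    then show ?case using D_scale by (simp only: tensor_bilinear(4)[OF vac_carrier[OF j]])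
  next
    case (step i u)
    have "tact j q (Hs i) (pt j q (vac j) u) \<in> ?D" by (rule D_step[OF step(3)]) (use step(1) in simp)
    then show ?case unfolding tact_pure(2)[OF j vac_carrier[OF j] step(2)] .
  qed
  have 2: "pt j q x u \<in> ?D" if "x \<in> \<pi> j" "u \<in> \<H> q" for x u
    using that(1)
  proof (induction x rule: M.lowering_induct)
    case vac
    show ?case by (rule 1[OF that(2)])
  next
    case zero
    show ?case using D0 by (simp only: pt_zero(1)[OF that(2) j])
  next
    case (add x y)
    then show ?case using D_add that(2) by (simp only: tensor_bilinear(1))
  next
    case (scale x c)
    then show ?case using D_scale that(2) by (simp only: tensor_bilinear(2))
  next
    case (step X i x)
    have "tact j q (Lp X i) (pt j q x u) \<in> ?D" by (rule D_step[OF step(3)]) (use step(1) in simp)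
    then show ?case unfolding tact_pure(1)[OF j step(2) that(2)] .
  qed
  have "t \<in> ?D" using t
  proof (induction t rule: tensor_space_induct)
    case (pure x u)
    then show ?case by (rule 2)
  next
    case zero
    show "0 \<in> ?D" by (rule D0)
  next
    case (add s t)
    show "s + t \<in> ?D" by (rule D_add[OF add(3,4)])
  next
    case (scale c t)
    show "tensor_scale c t \<in> ?D" by (rule D_scale[OF scale(2)])
  qed
  then obtain z where "t = fst z" "z \<in> graph j q e s" by blast
  then show ?thesis by (metis prod.collapse)
qed

end

section \<open>The modes of the combined vertex operators\<close>

lemma Sum_any_sum_list:
  fixes F :: "'a \<Rightarrow> int \<Rightarrow> 'b::comm_monoid_add"
  assumes "\<And>x. x \<in> set xs \<Longrightarrow> finite {m. F x m \<noteq> 0}"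
  shows "finite {m. (\<Sum>x\<leftarrow>xs. F x m) \<noteq> 0} \<and> Sum_any (\<lambda>m. \<Sum>x\<leftarrow>xs. F x m) = (\<Sum>x\<leftarrow>xs. Sum_any (F x))"
  using assms
proof (induction xs)
  case (Cons y xs)
  have "finite {m. F y m \<noteq> 0}" "finite {m. (\<Sum>x\<leftarrow>xs. F x m) \<noteq> 0}" using Cons by auto
  moreover from this have "finite {m. F y m + (\<Sum>x\<leftarrow>xs. F x m) \<noteq> 0}"
    by (rule_tac finite_subset[of _ "{m. F y m \<noteq> 0} \<union> {m. (\<Sum>x\<leftarrow>xs. F x m) \<noteq> 0}"]) auto
  ultimately show ?case using Cons by (simp add: Sum_any.distrib)
qed simp

lemma fin_action_le: "(c, b') \<in> set (fin_action k X b) \<Longrightarrow> b \<le> k \<Longrightarrow> b' \<le> k"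
  by (cases X) (auto split: if_splits)

context vertex_operators
begin

text \<open>On the vacuum a mode of positive index would produce a vector of positive degree. The
  bound is uniform in b because commuting with a loop letter changes b.\<close>

lemma psi_vanish:
  assumes j: "j \<le> k" and x: "x \<in> \<pi> j"
  shows "\<exists>M. \<forall>b\<le>k. \<forall>m\<ge>M. \<psi> j b m x = 0"
proof -
  interpret vector_space sv by (rule vs_sv)
  interpret M: integrable_highest_weight_module sv "\<pi> j" "\<rho> j" k j "vac j" by (rule module_H[OF j])
  have j': "k - j \<le> k" by simp
  interpret M': integrable_highest_weight_module sv "\<pi> (k - j)" "\<rho> (k - j)" k "k - j" "vac (k - j)" by (rule module_H[OF j'])
  show ?thesis using x
  proof (induction x rule: M.lowering_induct)
    case vac
    have "\<psi> j b m (vac j) = 0" if "b \<le> k" "m \<ge> 1" for b m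
    proof (rule M'.deriv_positive)
      show "\<psi> j b m (vac j) \<in> \<pi> (k - j)" by (rule psi_simps(1)[OF j that(1) M.vac_carrier])
      show "\<rho> (k - j) Deriv (\<psi> j b m (vac j)) = sv (of_int m) (\<psi> j b m (vac j))"
        using psi_Deriv[OF j that(1) M.vac_carrier, of m] M.vac_d psi_simps(3)[OF j that(1) M.carrier_closed(1), of m 0]
        by simp
    qed (use that in simp)
    then show ?case by blast
  next
    case zero
    then show ?case using psi_simps(3)[OF j _ M.carrier_closed(1), of _ _ 0] by auto
  next
    case (add x y)
    then obtain M1 M2 where "\<forall>b\<le>k. \<forall>m\<ge>M1. \<psi> j b m x = 0" "\<forall>b\<le>k. \<forall>m\<ge>M2. \<psi> j b m y = 0" by blast
    then have "\<forall>b\<le>k. \<forall>m\<ge>max M1 M2. \<psi> j b m (x + y) = 0" using add(1,2) by (simp add: psi_simps(2)[OF j])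
    then show ?case by blast
  next
    case (scale x c)
    then obtain M1 where "\<forall>b\<le>k. \<forall>m\<ge>M1. \<psi> j b m x = 0" by blast
    then have "\<forall>b\<le>k. \<forall>m\<ge>M1. \<psi> j b m (sv c x) = 0" using scale(1) by (simp add: psi_simps(3)[OF j])
    then show ?case by blast
  next
    case (step X i x)
    then obtain M1 where M1: "\<forall>b\<le>k. \<forall>m\<ge>M1. \<psi> j b m x = 0" by blast
    have "\<psi> j b m (\<rho> j (Loop X i) x) = 0" if "b \<le> k" "m \<ge> M1 + \<bar>i\<bar>" for b m
    proof -
      have "\<psi> j b' (m + i) x = 0" if "(c, b') \<in> set (fin_action k X b)" for c b'
        using M1 fin_action_le[OF that \<open>b \<le> k\<close>] \<open>m \<ge> M1 + \<bar>i\<bar>\<close> by auto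
      then have "map (\<lambda>(c, b'). sv c (\<psi> j b' (m + i) x)) (fin_action k X b) = map (\<lambda>z. 0) (fin_action k X b)"
        by (intro map_cong refl) auto
      then have "(\<Sum>(c, b')\<leftarrow>fin_action k X b. sv c (\<psi> j b' (m + i) x)) = (\<Sum>z\<leftarrow>fin_action k X b. 0)"
        by (rule arg_cong)
      moreover have "\<psi> j b m x = 0" using M1 that by auto
      ultimately show ?thesis using psi_Loop[OF j that(1) step(2), of X i m] M'.action_zero by simp
    qed
    then show ?case by blast
  qed
qed

end

text \<open>
  The hypothesis on \<open>g\<close> says that the expansion of \<open>\<phi>\<^sub>b (z)\<close> on \<open>\<pi>\<^sub>j \<otimes> \<H>\<^sub>q\<close> is in integer powers;
  \<open>g\<close> is then the ground index, the largest \<open>n\<close> with \<open>\<phi>\<^bsub>b,n\<^esub>\<close> nonzero on the vacuum for some \<open>b\<close>.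
\<close>

locale integral_charge = vertex_operators k sv sh \<pi> \<rho> vac bra \<psi> \<H> a v T
  for k :: nat
    and sv :: "complex \<Rightarrow> 'v::ab_group_add \<Rightarrow> 'v" and sh :: "complex \<Rightarrow> 'h::ab_group_add \<Rightarrow> 'h"
    and \<pi> :: "nat \<Rightarrow> 'v set" and \<rho> :: "nat \<Rightarrow> affine_sl2 \<Rightarrow> 'v \<Rightarrow> 'v"
    and vac :: "nat \<Rightarrow> 'v" and bra :: "nat \<Rightarrow> 'v \<Rightarrow> complex"
    and \<psi> :: "nat \<Rightarrow> nat \<Rightarrow> int \<Rightarrow> 'v \<Rightarrow> 'v"
    and \<H> :: "real \<Rightarrow> 'h set" and a :: "real \<Rightarrow> int \<Rightarrow> 'h \<Rightarrow> 'h" and v :: "real \<Rightarrow> 'h"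
    and T :: "real \<Rightarrow> real \<Rightarrow> 'h \<Rightarrow> 'h" +
  fixes j :: nat and q p :: real and g :: int
  assumes k_pos: "k > 0" and j_le: "j \<le> k" and p_def: "p = sqrt (real k / 2)"
    and exponent: "real j / 2 = p * q + of_int g"
begin

abbreviation w :: "int \<Rightarrow> 'h \<Rightarrow> 'h" where "w z \<equiv> w_coeff p q (p * q + of_int z)"

definition phi_term :: "nat \<Rightarrow> int \<Rightarrow> int \<Rightarrow> ('v, 'h) tensor \<Rightarrow> ('v, 'h) tensor"
  where "phi_term b n m = tensor_map sv sh (\<pi> (k - j)) (\<H> (q + p)) (\<psi> j b m) (w (g + m - n))"

lemma phi_eq: "phi j q b n t = Sum_any (\<lambda>m. phi_term b n m t)"
proof -
  have "real j / 2 + of_int m - of_int n = p * q + of_int (g + m - n)" for m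
    using exponent by simp
  then show ?thesis unfolding phi_def Let_def phi_term_def p_def[symmetric] by (simp only:)
qed

lemma phi_term_linear [simp]:
  "phi_term b n m (s + t) = phi_term b n m s + phi_term b n m t"
  "phi_term b n m (tensor_scale c t) = tensor_scale c (phi_term b n m t)"
  "phi_term b n m 0 = 0"
  by (simp_all only: phi_term_def tensor_map_linear)

lemma w_linear: "linear_map_on sh (\<H> q) sh (\<H> (q + p)) (w z)"
  by (simp add: linear_map_on_def w_simps)

lemma phi_term_pure:
  assumes "b \<le> k" "x \<in> \<pi> j" "u \<in> \<H> q"
  shows "phi_term b n m (pt j q x u) = pt (k - j) (q + p) (\<psi> j b m x) (w (g + m - n) u)"
  unfolding phi_term_def by (rule tensor_map_tensor[OF psi_linear[OF j_le assms(1)] w_linear assms(2,3)])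

lemma phi_term_closed:
  assumes "b \<le> k" "t \<in> TS j q" shows "phi_term b n m t \<in> TS (k - j) (q + p)"
  using assms(2)
proof (induction t rule: tensor_space_induct)
  case (pure x u)
  then show ?case unfolding phi_term_pure[OF assms(1) pure]
    by (intro tensor_space_closed psi_simps(1)[OF j_le assms(1)] w_simps)
qed (simp_all only: phi_term_linear tensor_space_closed)

text \<open>The index m is bounded above by \<open>psi_vanish\<close> and below by
  \<open>w_coeff_bounded\<close>.\<close>

lemma phi_term_finite:
  assumes "b \<le> k" "t \<in> TS j q" shows "finite {m. phi_term b n m t \<noteq> 0}"
  using assms(2)
proof (induction t rule: tensor_space_induct)
  case (pure x u)
  obtain M where M: "\<forall>b\<le>k. \<forall>m\<ge>M. \<psi> j b m x = 0" using psi_vanish[OF j_le pure(1)] by blast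
  obtain B where B: "\<forall>z<B. w z u = 0" using w_coeff_bounded[OF pure(2)] by blast
  have "m \<in> {B + n - g..<M}" if "phi_term b n m (pt j q x u) \<noteq> 0" for m
  proof -
    have "\<psi> j b m x \<noteq> 0" "w (g + m - n) u \<noteq> 0"
      using that unfolding phi_term_pure[OF assms(1) pure]
      using pt_zero(1)[OF w_simps(1)[OF pure(2)] diff_le_self] pt_zero(2)[OF psi_simps(1)[OF j_le assms(1) pure(1)]]
      by metis+
    moreover have "m < M" using M assms(1) calculation(1) by (meson not_le)
    moreover have "\<not> g + m - n < B" using B calculation(2) by blast
    ultimately show ?thesis by auto
  qed
  then show ?case by (intro finite_subset[of "{m. phi_term b n m (pt j q x u) \<noteq> 0}" "{B + n - g..<M}"]) auto
next
  case zero
  show ?case unfolding phi_term_linear by simp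
next
  case (add s t)
  have "{m. phi_term b n m (s + t) \<noteq> 0} \<subseteq> {m. phi_term b n m s \<noteq> 0} \<union> {m. phi_term b n m t \<noteq> 0}"
    unfolding phi_term_linear by (auto simp only: mem_Collect_eq Un_iff add_0_left)
  then show ?case using add(3,4) by (rule finite_subset[OF _ finite_UnI])
next
  case (scale c t)
  have "{m. phi_term b n m (tensor_scale c t) \<noteq> 0} \<subseteq> {m. phi_term b n m t \<noteq> 0}"
    unfolding phi_term_linear by (auto simp only: mem_Collect_eq tensor.scale_zero_right)
  then show ?case using scale(2) by (rule finite_subset)
qed

lemma phi_linear:
  assumes "b \<le> k"
  shows "s \<in> TS j q \<Longrightarrow> t \<in> TS j q \<Longrightarrow> phi j q b n (s + t) = phi j q b n s + phi j q b n t"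
    "t \<in> TS j q \<Longrightarrow> phi j q b n (tensor_scale c t) = tensor_scale c (phi j q b n t)"
    "phi j q b n 0 = 0"
proof -
  show "s \<in> TS j q \<Longrightarrow> t \<in> TS j q \<Longrightarrow> phi j q b n (s + t) = phi j q b n s + phi j q b n t"
    unfolding phi_eq phi_term_linear by (intro Sum_any.distrib phi_term_finite assms)
  show "t \<in> TS j q \<Longrightarrow> phi j q b n (tensor_scale c t) = tensor_scale c (phi j q b n t)"
    unfolding phi_eq phi_term_linear
    by (rule Sum_any_additive[of "tensor_scale c", symmetric])
      (simp_all only: tensor.scale_zero_right tensor.scale_right_distrib phi_term_finite[OF assms])
  show "phi j q b n 0 = 0" unfolding phi_eq phi_term_linear by simp
qed

lemma phi_closed: "b \<le> k \<Longrightarrow> t \<in> TS j q \<Longrightarrow> phi j q b n t \<in> TS (k - j) (q + p)"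
  unfolding phi_eq Sum_any.expand_set by (intro tensor_space_sum phi_term_closed)

lemma tact_phi:
  assumes "b \<le> k" "t \<in> TS j q"
  shows "tact (k - j) (q + p) x (phi j q b n t) = Sum_any (\<lambda>m. tact (k - j) (q + p) x (phi_term b n m t))"
  unfolding phi_eq
  by (rule Sum_any_additive[of "tact (k - j) (q + p) x"]) (simp_all only: tact_linear phi_term_finite[OF assms])

text \<open>Replacing n and m by n + i and m + i leaves \<open>g + m - n\<close> unchanged, so the
  bosonic factor is not affected and the relation is that of \<psi>.\<close>

lemma loop_phi:
  assumes b: "b \<le> k" and t: "t \<in> TS j q"
  shows "tact (k - j) (q + p) (Lp X i) (phi j q b n t) = phi j q b n (tact j q (Lp X i) t) +
    (\<Sum>(c, b')\<leftarrow>fin_action k X b. tensor_scale c (phi j q b' (n + i) t))"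
proof -
  let ?j = "k - j" and ?q = "q + p"
  have j': "?j \<le> k" by simp
  interpret vector_space sv by (rule vs_sv)
  have term_eq: "tact ?j ?q (Lp X i) (phi_term b n m t) = phi_term b n m (tact j q (Lp X i) t) +
    (\<Sum>(c, b')\<leftarrow>fin_action k X b. tensor_scale c (phi_term b' (n + i) (m + i) t))" for m
    using t
  proof (induction t rule: tensor_space_induct)
    case (pure x u)
    let ?w = "w (g + m - n) u"
    have w: "?w \<in> \<H> ?q" using w_simps(1)[OF pure(2)] .
    have ps: "\<psi> j b' m' x \<in> \<pi> ?j" if "b' \<le> k" for b' m' using psi_simps(1)[OF j_le that pure(1)] .
    have "\<rho> ?j (Loop X i) (\<psi> j b m x) = \<psi> j b m (\<rho> j (Loop X i) x) +
      (\<Sum>(c, b')\<leftarrow>fin_action k X b. sv c (\<psi> j b' (m + i) x))"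
      using psi_Loop[OF j_le b pure(1), of X i m] by (simp add: algebra_simps)
    moreover have "(\<Sum>(c, b')\<leftarrow>fin_action k X b. sv c (\<psi> j b' (m + i) x)) \<in> \<pi> ?j \<and>
      pt ?j ?q (\<Sum>(c, b')\<leftarrow>fin_action k X b. sv c (\<psi> j b' (m + i) x)) ?w =
      (\<Sum>(c, b')\<leftarrow>fin_action k X b. tensor_scale c (pt ?j ?q (\<psi> j b' (m + i) x) ?w))"
      by (rule pt_sum_list[OF j' w]) (auto intro: ps fin_action_le[OF _ b])
    moreover have "map (\<lambda>(c, b'). tensor_scale c (pt ?j ?q (\<psi> j b' (m + i) x) ?w)) (fin_action k X b) =
      map (\<lambda>(c, b'). tensor_scale c (phi_term b' (n + i) (m + i) (pt j q x u))) (fin_action k X b)"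
    proof (rule map_cong[OF refl])
      fix z assume "z \<in> set (fin_action k X b)"
      moreover obtain c b' where z: "z = (c, b')" by (cases z)
      ultimately have "b' \<le> k" using fin_action_le[OF _ b] by blast
      have "g + (m + i) - (n + i) = g + m - n" by simp
      then show "(case z of (c, b') \<Rightarrow> tensor_scale c (pt ?j ?q (\<psi> j b' (m + i) x) ?w)) =
        (case z of (c, b') \<Rightarrow> tensor_scale c (phi_term b' (n + i) (m + i) (pt j q x u)))"
        unfolding z prod.case phi_term_pure[OF \<open>b' \<le> k\<close> pure] by (simp only:)
    qed
    moreover have rx: "\<rho> j (Loop X i) x \<in> \<pi> j" by (rule rho_simps(1)[OF j_le pure(1)])
    ultimately show ?case
      by (simp only: phi_term_pure[OF b pure] tact_pure[OF j_le pure] tact_pure[OF j' ps[OF b] w]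
          phi_term_pure[OF b rx pure(2)] tensor_bilinear(1)[OF psi_simps(1)[OF j_le b rx] _ w])
  next
    case zero
    have "(\<Sum>(c, b')\<leftarrow>xs. 0 :: ('v, 'h) tensor) = 0" for xs :: "(complex \<times> nat) list"
      unfolding case_prod_beta' by (induction xs) auto
    then show ?case by (simp only: tact_linear phi_term_linear tensor.scale_zero_right add_0_left)
  next
    case (add s t)
    then show ?case
      by (simp only: tact_linear phi_term_linear tensor.scale_right_distrib case_prod_beta' sum_list_addf ac_simps)
  next
    case (scale d t)
    have ts: "(\<Sum>x\<leftarrow>xs. tensor_scale d (f x)) = tensor_scale d (\<Sum>x\<leftarrow>xs. f x)" for f :: "_ \<Rightarrow> ('v, 'h) tensor" and xs :: "(complex \<times> nat) list"
    proof (induction xs)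
      case (Cons y xs)
      then show "(\<Sum>x\<leftarrow>y # xs. tensor_scale d (f x)) = tensor_scale d (\<Sum>x\<leftarrow>y # xs. f x)"
        by (simp only: list.map sum_list.Cons tensor.scale_right_distrib)
    qed (simp only: list.map sum_list.Nil tensor.scale_zero_right)
    have "(\<Sum>(c, b')\<leftarrow>xs. tensor_scale c (tensor_scale d (f b'))) = tensor_scale d (\<Sum>(c, b')\<leftarrow>xs. tensor_scale c (f b'))"
      for f :: "_ \<Rightarrow> ('v, 'h) tensor" and xs :: "(complex \<times> nat) list"
      unfolding case_prod_beta' ts[symmetric] by (simp only: tensor.scale_left_commute)
    then show ?case
      by (simp only: tact_linear phi_term_linear scale(2) tensor.scale_right_distrib)
  qed
  have fin: "finite {m. (case z of (c, b') \<Rightarrow> tensor_scale c (phi_term b' (n + i) (m + i) t)) \<noteq> 0}"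
    if "z \<in> set (fin_action k X b)" for z
  proof -
    obtain c b' where z: "z = (c, b')" by (cases z)
    have "b' \<le> k" using fin_action_le[OF _ b] that z by blast
    have "finite ((\<lambda>m. m - i) ` {m. phi_term b' (n + i) m t \<noteq> 0})"
      by (intro finite_imageI phi_term_finite[OF \<open>b' \<le> k\<close> t])
    moreover have "{m. (case z of (c, b') \<Rightarrow> tensor_scale c (phi_term b' (n + i) (m + i) t)) \<noteq> 0} \<subseteq>
      (\<lambda>m. m - i) ` {m. phi_term b' (n + i) m t \<noteq> 0}"
    proof
      fix m assume "m \<in> {m. (case z of (c, b') \<Rightarrow> tensor_scale c (phi_term b' (n + i) (m + i) t)) \<noteq> 0}"
      then have "phi_term b' (n + i) (m + i) t \<noteq> 0" using z by (auto simp only: mem_Collect_eq prod.case tensor.scale_zero_right)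
      then show "m \<in> (\<lambda>m. m - i) ` {m. phi_term b' (n + i) m t \<noteq> 0}" by (intro image_eqI[of _ _ "m + i"]) auto
    qed
    ultimately show ?thesis by (rule finite_subset[rotated])
  qed
  note F = Sum_any_sum_list[OF fin, of "fin_action k X b", simplified]
  have sc: "Sum_any (\<lambda>m. tensor_scale c (phi_term b' (n + i) (m + i) t)) = tensor_scale c (phi j q b' (n + i) t)"
    if "(c, b') \<in> set (fin_action k X b)" for c b'
  proof -
    have "b' \<le> k" using fin_action_le[OF that b] .
    have "Sum_any (\<lambda>m. tensor_scale c (phi_term b' (n + i) (m + i) t)) =
      Sum_any (\<lambda>m. tensor_scale c (phi_term b' (n + i) m t))"
      by (rule Sum_any_shift)
    also have "\<dots> = tensor_scale c (phi j q b' (n + i) t)"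
      unfolding phi_eq by (rule Sum_any_additive[of "tensor_scale c", symmetric])
        (simp_all only: tensor.scale_zero_right tensor.scale_right_distrib phi_term_finite[OF \<open>b' \<le> k\<close> t])
    finally show ?thesis .
  qed
  have "tact ?j ?q (Lp X i) (phi j q b n t) = Sum_any (\<lambda>m. phi_term b n m (tact j q (Lp X i) t) +
    (\<Sum>(c, b')\<leftarrow>fin_action k X b. tensor_scale c (phi_term b' (n + i) (m + i) t)))"
    unfolding tact_phi[OF b t] term_eq ..
  also have "\<dots> = phi j q b n (tact j q (Lp X i) t) +
    Sum_any (\<lambda>m. \<Sum>z\<leftarrow>fin_action k X b. case z of (c, b') \<Rightarrow> tensor_scale c (phi_term b' (n + i) (m + i) t))"
    unfolding phi_eq using fin
    by (intro Sum_any.distrib phi_term_finite[OF b tact_closed[OF j_le t]] conjunct1[OF Sum_any_sum_list])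
  also have "Sum_any (\<lambda>m. \<Sum>z\<leftarrow>fin_action k X b. case z of (c, b') \<Rightarrow> tensor_scale c (phi_term b' (n + i) (m + i) t)) =
    (\<Sum>z\<leftarrow>fin_action k X b. Sum_any (\<lambda>m. case z of (c, b') \<Rightarrow> tensor_scale c (phi_term b' (n + i) (m + i) t)))"
    using fin by (intro conjunct2[OF Sum_any_sum_list])
  also have "map (\<lambda>z. Sum_any (\<lambda>m. case z of (c, b') \<Rightarrow> tensor_scale c (phi_term b' (n + i) (m + i) t))) (fin_action k X b) =
    map (\<lambda>(c, b'). tensor_scale c (phi j q b' (n + i) t)) (fin_action k X b)"
    by (rule map_cong[OF refl]) (use sc in auto)
  finally show ?thesis .
qed

lemma heisenberg_phi:
  assumes b: "b \<le> k" and t: "t \<in> TS j q" and i: "i \<noteq> 0"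
  shows "tact (k - j) (q + p) (Hs i) (phi j q b n t) =
    phi j q b n (tact j q (Hs i) t) + tensor_scale (of_real p) (phi j q b (n + i) t)"
proof -
  let ?j = "k - j" and ?q = "q + p"
  have j': "?j \<le> k" by simp
  have term_eq: "tact ?j ?q (Hs i) (phi_term b n m t) = phi_term b n m (tact j q (Hs i) t) +
    tensor_scale (of_real p) (phi_term b (n + i) m t)" for m
    using t
  proof (induction t rule: tensor_space_induct)
    case (pure x u)
    have ps: "\<psi> j b m x \<in> \<pi> ?j" using psi_simps(1)[OF j_le b pure(1)] .
    have w: "w z u \<in> \<H> ?q" for z using w_simps(1)[OF pure(2)] .
    have au: "a q i u \<in> \<H> q" by (rule a_simps(1)[OF pure(2)])
    have e: "g + m - n - i = g + m - (n + i)" by simp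
    have "a ?q i (w (g + m - n) u) = w (g + m - n) (a q i u) + sh (of_real p) (w (g + m - (n + i)) u)"
      using w_coeff_commute[OF pure(2) i, of p "g + m - n"] unfolding e .
    then show ?case
      by (simp only: phi_term_pure[OF b pure] tact_pure[OF j_le pure] tact_pure[OF j' ps w]
          phi_term_pure[OF b pure(1) au] tensor_bilinear(3)[OF ps w_simps(1)[OF au] H_closed(3)[OF w]]
          tensor_bilinear(4)[OF ps w])
  next
    case zero
    then show ?case by (simp only: tact_linear phi_term_linear tensor.scale_zero_right add_0_left)
  next
    case (add s t)
    then show ?case by (simp only: tact_linear phi_term_linear tensor.scale_right_distrib ac_simps)
  next
    case (scale d t)
    then show ?case
      by (simp only: tact_linear phi_term_linear tensor.scale_right_distrib tensor.scale_left_commute)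
  qed
  have fin: "finite {m. tensor_scale (of_real p) (phi_term b (n + i) m t) \<noteq> 0}"
    using phi_term_finite[OF b t, of "n + i"]
    by (rule finite_subset[rotated]) (auto simp only: mem_Collect_eq tensor.scale_zero_right)
  show ?thesis
    unfolding tact_phi[OF b t] term_eq
    unfolding Sum_any.distrib[OF phi_term_finite[OF b tact_closed[OF j_le t]] fin] phi_eq
    by (rule arg_cong2[of _ _ _ _ plus, OF refl], rule Sum_any_additive[of "tensor_scale (of_real p)", symmetric])
      (simp_all only: tensor.scale_zero_right tensor.scale_right_distrib phi_term_finite[OF b t])
qed

section \<open>Matrix elements between highest weight vectors\<close>

lemma H0_psi_vac:
  assumes b: "b \<le> k"
  shows "\<rho> (k - j) (Loop H 0) (\<psi> j b m (vac j)) = sv (of_nat j + (of_nat k - 2 * of_nat b)) (\<psi> j b m (vac j))"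
proof -
  interpret vector_space sv by (rule vs_sv)
  interpret M: integrable_highest_weight_module sv "\<pi> j" "\<rho> j" k j "vac j" by (rule module_H[OF j_le])
  note x = vac_carrier[OF j_le]
  show ?thesis
    using psi_Loop[OF j_le b x, of H 0 m] M.vac_H0 psi_simps(3)[OF j_le b x, of m "of_nat j"]
    by (simp add: algebra_simps)
qed

text \<open>For \<open>b \<noteq> j\<close> the two evaluations of H_0 between the vacua give
  different weights. For b = j the normalisation leaves m = 0, and the bosonic vacuum coefficient
  then forces n = g.\<close>

lemma tform_phi_vacuum:
  assumes b: "b \<le> k"
  shows "tform (k - j) (q + p) (phi j q b n (pt j q (vac j) (v q))) = (if b = j \<and> n = g then 1 else 0)"
proof -
  let ?j = "k - j" and ?q = "q + p"
  have j': "?j \<le> k" by simp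
  interpret vector_space sv by (rule vs_sv)
  interpret M: integrable_highest_weight_module sv "\<pi> j" "\<rho> j" k j "vac j" by (rule module_H[OF j_le])
  interpret D: dual_vacuum sv "\<pi> ?j" "\<rho> ?j" k ?j "vac ?j" "bra ?j" by (rule module_and_dual[OF j'])
  note x = vac_carrier[OF j_le] and u = v_carrier
  have ps: "\<psi> j b m (vac j) \<in> \<pi> ?j" for m by (rule psi_simps(1)[OF j_le b x])
  have bra: "bra ?j (\<psi> j b m (vac j)) = (if b = j \<and> m = 0 then 1 else 0)" for m
  proof (cases "b = j")
    case True
    then show ?thesis using psi_normalised[OF j_le] by simp
  next
    case False
    have ofd: "(of_nat ?j :: complex) = of_nat k - of_nat j" using j_le by (rule of_nat_diff)
    let ?B = "bra ?j (\<psi> j b m (vac j))"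
    have "of_nat ?j * ?B = (of_nat j + (of_nat k - 2 * of_nat b)) * ?B"
      unfolding D.bra_H0[OF ps, symmetric] H0_psi_vac[OF b] D.bra_simps(3)[OF ps] ..
    then have "2 * ((of_nat j - of_nat b) * ?B) = 0" unfolding ofd by algebra
    then show ?thesis using False by simp
  qed
  have "tform ?j ?q (phi j q b n (pt j q (vac j) (v q))) =
    Sum_any (\<lambda>m. tform ?j ?q (phi_term b n m (pt j q (vac j) (v q))))"
    unfolding phi_eq
    by (rule Sum_any_additive[of "tform ?j ?q"]) (simp_all only: tform_simps phi_term_finite[OF b tensor_space_closed(4)[OF x u]])
  also have "(\<lambda>m. tform ?j ?q (phi_term b n m (pt j q (vac j) (v q)))) =
    (\<lambda>m. if m = 0 then (if b = j \<and> n = g then 1 else 0) else 0)"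
  proof
    fix m
    show "tform ?j ?q (phi_term b n m (pt j q (vac j) (v q))) = (if m = 0 then (if b = j \<and> n = g then 1 else 0) else 0)"
      unfolding phi_term_pure[OF b x u] tform_pure[OF j' ps w_simps(1)[OF u]]
      unfolding w_coeff_v vac_form_creation bra
      by auto
  qed
  also have "Sum_any \<dots> = (if b = j \<and> n = g then 1 else 0)"
    by (subst Sum_any.expand_superset[of "{0}"]) auto
  finally show ?thesis .
qed

text \<open>Positive m is excluded by the degree of the \<psi> mode and negative m by the bosonic
  factor. For m = 0 the vector has degree 0 and weight \<open>k - j\<close>, so
  \<open>top_vector\<close> and the normalisation identify it.\<close>

lemma phi_ground: "phi j q j g (pt j q (vac j) (v q)) = pt (k - j) (q + p) (vac (k - j)) (v (q + p))"
proof -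
  let ?j = "k - j" and ?q = "q + p"
  have j': "?j \<le> k" by simp
  interpret vector_space sv by (rule vs_sv)
  interpret M: integrable_highest_weight_module sv "\<pi> j" "\<rho> j" k j "vac j" by (rule module_H[OF j_le])
  interpret D: dual_vacuum sv "\<pi> ?j" "\<rho> ?j" k ?j "vac ?j" "bra ?j" by (rule module_and_dual[OF j'])
  note x = vac_carrier[OF j_le] and u = v_carrier
  have ps: "\<psi> j j m (vac j) \<in> \<pi> ?j" for m by (rule psi_simps(1)[OF j_le j_le x])
  have deriv: "\<rho> ?j Deriv (\<psi> j j m (vac j)) = sv (of_int m) (\<psi> j j m (vac j))" for m
    using psi_Deriv[OF j_le j_le x, of m] M.vac_d psi_simps(3)[OF j_le j_le M.carrier_closed(1), of m 0] by simp
  have pos: "\<psi> j j m (vac j) = 0" if "m > 0" for m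
    using D.deriv_positive[OF ps deriv that] .
  have zero: "\<psi> j j 0 (vac j) = vac ?j"
  proof -
    have "of_nat j + (of_nat k - 2 * of_nat j) = (of_nat ?j :: complex)" using j_le by (simp add: of_nat_diff)
    then have "\<rho> ?j (Loop H 0) (\<psi> j j 0 (vac j)) = sv (of_nat ?j) (\<psi> j j 0 (vac j))"
      using H0_psi_vac[OF j_le, of 0] by (simp only:)
    moreover have "\<rho> ?j Deriv (\<psi> j j 0 (vac j)) = 0" using deriv[of 0] by simp
    ultimately obtain c where c: "\<psi> j j 0 (vac j) = sv c (vac ?j)" using D.top_vector[OF ps] by blast
    moreover have "c = 1"
      using psi_normalised[OF j_le, of 0] D.bra_simps(3)[OF D.vac_carrier] D.bra_vac unfolding c by simp
    ultimately show ?thesis by simp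
  qed
  have "phi_term j g m (pt j q (vac j) (v q)) = (if m = 0 then pt ?j ?q (vac ?j) (v ?q) else 0)" for m
  proof -
    have e: "g + m - g = m" by simp
    have w: "w m (v q) \<in> \<H> ?q" by (rule w_simps(1)[OF u])
    consider "m > 0" | "m = 0" | "m < 0" by linarith
    then show ?thesis unfolding phi_term_pure[OF j_le x u] e
    proof cases
      case 1
      then show "pt ?j ?q (\<psi> j j m (vac j)) (w m (v q)) = (if m = 0 then pt ?j ?q (vac ?j) (v ?q) else 0)"
        using pos pt_zero(1)[OF w j'] by simp
    next
      case 2
      then show "pt ?j ?q (\<psi> j j m (vac j)) (w m (v q)) = (if m = 0 then pt ?j ?q (vac ?j) (v ?q) else 0)"
        using zero by (simp only: w_coeff_v creation_int_0 simp_thms if_True)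
    next
      case 3
      then show "pt ?j ?q (\<psi> j j m (vac j)) (w m (v q)) = (if m = 0 then pt ?j ?q (vac ?j) (v ?q) else 0)"
        using pt_zero(2)[OF ps] by (simp add: w_coeff_v creation_int_def)
    qed
  qed
  then have "phi j q j g (pt j q (vac j) (v q)) = Sum_any (\<lambda>m::int. if m = 0 then pt ?j ?q (vac ?j) (v ?q) else 0)"
    unfolding phi_eq by (simp only:)
  also have "\<dots> = pt ?j ?q (vac ?j) (v ?q)"
    by (subst Sum_any.expand_superset[of "{0}"]) auto
  finally show ?thesis .
qed

end

section \<open>Modes on corresponding vectors\<close>

lemma sum_div_window:
  fixes G :: "int \<Rightarrow> int"
  assumes k: "k > 0" and r: "r \<le> k"
  shows "(\<Sum>\<nu>\<in>{int k * t - int r - int k..<int k * t - int r}. G (\<nu> div int k)) =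
    int r * G (t - 2) + int (k - r) * G (t - 1)"
proof -
  let ?b = "int k * (t - 1)"
  have split: "{int k * t - int r - int k..<int k * t - int r} = {?b - int r..<?b} \<union> {?b..<?b + int (k - r)}"
    using r by (auto simp: algebra_simps of_nat_diff)
  have "(\<Sum>\<nu>\<in>{?b - int r..<?b}. G (\<nu> div int k)) = (\<Sum>\<nu>\<in>{?b - int r..<?b}. G (t - 2))"
  proof (intro sum.cong refl arg_cong[of _ _ G])
    fix \<nu> assume "\<nu> \<in> {?b - int r..<?b}"
    then show "\<nu> div int k = t - 2" using r k
      by (intro int_div_pos_eq[of _ _ _ "\<nu> - int k * (t - 2)"]) (auto simp: algebra_simps)
  qed
  moreover have "(\<Sum>\<nu>\<in>{?b..<?b + int (k - r)}. G (\<nu> div int k)) = (\<Sum>\<nu>\<in>{?b..<?b + int (k - r)}. G (t - 1))"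
  proof (intro sum.cong refl arg_cong[of _ _ G])
    fix \<nu> assume "\<nu> \<in> {?b..<?b + int (k - r)}"
    then show "\<nu> div int k = t - 1" using r k
      by (intro int_div_pos_eq[of _ _ _ "\<nu> - int k * (t - 1)"]) (auto simp: algebra_simps of_nat_diff)
  qed
  ultimately show ?thesis unfolding split by (subst sum.union_disjoint) auto
qed

text \<open>The seas \<open>ray (k t - r)\<close> are the fermionic ground states: their weights,
  and by the next lemma their window energies, follow the ground path.\<close>

lemma ray_weight_ground:
  assumes "k > 0" "r \<le> k"
  shows "ray_weight k (int k * int t - int r) = fst (ground_path k r l t)"
proof -
  have "int (ray_weight k (int k * int t - int r)) = int (fst (ground_path k r l t))"
    unfolding ray_weight_spin sum_div_window[OF assms]
    by (auto simp: ground_path_def spin_down_def)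
  then show ?thesis by simp
qed

lemma window_energy_ground:
  assumes "k > 0" "r \<le> k"
  shows "window_energy k (int k * int t - int r) = snd (ground_path k r l t) + (l - int k)"
proof (cases "even t")
  case True
  then obtain u where "t = 2 * u" by blast
  moreover have "(2 * int u - 1) div 2 = int u - 1" by simp
  ultimately show ?thesis unfolding window_energy_def sum_div_window[OF assms, where G = "\<lambda>N. N div 2"]
    using assms by (simp add: ground_path_def of_nat_diff) (simp add: algebra_simps)
next
  case False
  then obtain u where "t = 2 * u + 1" using oddE by blast
  moreover have "(2 + int u * 2) * int k div 2 = (1 + int u) * int k"
    using nonzero_mult_div_cancel_left[of 2 "(1 + int u) * int k"] by (simp add: algebra_simps)
  moreover have "(2 * int u - 1) div 2 = int u - 1" by simp
  ultimately show ?thesis unfolding window_energy_def sum_div_window[OF assms, where G = "\<lambda>N. N div 2"]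
    using assms by (simp add: ground_path_def of_nat_diff) (simp add: algebra_simps)
qed

lemma gen_fin_action:
  assumes "b \<le> k" "\<And>b'. b' \<le> k \<Longrightarrow> f b' \<in> gen sc P L B"
  shows "(\<Sum>(c, b')\<leftarrow>fin_action k X b. sc c (f b')) \<in> gen sc P L B"
proof (rule gen_sum_list)
  fix z assume "z \<in> set (fin_action k X b)"
  moreover obtain c b' where z: "z = (c, b')" by (cases z)
  ultimately have "b' \<le> k" using fin_action_le[OF _ assms(1)] by blast
  then show "(case z of (c, b') \<Rightarrow> sc c (f b')) \<in> gen sc P L B"
    unfolding z prod.case by (intro gen_scale assms(2))
qed

context integral_charge
begin

definition pmap :: "int \<Rightarrow> nat \<Rightarrow> int \<Rightarrow> ('v, 'h) tensor \<times> fock \<Rightarrow> ('v, 'h) tensor \<times> fock"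
  where "pmap d b n z = (phi j q b n (fst z), cur k k (int b) (n + d) (snd z))"

lemma pmap_sel [simp]: "fst (pmap d b n z) = phi j q b n (fst z)" "snd (pmap d b n z) = cur k k (int b) (n + d) (snd z)"
  by (simp_all add: pmap_def)

lemma pmap_linear:
  assumes "b \<le> k"
  shows "fst y \<in> TS j q \<Longrightarrow> fst z \<in> TS j q \<Longrightarrow> pmap d b n (y + z) = pmap d b n y + pmap d b n z"
    "fst z \<in> TS j q \<Longrightarrow> pmap d b n (psc c z) = psc c (pmap d b n z)"
    "pmap d b n 0 = 0"
  by (simp_all only: prod_eq_iff pmap_sel fst_add snd_add fst_zero snd_zero psc_simps phi_linear[OF assms]
      cur_add[OF order_refl] cur_fsc cur_zero simp_thms)

lemma pact_pmap_Lp: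
  assumes b: "b \<le> k" and z: "fst z \<in> TS j q"
  shows "pact (k - j) (q + p) (Lp X i) (pmap d b n z) =
    pmap d b n (pact j q (Lp X i) z) + (\<Sum>(c, b')\<leftarrow>fin_action k X b. psc c (pmap d b' (n + i) z))"
proof -
  have "snd (\<Sum>(c, b')\<leftarrow>fin_action k X b. psc c (pmap d b' (n + i) z)) =
    (\<Sum>(c, b')\<leftarrow>fin_action k X b. fsc c (cur k k (int b') (n + i + d) (snd z)))"
    by (simp only: snd_sum_list case_prod_beta' psc_simps pmap_sel)
  also have "\<dots> = fsc (spin_factor X k (int b)) (cur k k (int b - sl2_step X) (n + d + i) (snd z))"
    unfolding fin_action_cur[OF b] by (simp only: ac_simps)
  finally have 2: "snd (\<Sum>(c, b')\<leftarrow>fin_action k X b. psc c (pmap d b' (n + i) z)) =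
    fsc (spin_factor X k (int b)) (cur k k (int b - sl2_step X) (n + d + i) (snd z))" .
  have 1: "fst (\<Sum>(c, b')\<leftarrow>fin_action k X b. psc c (pmap d b' (n + i) z)) =
    (\<Sum>(c, b')\<leftarrow>fin_action k X b. tensor_scale c (phi j q b' (n + i) (fst z)))"
    by (simp only: fst_sum_list case_prod_beta' psc_simps pmap_sel)
  show ?thesis
    unfolding prod_eq_iff fst_add snd_add 1 2 pact_sel pmap_sel loop_phi[OF b z] loop_cur by (simp only: simp_thms)
qed

lemma pact_pmap_Hs:
  assumes "b \<le> k" "fst z \<in> TS j q" "i \<noteq> 0"
  shows "pact (k - j) (q + p) (Hs i) (pmap d b n z) =
    pmap d b n (pact j q (Hs i) z) + psc (of_real p) (pmap d b (n + i) z)"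
proof -
  have e: "n + d + i = n + i + d" by simp
  show ?thesis
    unfolding prod_eq_iff fst_add snd_add pact_sel pmap_sel psc_simps heisenberg_phi[OF assms]
      heisenberg_cur[OF k_pos, folded p_def] e by (simp only: simp_thms)
qed

text \<open>
  The images of the vacuum pair under the modes are adjoined to the vacuum pair of the target:
  the uniqueness statement, applied to the enlarged set of words, shows that they belong to the
  correspondence already.
\<close>

lemma graph_step:
  assumes e: "ray_weight k e = j" "ray_weight k (e - int k) = k - j" "g + d = window_energy k e"
    and s: "s \<noteq> 0"
  shows "\<exists>s'. s' \<noteq> 0 \<and> (\<forall>b n z. b \<le> k \<longrightarrow> z \<in> graph j q e s \<longrightarrow>
    pmap d b n z \<in> graph (k - j) (q + p) (e - int k) s')"
proof -
  \<comment> \<open>The coefficient of the next sea in the image under the ground mode, nonzero by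
    \<open>cur_ray_at_ray\<close>. All other modes give zero on both sides, so this one scalar makes
    the functionals agree on all generators.\<close>
  define s' where "s' = s * cur k k (int j) (g + d) (basis (ray e)) (ray (e - int k))"
  let ?j = "k - j" and ?q = "q + p" and ?e = "e - int k"
  let ?v = "vacuum_pair j q e s" and ?v' = "vacuum_pair ?j ?q ?e s'"
  let ?B = "insert ?v' {pmap d b n ?v |b n. b \<le> k}"
  let ?G = "joint ?j ?q ?B"
  have j': "?j \<le> k" by simp
  have s'0: "s' \<noteq> 0" using s e(1,3) cur_ray_at_ray[OF k_pos, of "int j" "g + d" e] by (simp add: s'_def)
  have v: "fst ?v \<in> TS j q" "finsupp (snd ?v)" using vacuum_pair_mem[OF j_le] by blast+
  have cur_mem: "cur k k (int b) m (snd ?v) \<in> ray_module k ?e" for b m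
    unfolding vacuum_pair_def snd_conv cur_fsc by (intro ray_module_closed(4) cur_ray_mem k_pos)
  have B: "fst z \<in> TS ?j ?q \<and> finsupp (snd z)" if "z \<in> ?B" for z
  proof -
    from that consider "z = ?v'" | b n where "b \<le> k" "z = pmap d b n ?v" by blast
    then show ?thesis
    proof cases
      case 1
      then show ?thesis using vacuum_pair_mem[OF j'] by (simp only:)
    next
      case 2
      then show ?thesis using phi_closed[OF 2(1) v(1)] ray_module_finsupp[OF cur_mem[of b "n + d"]]
        by (simp only: pmap_sel simp_thms)
    qed
  qed
  have pm: "pmap d b n ?v \<in> ?G" if "b \<le> k" for b n by (rule gen_base) (use that in blast)
  have base: "pact ?j ?q x z \<in> ?G" if x: "x \<in> proper_letters" "\<not> lowering x" and z: "z \<in> ?B" for x z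
  proof -
    from z consider "z = ?v'" | b n where "b \<le> k" "z = pmap d b n ?v" by blast
    then show ?thesis
    proof cases
      case 1
      have "psc c ?v' \<in> ?G" for c by (intro gen_scale gen_base insertI1)
      then show ?thesis unfolding 1 pact_vacuum_pair[OF k_pos j' e(2) x] .
    next
      case 2
      have top: "pmap d b n (pact j q x ?v) \<in> ?G"
        unfolding pact_vacuum_pair[OF k_pos j_le e(1) x] pmap_linear(2)[OF 2(1) v(1)]
        by (intro gen_scale pm 2)
      show ?thesis
      proof (cases x)
        case (Lp X i)
        have "(\<Sum>(c, b')\<leftarrow>fin_action k X b. psc c (pmap d b' (n + i) ?v)) \<in> ?G"
          by (rule gen_fin_action[OF 2(1) pm])
        then show ?thesis using top unfolding 2 Lp pact_pmap_Lp[OF 2(1) v(1)] by (intro gen_add)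
      next
        case (Hs i)
        then have "i \<noteq> 0" using x by (simp add: proper_letters_def)
        then show ?thesis using top unfolding 2 Hs pact_pmap_Hs[OF 2(1) v(1) \<open>i \<noteq> 0\<close>]
          by (intro gen_add gen_scale pm 2)
      qed
    qed
  qed
  have form_base: "s' * tform ?j ?q (fst z) = snd z (ray ?e)" if z: "z \<in> ?B" for z
  proof -
    from z consider "z = ?v'" | b n where "b \<le> k" "z = pmap d b n ?v" by blast
    then show ?thesis
    proof cases
      case 1
      then show ?thesis
        by (simp add: vacuum_pair_def tform_pure[OF j' vac_carrier[OF j'] v_carrier]
            dual_vacuum.bra_vac[OF module_and_dual[OF j']] vac_form_simps fsc_def basis_def)
    next
      case 2
      have eq: "snd z (ray ?e) = s * cur k k (int b) (n + d) (basis (ray e)) (ray ?e)"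
        unfolding 2 pmap_sel vacuum_pair_def snd_conv cur_fsc by (simp add: fsc_def)
      have t: "tform ?j ?q (fst z) = (if b = j \<and> n = g then 1 else 0)"
        unfolding 2 pmap_sel vacuum_pair_def fst_conv by (rule tform_phi_vacuum[OF 2(1)])
      show ?thesis
      proof (cases "b = j \<and> n = g")
        case True
        then show ?thesis unfolding eq t by (simp add: s'_def)
      next
        case False
        then have "cur k k (int b) (n + d) (basis (ray e)) (ray ?e) = 0"
          using cur_ray_at_ray[OF k_pos, of "int b" "n + d" e] e(1,3) by auto
        then show ?thesis unfolding eq t using False by auto
      qed
    qed
  qed
  have base_mem: "pmap d b n ?v \<in> graph ?j ?q ?e s'" if b: "b \<le> k" for b n
  proof -
    have "phi j q b n (fst ?v) \<in> TS ?j ?q" by (rule phi_closed[OF b v(1)])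
    then obtain y where y: "(phi j q b n (fst ?v), y) \<in> graph ?j ?q ?e s'"
      using graph_surj[OF k_pos j' e(2)] by blast
    have "(phi j q b n (fst ?v), y) \<in> ?G" by (rule gen_mono[OF y]) (auto intro: gen_base)
    \<comment> \<open>The tensor part of the difference is zero, so uniqueness identifies the two
      states.\<close>
    then have "(phi j q b n (fst ?v), y) - pmap d b n ?v \<in> ?G"
      by (rule gen_diff[OF vector_space_psc _ pm[OF b]])
    then have "(0, y - snd (pmap d b n ?v)) \<in> ?G"
      by (simp only: pmap_def diff_Pair fst_conv snd_conv diff_self)
    moreover have "y - snd (pmap d b n ?v) \<in> ray_module k ?e"
    proof -
      have "y \<in> ray_module k ?e" using graph_snd[OF y] by (simp only: snd_conv)
      then show ?thesis unfolding pmap_sel ray_module_def using cur_mem[unfolded ray_module_def]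
        by (intro gen_diff[OF fock.vector_space_axioms])
    qed
    ultimately have "y - snd (pmap d b n ?v) = 0"
      using joint_mem[OF j' B] joint_closed[OF k_pos j' B base] joint_form[OF k_pos j' B form_base]
      by (intro joint_unique[OF k_pos, of ?j ?q ?B s' ?e]) blast+
    then have "pmap d b n ?v = (phi j q b n (fst ?v), y)" by (simp add: pmap_def)
    then show ?thesis using y by (simp only:)
  qed
  have "pmap d b n z \<in> graph ?j ?q ?e s'" if b: "b \<le> k" and z: "z \<in> graph j q e s" for b n z
  proof -
    have mem: "fst z \<in> TS j q" if "z \<in> graph j q e s" for z
      using joint_mem[OF j_le, of "{?v}" q z] v that by blast
    \<comment> \<open>The quantifiers belong inside the induction, because commuting with a letter
      changes b and n.\<close>
    have "\<forall>b\<le>k. \<forall>n. pmap d b n z \<in> graph ?j ?q ?e s'" using z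
    proof induction
      case (gen_base z)
      then show ?case using base_mem by blast
    next
      case gen_zero
      show "\<forall>b\<le>k. \<forall>n. pmap d b n 0 \<in> graph ?j ?q ?e s'"
        using pmap_linear(3) gen.gen_zero by metis
    next
      case (gen_add y z)
      show "\<forall>b\<le>k. \<forall>n. pmap d b n (y + z) \<in> graph ?j ?q ?e s'"
      proof (intro allI impI)
        fix b n assume b: "b \<le> k"
        show "pmap d b n (y + z) \<in> graph ?j ?q ?e s'"
          unfolding pmap_linear(1)[OF b mem[OF gen_add(1)] mem[OF gen_add(2)]]
          using gen_add(3,4) b by (intro gen.gen_add) blast+
      qed
    next
      case (gen_scale z c)
      show "\<forall>b\<le>k. \<forall>n. pmap d b n (psc c z) \<in> graph ?j ?q ?e s'"
      proof (intro allI impI)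
        fix b n assume b: "b \<le> k"
        show "pmap d b n (psc c z) \<in> graph ?j ?q ?e s'"
          unfolding pmap_linear(2)[OF b mem[OF gen_scale(1)]]
          using gen_scale(2) b by (intro gen.gen_scale) blast
      qed
    next
      case (gen_step x z)
      show "\<forall>b\<le>k. \<forall>n. pmap d b n (pact j q x z) \<in> graph ?j ?q ?e s'"
      proof (intro allI impI)
        fix b n assume b: "b \<le> k"
        have IH: "pmap d b' m z \<in> graph ?j ?q ?e s'" if "b' \<le> k" for b' m using gen_step(3) that by blast
        have low: "pact ?j ?q x (pmap d b n z) \<in> graph ?j ?q ?e s'" by (rule gen.gen_step[OF gen_step(1) IH[OF b]])
        \<comment> \<open>The image of a lowered pair is the lowered image minus commutator terms,
          which the induction hypothesis covers.\<close>
        have cancel: "pmap d b n (pact j q x z) \<in> graph ?j ?q ?e s'"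
          if "pact ?j ?q x (pmap d b n z) = pmap d b n (pact j q x z) + y" "y \<in> graph ?j ?q ?e s'" for y
        proof -
          have "pmap d b n (pact j q x z) = pact ?j ?q x (pmap d b n z) - y"
            unfolding that(1) by (rule add_diff_cancel_right'[symmetric])
          then show ?thesis using gen_diff[OF vector_space_psc low that(2)] by (simp only:)
        qed
        show "pmap d b n (pact j q x z) \<in> graph ?j ?q ?e s'"
        proof (cases x)
          case (Lp X i)
          have "(\<Sum>(c, b')\<leftarrow>fin_action k X b. psc c (pmap d b' (n + i) z)) \<in> graph ?j ?q ?e s'"
            by (rule gen_fin_action[OF b IH])
          then show ?thesis using cancel pact_pmap_Lp[OF b mem[OF gen_step(2)]] unfolding Lp by blast
        next
          case (Hs i)
          then have "i \<noteq> 0" using gen_step(1) by simp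
          have "psc (of_real p) (pmap d b (n + i) z) \<in> graph ?j ?q ?e s'" by (intro gen.gen_scale IH b)
          then show ?thesis using cancel pact_pmap_Hs[OF b mem[OF gen_step(2)] \<open>i \<noteq> 0\<close>] unfolding Hs by blast
        qed
      qed
    qed
    then show ?thesis using b by blast
  qed
  then show ?thesis using s'0 by blast
qed

end

section \<open>Path vectors\<close>

context vertex_operators
begin

lemma charge_add:
  assumes "k > 0" shows "charge M + of_nat n * sqrt (real k / 2) = charge (M + int k * int n)"
proof -
  have "sqrt (2 * real k) * sqrt (real k / 2) = real k"
    by (simp add: real_sqrt_mult[symmetric] power2_eq_square[symmetric])
  moreover have "sqrt (2 * real k) > 0" using assms by simp
  ultimately show ?thesis by (simp add: charge_def field_simps)
qed

lemma charge_exponent: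
  assumes "k > 0" shows "sqrt (real k / 2) * charge M = of_int M / 2"
proof -
  have "sqrt (2 * real k) = 2 * sqrt (real k / 2)"
    by (simp add: real_sqrt_mult real_sqrt_divide)
      (metis real_div_sqrt zero_le_numeral mult.commute times_divide_eq_right)
  moreover have "sqrt (real k / 2) > 0" using assms by simp
  ultimately show ?thesis by (simp add: charge_def field_simps)
qed

text \<open>The second component of a ground letter is the ground index g of
  \<open>integral_charge\<close> at its position; in particular the expansion there is in integer
  powers.\<close>

lemma charge_exponent_ground:
  assumes "k > 0" "r \<le> k"
  shows "real (fst (ground_path k r l t)) / 2 =
    sqrt (real k / 2) * charge (int r + 2 * l - int k * int t) + of_int (snd (ground_path k r l t))"
proof (cases "even t")
  case True
  then obtain u where "t = 2 * u" by blast
  then show ?thesis unfolding charge_exponent[OF assms(1)] by (simp add: ground_path_def field_simps)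
next
  case False
  then obtain u where t: "t = 2 * u + 1" using oddE by blast
  have "(int t + 1) * int k div 2 = (1 + int u) * int k"
    using nonzero_mult_div_cancel_left[of 2 "(1 + int u) * int k"] by (simp add: t algebra_simps)
  then show ?thesis unfolding charge_exponent[OF assms(1)] using assms(2)
    by (simp add: ground_path_def t of_nat_diff field_simps)
qed

lemma ground_charge:
  assumes "k > 0" "r \<le> k"
  shows "integral_charge k sv sh \<pi> \<rho> vac bra \<psi> \<H> a v T (fst (ground_path k r l t))
    (charge (int r + 2 * l - int k * int t)) (sqrt (real k / 2)) (snd (ground_path k r l t))"
proof unfold_locales
  show "fst (ground_path k r l t) \<le> k" using assms by (auto simp: ground_path_def)
qed (use assms charge_exponent_ground in auto)

text \<open>Words are built from the right, and after n letters the pair sits at position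
  \<open>L - n\<close> of the ground path. A single s serves all words of the given length, as it
  must for linear combinations of pairs to stay in one graph.\<close>

lemma phi_word_graph:
  assumes k: "k > 0" "r \<le> k" and L: "even L" "n \<le> L"
  shows "\<exists>s. s \<noteq> 0 \<and> (\<forall>xs. length xs = n \<longrightarrow> (\<forall>x\<in>set xs. fst x \<le> k) \<longrightarrow>
    (phi_word r (charge (int r + 2 * l - int k * int L)) xs (omega r (int r + 2 * l - int k * int L)),
     fermion_word k (l - int k) xs (basis (ray (int k * int L - int r))))
    \<in> graph (fst (ground_path k r l (L - n))) (charge (int r + 2 * l - int k * int (L - n)))
      (int k * int (L - n) - int r) s)"
  using L(2)
proof (induction n)
  case 0
  have "fst (ground_path k r l L) = r" using L(1) by (simp add: ground_path_def)
  moreover have "(omega r (int r + 2 * l - int k * int L), basis (ray (int k * int L - int r))) =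
    vacuum_pair r (charge (int r + 2 * l - int k * int L)) (int k * int L - int r) 1"
    by (simp only: omega_def vacuum_pair_def fock.scale_one)
  ultimately show ?case by (intro exI[of _ 1]) (auto intro: gen_base simp del: One_nat_def)
next
  case (Suc n)
  define t where "t = L - Suc n"
  have t: "L - n = Suc t" "L = Suc t + n" using Suc.prems by (simp_all add: t_def)
  let ?m = "int r + 2 * l - int k * int L"
  let ?M = "int r + 2 * l - int k * int (Suc t)" and ?p = "sqrt (real k / 2)"
  let ?J = "fst (ground_path k r l (Suc t))" and ?e = "int k * int (Suc t) - int r"
  obtain s where s: "s \<noteq> 0" and word: "\<And>xs. length xs = n \<Longrightarrow> (\<forall>x\<in>set xs. fst x \<le> k) \<Longrightarrow>
    (phi_word r (charge ?m) xs (omega r ?m), fermion_word k (l - int k) xs (basis (ray (int k * int L - int r))))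
    \<in> graph ?J (charge ?M) ?e s"
    using Suc unfolding t(1) by auto
  interpret I: integral_charge k sv sh \<pi> \<rho> vac bra \<psi> \<H> a v T ?J "charge ?M" ?p "snd (ground_path k r l (Suc t))"
    by (rule ground_charge[OF k])
  have J: "k - ?J = fst (ground_path k r l t)" using k by (auto simp: ground_path_def)
  have e: "?e - int k = int k * int t - int r" by (simp add: algebra_simps)
  have q: "charge ?M + ?p = charge (int r + 2 * l - int k * int t)"
    using charge_add[OF k(1), of ?M 1] by (simp add: algebra_simps)
  have 1: "ray_weight k ?e = ?J" by (rule ray_weight_ground[OF k])
  have 2: "ray_weight k (?e - int k) = k - ?J" unfolding J e by (rule ray_weight_ground[OF k])
  have 3: "snd (ground_path k r l (Suc t)) + (l - int k) = window_energy k ?e"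
    by (rule window_energy_ground[OF k, symmetric])
  obtain s' where s': "s' \<noteq> 0" and step: "\<And>b n z. b \<le> k \<Longrightarrow> z \<in> graph ?J (charge ?M) ?e s \<Longrightarrow>
    I.pmap (l - int k) b n z \<in> graph (k - ?J) (charge ?M + ?p) (?e - int k) s'"
    using I.graph_step[OF 1 2 3 s] by blast
  have par: "(if even n then r else k - r) = ?J"
    using L(1) k unfolding t(2) by (auto simp: ground_path_def)
  have qn: "charge ?m + of_nat n * ?p = charge ?M"
    unfolding charge_add[OF k(1)] t(2) by (simp add: algebra_simps)
  have "(phi_word r (charge ?m) xs (omega r ?m), fermion_word k (l - int k) xs (basis (ray (int k * int L - int r))))
    \<in> graph (fst (ground_path k r l t)) (charge (int r + 2 * l - int k * int t)) (int k * int t - int r) s'"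
    if "length xs = Suc n" "\<forall>x\<in>set xs. fst x \<le> k" for xs
  proof -
    obtain x ys where xs: "xs = x # ys" "length ys = n"
      using \<open>length xs = Suc n\<close> unfolding length_Suc_conv by blast
    have "fst x \<le> k" "\<forall>x\<in>set ys. fst x \<le> k" using that(2) xs by auto
    from step[OF this(1) word[OF xs(2) this(2)], of "snd x"] show ?thesis
      unfolding J e q I.pmap_def fst_conv snd_conv xs phi_word.simps fermion_word.simps xs(2) par qn .
  qed
  then show ?case using s' unfolding t_def[symmetric] by blast
qed

lemma phi_word_append:
  assumes "even (length ys)"
  shows "phi_word j q (xs @ ys) t = phi_word j (q + of_nat (length ys) * sqrt (real k / 2)) xs (phi_word j q ys t)"
  using assms by (induction xs) (auto simp: algebra_simps)

text \<open>By two applications of \<open>phi_ground\<close>, the two additional ground letters map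
  the outer vacuum tensor to the previous one.\<close>

lemma truncated_path_vector_Suc:
  assumes k: "k > 0" "r \<le> k"
    and P: "P (2 * N + 1) = ground_path k r l (2 * N + 1)" "P (2 * N + 2) = ground_path k r l (2 * N + 2)"
  shows "truncated_path_vector r l P (Suc N) = truncated_path_vector r l P N"
proof -
  let ?M = "\<lambda>t. int r + 2 * l - int k * int t" and ?p = "sqrt (real k / 2)"
  let ?G = "ground_path k r l"
  have Q: "charge (?M (Suc t)) + ?p = charge (?M t)" for t
    using charge_add[OF k(1), of "?M (Suc t)" 1] by (simp add: algebra_simps)
  have J: "k - fst (?G (Suc t)) = fst (?G t)" for t using k by (auto simp: ground_path_def)
  have ground: "phi (fst (?G (Suc t))) (charge (?M (Suc t))) (fst (?G (Suc t))) (snd (?G (Suc t)))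
      (omega (fst (?G (Suc t))) (?M (Suc t))) = omega (fst (?G t)) (?M t)" for t
    using integral_charge.phi_ground[OF ground_charge[OF k], of l "Suc t"]
    unfolding J Q omega_def .
  have r: "fst (?G (2 * N)) = r" "fst (?G (Suc (Suc (2 * N)))) = r" "fst (?G (Suc (2 * N))) = k - r"
    by (simp_all add: ground_path_def)
  have m: "int r + 2 * l - 2 * int k * int (Suc N) = ?M (Suc (Suc (2 * N)))" "int r + 2 * l - 2 * int k * int N = ?M (2 * N)"
    by (simp_all add: algebra_simps)
  have list: "map P [1..<2 * Suc N + 1] = map P [1..<2 * N + 1] @ [?G (Suc (2 * N)), ?G (Suc (Suc (2 * N)))]"
    using P by simp
  have q: "charge (?M (Suc (Suc (2 * N)))) + of_nat (length [?G (Suc (2 * N)), ?G (Suc (Suc (2 * N)))]) * ?p = charge (?M (2 * N))"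
    using charge_add[OF k(1), of "?M (Suc (Suc (2 * N)))" 2] by (simp add: algebra_simps)
  have "even (length [?G (Suc (2 * N)), ?G (Suc (Suc (2 * N)))])" by simp
  note app = phi_word_append[OF this, of r "charge (?M (Suc (Suc (2 * N))))", unfolded q]
  have "phi_word r (charge (?M (Suc (Suc (2 * N))))) [?G (Suc (2 * N)), ?G (Suc (Suc (2 * N)))] (omega r (?M (Suc (Suc (2 * N))))) =
    omega r (?M (2 * N))"
    using ground[of "Suc (2 * N)"] ground[of "2 * N"] Q[of "Suc (2 * N)"] unfolding r by (simp add: r)
  then show ?thesis
    unfolding truncated_path_vector_def Let_def m list
    unfolding app by (rule arg_cong)
qed

lemma path_vector_eq:
  assumes k: "k > 0" "r \<le> k" and P: "\<And>j. j > 2 * N \<Longrightarrow> P j = ground_path k r l j"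
  shows "path_vector r l P = truncated_path_vector r l P N"
proof -
  have stable: "truncated_path_vector r l P (N + i) = truncated_path_vector r l P N" for i
  proof (induction i)
    case (Suc i)
    have "truncated_path_vector r l P (Suc (N + i)) = truncated_path_vector r l P (N + i)"
      by (intro truncated_path_vector_Suc k P) auto
    then show "truncated_path_vector r l P (N + Suc i) = truncated_path_vector r l P N"
      by (simp only: add_Suc_right Suc)
  qed simp
  then have *: "\<forall>M\<ge>N. truncated_path_vector r l P M = truncated_path_vector r l P N"
    by (metis le_Suc_ex)
  show ?thesis unfolding path_vector_def
  proof (rule the_equality)
    show "\<exists>N\<^sub>0. \<forall>M\<ge>N\<^sub>0. truncated_path_vector r l P M = truncated_path_vector r l P N" using * by blast
    fix t assume "\<exists>N\<^sub>0. \<forall>M\<ge>N\<^sub>0. truncated_path_vector r l P M = t"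
    then obtain N\<^sub>0 where "\<forall>M\<ge>N\<^sub>0. truncated_path_vector r l P M = t" by blast
    then have "truncated_path_vector r l P (max N N\<^sub>0) = t" using max.cobounded2 by blast
    moreover have "truncated_path_vector r l P (max N N\<^sub>0) = truncated_path_vector r l P N"
      using * max.cobounded1 by blast
    ultimately show "t = truncated_path_vector r l P N" by (rule trans[OF sym])
  qed
qed

lemma path_vector_graph:
  assumes k: "k > 0" "r \<le> k"
  shows "\<exists>s. s \<noteq> 0 \<and> (\<forall>P. P \<in> paths k r l \<longrightarrow> (\<forall>j>2 * N. P j = ground_path k r l j) \<longrightarrow>
    (path_vector r l P, fermion_word k (l - int k) (map P [1..<2 * N + 1]) (basis (ray (int k * int (2 * N) - int r))))
    \<in> graph r (charge (int r + 2 * l)) (- int r) s)"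
proof -
  obtain s where s: "s \<noteq> 0" and word: "\<And>xs. length xs = 2 * N \<Longrightarrow> (\<forall>x\<in>set xs. fst x \<le> k) \<Longrightarrow>
    (phi_word r (charge (int r + 2 * l - int k * int (2 * N))) xs (omega r (int r + 2 * l - int k * int (2 * N))),
     fermion_word k (l - int k) xs (basis (ray (int k * int (2 * N) - int r))))
    \<in> graph (fst (ground_path k r l 0)) (charge (int r + 2 * l - int k * int 0)) (int k * int 0 - int r) s"
    using phi_word_graph[OF k, of "2 * N" "2 * N" l] by auto
  have r: "fst (ground_path k r l 0) = r" "int r + 2 * l - int k * int 0 = int r + 2 * l" "int k * int 0 - int r = - int r"
    by (simp_all add: ground_path_def)
  have "(path_vector r l P, fermion_word k (l - int k) (map P [1..<2 * N + 1]) (basis (ray (int k * int (2 * N) - int r))))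
    \<in> graph r (charge (int r + 2 * l)) (- int r) s"
    if P: "P \<in> paths k r l" "\<forall>j>2 * N. P j = ground_path k r l j" for P
  proof -
    have m: "int r + 2 * l - 2 * int k * int N = int r + 2 * l - int k * int (2 * N)" by simp
    have "path_vector r l P = truncated_path_vector r l P N"
      by (rule path_vector_eq[OF k]) (use P(2) in blast)
    then have "path_vector r l P = phi_word r (charge (int r + 2 * l - int k * int (2 * N))) (map P [1..<2 * N + 1])
        (omega r (int r + 2 * l - int k * int (2 * N)))"
      unfolding truncated_path_vector_def Let_def m .
    moreover have "fst (P j) \<le> k" if "j \<ge> 1" for j
    proof -
      have "P \<in> {1..} \<rightarrow>\<^sub>E {0..k} \<times> UNIV" using P(1) by (simp add: paths_def)
      from PiE_mem[OF this, of j] that show ?thesis by (cases "P j") auto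
    qed
    then have "\<forall>x\<in>set (map P [1..<2 * N + 1]). fst x \<le> k" by auto
    ultimately show ?thesis using word[of "map P [1..<2 * N + 1]"] unfolding r by simp
  qed
  then show ?thesis using s by blast
qed

lemma path_ground_bound:
  assumes "finite Q" "Q \<subseteq> paths k r l"
  shows "\<exists>N. \<forall>P\<in>Q. \<forall>j>2 * N. P j = ground_path k r l j"
  using assms
proof (induction Q)
  case (insert P Q)
  then obtain N where N: "\<forall>P\<in>Q. \<forall>j>2 * N. P j = ground_path k r l j" by auto
  from insert obtain J where "\<forall>j\<ge>J. P j = ground_path k r l j" by (auto simp: paths_def)
  with N have "\<forall>P\<in>insert P Q. \<forall>j>2 * max N J. P j = ground_path k r l j" by auto
  then show ?case by blast
qed simp

lemma path_vector_mem:
  assumes "k > 0" "r \<le> k" "P \<in> paths k r l"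
  shows "path_vector r l P \<in> TS r (charge (int r + 2 * l))"
proof -
  obtain N where N: "\<forall>j>2 * N. P j = ground_path k r l j"
    using path_ground_bound[of "{P}" r l] assms(3) by auto
  then obtain s f where "(path_vector r l P, f) \<in> graph r (charge (int r + 2 * l)) (- int r) s"
    using path_vector_graph[OF assms(1,2), of l N] assms(3) by blast
  from joint_mem[OF assms(2) _ this] vacuum_pair_mem[OF assms(2)] show ?thesis by auto
qed

text \<open>The relation puts (0, y) into the graph, where y is the same combination of fermionic
  words; \<open>joint_unique\<close> gives y = 0.\<close>

lemma path_vectors_independent:
  assumes k: "k > 0" "r \<le> k" and Q: "finite Q" "Q \<subseteq> paths k r l"
    and zero: "(\<Sum>P\<in>Q. tensor_scale (c P) (path_vector r l P)) = 0" and P: "P \<in> Q"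
  shows "c P = 0"
proof -
  obtain N where N: "\<forall>P\<in>Q. \<forall>j>2 * N. P j = ground_path k r l j" using path_ground_bound[OF Q] by blast
  let ?w = "\<lambda>P. fermion_word k (l - int k) (map P [1..<2 * N + 1]) (basis (ray (int k * int (2 * N) - int r)))"
  let ?q = "charge (int r + 2 * l)"
  obtain s where s: "\<And>P. P \<in> Q \<Longrightarrow> (path_vector r l P, ?w P) \<in> graph r ?q (- int r) s"
    using path_vector_graph[OF k, of l N] Q(2) N by blast
  have e: "ray_weight k (- int r) = r" using ray_weight_ground[OF k, of 0 l] by (simp add: ground_path_def)
  have sum_mem: "(\<Sum>P\<in>Q. psc (c P) (path_vector r l P, ?w P)) \<in> graph r ?q (- int r) s"
    by (intro gen_sum gen_scale s)
  have "(\<Sum>P\<in>Q. psc (c P) (path_vector r l P, ?w P)) = (0, \<Sum>P\<in>Q. fsc (c P) (?w P))"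
    unfolding prod_eq_iff fst_sum snd_sum psc_simps fst_conv snd_conv zero by (simp only: simp_thms)
  with sum_mem have mem: "(0, \<Sum>P\<in>Q. fsc (c P) (?w P)) \<in> graph r ?q (- int r) s" by (simp only:)
  have base: "fst z \<in> TS r ?q \<and> finsupp (snd z)" if "z \<in> {vacuum_pair r ?q (- int r) s}" for z
    using that vacuum_pair_mem[OF k(2)] by (simp only: singleton_iff)
  have form: "s * tform r ?q (fst z) = snd z (ray (- int r))" if "z \<in> {vacuum_pair r ?q (- int r) s}" for z
    using that by (simp add: vacuum_pair_def tform_pure[OF k(2) vac_carrier[OF k(2)] v_carrier]
        dual_vacuum.bra_vac[OF module_and_dual[OF k(2)]] vac_form_simps fsc_def basis_def)
  have "(\<Sum>P\<in>Q. fsc (c P) (?w P)) = 0"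
  proof (rule joint_unique[OF k(1) _ _ _ mem])
    show "(\<Sum>P\<in>Q. fsc (c P) (?w P)) \<in> ray_module k (- int r)" using graph_snd[OF mem] by (simp only: snd_conv)
  qed (use joint_mem[OF k(2) base] graph_closed[OF k e] joint_form[OF k base form] in blast)+
  then show ?thesis
    using N by (intro fermion_words_independent[OF k Q, of "2 * N" c P, OF _ _ _ P]) auto
qed

end

text \<open>Injectivity together with independence of the image is linear independence of the family
  indexed by the paths.\<close>

theorem mainTheorem4:
  fixes k r :: nat and l :: int
    and sv :: "complex \<Rightarrow> 'v::ab_group_add \<Rightarrow> 'v" and sh :: "complex \<Rightarrow> 'h::ab_group_add \<Rightarrow> 'h"
    and \<pi> :: "nat \<Rightarrow> 'v set" and \<rho> :: "nat \<Rightarrow> affine_sl2 \<Rightarrow> 'v \<Rightarrow> 'v"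
    and vac :: "nat \<Rightarrow> 'v" and bra :: "nat \<Rightarrow> 'v \<Rightarrow> complex"
    and \<psi> :: "nat \<Rightarrow> nat \<Rightarrow> int \<Rightarrow> 'v \<Rightarrow> 'v"
    and \<H> :: "real \<Rightarrow> 'h set" and a :: "real \<Rightarrow> int \<Rightarrow> 'h \<Rightarrow> 'h" and v :: "real \<Rightarrow> 'h"
    and T :: "real \<Rightarrow> real \<Rightarrow> 'h \<Rightarrow> 'h"
  assumes "k \<ge> 1" and "r \<le> k"
    and "vertex_operators k sv sh \<pi> \<rho> vac bra \<psi> \<H> a v T"
  defines "\<omega> \<equiv> vertex_operators.path_vector k sv sh \<pi> vac \<psi> \<H> a v T r l"
    and "q \<equiv> of_int (int r + 2 * l) / sqrt (2 * real k)"
  shows "(\<forall>P\<in>paths k r l. \<omega> P \<in> tensor_space sv sh (\<pi> r) (\<H> q)) \<and>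
    inj_on \<omega> (paths k r l) \<and> tensor.independent (\<omega> ` paths k r l)"
proof -
  interpret vertex_operators k sv sh \<pi> \<rho> vac bra \<psi> \<H> a v T by fact
  have k: "k > 0" "r \<le> k" using assms by auto
  have q: "q = charge (int r + 2 * l)" by (simp add: q_def charge_def)
  have inj: "inj_on \<omega> (paths k r l)"
  proof (rule inj_onI, rule ccontr)
    fix P P' assume P: "P \<in> paths k r l" "P' \<in> paths k r l" "\<omega> P = \<omega> P'" "P \<noteq> P'"
    \<comment> \<open>Equal vectors for two distinct paths would be a relation with coefficients 1
      and -1.\<close>
    let ?c = "\<lambda>X. if X = P then 1 else - 1 :: complex"
    have "(\<Sum>X\<in>{P, P'}. tensor_scale (?c X) (\<omega> X)) = tensor_scale (1 + - 1) (\<omega> P)"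
      using P by (simp only: tensor.scale_left_distrib) simp
    then have "?c P = 0"
      using P by (subst path_vectors_independent[OF k, of "{P, P'}" l ?c P]) (simp_all only: \<omega>_def, auto)
    then show False by simp
  qed
  have "tensor.independent (\<omega> ` paths k r l)"
  proof
    assume "tensor.dependent (\<omega> ` paths k r l)"
    then obtain t u y where t: "finite t" "t \<subseteq> \<omega> ` paths k r l" "(\<Sum>y\<in>t. tensor_scale (u y) y) = 0" "y \<in> t"
      and nz: "u y \<noteq> 0"
      unfolding tensor.dependent_explicit by blast
    then obtain Q where Q: "Q \<subseteq> paths k r l" "t = \<omega> ` Q" by (auto simp: subset_image_iff)
    have injQ: "inj_on \<omega> Q" using inj Q(1) by (rule inj_on_subset)
    have "finite Q" using t(1) Q(2) injQ by (simp add: finite_image_iff)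
    obtain P where P: "P \<in> Q" "y = \<omega> P" using t(4) Q(2) by blast
    have "(\<Sum>P\<in>Q. tensor_scale (u (\<omega> P)) (\<omega> P)) = 0"
      using t(3) unfolding Q(2) sum.reindex[OF injQ] o_def .
    then have zero: "(\<Sum>P\<in>Q. tensor_scale (u (path_vector r l P)) (path_vector r l P)) = 0"
      unfolding \<omega>_def .
    have "u (path_vector r l P) = 0"
      by (rule path_vectors_independent[OF k \<open>finite Q\<close> Q(1) zero P(1)])
    with nz show False unfolding P(2) \<omega>_def by (rule notE)
  qed
  then show ?thesis using inj path_vector_mem[OF k] by (simp add: q \<omega>_def)
qed

end
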